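(* Let $M$ be a right-left SAYD module over $H$. (1) Let $\mathcal D_H,\mathcal D_H'$ be left $H$-categories. An $H$-linear semifunctor $\alpha:\mathcal{D}_H\to\mathcal{D}_H'$ induces, for all $n\geq 0$, a morphism $$C^n_H(\alpha,M):C^n_H(\mathcal{D}_H',M)\longrightarrow C^n_H(\mathcal{D}_H,M),\qquad C^{n}_H(\alpha,M)(\phi)(m \otimes f^0 \otimes \ldots \otimes f^n)=\phi\left(m \otimes \alpha(f^0) \otimes \ldots \otimes \alpha(f^n)\right)$$ for $\phi \in C^n_H(\mathcal{D}_H',M)$, $m \in M$ and $f^0 \otimes \ldots \otimes f^n \in CN_n(\mathcal{D}_H)$. This leads to a morphism $C^{\bullet\bullet}_H(\alpha,M)^{cy}:C^{\bullet\bullet}_H(\mathcal{D}_H',M)^{cy} \longrightarrow C^{\bullet\bullet}_H(\mathcal{D}_H,M)^{cy}$ of the double complexes computing cyclic cohomology, and induces a functor $HC^\bullet_H(-,M):\overline{Cat}_H^{op} \longrightarrow Vect_k$. (2) Let $\mathcal D_H$ be a left $H$-category and let $\eta\in \mathbb U_H(\mathcal D_H)$. Then the automorphism $\Phi_\eta:\mathcal D_H\to\mathcal D_H$ given by $\Phi_\eta(X)=X$ and $\Phi_\eta(f)=\eta(Y)\circ f\circ\eta(X)^{-1}$ for $f\in Hom_{\mathcal D_H}(X,Y)$ induces the identity map on $HC^\bullet_H(\mathcal{D}_H,M)$.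
   Context: $H$ is a Hopf algebra over $k=\mathbb C$ with comultiplication $\Delta(h)=h_1\otimes h_2$ (Sweedler notation), counit $\varepsilon$ and bijective antipode $S$. A left $H$-category is a small $k$-linear category $\mathcal D_H$ whose Hom spaces are left $H$-modules with $h(\mathrm{id}_X)=\varepsilon(h)\mathrm{id}_X$ and $h(gf)=(h_1g)(h_2f)$. A semifunctor preserves composition but not necessarily identities; an $H$-linear semifunctor is $k$-linear and $H$-linear on Hom spaces. $\overline{Cat}_H$ is the category of left $H$-categories with $H$-linear semifunctors; $Vect_k$ is the category of $k$-vector spaces. A right-left SAYD module is a right $H$-module and left $H$-comodule $M$, $m\mapsto m_{(-1)}\otimes m_{(0)}$, with $(mh)_{(-1)}\otimes (mh)_{(0)}=S(h_3)m_{(-1)}h_1\otimes m_{(0)}h_2$ and $m_{(0)}m_{(-1)}=m$. $CN_n(\mathcal D_H)=\bigoplus_{(X_0,\dots,X_n)} Hom(X_1,X_0)\otimes Hom(X_2,X_1)\otimes\cdots\otimes Hom(X_0,X_n)$, with diagonal $H$-action. $C^n_H(\mathcal D_H,M)$ is the space of $k$-linear maps $\phi:M\otimes CN_n(\mathcal D_H)\to k$ with $\phi(mh_1\otimes S(h_2)(f^0\otimes\cdots\otimes f^n))=\varepsilon(h)\phi(m\otimes f^0\otimes\cdots\otimes f^n)$. On $C^n_H$: $b=\sum_{i=0}^{n+1}(-1)^i\delta_i$, $b'=\sum_{i=0}^{n}(-1)^i\delta_i$, where $(\delta_i\phi)(m\otimes f^0\otimes\cdots\otimes f^{n+1})=\phi(m\otimes\cdots\otimes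 f^if^{i+1}\otimes\cdots\otimes f^{n+1})$ for $0\le i\le n$ and $(\delta_{n+1}\phi)(m\otimes f^0\otimes\cdots\otimes f^{n+1})=\phi(m_{(0)}\otimes (S^{-1}(m_{(-1)})f^{n+1})f^0\otimes f^1\otimes\cdots\otimes f^n)$; and $\lambda=(-1)^n\tau_n$ with $(\tau_n\phi)(m\otimes f^0\otimes\cdots\otimes f^n)=\phi(m_{(0)}\otimes S^{-1}(m_{(-1)})f^n\otimes f^0\otimes\cdots\otimes f^{n-1})$. The Hopf-cyclic cohomology $HC^\bullet_H(\mathcal D_H,M)$ is the cohomology of the complex $(\ker(1-\lambda),b)$; equivalently (characteristic zero), it is the cohomology of the total complex of the usual cyclic double complex $C^{\bullet\bullet}_H(\mathcal D_H,M)^{cy}$ of this cocyclic module, whose columns are copies of $C^\bullet_H(\mathcal D_H,M)$ with differentials alternately $b$ and $-b'$ and whose rows have differentials alternately $1-\lambda$ and $1+\lambda+\cdots+\lambda^n$. $\mathbb U_H(\mathcal D_H)$ is the group of families $\eta=\{\eta(X)\in Aut_{\mathcal D_H}(X)\}_{X\in Ob(\mathcal D_H)}$ with $h(\eta(X))=\varepsilon(h)\eta(X)$ for all $h\in H$ and all $X$. *)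

theory Defs
  imports
    Complex_Main
    "HOL-Library.Poly_Mapping"
    "HOL-Library.Function_Algebras"
    "HOL-Library.Set_Algebras"
    "HOL-Library.FuncSet"
    "HOL-Algebra.Module"
begin

section \<open>Complex vector spaces\<close>

class complex_vector = ab_group_add +
  fixes scaleC :: "complex \<Rightarrow> 'a \<Rightarrow> 'a"  (infixr \<open>*\<^sub>C\<close> 75)
  assumes scaleC_add_right: "a *\<^sub>C (x + y) = a *\<^sub>C x + a *\<^sub>C y"
    and scaleC_add_left: "(a + b) *\<^sub>C x = a *\<^sub>C x + b *\<^sub>C x"
    and scaleC_scaleC: "a *\<^sub>C (b *\<^sub>C x) = (a * b) *\<^sub>C x"
    and scaleC_one: "1 *\<^sub>C x = x"

class complex_algebra_1 = complex_vector + ring_1 +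
  assumes scaleC_mult_left: "(a *\<^sub>C x) * y = a *\<^sub>C (x * y)"
    and scaleC_mult_right: "x * (a *\<^sub>C y) = a *\<^sub>C (x * y)"

interpretation cvs: vector_space "scaleC :: complex \<Rightarrow> 'a::complex_vector \<Rightarrow> 'a"
  by unfold_locales (simp_all add: scaleC_add_right scaleC_add_left scaleC_scaleC scaleC_one)

abbreviation clinear :: "('a::complex_vector \<Rightarrow> 'b::complex_vector) \<Rightarrow> bool" where
  "clinear \<equiv> Vector_Spaces.linear scaleC scaleC"

lemma clinear_iff:
  "clinear f \<longleftrightarrow> (\<forall>x y. f (x + y) = f x + f y) \<and> (\<forall>c x. f (c *\<^sub>C x) = c *\<^sub>C f x)"
  by (auto simp: Vector_Spaces.linear_def module_hom_def module_hom_axioms_def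
      cvs.vector_space_axioms cvs.module_axioms)

definition cbilinear :: "('a::complex_vector \<Rightarrow> 'b::complex_vector \<Rightarrow> 'c::complex_vector) \<Rightarrow> bool" where
  "cbilinear \<beta> \<longleftrightarrow> (\<forall>b. clinear (\<lambda>a. \<beta> a b)) \<and> (\<forall>a. clinear (\<beta> a))"

definition linear_on :: "'a::complex_vector set \<Rightarrow> ('a \<Rightarrow> 'b::complex_vector) \<Rightarrow> bool" where
  "linear_on V f \<longleftrightarrow> (\<forall>x\<in>V. \<forall>y\<in>V. f (x + y) = f x + f y) \<and> (\<forall>c. \<forall>x\<in>V. f (c *\<^sub>C x) = c *\<^sub>C f x)"

definition linear_map :: "'a::complex_vector set \<Rightarrow> 'b::complex_vector set \<Rightarrow> ('a \<Rightarrow> 'b) \<Rightarrow> bool" where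
  "linear_map V W f \<longleftrightarrow> f \<in> V \<rightarrow> W \<and> linear_on V f"

instantiation complex :: complex_vector
begin
definition scaleC_complex :: "complex \<Rightarrow> complex \<Rightarrow> complex" where
  "scaleC_complex c x = c * x"
instance by standard (simp_all add: scaleC_complex_def algebra_simps)
end

instantiation "fun" :: (type, complex_vector) complex_vector
begin
definition scaleC_fun :: "complex \<Rightarrow> ('a \<Rightarrow> 'b) \<Rightarrow> 'a \<Rightarrow> 'b" where
  "scaleC_fun c f = (\<lambda>x. c *\<^sub>C f x)"
instance
  by standard (simp_all add: scaleC_fun_def fun_eq_iff scaleC_add_right scaleC_add_left
      scaleC_scaleC scaleC_one)
end

instantiation poly_mapping :: (type, complex_vector) complex_vector
begin
definition scaleC_poly_mapping :: "complex \<Rightarrow> ('a \<Rightarrow>\<^sub>0 'b) \<Rightarrow> 'a \<Rightarrow>\<^sub>0 'b" where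
  "scaleC_poly_mapping c p = Poly_Mapping.map (scaleC c) p"
instance
proof -
  have lk: "Poly_Mapping.lookup (c *\<^sub>C p) k = c *\<^sub>C Poly_Mapping.lookup p k" for c k and p :: "'a \<Rightarrow>\<^sub>0 'b"
    by (simp add: scaleC_poly_mapping_def map.rep_eq when_def cvs.scale_zero_right)
  show "OFCLASS('a \<Rightarrow>\<^sub>0 'b, complex_vector_class)"
    by standard (rule poly_mapping_eqI; simp add: lk lookup_add scaleC_add_right
      scaleC_add_left scaleC_scaleC scaleC_one)+
qed
end

lemma lookup_scaleC: "Poly_Mapping.lookup (c *\<^sub>C p) k = c *\<^sub>C Poly_Mapping.lookup p k"
  by (simp add: scaleC_poly_mapping_def map.rep_eq when_def cvs.scale_zero_right)


section \<open>Tensor products\<close>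

subsection \<open>The tensor product of two complex vector spaces\<close>

definition tensor_relations :: "(('a::complex_vector \<times> 'b::complex_vector) \<Rightarrow>\<^sub>0 complex) set" where
  "tensor_relations =
     {Poly_Mapping.single (x + y, b) 1 - Poly_Mapping.single (x, b) 1 - Poly_Mapping.single (y, b) 1 | x y b. True}
   \<union> {Poly_Mapping.single (a, x + y) 1 - Poly_Mapping.single (a, x) 1 - Poly_Mapping.single (a, y) 1 | a x y. True}
   \<union> {Poly_Mapping.single (c *\<^sub>C a, b) 1 - c *\<^sub>C Poly_Mapping.single (a, b) 1 | c a b. True}
   \<union> {Poly_Mapping.single (a, c *\<^sub>C b) 1 - c *\<^sub>C Poly_Mapping.single (a, b) 1 | c a b. True}"

lemma equivp_span: "equivp (\<lambda>p q. p - q \<in> cvs.span R)"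
proof (rule equivpI)
  show "reflp (\<lambda>p q. p - q \<in> cvs.span R)"
    by (simp add: reflp_def cvs.span_zero)
  show "symp (\<lambda>p q. p - q \<in> cvs.span R)"
    by (rule sympI) (metis cvs.span_neg minus_diff_eq)
  show "transp (\<lambda>p q. p - q \<in> cvs.span R)"
  proof (rule transpI)
    fix x y z assume "x - y \<in> cvs.span R" "y - z \<in> cvs.span R"
    then have "(x - y) + (y - z) \<in> cvs.span R" by (rule cvs.span_add)
    then show "x - z \<in> cvs.span R" by simp
  qed
qed

lemma span_cong_eq: "p = q \<Longrightarrow> p - q \<in> cvs.span R"
  by (simp add: cvs.span_zero)

lemma span_cong_add:
  assumes "p - p' \<in> cvs.span R" "q - q' \<in> cvs.span R"
  shows "(p + q) - (p' + q') \<in> cvs.span R"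
  using cvs.span_add[OF assms] by (simp add: add_diff_add)

lemma span_cong_uminus: "p - p' \<in> cvs.span R \<Longrightarrow> - p - - p' \<in> cvs.span R"
  using cvs.span_neg[of "p - p'" R] by simp

lemma span_cong_diff:
  assumes "p - p' \<in> cvs.span R" "q - q' \<in> cvs.span R"
  shows "(p - q) - (p' - q') \<in> cvs.span R"
  using span_cong_add[OF assms(1) span_cong_uminus[OF assms(2)]] by simp

lemma span_cong_scaleC: "p - p' \<in> cvs.span R \<Longrightarrow> c *\<^sub>C p - c *\<^sub>C p' \<in> cvs.span R"
  using cvs.span_scale[of "p - p'" R c] by (simp add: cvs.scale_right_diff_distrib)

quotient_type (overloaded) ('a, 'b) tensor (infixr \<open>\<otimes>\<close> 25) =
  "('a::complex_vector \<times> 'b::complex_vector) \<Rightarrow>\<^sub>0 complex" /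
  "\<lambda>p q. p - q \<in> cvs.span tensor_relations"
  by (rule equivp_span)

instantiation tensor :: (complex_vector, complex_vector) complex_vector
begin
lift_definition zero_tensor :: "'a \<otimes> 'b" is 0 .
lift_definition plus_tensor :: "'a \<otimes> 'b \<Rightarrow> 'a \<otimes> 'b \<Rightarrow> 'a \<otimes> 'b" is "(+)"
  by (rule span_cong_add)
lift_definition minus_tensor :: "'a \<otimes> 'b \<Rightarrow> 'a \<otimes> 'b \<Rightarrow> 'a \<otimes> 'b" is "(-)"
  by (rule span_cong_diff)
lift_definition uminus_tensor :: "'a \<otimes> 'b \<Rightarrow> 'a \<otimes> 'b" is uminus
  by (rule span_cong_uminus)
lift_definition scaleC_tensor :: "complex \<Rightarrow> 'a \<otimes> 'b \<Rightarrow> 'a \<otimes> 'b" is scaleC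
  by (rule span_cong_scaleC)
instance
  by standard
    (transfer, rule span_cong_eq,
      simp add: add.assoc add.commute scaleC_add_right scaleC_add_left scaleC_scaleC scaleC_one)+
end

lift_definition tensor_pure :: "'a::complex_vector \<Rightarrow> 'b::complex_vector \<Rightarrow> 'a \<otimes> 'b"
  (infixr \<open>\<otimes>\<^sub>C\<close> 72) is "\<lambda>a b. Poly_Mapping.single (a, b) 1" .

text \<open>
  The linear map out of a tensor product induced by a bilinear map.  It renders Sweedler notation:
  \<open>tensor_lift (\<lambda>h\<^sub>1 h\<^sub>2. \<beta> h\<^sub>1 h\<^sub>2) (comult H h)\<close> stands for \<open>\<beta>(h\<^sub>1, h\<^sub>2)\<close>.
\<close>
definition tensor_lift ::
    "('a::complex_vector \<Rightarrow> 'b::complex_vector \<Rightarrow> 'c::complex_vector) \<Rightarrow> 'a \<otimes> 'b \<Rightarrow> 'c" where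
  "tensor_lift \<beta> = (THE L. clinear L \<and> (\<forall>a b. L (a \<otimes>\<^sub>C b) = \<beta> a b))"


subsection \<open>Tensor words\<close>

text \<open>
  \<open>('i, 'v) words\<close> is the direct sum, over all finite sequences \<open>(i\<^sub>0, \<dots>, i\<^sub>r\<^sub>-\<^sub>1)\<close> of labels in \<open>'i\<close>,
  of the \<open>r\<close>-fold tensor powers of \<open>'v\<close>: the labels are carried along, and multilinearity
  is imposed in the vectors only.
\<close>

definition word_relations :: "(('i \<times> 'v::complex_vector) list \<Rightarrow>\<^sub>0 complex) set" where
  "word_relations =
     {Poly_Mapping.single (us @ (i, x + y) # vs) 1 - Poly_Mapping.single (us @ (i, x) # vs) 1
        - Poly_Mapping.single (us @ (i, y) # vs) 1 | us i x y vs. True}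
   \<union> {Poly_Mapping.single (us @ (i, c *\<^sub>C x) # vs) 1
        - c *\<^sub>C Poly_Mapping.single (us @ (i, x) # vs) 1 | us i c x vs. True}"

quotient_type (overloaded) ('i, 'v) words =
  "('i \<times> 'v::complex_vector) list \<Rightarrow>\<^sub>0 complex" / "\<lambda>p q. p - q \<in> cvs.span word_relations"
  by (rule equivp_span)

instantiation words :: (type, complex_vector) complex_vector
begin
lift_definition zero_words :: "('a, 'b) words" is 0 .
lift_definition plus_words :: "('a, 'b) words \<Rightarrow> ('a, 'b) words \<Rightarrow> ('a, 'b) words" is "(+)"
  by (rule span_cong_add)
lift_definition minus_words :: "('a, 'b) words \<Rightarrow> ('a, 'b) words \<Rightarrow> ('a, 'b) words" is "(-)"
  by (rule span_cong_diff)
lift_definition uminus_words :: "('a, 'b) words \<Rightarrow> ('a, 'b) words" is uminus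
  by (rule span_cong_uminus)
lift_definition scaleC_words :: "complex \<Rightarrow> ('a, 'b) words \<Rightarrow> ('a, 'b) words" is scaleC
  by (rule span_cong_scaleC)
instance
  by standard
    (transfer, rule span_cong_eq,
      simp add: add.assoc add.commute scaleC_add_right scaleC_add_left scaleC_scaleC scaleC_one)+
end

text \<open>\<open>word_pure [(i\<^sub>0, x\<^sub>0), \<dots>, (i\<^sub>n, x\<^sub>n)]\<close> is the elementary tensor \<open>x\<^sub>0 \<otimes> \<dots> \<otimes> x\<^sub>n\<close> in the summand labelled
  \<open>(i\<^sub>0, \<dots>, i\<^sub>n)\<close>.\<close>
lift_definition word_pure :: "('i \<times> 'v::complex_vector) list \<Rightarrow> ('i, 'v) words" is
  "\<lambda>w. Poly_Mapping.single w 1" .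

definition word_lift :: "(('i \<times> 'v::complex_vector) list \<Rightarrow> 'c::complex_vector) \<Rightarrow> ('i, 'v) words \<Rightarrow> 'c" where
  "word_lift g = (THE L. clinear L \<and> (\<forall>w. L (word_pure w) = g w))"

text \<open>\<open>x\<^sub>0 \<otimes> \<dots> \<otimes> x\<^sub>n \<mapsto> x \<otimes> x\<^sub>0 \<otimes> \<dots> \<otimes> x\<^sub>n\<close>\<close>
definition word_cons :: "'i \<times> 'v::complex_vector \<Rightarrow> ('i, 'v) words \<Rightarrow> ('i, 'v) words" where
  "word_cons x = word_lift (\<lambda>w. word_pure (x # w))"


subsection \<open>Universal properties\<close>

definition free_lift :: "('k \<Rightarrow> 'c::complex_vector) \<Rightarrow> ('k \<Rightarrow>\<^sub>0 complex) \<Rightarrow> 'c" where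
  "free_lift g p = (\<Sum>k\<in>Poly_Mapping.keys p. Poly_Mapping.lookup p k *\<^sub>C g k)"

lemma free_lift_superset:
  assumes "finite A" "Poly_Mapping.keys p \<subseteq> A"
  shows "free_lift g p = (\<Sum>k\<in>A. Poly_Mapping.lookup p k *\<^sub>C g k)"
  unfolding free_lift_def using assms
  by (intro sum.mono_neutral_left) (auto simp: in_keys_iff)

lemma clinear_free_lift: "clinear (free_lift g)"
  unfolding clinear_iff
proof (intro conjI allI)
  fix p q :: "'a \<Rightarrow>\<^sub>0 complex"
  let ?A = "Poly_Mapping.keys p \<union> Poly_Mapping.keys q"
  have "Poly_Mapping.keys (p + q) \<subseteq> ?A" by (rule Poly_Mapping.keys_add)
  then show "free_lift g (p + q) = free_lift g p + free_lift g q"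
    by (simp add: free_lift_superset[of ?A] lookup_add scaleC_add_left sum.distrib)
next
  fix c and p :: "'a \<Rightarrow>\<^sub>0 complex"
  have "Poly_Mapping.keys (c *\<^sub>C p) \<subseteq> Poly_Mapping.keys p"
    by (auto simp: in_keys_iff lookup_scaleC cvs.scale_zero_right)
  then show "free_lift g (c *\<^sub>C p) = c *\<^sub>C free_lift g p"
    by (simp add: free_lift_superset[of "Poly_Mapping.keys p"] lookup_scaleC cvs.scale_sum_right
        scaleC_complex_def scaleC_scaleC)
qed

lemma free_lift_single [simp]: "free_lift g (Poly_Mapping.single k 1) = g k"
  by (simp add: free_lift_def scaleC_one)

lemma clinear_eq_on_free:
  fixes f g :: "('k \<Rightarrow>\<^sub>0 complex) \<Rightarrow> 'c::complex_vector"
  assumes "clinear f" "clinear g" "\<And>k. f (Poly_Mapping.single k 1) = g (Poly_Mapping.single k 1)"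
  shows "f p = g p"
proof -
  interpret f: Vector_Spaces.linear scaleC scaleC f by fact
  interpret g: Vector_Spaces.linear scaleC scaleC g by fact
  have "p = (\<Sum>k\<in>Poly_Mapping.keys p. Poly_Mapping.lookup p k *\<^sub>C Poly_Mapping.single k 1)"
    by (rule poly_mapping_eqI)
      (auto simp: lookup_sum lookup_scaleC lookup_single when_def scaleC_complex_def in_keys_iff
        if_distrib sum.delta cong: if_cong)
  then obtain A u where "p = (\<Sum>k\<in>A. u k *\<^sub>C Poly_Mapping.single k 1)" by blast
  then show ?thesis by (simp add: f.sum g.sum f.scale g.scale assms(3))
qed

lemma free_lift_span:
  assumes "\<And>r. r \<in> R \<Longrightarrow> free_lift g r = 0" "p - q \<in> cvs.span R"
  shows "free_lift g p = free_lift g q"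
proof -
  interpret f: Vector_Spaces.linear scaleC scaleC "free_lift g" by (rule clinear_free_lift)
  have "free_lift g (p - q) = 0"
    using assms(2) by (induction rule: cvs.span_induct_alt) (auto simp: f.zero f.add f.scale assms(1))
  then show ?thesis by (simp add: f.diff)
qed

lemma tensor_lift_unique_ex:
  assumes "cbilinear \<beta>"
  shows "\<exists>!L. clinear L \<and> (\<forall>a b. L (a \<otimes>\<^sub>C b) = \<beta> a b)"
proof -
  let ?g = "\<lambda>(a, b). \<beta> a b"
  interpret f: Vector_Spaces.linear scaleC scaleC "free_lift ?g" by (rule clinear_free_lift)
  have bil: "\<beta> (x + y) b = \<beta> x b + \<beta> y b" "\<beta> a (u + v) = \<beta> a u + \<beta> a v"
    "\<beta> (c *\<^sub>C x) b = c *\<^sub>C \<beta> x b" "\<beta> a (c *\<^sub>C u) = c *\<^sub>C \<beta> a u" for x y b a u v c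
    using assms by (auto simp: cbilinear_def clinear_iff)
  have "free_lift ?g r = 0" if "r \<in> tensor_relations" for r
    using that by (auto simp: tensor_relations_def f.diff f.scale bil)
  then have R: "free_lift ?g p = free_lift ?g q" if "p - q \<in> cvs.span tensor_relations" for p q
    using free_lift_span that by blast
  define L where "L t = free_lift ?g (rep_tensor t)" for t
  have L: "L (abs_tensor p) = free_lift ?g p" for p
    unfolding L_def by (rule R) (rule Quotient3_rep_abs[OF Quotient3_tensor, OF span_cong_eq, OF refl])
  show ?thesis
  proof (rule ex1I)
    have "clinear L"
      unfolding clinear_iff
    proof (intro conjI allI)
      show "L (x + y) = L x + L y" for x y
      proof (induct x, induct y)
        fix p q show "L (abs_tensor q + abs_tensor p) = L (abs_tensor q) + L (abs_tensor p)"
          by (simp add: L plus_tensor.abs_eq f.add)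
      qed
      show "L (c *\<^sub>C x) = c *\<^sub>C L x" for c x
        by (induct x) (simp add: L scaleC_tensor.abs_eq f.scale)
    qed
    then show "clinear L \<and> (\<forall>a b. L (a \<otimes>\<^sub>C b) = \<beta> a b)"
      by (simp add: tensor_pure.abs_eq L)
    fix K assume K: "clinear K \<and> (\<forall>a b. K (a \<otimes>\<^sub>C b) = \<beta> a b)"
    show "K = L"
    proof
      fix t show "K t = L t"
      proof (induct t)
        fix p
        have "K (abs_tensor p) = free_lift ?g p"
        proof (rule clinear_eq_on_free[where f = "\<lambda>p. K (abs_tensor p)", OF _ clinear_free_lift])
          show "clinear (\<lambda>p. K (abs_tensor p))"
            using K by (auto simp: clinear_iff plus_tensor.abs_eq[symmetric] scaleC_tensor.abs_eq[symmetric])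
          show "K (abs_tensor (Poly_Mapping.single k 1)) = free_lift ?g (Poly_Mapping.single k 1)" for k
            using K by (cases k) (simp add: tensor_pure.abs_eq[symmetric])
        qed
        then show "K (abs_tensor p) = L (abs_tensor p)" by (simp add: L)
      qed
    qed
  qed
qed

lemma
  assumes "cbilinear \<beta>"
  shows clinear_tensor_lift: "clinear (tensor_lift \<beta>)"
    and tensor_lift_pure: "tensor_lift \<beta> (a \<otimes>\<^sub>C b) = \<beta> a b"
  using theI'[OF tensor_lift_unique_ex[OF assms]] unfolding tensor_lift_def by auto

definition multilinear :: "(('i \<times> 'v::complex_vector) list \<Rightarrow> 'c::complex_vector) \<Rightarrow> bool" where
  "multilinear g \<longleftrightarrow> (\<forall>us i vs. clinear (\<lambda>x. g (us @ (i, x) # vs)))"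

lemma word_lift_unique_ex:
  assumes "multilinear g"
  shows "\<exists>!L. clinear L \<and> (\<forall>w. L (word_pure w) = g w)"
proof -
  interpret f: Vector_Spaces.linear scaleC scaleC "free_lift g" by (rule clinear_free_lift)
  have mul: "g (us @ (i, x + y) # vs) = g (us @ (i, x) # vs) + g (us @ (i, y) # vs)"
    "g (us @ (i, c *\<^sub>C x) # vs) = c *\<^sub>C g (us @ (i, x) # vs)" for us i x y vs c
    using assms unfolding multilinear_def clinear_iff by blast+
  have "free_lift g r = 0" if "r \<in> word_relations" for r
    using that by (auto simp: word_relations_def f.diff f.scale mul)
  then have R: "free_lift g p = free_lift g q" if "p - q \<in> cvs.span word_relations" for p q
    using free_lift_span that by blast
  define L where "L t = free_lift g (rep_words t)" for t
  have L: "L (abs_words p) = free_lift g p" for p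
    unfolding L_def by (rule R) (rule Quotient3_rep_abs[OF Quotient3_words, OF span_cong_eq, OF refl])
  show ?thesis
  proof (rule ex1I)
    have "clinear L"
      unfolding clinear_iff
    proof (intro conjI allI)
      show "L (x + y) = L x + L y" for x y
      proof (induct x, induct y)
        fix p q show "L (abs_words q + abs_words p) = L (abs_words q) + L (abs_words p)"
          by (simp add: L plus_words.abs_eq f.add)
      qed
      show "L (c *\<^sub>C x) = c *\<^sub>C L x" for c x
        by (induct x) (simp add: L scaleC_words.abs_eq f.scale)
    qed
    then show "clinear L \<and> (\<forall>w. L (word_pure w) = g w)"
      by (simp add: word_pure.abs_eq L)
    fix K assume K: "clinear K \<and> (\<forall>w. K (word_pure w) = g w)"
    show "K = L"
    proof
      fix t show "K t = L t"
      proof (induct t)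
        fix p
        have "K (abs_words p) = free_lift g p"
        proof (rule clinear_eq_on_free[where f = "\<lambda>p. K (abs_words p)", OF _ clinear_free_lift])
          show "clinear (\<lambda>p. K (abs_words p))"
            using K by (auto simp: clinear_iff plus_words.abs_eq[symmetric] scaleC_words.abs_eq[symmetric])
          show "K (abs_words (Poly_Mapping.single k 1)) = free_lift g (Poly_Mapping.single k 1)" for k
            using K by (simp add: word_pure.abs_eq[symmetric])
        qed
        then show "K (abs_words p) = L (abs_words p)" by (simp add: L)
      qed
    qed
  qed
qed

lemma
  assumes "multilinear g"
  shows clinear_word_lift: "clinear (word_lift g)"
    and word_lift_pure: "word_lift g (word_pure w) = g w"
  using theI'[OF word_lift_unique_ex[OF assms]] unfolding word_lift_def by auto


section \<open>Hopf algebras and SAYD modules\<close>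

record (overloaded) 'h hopf_data =
  comult :: "'h \<Rightarrow> 'h \<otimes> 'h"
  counit :: "'h \<Rightarrow> complex"
  antipode :: "'h \<Rightarrow> 'h"

definition antipode_inv :: "'h::complex_vector hopf_data \<Rightarrow> 'h \<Rightarrow> 'h" where
  "antipode_inv H = inv_into UNIV (antipode H)"

definition hopf_algebra :: "('h::complex_algebra_1) hopf_data \<Rightarrow> bool" where
  "hopf_algebra H \<longleftrightarrow>
     clinear (comult H) \<and> clinear (counit H) \<and> clinear (antipode H) \<and> bij (antipode H) \<and>
     \<comment> \<open>coassociativity and counit\<close>
     (\<forall>h. tensor_lift (\<lambda>a b. tensor_lift (\<lambda>a\<^sub>1 a\<^sub>2. a\<^sub>1 \<otimes>\<^sub>C (a\<^sub>2 \<otimes>\<^sub>C b)) (comult H a)) (comult H h)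
        = tensor_lift (\<lambda>a b. a \<otimes>\<^sub>C comult H b) (comult H h)) \<and>
     (\<forall>h. tensor_lift (\<lambda>a b. counit H a *\<^sub>C b) (comult H h) = h) \<and>
     (\<forall>h. tensor_lift (\<lambda>a b. counit H b *\<^sub>C a) (comult H h) = h) \<and>
     \<comment> \<open>comultiplication and counit are algebra maps\<close>
     (\<forall>g h. comult H (g * h) =
        tensor_lift (\<lambda>g\<^sub>1 g\<^sub>2. tensor_lift (\<lambda>h\<^sub>1 h\<^sub>2. (g\<^sub>1 * h\<^sub>1) \<otimes>\<^sub>C (g\<^sub>2 * h\<^sub>2)) (comult H h)) (comult H g)) \<and>
     comult H 1 = 1 \<otimes>\<^sub>C 1 \<and>
     (\<forall>g h. counit H (g * h) = counit H g * counit H h) \<and> counit H 1 = 1 \<and>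
     \<comment> \<open>antipode\<close>
     (\<forall>h. tensor_lift (\<lambda>a b. antipode H a * b) (comult H h) = counit H h *\<^sub>C 1) \<and>
     (\<forall>h. tensor_lift (\<lambda>a b. a * antipode H b) (comult H h) = counit H h *\<^sub>C 1)"

record (overloaded) ('h, 'm) mod_comod =
  ract :: "'m \<Rightarrow> 'h \<Rightarrow> 'm"
  coact :: "'m \<Rightarrow> 'h \<otimes> 'm"

definition right_module :: "('h::complex_algebra_1, 'm::complex_vector) mod_comod \<Rightarrow> bool" where
  "right_module M \<longleftrightarrow> cbilinear (ract M) \<and> (\<forall>m. ract M m 1 = m) \<and>
     (\<forall>m g h. ract M m (g * h) = ract M (ract M m g) h)"

definition left_comodule :: "('h::complex_algebra_1) hopf_data \<Rightarrow> ('h, 'm::complex_vector) mod_comod \<Rightarrow> bool" where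
  "left_comodule H M \<longleftrightarrow> clinear (coact M) \<and>
     (\<forall>m. tensor_lift (\<lambda>a n. tensor_lift (\<lambda>a\<^sub>1 a\<^sub>2. a\<^sub>1 \<otimes>\<^sub>C (a\<^sub>2 \<otimes>\<^sub>C n)) (comult H a)) (coact M m)
        = tensor_lift (\<lambda>a n. a \<otimes>\<^sub>C coact M n) (coact M m)) \<and>
     (\<forall>m. tensor_lift (\<lambda>a n. counit H a *\<^sub>C n) (coact M m) = m)"

definition sayd_module :: "('h::complex_algebra_1) hopf_data \<Rightarrow> ('h, 'm::complex_vector) mod_comod \<Rightarrow> bool" where
  "sayd_module H M \<longleftrightarrow> right_module M \<and> left_comodule H M \<and>
     (\<forall>m h. coact M (ract M m h) =
        tensor_lift (\<lambda>h\<^sub>1 h'. tensor_lift (\<lambda>h\<^sub>2 h\<^sub>3. tensor_lift (\<lambda>a n.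
            (antipode H h\<^sub>3 * a * h\<^sub>1) \<otimes>\<^sub>C ract M n h\<^sub>2) (coact M m)) (comult H h')) (comult H h)) \<and>
     (\<forall>m. tensor_lift (\<lambda>a n. ract M n a) (coact M m) = m)"


section \<open>Left \<open>H\<close>-categories and semifunctors\<close>

text \<open>
  The Hom spaces of a small \<open>k\<close>-linear category are presented as subspaces of one ambient vector
  space \<open>'f\<close>, which is no restriction since any family of vector spaces embeds in its direct sum.
  They are allowed to overlap, so all operations carry the objects involved:
  \<open>Comp D X Y Z g f\<close> is the composite \<open>g \<circ> f\<close> for \<open>f : X \<rightarrow> Y\<close>, \<open>g : Y \<rightarrow> Z\<close>.
\<close>
record ('o, 'f, 'h) hcat =
  Ob :: "'o set"
  Hom :: "'o \<Rightarrow> 'o \<Rightarrow> 'f set"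
  Comp :: "'o \<Rightarrow> 'o \<Rightarrow> 'o \<Rightarrow> 'f \<Rightarrow> 'f \<Rightarrow> 'f"
  Id :: "'o \<Rightarrow> 'f"
  Act :: "'o \<Rightarrow> 'o \<Rightarrow> 'h \<Rightarrow> 'f \<Rightarrow> 'f"

definition k_linear_category :: "('o, 'f::complex_vector, 'h) hcat \<Rightarrow> bool" where
  "k_linear_category D \<longleftrightarrow>
     (\<forall>X\<in>Ob D. \<forall>Y\<in>Ob D. cvs.subspace (Hom D X Y)) \<and>
     (\<forall>X\<in>Ob D. \<forall>Y\<in>Ob D. \<forall>Z\<in>Ob D. \<forall>g\<in>Hom D Y Z. linear_map (Hom D X Y) (Hom D X Z) (Comp D X Y Z g)) \<and>
     (\<forall>X\<in>Ob D. \<forall>Y\<in>Ob D. \<forall>Z\<in>Ob D. \<forall>f\<in>Hom D X Y. linear_map (Hom D Y Z) (Hom D X Z) (\<lambda>g. Comp D X Y Z g f)) \<and>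
     (\<forall>W\<in>Ob D. \<forall>X\<in>Ob D. \<forall>Y\<in>Ob D. \<forall>Z\<in>Ob D. \<forall>f\<in>Hom D W X. \<forall>g\<in>Hom D X Y. \<forall>h\<in>Hom D Y Z.
        Comp D W Y Z h (Comp D W X Y g f) = Comp D W X Z (Comp D X Y Z h g) f) \<and>
     (\<forall>X\<in>Ob D. Id D X \<in> Hom D X X) \<and>
     (\<forall>X\<in>Ob D. \<forall>Y\<in>Ob D. \<forall>f\<in>Hom D X Y. Comp D X Y Y (Id D Y) f = f \<and> Comp D X X Y f (Id D X) = f)"

definition left_H_category ::
    "('h::complex_algebra_1) hopf_data \<Rightarrow> ('o, 'f::complex_vector, 'h) hcat \<Rightarrow> bool" where
  "left_H_category H D \<longleftrightarrow> k_linear_category D \<and>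
     \<comment> \<open>the Hom spaces are left modules\<close>
     (\<forall>X\<in>Ob D. \<forall>Y\<in>Ob D. \<forall>h. linear_map (Hom D X Y) (Hom D X Y) (Act D X Y h)) \<and>
     (\<forall>X\<in>Ob D. \<forall>Y\<in>Ob D. \<forall>f\<in>Hom D X Y. clinear (\<lambda>h. Act D X Y h f) \<and> Act D X Y 1 f = f \<and>
        (\<forall>g h. Act D X Y (g * h) f = Act D X Y g (Act D X Y h f))) \<and>
     \<comment> \<open>identities are invariant and composition is equivariant\<close>
     (\<forall>X\<in>Ob D. \<forall>h. Act D X X h (Id D X) = counit H h *\<^sub>C Id D X) \<and>
     (\<forall>X\<in>Ob D. \<forall>Y\<in>Ob D. \<forall>Z\<in>Ob D. \<forall>f\<in>Hom D X Y. \<forall>g\<in>Hom D Y Z. \<forall>h.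
        Act D X Z h (Comp D X Y Z g f) =
          tensor_lift (\<lambda>h\<^sub>1 h\<^sub>2. Comp D X Y Z (Act D Y Z h\<^sub>1 g) (Act D X Y h\<^sub>2 f)) (comult H h))"

record ('o1, 'f1, 'o2, 'f2) semifun =
  on_ob :: "'o1 \<Rightarrow> 'o2"
  on_hom :: "'o1 \<Rightarrow> 'o1 \<Rightarrow> 'f1 \<Rightarrow> 'f2"

definition H_semifunctor ::
    "('o1, 'f1::complex_vector, 'h) hcat \<Rightarrow> ('o2, 'f2::complex_vector, 'h) hcat
      \<Rightarrow> ('o1, 'f1, 'o2, 'f2) semifun \<Rightarrow> bool" where
  "H_semifunctor D D' F \<longleftrightarrow>
     on_ob F \<in> Ob D \<rightarrow> Ob D' \<and>
     (\<forall>X\<in>Ob D. \<forall>Y\<in>Ob D. linear_map (Hom D X Y) (Hom D' (on_ob F X) (on_ob F Y)) (on_hom F X Y)) \<and>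
     (\<forall>X\<in>Ob D. \<forall>Y\<in>Ob D. \<forall>Z\<in>Ob D. \<forall>f\<in>Hom D X Y. \<forall>g\<in>Hom D Y Z.
        on_hom F X Z (Comp D X Y Z g f) =
          Comp D' (on_ob F X) (on_ob F Y) (on_ob F Z) (on_hom F Y Z g) (on_hom F X Y f)) \<and>
     (\<forall>X\<in>Ob D. \<forall>Y\<in>Ob D. \<forall>f\<in>Hom D X Y. \<forall>h.
        on_hom F X Y (Act D X Y h f) = Act D' (on_ob F X) (on_ob F Y) h (on_hom F X Y f))"

definition id_semifun :: "('o, 'f, 'o, 'f) semifun" where
  "id_semifun = \<lparr>on_ob = (\<lambda>X. X), on_hom = (\<lambda>X Y f. f)\<rparr>"

definition comp_semifun ::
    "('o2, 'f2, 'o3, 'f3) semifun \<Rightarrow> ('o1, 'f1, 'o2, 'f2) semifun \<Rightarrow> ('o1, 'f1, 'o3, 'f3) semifun" where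
  "comp_semifun G F = \<lparr>on_ob = (\<lambda>X. on_ob G (on_ob F X)),
     on_hom = (\<lambda>X Y f. on_hom G (on_ob F X) (on_ob F Y) (on_hom F X Y f))\<rparr>"

definition H_automorphism ::
    "('o, 'f::complex_vector, 'h) hcat \<Rightarrow> ('o, 'f, 'o, 'f) semifun \<Rightarrow> bool" where
  "H_automorphism D F \<longleftrightarrow> H_semifunctor D D F \<and>
     (\<forall>X\<in>Ob D. on_hom F X X (Id D X) = Id D (on_ob F X)) \<and>
     bij_betw (on_ob F) (Ob D) (Ob D) \<and>
     (\<forall>X\<in>Ob D. \<forall>Y\<in>Ob D. bij_betw (on_hom F X Y) (Hom D X Y) (Hom D (on_ob F X) (on_ob F Y)))"

definition inverse_arrows :: "('o, 'f, 'h) hcat \<Rightarrow> 'o \<Rightarrow> 'f \<Rightarrow> 'f \<Rightarrow> bool" where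
  "inverse_arrows D X f g \<longleftrightarrow> f \<in> Hom D X X \<and> g \<in> Hom D X X \<and>
     Comp D X X X f g = Id D X \<and> Comp D X X X g f = Id D X"

definition Aut :: "('o, 'f, 'h) hcat \<Rightarrow> 'o \<Rightarrow> 'f set" where
  "Aut D X = {f. \<exists>g. inverse_arrows D X f g}"

definition inv_arrow :: "('o, 'f, 'h) hcat \<Rightarrow> 'o \<Rightarrow> 'f \<Rightarrow> 'f" where
  "inv_arrow D X f = (THE g. inverse_arrows D X f g)"

definition unit_families :: "'h hopf_data \<Rightarrow> ('o, 'f::complex_vector, 'h::complex_vector) hcat \<Rightarrow> ('o \<Rightarrow> 'f) set" where
  "unit_families H D = {\<eta>. \<forall>X\<in>Ob D. \<eta> X \<in> Aut D X \<and> (\<forall>h. Act D X X h (\<eta> X) = counit H h *\<^sub>C \<eta> X)}"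

definition inner_automorphism :: "('o, 'f, 'h) hcat \<Rightarrow> ('o \<Rightarrow> 'f) \<Rightarrow> ('o, 'f, 'o, 'f) semifun" where
  "inner_automorphism D \<eta> = \<lparr>on_ob = (\<lambda>X. X),
     on_hom = (\<lambda>X Y f. Comp D X Y Y (\<eta> Y) (Comp D X X Y f (inv_arrow D X (\<eta> X))))\<rparr>"


section \<open>The cocyclic module of a left \<open>H\<close>-category\<close>

text \<open>An arrow \<open>f : X \<rightarrow> Y\<close> is recorded with its source and target as \<open>((X, Y), f)\<close>.\<close>
type_synonym ('o, 'f) arrow = "('o \<times> 'o) \<times> 'f"

abbreviation arr_src :: "('o, 'f) arrow \<Rightarrow> 'o" where "arr_src a \<equiv> fst (fst a)"
abbreviation arr_tgt :: "('o, 'f) arrow \<Rightarrow> 'o" where "arr_tgt a \<equiv> snd (fst a)"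

definition arr_comp :: "('o, 'f, 'h) hcat \<Rightarrow> ('o, 'f) arrow \<Rightarrow> ('o, 'f) arrow \<Rightarrow> ('o, 'f) arrow" where
  "arr_comp D b a =
     ((arr_src a, arr_tgt b), Comp D (arr_src a) (arr_tgt a) (arr_tgt b) (snd b) (snd a))"

definition arr_act :: "('o, 'f, 'h) hcat \<Rightarrow> 'h \<Rightarrow> ('o, 'f) arrow \<Rightarrow> ('o, 'f) arrow" where
  "arr_act D h a = (fst a, Act D (arr_src a) (arr_tgt a) h (snd a))"

definition arr_map :: "('o1, 'f1, 'o2, 'f2) semifun \<Rightarrow> ('o1, 'f1) arrow \<Rightarrow> ('o2, 'f2) arrow" where
  "arr_map F a = ((on_ob F (arr_src a), on_ob F (arr_tgt a)), on_hom F (arr_src a) (arr_tgt a) (snd a))"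

text \<open>Words \<open>[f\<^sup>0, \<dots>, f\<^sup>n]\<close> with \<open>f\<^sup>i : X\<^sub>i\<^sub>+\<^sub>1 \<rightarrow> X\<^sub>i\<close>, where \<open>X\<^sub>n\<^sub>+\<^sub>1 = X\<^sub>0\<close>.\<close>
definition cyclic_words :: "('o, 'f, 'h) hcat \<Rightarrow> nat \<Rightarrow> ('o, 'f) arrow list set" where
  "cyclic_words D n = {w. length w = Suc n \<and>
     (\<forall>a\<in>set w. arr_src a \<in> Ob D \<and> arr_tgt a \<in> Ob D \<and> snd a \<in> Hom D (arr_src a) (arr_tgt a)) \<and>
     (\<forall>i\<le>n. arr_src (w ! i) = arr_tgt (w ! (Suc i mod Suc n)))}"

text \<open>The span of the elementary tensors with factors in given subspaces is the tensor product of
  these subspaces.\<close>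
definition CN :: "('o, 'f::complex_vector, 'h) hcat \<Rightarrow> nat \<Rightarrow> ('o \<times> 'o, 'f) words set" where
  "CN D n = cvs.span (word_pure ` cyclic_words D n)"

definition M_tensor_CN :: "('o, 'f::complex_vector, 'h) hcat \<Rightarrow> nat
    \<Rightarrow> ('m::complex_vector \<otimes> ('o \<times> 'o, 'f) words) set" where
  "M_tensor_CN D n = cvs.span {m \<otimes>\<^sub>C x | m x. x \<in> CN D n}"

text \<open>The diagonal action \<open>h (f\<^sup>0 \<otimes> \<dots> \<otimes> f\<^sup>n) = h\<^sub>1 f\<^sup>0 \<otimes> \<dots> \<otimes> h\<^sub>n\<^sub>+\<^sub>1 f\<^sup>n\<close>; on the empty word,
  where the recursion ends, \<open>h\<close> acts through the counit.\<close>
primrec diag_act :: "'h::complex_vector hopf_data \<Rightarrow> ('o, 'f::complex_vector, 'h) hcat \<Rightarrow> ('o, 'f) arrow list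
    \<Rightarrow> 'h \<Rightarrow> ('o \<times> 'o, 'f) words" where
  "diag_act H D [] = (\<lambda>h. counit H h *\<^sub>C word_pure [])"
| "diag_act H D (a # w) =
     (\<lambda>h. tensor_lift (\<lambda>h\<^sub>1 h\<^sub>2. word_cons (arr_act D h\<^sub>1 a) (diag_act H D w h\<^sub>2)) (comult H h))"

text \<open>Linear functionals on a subspace \<open>V\<close>, represented by functions vanishing off \<open>V\<close>.\<close>
definition functionals :: "'a::complex_vector set \<Rightarrow> ('a \<Rightarrow> complex) set" where
  "functionals V = {\<phi>. linear_on V \<phi> \<and> (\<forall>x. x \<notin> V \<longrightarrow> \<phi> x = 0)}"

type_synonym ('m, 'o, 'f) cochain = "'m \<otimes> ('o \<times> 'o, 'f) words \<Rightarrow> complex"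

definition cochains :: "('h::complex_algebra_1) hopf_data \<Rightarrow> ('h, 'm::complex_vector) mod_comod
    \<Rightarrow> ('o, 'f::complex_vector, 'h) hcat \<Rightarrow> nat \<Rightarrow> ('m, 'o, 'f) cochain set" where
  "cochains H M D n = {\<phi> \<in> functionals (M_tensor_CN D n).
     \<forall>m h. \<forall>w\<in>cyclic_words D n.
       \<phi> (tensor_lift (\<lambda>h\<^sub>1 h\<^sub>2. ract M m h\<^sub>1 \<otimes>\<^sub>C diag_act H D w (antipode H h\<^sub>2)) (comult H h))
         = counit H h * \<phi> (m \<otimes>\<^sub>C word_pure w)}"

text \<open>The functional on \<open>M \<otimes> CN\<^sub>n(D)\<close> with prescribed (multilinear) values on elementary tensors.\<close>
definition functional_of :: "('o, 'f::complex_vector, 'h) hcat \<Rightarrow> nat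
    \<Rightarrow> ('m::complex_vector \<Rightarrow> ('o, 'f) arrow list \<Rightarrow> complex) \<Rightarrow> ('m, 'o, 'f) cochain" where
  "functional_of D n g = (THE \<phi>. \<phi> \<in> functionals (M_tensor_CN D n) \<and>
     (\<forall>m. \<forall>w\<in>cyclic_words D n. \<phi> (m \<otimes>\<^sub>C word_pure w) = g m w))"

text \<open>\<open>f\<^sup>0 \<otimes> \<dots> \<otimes> f\<^sup>i f\<^sup>i\<^sup>+\<^sup>1 \<otimes> \<dots> \<otimes> f\<^sup>n\<^sup>+\<^sup>1\<close>\<close>
definition merge :: "('o, 'f, 'h) hcat \<Rightarrow> nat \<Rightarrow> ('o, 'f) arrow list \<Rightarrow> ('o, 'f) arrow list" where
  "merge D i w = take i w @ arr_comp D (w ! i) (w ! Suc i) # drop (i + 2) w"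

text \<open>In the following operators \<open>n\<close> is the degree of the cochain they are applied to.\<close>

definition delta :: "('h::complex_algebra_1) hopf_data \<Rightarrow> ('h, 'm::complex_vector) mod_comod
    \<Rightarrow> ('o, 'f::complex_vector, 'h) hcat \<Rightarrow> nat \<Rightarrow> nat \<Rightarrow> ('m, 'o, 'f) cochain \<Rightarrow> ('m, 'o, 'f) cochain" where
  "delta H M D n i \<phi> = functional_of D (Suc n) (\<lambda>m w.
     if i \<le> n then \<phi> (m \<otimes>\<^sub>C word_pure (merge D i w))
     else \<phi> (tensor_lift (\<lambda>a m\<^sub>0. m\<^sub>0 \<otimes>\<^sub>C word_pure
        (arr_comp D (arr_act D (antipode_inv H a) (last w)) (hd w) # butlast (tl w))) (coact M m)))"

definition tau :: "('h::complex_algebra_1) hopf_data \<Rightarrow> ('h, 'm::complex_vector) mod_comod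
    \<Rightarrow> ('o, 'f::complex_vector, 'h) hcat \<Rightarrow> nat \<Rightarrow> ('m, 'o, 'f) cochain \<Rightarrow> ('m, 'o, 'f) cochain" where
  "tau H M D n \<phi> = functional_of D n (\<lambda>m w.
     \<phi> (tensor_lift (\<lambda>a m\<^sub>0. m\<^sub>0 \<otimes>\<^sub>C word_pure
        (arr_act D (antipode_inv H a) (last w) # butlast w)) (coact M m)))"

definition hoch_b where
  "hoch_b H M D n \<phi> = (\<Sum>i\<le>Suc n. (-1) ^ i *\<^sub>C delta H M D n i \<phi>)"

definition hoch_b' where
  "hoch_b' H M D n \<phi> = (\<Sum>i\<le>n. (-1) ^ i *\<^sub>C delta H M D n i \<phi>)"

definition lambda where
  "lambda H M D n \<phi> = (-1) ^ n *\<^sub>C tau H M D n \<phi>"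

definition one_minus_lambda where
  "one_minus_lambda H M D n \<phi> = \<phi> - lambda H M D n \<phi>"

definition norm_op where
  "norm_op H M D n \<phi> = (\<Sum>i\<le>n. (lambda H M D n ^^ i) \<phi>)"

text \<open>The map induced on cochains by a semifunctor \<open>F\<close> with source \<open>D\<close>.\<close>
definition cochain_map :: "('o1, 'f1::complex_vector, 'h) hcat
    \<Rightarrow> ('o1, 'f1, 'o2, 'f2::complex_vector) semifun \<Rightarrow> nat
    \<Rightarrow> ('m::complex_vector, 'o2, 'f2) cochain \<Rightarrow> ('m, 'o1, 'f1) cochain" where
  "cochain_map D F n \<phi> = functional_of D n (\<lambda>m w. \<phi> (m \<otimes>\<^sub>C word_pure (map (arr_map F) w)))"


section \<open>The cyclic double complex\<close>

text \<open>First quadrant cohomological double complexes with anticommuting differentials;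
  \<open>p\<close> is the column and \<open>q\<close> the row.\<close>
record 'v double_complex_data =
  dc_space :: "nat \<Rightarrow> nat \<Rightarrow> 'v set"
  dc_vert :: "nat \<Rightarrow> nat \<Rightarrow> 'v \<Rightarrow> 'v"
  dc_horiz :: "nat \<Rightarrow> nat \<Rightarrow> 'v \<Rightarrow> 'v"

definition double_complex :: "'v::complex_vector double_complex_data \<Rightarrow> bool" where
  "double_complex A \<longleftrightarrow> (\<forall>p q. cvs.subspace (dc_space A p q) \<and>
     linear_map (dc_space A p q) (dc_space A p (Suc q)) (dc_vert A p q) \<and>
     linear_map (dc_space A p q) (dc_space A (Suc p) q) (dc_horiz A p q) \<and>
     (\<forall>x\<in>dc_space A p q.
        dc_vert A p (Suc q) (dc_vert A p q x) = 0 \<and>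
        dc_horiz A (Suc p) q (dc_horiz A p q x) = 0 \<and>
        dc_horiz A p (Suc q) (dc_vert A p q x) + dc_vert A (Suc p) q (dc_horiz A p q x) = 0))"

definition double_complex_morphism :: "'v::complex_vector double_complex_data
    \<Rightarrow> 'w::complex_vector double_complex_data \<Rightarrow> (nat \<Rightarrow> nat \<Rightarrow> 'v \<Rightarrow> 'w) \<Rightarrow> bool" where
  "double_complex_morphism A B F \<longleftrightarrow> double_complex A \<and> double_complex B \<and>
     (\<forall>p q. linear_map (dc_space A p q) (dc_space B p q) (F p q) \<and>
       (\<forall>x\<in>dc_space A p q.
          F p (Suc q) (dc_vert A p q x) = dc_vert B p q (F p q x) \<and>
          F (Suc p) q (dc_horiz A p q x) = dc_horiz B p q (F p q x)))"

definition cyclic_double_complex :: "('h::complex_algebra_1) hopf_data \<Rightarrow> ('h, 'm::complex_vector) mod_comod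
    \<Rightarrow> ('o, 'f::complex_vector, 'h) hcat \<Rightarrow> ('m, 'o, 'f) cochain double_complex_data" where
  "cyclic_double_complex H M D = \<lparr>
     dc_space = (\<lambda>p q. cochains H M D q),
     dc_vert = (\<lambda>p q \<phi>. if even p then hoch_b H M D q \<phi> else - hoch_b' H M D q \<phi>),
     dc_horiz = (\<lambda>p q \<phi>. if even p then one_minus_lambda H M D q \<phi> else norm_op H M D q \<phi>)\<rparr>"


section \<open>Hopf-cyclic cohomology\<close>

definition complex_ring :: "complex ring" where
  "complex_ring = \<lparr>carrier = UNIV, mult = (*), one = 1, zero = 0, add = (+)\<rparr>"

text \<open>The quotient of \<open>Z\<close> by \<open>B \<subseteq> Z\<close>, with cosets as elements.  (The type of modules extends that
  of rings; its fields \<open>mult\<close> and \<open>one\<close> are not used.)\<close>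
definition quotient_space :: "'v::complex_vector set \<Rightarrow> 'v set \<Rightarrow> (complex, 'v set) module" where
  "quotient_space Z B = \<lparr>carrier = (\<lambda>z. z +o B) ` Z, mult = undefined, one = undefined,
     zero = B, add = (\<lambda>K L. K + L), smult = (\<lambda>c K. (\<lambda>z. c *\<^sub>C z) ` K + B)\<rparr>"

definition module_linear :: "(complex, 'a) module \<Rightarrow> (complex, 'b) module \<Rightarrow> ('a \<Rightarrow> 'b) \<Rightarrow> bool" where
  "module_linear V W f \<longleftrightarrow> f \<in> carrier V \<rightarrow> carrier W \<and>
     (\<forall>x\<in>carrier V. \<forall>y\<in>carrier V. f (x \<oplus>\<^bsub>V\<^esub> y) = f x \<oplus>\<^bsub>W\<^esub> f y) \<and>
     (\<forall>c. \<forall>x\<in>carrier V. f (c \<odot>\<^bsub>V\<^esub> x) = c \<odot>\<^bsub>W\<^esub> f x)"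

definition cyclic_cochains where
  "cyclic_cochains H M D n = {\<phi> \<in> cochains H M D n. one_minus_lambda H M D n \<phi> = 0}"

definition cyclic_cocycles where
  "cyclic_cocycles H M D n = {\<phi> \<in> cyclic_cochains H M D n. hoch_b H M D n \<phi> = 0}"

definition cyclic_coboundaries where
  "cyclic_coboundaries H M D n =
     (case n of 0 \<Rightarrow> {0} | Suc k \<Rightarrow> hoch_b H M D k ` cyclic_cochains H M D k)"

definition HC :: "('h::complex_algebra_1) hopf_data \<Rightarrow> ('h, 'm::complex_vector) mod_comod
    \<Rightarrow> ('o, 'f::complex_vector, 'h) hcat \<Rightarrow> nat \<Rightarrow> (complex, ('m, 'o, 'f) cochain set) module" where
  "HC H M D n = quotient_space (cyclic_cocycles H M D n) (cyclic_coboundaries H M D n)"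

definition HC_class where
  "HC_class H M D n \<phi> = \<phi> +o cyclic_coboundaries H M D n"

text \<open>The map induced on cohomology by a semifunctor \<open>F\<close> with source \<open>D\<close>: the class \<open>[\<phi>]\<close> is sent
  to the class of the image of \<open>\<phi>\<close>.\<close>
definition HC_map :: "('h::complex_algebra_1) hopf_data \<Rightarrow> ('h, 'm::complex_vector) mod_comod
    \<Rightarrow> ('o1, 'f1::complex_vector, 'h) hcat \<Rightarrow> ('o1, 'f1, 'o2, 'f2::complex_vector) semifun \<Rightarrow> nat
    \<Rightarrow> ('m, 'o2, 'f2) cochain set \<Rightarrow> ('m, 'o1, 'f1) cochain set" where
  "HC_map H M D F n K = cochain_map D F n ` K + cyclic_coboundaries H M D n"

end

theory Submission
  imports Defs
begin

text \<open>
  The condition on a cochain is equivalent to \<open>\<phi>(mh \<otimes> x) = \<phi>(m \<otimes> hx)\<close>.  With the (anti-)Yetter-Drinfeld and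
  stability conditions this makes the cochains a cocyclic module: \<open>\<tau>\<^sup>k\<close> moves the last \<open>k\<close> factors to the
  front while \<open>S\<^sup>-\<^sup>1(m\<^sub>(\<^sub>-\<^sub>1\<^sub>))\<close> acts on them diagonally, so \<open>\<tau>\<^sup>n\<^sup>+\<^sup>1\<close> turns \<open>m\<close> into \<open>m\<^sub>(\<^sub>0\<^sub>) S\<^sup>-\<^sup>1(m\<^sub>(\<^sub>-\<^sub>1\<^sub>)) = m\<close>.

  For the second part, double every object of \<open>D\<close>.  The inclusions \<open>i\<^sub>0, i\<^sub>1\<close> of \<open>D\<close> as one or the other
  copy and the semifunctor \<open>q\<close> that transports the second copy back along \<open>\<eta>\<close> satisfy \<open>q i\<^sub>0 = 1\<close> and
  \<open>q i\<^sub>1 = \<Phi>\<^sub>\<eta>\<close>.  The idempotent \<open>p\<close> that collapses both copies to the first one satisfies \<open>p i\<^sub>1 = i\<^sub>0\<close> and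
  is homotopic to the identity on the Hochschild complex, so the kernel of \<open>p\<^sup>*\<close> has vanishing
  Hochschild cohomology and, by Connes' periodicity argument, vanishing cyclic cohomology.  Hence
  \<open>q\<^sup>*\<phi> - p\<^sup>*q\<^sup>*\<phi>\<close> is a coboundary for each cyclic cocycle \<open>\<phi>\<close>, and \<open>i\<^sub>1\<^sup>*\<close> turns it into \<open>\<Phi>\<^sub>\<eta>\<^sup>*\<phi> - \<phi>\<close>.
\<close>

section \<open>Linear algebra\<close>

text \<open>A natural isomorphism between two semifunctors yields a homotopy on the Hochschild
  complex, but this homotopy does not commute with \<open>tau\<close>. Used directly between
  \<Phi>_\<eta> and the identity, it would settle Hochschild cohomology only, and periodicity alone
  would then make \<Phi>_\<eta> - 1 nilpotent on cyclic cohomology, not zero. An idempotent p is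
  better: 1 - p is idempotent too, hence zero once it is nilpotent. Doubling the objects trades
  \<Phi>_\<eta> for such an idempotent. The isomorphisms between the two copies are identities of
  \<open>D\<close>, so \<open>H\<close> acts on them through the counit; \<eta> enters only through
  q. The other obstacle is the bookkeeping with coefficients. Cochains are functionals on a subspace
  of a large tensor space, so every operator is handled through its values on elementary tensors,
  and \<open>hact\<close> and \<open>tsum\<close> express these values in Sweedler form. The last
  coface is \<open>tau\<close> after the zeroth one, which leaves only merging and rotation to
  analyse; the anti-Yetter-Drinfeld condition is used in the rotation alone.\<close>

named_theorems clin

lemma clinearI:
  "(\<And>x y. f (x + y) = f x + f y) \<Longrightarrow> (\<And>c x. f (c *\<^sub>C x) = c *\<^sub>C f x) \<Longrightarrow> clinear f"
  by (simp add: clinear_iff)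

lemma clinear_add: "clinear f \<Longrightarrow> f (x + y) = f x + f y"
  and clinear_scale: "clinear f \<Longrightarrow> f (c *\<^sub>C x) = c *\<^sub>C f x"
  by (simp_all add: clinear_iff)

lemma clinear_zero: "clinear f \<Longrightarrow> f 0 = 0"
  using clinear_scale[of f 0 0] by (simp add: cvs.scale_zero_left)

lemma clinear_sum_list: "clinear f \<Longrightarrow> f (\<Sum>x\<leftarrow>xs. g x) = (\<Sum>x\<leftarrow>xs. f (g x))"
  by (induction xs) (simp_all add: clinear_zero clinear_add)

lemma scaleC_sum_list: "c *\<^sub>C (\<Sum>x\<leftarrow>xs. g x) = (\<Sum>x\<leftarrow>xs. c *\<^sub>C (g x :: 'a::complex_vector))"
  by (induction xs) (simp_all add: scaleC_add_right cvs.scale_zero_right)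

lemma sum_list_swap: "(\<Sum>x\<leftarrow>xs. \<Sum>y\<leftarrow>ys. f x y) = (\<Sum>y\<leftarrow>ys. \<Sum>x\<leftarrow>xs. (f x y :: 'a::comm_monoid_add))"
  by (induction xs) (simp_all add: sum_list_addf)

lemma clinear_ident [clin]: "clinear (\<lambda>x. x)"
  by (simp add: clinear_iff)

lemma clinear_scaleC_left [clin]: "clinear f \<Longrightarrow> clinear (\<lambda>x. f x *\<^sub>C v)" for f :: "'a::complex_vector \<Rightarrow> complex"
  by (simp add: clinear_iff scaleC_add_left scaleC_complex_def scaleC_scaleC)

lemma clinear_scaleC_right [clin]: "clinear f \<Longrightarrow> clinear (\<lambda>x. c *\<^sub>C f x)"
  by (simp add: clinear_iff scaleC_add_right scaleC_scaleC mult.commute)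

lemma clinear_mult_right [clin]: "clinear f \<Longrightarrow> clinear (\<lambda>x. f x * (c::'a::complex_algebra_1))"
  by (simp add: clinear_iff distrib_right scaleC_mult_left)

lemma clinear_mult_left [clin]: "clinear f \<Longrightarrow> clinear (\<lambda>x. (c::'a::complex_algebra_1) * f x)"
  by (simp add: clinear_iff distrib_left scaleC_mult_right)

text \<open>Composition stays out of \<open>clin\<close>: with both maps unknown it would match
  every goal. Only instances with a fixed outer map are collected.\<close>

lemma clinear_comp: "clinear g \<Longrightarrow> clinear f \<Longrightarrow> clinear (\<lambda>x. g (f x))"
  by (simp add: clinear_iff)

lemma clinear_plus [clin]: "clinear f \<Longrightarrow> clinear g \<Longrightarrow> clinear (\<lambda>x. f x + g x)"
  by (simp add: clinear_iff scaleC_add_right add.assoc add.left_commute)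

lemma clinear_const_zero [clin]: "clinear (\<lambda>x. 0)"
  by (simp add: clinear_iff cvs.scale_zero_right)

lemma cbilinearI [clin]:
  "(\<And>b. clinear (\<lambda>a. \<beta> a b)) \<Longrightarrow> (\<And>a. clinear (\<lambda>b. \<beta> a b)) \<Longrightarrow> cbilinear \<beta>"
  by (simp add: cbilinear_def)

lemma cbilinear_left: "cbilinear \<beta> \<Longrightarrow> clinear f \<Longrightarrow> clinear (\<lambda>x. \<beta> (f x) b)"
  by (auto simp: cbilinear_def intro: clinear_comp[of "\<lambda>a. \<beta> a b"])

lemma cbilinear_right: "cbilinear \<beta> \<Longrightarrow> clinear f \<Longrightarrow> clinear (\<lambda>x. \<beta> a (f x))"
  by (auto simp: cbilinear_def intro: clinear_comp)

lemma clinear_sum_list_fun [clin]: "(\<And>y. clinear (\<lambda>x. f y x)) \<Longrightarrow> clinear (\<lambda>x. \<Sum>y\<leftarrow>ys. f y x)"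
  by (induction ys) (simp_all add: clin)

lemma cbilinear_tensor_pure: "cbilinear (\<otimes>\<^sub>C)"
proof (intro cbilinearI clinearI)
  show "(x + y) \<otimes>\<^sub>C b = x \<otimes>\<^sub>C b + y \<otimes>\<^sub>C b" for x y :: 'a and b :: 'b
    by transfer (unfold diff_diff_add[symmetric], rule cvs.span_base, unfold tensor_relations_def, blast)
  show "a \<otimes>\<^sub>C (x + y) = a \<otimes>\<^sub>C x + a \<otimes>\<^sub>C y" for x y :: 'b and a :: 'a
    by transfer (unfold diff_diff_add[symmetric], rule cvs.span_base, unfold tensor_relations_def, blast)
  show "(c *\<^sub>C x) \<otimes>\<^sub>C b = c *\<^sub>C (x \<otimes>\<^sub>C b)" for c and x :: 'a and b :: 'b
    by transfer (rule cvs.span_base, unfold tensor_relations_def, blast)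
  show "a \<otimes>\<^sub>C (c *\<^sub>C x) = c *\<^sub>C (a \<otimes>\<^sub>C x)" for c and x :: 'b and a :: 'a
    by transfer (rule cvs.span_base, unfold tensor_relations_def, blast)
qed

lemmas clinear_tensor_pure [clin] =
  cbilinear_left[OF cbilinear_tensor_pure] cbilinear_right[OF cbilinear_tensor_pure]

lemma tensor_pure_add_left: "(x + y) \<otimes>\<^sub>C b = x \<otimes>\<^sub>C b + y \<otimes>\<^sub>C b"
  by (rule clinear_add[of "\<lambda>a. a \<otimes>\<^sub>C b"]) (intro clin)

lemma tensor_pure_scaleC: "(c *\<^sub>C a) \<otimes>\<^sub>C b = c *\<^sub>C (a \<otimes>\<^sub>C b)"
  by (rule clinear_scale[of "\<lambda>a. a \<otimes>\<^sub>C b"]) (intro clin)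

lemma multilinear_word_pure: "multilinear word_pure"
  unfolding multilinear_def
proof (intro allI clinearI)
  fix us vs :: "('a \<times> 'b) list" and i
  show "word_pure (us @ (i, x + y) # vs) = word_pure (us @ (i, x) # vs) + word_pure (us @ (i, y) # vs)" for x y
    by transfer (unfold diff_diff_add[symmetric], rule cvs.span_base, unfold word_relations_def, blast)
  show "word_pure (us @ (i, c *\<^sub>C x) # vs) = c *\<^sub>C word_pure (us @ (i, x) # vs)" for c x
    by transfer (rule cvs.span_base, unfold word_relations_def, blast)
qed

text \<open>A tensor is represented by a finitely supported combination of pairs. Each coefficient
  is absorbed into the left factor, so a plain list of pairs suffices.\<close>

lemma tensor_decomposition: "\<exists>xs. t = (\<Sum>p\<leftarrow>xs. fst p \<otimes>\<^sub>C snd p)"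
proof (induct t)
  fix p :: "'a \<times> 'b \<Rightarrow>\<^sub>0 complex"
  let ?g = "\<lambda>k::'a \<times> 'b. fst k \<otimes>\<^sub>C snd k"
  have "abs_tensor p = free_lift ?g p"
    by (rule clinear_eq_on_free[OF _ clinear_free_lift])
      (auto simp: clinear_iff plus_tensor.abs_eq scaleC_tensor.abs_eq tensor_pure.abs_eq[symmetric])
  moreover have "\<exists>xs. (\<Sum>k\<in>K. c k *\<^sub>C ?g k) = (\<Sum>p\<leftarrow>xs. fst p \<otimes>\<^sub>C snd p)" if "finite K" for K c
    using that
  proof induction
    case empty
    show ?case by (rule exI[of _ "[]"]) simp
  next
    case (insert k K)
    then obtain xs where "(\<Sum>k\<in>K. c k *\<^sub>C ?g k) = (\<Sum>p\<leftarrow>xs. fst p \<otimes>\<^sub>C snd p)" by blast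
    then show ?case using insert.hyps
      by (intro exI[of _ "(c k *\<^sub>C fst k, snd k) # xs"])
        (simp add: tensor_pure_scaleC)
  qed
  ultimately show "\<exists>xs. abs_tensor p = (\<Sum>p\<leftarrow>xs. fst p \<otimes>\<^sub>C snd p)"
    by (simp add: free_lift_def)
qed

section \<open>Sweedler sums over a chosen decomposition\<close>

definition tensor_dec :: "('a::complex_vector \<otimes> 'b::complex_vector) \<Rightarrow> ('a \<times> 'b) list" where
  "tensor_dec t = (SOME xs. t = (\<Sum>p\<leftarrow>xs. fst p \<otimes>\<^sub>C snd p))"

lemma tensor_dec: "(\<Sum>p\<leftarrow>tensor_dec t. fst p \<otimes>\<^sub>C snd p) = t"
  using someI_ex[OF tensor_decomposition[of t]] unfolding tensor_dec_def by simp

text \<open>Sums over one fixed decomposition into elementary tensors can be interchanged and pulled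
  through linear maps without any side condition on the summand.\<close>

definition tsum :: "('a::complex_vector \<otimes> 'b::complex_vector) \<Rightarrow> ('a \<Rightarrow> 'b \<Rightarrow> 'c::complex_vector) \<Rightarrow> 'c" where
  "tsum t \<beta> = (\<Sum>p\<leftarrow>tensor_dec t. \<beta> (fst p) (snd p))"

lemma tsum_cong [cong]: "t = t' \<Longrightarrow> (\<And>a b. f a b = g a b) \<Longrightarrow> tsum t f = tsum t' g"
  by (simp add: tsum_def)

lemma tensor_lift_eq_tsum: "cbilinear \<beta> \<Longrightarrow> tensor_lift \<beta> t = tsum t \<beta>"
  using clinear_sum_list[OF clinear_tensor_lift, of \<beta> "\<lambda>p. fst p \<otimes>\<^sub>C snd p" "tensor_dec t"]
  by (simp add: tensor_dec tsum_def tensor_lift_pure)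

text \<open>The chosen decomposition does not depend linearly on the tensor. For bilinear summands
  the sum is independent of the choice, being the value of \<open>tensor_lift\<close>, and so
  becomes linear.\<close>

lemma clinear_tsum: "cbilinear \<beta> \<Longrightarrow> clinear (\<lambda>t. tsum t \<beta>)"
  using clinear_tensor_lift[of \<beta>] tensor_lift_eq_tsum[of \<beta>] by (simp add: clinear_iff)

lemma clinear_tsum_arg [clin]: "clinear f \<Longrightarrow> cbilinear \<beta> \<Longrightarrow> clinear (\<lambda>x. tsum (f x) \<beta>)"
  by (rule clinear_comp[OF clinear_tsum])

lemma clinear_tsum_fun [clin]: "(\<And>a b. clinear (\<lambda>x. \<beta> x a b)) \<Longrightarrow> clinear (\<lambda>x. tsum t (\<beta> x))"
  unfolding tsum_def by (rule clinear_sum_list_fun)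

lemma tsum_pure: "cbilinear \<beta> \<Longrightarrow> tsum (a \<otimes>\<^sub>C b) \<beta> = \<beta> a b"
  by (simp add: tensor_lift_eq_tsum[symmetric] tensor_lift_pure)

lemma clinear_tsum_out: "clinear L \<Longrightarrow> L (tsum t \<beta>) = tsum t (\<lambda>a b. L (\<beta> a b))"
  by (simp add: tsum_def clinear_sum_list)

lemma tsum_swap: "tsum s (\<lambda>a b. tsum t (\<lambda>c d. f a b c d)) = tsum t (\<lambda>c d. tsum s (\<lambda>a b. f a b c d))"
  unfolding tsum_def by (rule sum_list_swap)

lemma tsum_scaleC: "tsum t (\<lambda>a b. c *\<^sub>C f a b) = c *\<^sub>C tsum t f"
  by (simp add: tsum_def scaleC_sum_list)

text \<open>Membership is proved along with additivity, because \<open>f\<close> is additive only on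
  \<open>V\<close> and the partial sums must stay there.\<close>

lemma linear_on_sum_list:
  assumes "linear_on V f" "cvs.subspace V" "\<forall>x\<in>set xs. g x \<in> V"
  shows "f (\<Sum>x\<leftarrow>xs. g x) = (\<Sum>x\<leftarrow>xs. f (g x)) \<and> (\<Sum>x\<leftarrow>xs. g x) \<in> V"
  using assms(3)
proof (induction xs)
  case Nil
  have "f (0 *\<^sub>C 0) = 0 *\<^sub>C f 0"
    using assms(1,2) unfolding linear_on_def by (meson cvs.subspace_0)
  then show ?case using assms(2) by (simp add: cvs.scale_zero_left cvs.subspace_0)
next
  case (Cons a xs)
  then show ?case using assms by (auto simp: linear_on_def cvs.subspace_add)
qed

lemma linear_on_tsum_out:
  assumes "linear_on V f" "cvs.subspace V" "\<And>a b. \<beta> a b \<in> V"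
  shows "f (tsum t \<beta>) = tsum t (\<lambda>a b. f (\<beta> a b))"
  using linear_on_sum_list[OF assms(1,2), where g = "\<lambda>p. \<beta> (fst p) (snd p)"] assms(3)
  by (simp add: tsum_def)

lemma subspace_tsum: "cvs.subspace V \<Longrightarrow> (\<And>a b. \<beta> a b \<in> V) \<Longrightarrow> tsum t \<beta> \<in> V"
  using linear_on_sum_list[of V "\<lambda>x. x"  _ "\<lambda>p. \<beta> (fst p) (snd p)"]
  by (auto simp: tsum_def linear_on_def)

text \<open>Obtained from a left inverse of the inclusion of \<open>V\<close>. It serves to extend
  families that are multilinear on Hom spaces to the ambient space of arrows.\<close>

lemma subspace_projection:
  assumes "cvs.subspace V"
  shows "\<exists>\<pi>. clinear \<pi> \<and> range \<pi> \<subseteq> V \<and> (\<forall>x\<in>V. \<pi> x = x)"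
proof -
  interpret vector_space_pair "scaleC :: complex \<Rightarrow> 'a::complex_vector \<Rightarrow> 'a" scaleC
    by unfold_locales
  show ?thesis
    using linear_exists_left_inverse_on[of "\<lambda>x. x", OF clinear_ident assms] by auto
qed

section \<open>Hopf algebras in Sweedler form\<close>

locale hopf =
  fixes H :: "('h::complex_algebra_1) hopf_data"
  assumes hopf: "hopf_algebra H"
begin

abbreviation comult_H ("\<Delta>") where "\<Delta> \<equiv> comult H"
abbreviation counit_H ("\<epsilon>") where "\<epsilon> \<equiv> counit H"
abbreviation antipode_H ("S") where "S \<equiv> antipode H"
abbreviation antipode_inv_H ("S''") where "S' \<equiv> antipode_inv H"

lemma clinear_comult: "clinear \<Delta>" and clinear_counit: "clinear \<epsilon>" and clinear_antipode: "clinear S"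
  and bij_antipode: "bij S"
  using hopf by (simp_all add: hopf_algebra_def)

lemma counit_mult: "\<epsilon> (g * h) = \<epsilon> g * \<epsilon> h" and counit_one: "\<epsilon> 1 = 1"
  and comult_one: "\<Delta> 1 = 1 \<otimes>\<^sub>C 1"
  using hopf by (simp_all add: hopf_algebra_def)

lemma antipode_antipode_inv [simp]: "S (S' x) = x" "S' (S x) = x"
  using bij_antipode by (simp_all add: antipode_inv_def bij_is_surj bij_is_inj surj_f_inv_f)

lemma clinear_antipode_inv: "clinear S'"
proof (rule clinearI)
  show "S' (x + y) = S' x + S' y" for x y
    by (metis antipode_antipode_inv clinear_add[OF clinear_antipode])
  show "S' (c *\<^sub>C x) = c *\<^sub>C S' x" for c x
    by (metis antipode_antipode_inv clinear_scale[OF clinear_antipode])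
qed

lemmas clinear_hopf [clin] = clinear_comp[OF clinear_comult] clinear_comp[OF clinear_counit]
  clinear_comp[OF clinear_antipode] clinear_comp[OF clinear_antipode_inv]

text \<open>The axiom is an equation in a threefold tensor product. Applying the linear map induced
  by a trilinear \<open>T\<close> turns it into a rule for rebracketing any Sweedler sum.\<close>

lemma coassoc:
  assumes "\<And>b c. clinear (\<lambda>a. T a b c)" "\<And>a c. clinear (\<lambda>b. T a b c)" "\<And>a b. clinear (\<lambda>c. T a b c)"
  shows "tsum (\<Delta> h) (\<lambda>a b. tsum (\<Delta> a) (\<lambda>a1 a2. T a1 a2 b)) = tsum (\<Delta> h) (\<lambda>a b. tsum (\<Delta> b) (\<lambda>b1 b2. T a b1 b2))"
proof -
  have bT: "cbilinear (\<lambda>a u. tsum u (T a))" "cbilinear (T a)" for a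
    by (intro clin assms)+
  have "tensor_lift (\<lambda>a b. tensor_lift (\<lambda>a\<^sub>1 a\<^sub>2. a\<^sub>1 \<otimes>\<^sub>C (a\<^sub>2 \<otimes>\<^sub>C b)) (\<Delta> a)) (\<Delta> h)
      = tensor_lift (\<lambda>a b. a \<otimes>\<^sub>C \<Delta> b) (\<Delta> h)"
    using hopf by (simp add: hopf_algebra_def)
  then have "tsum (\<Delta> h) (\<lambda>a b. tsum (\<Delta> a) (\<lambda>a1 a2. a1 \<otimes>\<^sub>C (a2 \<otimes>\<^sub>C b))) = tsum (\<Delta> h) (\<lambda>a b. a \<otimes>\<^sub>C \<Delta> b)"
    by (simp add: tensor_lift_eq_tsum clin)
  then have "tsum (tsum (\<Delta> h) (\<lambda>a b. tsum (\<Delta> a) (\<lambda>a1 a2. a1 \<otimes>\<^sub>C (a2 \<otimes>\<^sub>C b)))) (\<lambda>a u. tsum u (T a))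
     = tsum (tsum (\<Delta> h) (\<lambda>a b. a \<otimes>\<^sub>C \<Delta> b)) (\<lambda>a u. tsum u (T a))"
    by simp
  then show ?thesis
    by (simp add: clinear_tsum_out[OF clinear_tsum[OF bT(1)]] tsum_pure[OF bT(1)] tsum_pure[OF bT(2)])
qed

lemma counit_left:
  assumes "clinear f" shows "tsum (\<Delta> h) (\<lambda>a b. \<epsilon> a *\<^sub>C f b) = f h"
proof -
  have "tensor_lift (\<lambda>a b. \<epsilon> a *\<^sub>C b) (\<Delta> h) = h" using hopf by (simp add: hopf_algebra_def)
  then have "f (tsum (\<Delta> h) (\<lambda>a b. \<epsilon> a *\<^sub>C b)) = f h" by (simp add: tensor_lift_eq_tsum clin)
  then show ?thesis by (simp add: clinear_tsum_out[OF assms] clinear_scale[OF assms])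
qed

lemma counit_right:
  assumes "clinear f" shows "tsum (\<Delta> h) (\<lambda>a b. \<epsilon> b *\<^sub>C f a) = f h"
proof -
  have "tensor_lift (\<lambda>a b. \<epsilon> b *\<^sub>C a) (\<Delta> h) = h" using hopf by (simp add: hopf_algebra_def)
  then have "f (tsum (\<Delta> h) (\<lambda>a b. \<epsilon> b *\<^sub>C a)) = f h" by (simp add: tensor_lift_eq_tsum clin)
  then show ?thesis by (simp add: clinear_tsum_out[OF assms] clinear_scale[OF assms])
qed

lemma antipode_left:
  assumes "clinear f" shows "tsum (\<Delta> h) (\<lambda>a b. f (S a * b)) = \<epsilon> h *\<^sub>C f 1"
proof -
  have "tensor_lift (\<lambda>a b. S a * b) (\<Delta> h) = \<epsilon> h *\<^sub>C 1" using hopf by (simp add: hopf_algebra_def)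
  then have "f (tsum (\<Delta> h) (\<lambda>a b. S a * b)) = f (\<epsilon> h *\<^sub>C 1)" by (simp add: tensor_lift_eq_tsum clin)
  then show ?thesis by (simp add: clinear_tsum_out[OF assms] clinear_scale[OF assms])
qed

lemma antipode_right:
  assumes "clinear f" shows "tsum (\<Delta> h) (\<lambda>a b. f (a * S b)) = \<epsilon> h *\<^sub>C f 1"
proof -
  have "tensor_lift (\<lambda>a b. a * S b) (\<Delta> h) = \<epsilon> h *\<^sub>C 1" using hopf by (simp add: hopf_algebra_def)
  then have "f (tsum (\<Delta> h) (\<lambda>a b. a * S b)) = f (\<epsilon> h *\<^sub>C 1)" by (simp add: tensor_lift_eq_tsum clin)
  then show ?thesis by (simp add: clinear_tsum_out[OF assms] clinear_scale[OF assms])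
qed

lemma comult_mult:
  assumes "cbilinear T"
  shows "tsum (\<Delta> (g * h)) T = tsum (\<Delta> g) (\<lambda>g1 g2. tsum (\<Delta> h) (\<lambda>h1 h2. T (g1 * h1) (g2 * h2)))"
proof -
  have "\<Delta> (g * h) = tensor_lift (\<lambda>g\<^sub>1 g\<^sub>2. tensor_lift (\<lambda>h\<^sub>1 h\<^sub>2. (g\<^sub>1 * h\<^sub>1) \<otimes>\<^sub>C (g\<^sub>2 * h\<^sub>2)) (\<Delta> h)) (\<Delta> g)"
    using hopf by (simp add: hopf_algebra_def)
  also have "\<dots> = tsum (\<Delta> g) (\<lambda>g1 g2. tsum (\<Delta> h) (\<lambda>h1 h2. (g1 * h1) \<otimes>\<^sub>C (g2 * h2)))"
    by (simp add: tensor_lift_eq_tsum clin)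
  finally show ?thesis
    by (simp add: clinear_tsum_out[OF clinear_tsum[OF assms]] tsum_pure[OF assms])
qed

section \<open>The antipode and its inverse reverse products and coproducts\<close>

lemma antipode_one: "S 1 = 1"
proof -
  have "tsum (\<Delta> 1) (\<lambda>a b. S a * b) = \<epsilon> 1 *\<^sub>C 1"
    by (rule antipode_left) (intro clin)
  then show ?thesis by (simp add: comult_one tsum_pure clin counit_one scaleC_one)
qed

lemma antipode_mult: "S (g * h) = S h * S g"
  \<comment> \<open>both sides equal \<open>S(g\<^sub>1 h\<^sub>1) g\<^sub>2 h\<^sub>2 S(h\<^sub>3) S(g\<^sub>3)\<close>\<close>
proof -
  have inv: "tsum (\<Delta> g) (\<lambda>g1 g2. tsum (\<Delta> h) (\<lambda>h1 h2. S (g1 * h1) * (g2 * h2))) = \<epsilon> g *\<^sub>C \<epsilon> h *\<^sub>C 1" for g h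
    using antipode_left[of "\<lambda>x. x" "g * h"]
    by (simp add: comult_mult clin counit_mult scaleC_scaleC)
  have "S h * S g = tsum (\<Delta> g) (\<lambda>g1 g2. \<epsilon> g1 *\<^sub>C (S h * S g2))"
    by (rule counit_left[symmetric]) (intro clin)
  also have "\<dots> = tsum (\<Delta> g) (\<lambda>g1 g2. tsum (\<Delta> h) (\<lambda>h1 h2. \<epsilon> h1 *\<^sub>C (\<epsilon> g1 *\<^sub>C (S h2 * S g2))))"
    by (intro tsum_cong refl counit_left[symmetric] clin)
  also have "\<dots> = tsum (\<Delta> g) (\<lambda>g1 g2. tsum (\<Delta> h) (\<lambda>h1 h2. (\<epsilon> g1 *\<^sub>C \<epsilon> h1 *\<^sub>C 1) * (S h2 * S g2)))"
    by (simp add: scaleC_mult_left scaleC_scaleC mult.commute)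
  also have "\<dots> = tsum (\<Delta> g) (\<lambda>g1 g2. tsum (\<Delta> h) (\<lambda>h1 h2. tsum (\<Delta> g1) (\<lambda>g11 g12. tsum (\<Delta> h1) (\<lambda>h11 h12.
      S (g11 * h11) * (g12 * h12) * (S h2 * S g2)))))"
    by (simp only: inv[symmetric] clinear_tsum_out[OF clinear_mult_right[OF clinear_ident]])
  also have "\<dots> = tsum (\<Delta> g) (\<lambda>g1 g2. tsum (\<Delta> g1) (\<lambda>g11 g12. tsum (\<Delta> h) (\<lambda>h1 h2. tsum (\<Delta> h1) (\<lambda>h11 h12.
      S (g11 * h11) * (g12 * h12) * (S h2 * S g2)))))"
    by (subst tsum_swap) (rule refl)
  also have "\<dots> = tsum (\<Delta> g) (\<lambda>g1 g2. tsum (\<Delta> g2) (\<lambda>g21 g22. tsum (\<Delta> h) (\<lambda>h1 h2. tsum (\<Delta> h1) (\<lambda>h11 h12.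
      S (g1 * h11) * (g21 * h12) * (S h2 * S g22)))))"
    by (rule coassoc) (intro clin)+
  also have "\<dots> = tsum (\<Delta> g) (\<lambda>g1 g2. tsum (\<Delta> g2) (\<lambda>g21 g22. tsum (\<Delta> h) (\<lambda>h1 h2. tsum (\<Delta> h2) (\<lambda>h21 h22.
      S (g1 * h1) * (g21 * h21) * (S h22 * S g22)))))"
    by (intro tsum_cong refl coassoc clin)
  also have "\<dots> = tsum (\<Delta> g) (\<lambda>g1 g2. tsum (\<Delta> g2) (\<lambda>g21 g22. tsum (\<Delta> h) (\<lambda>h1 h2. tsum (\<Delta> h2) (\<lambda>h21 h22.
      S (g1 * h1) * g21 * (h21 * S h22) * S g22))))"
    by (simp add: mult.assoc)
  also have "\<dots> = tsum (\<Delta> g) (\<lambda>g1 g2. tsum (\<Delta> g2) (\<lambda>g21 g22. tsum (\<Delta> h) (\<lambda>h1 h2. \<epsilon> h2 *\<^sub>C (S (g1 * h1) * g21 * 1 * S g22))))"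
    by (intro tsum_cong refl antipode_right clin)
  also have "\<dots> = tsum (\<Delta> g) (\<lambda>g1 g2. tsum (\<Delta> g2) (\<lambda>g21 g22. S (g1 * h) * g21 * 1 * S g22))"
    by (intro tsum_cong refl counit_right clin)
  also have "\<dots> = tsum (\<Delta> g) (\<lambda>g1 g2. tsum (\<Delta> g2) (\<lambda>g21 g22. S (g1 * h) * (g21 * S g22)))"
    by (simp add: mult.assoc)
  also have "\<dots> = tsum (\<Delta> g) (\<lambda>g1 g2. \<epsilon> g2 *\<^sub>C (S (g1 * h) * 1))"
    by (intro tsum_cong refl antipode_right clin)
  also have "\<dots> = S (g * h) * 1"
    by (rule counit_right) (intro clin)
  finally show ?thesis by simp
qed

lemma antipode_inv_one: "S' 1 = 1"
  using antipode_antipode_inv(2)[of 1] by (simp add: antipode_one)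

lemma antipode_inv_mult: "S' (g * h) = S' h * S' g"
  by (metis antipode_antipode_inv antipode_mult)

text \<open>The anti-multiplicative \<open>S'\<close> turns \<open>S a * b\<close> into
  \<open>S' b * a\<close>, so this is the antipode axiom seen through \<open>S'\<close>.\<close>

lemma antipode_inv_left:
  assumes "clinear f" shows "tsum (\<Delta> h) (\<lambda>a b. f (S' b * a)) = \<epsilon> h *\<^sub>C f 1"
  using antipode_left[of "\<lambda>x. f (S' x)" h] clinear_comp[OF assms clinear_antipode_inv]
  by (simp add: antipode_inv_mult antipode_inv_one)

lemma antipode_inv_right:
  assumes "clinear f" shows "tsum (\<Delta> h) (\<lambda>a b. f (b * S' a)) = \<epsilon> h *\<^sub>C f 1"
  using antipode_right[of "\<lambda>x. f (S' x)" h] clinear_comp[OF assms clinear_antipode_inv]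
  by (simp add: antipode_inv_mult antipode_inv_one)

text \<open>Apply the counit to \<open>S' b * a\<close> summed over the coproduct: the antipode
  gives one side, the counit axiom the other.\<close>

lemma counit_antipode_inv: "\<epsilon> (S' h) = \<epsilon> h"
proof -
  have "tsum (\<Delta> h) (\<lambda>a b. \<epsilon> (S' b * a)) = \<epsilon> h *\<^sub>C \<epsilon> 1"
    by (intro antipode_inv_left clin)
  moreover have "tsum (\<Delta> h) (\<lambda>a b. \<epsilon> a *\<^sub>C \<epsilon> (S' b)) = \<epsilon> (S' h)"
    by (intro counit_left clin)
  ultimately show ?thesis by (simp add: counit_mult counit_one scaleC_complex_def mult.commute)
qed

text \<open>With \<open>R(h) = S\<^sup>-\<^sup>1(h\<^sub>2) \<otimes> S\<^sup>-\<^sup>1(h\<^sub>1)\<close> one has \<open>\<Delta>(h\<^sub>2) R(h\<^sub>1) = \<epsilon>(h)\<close>; multiply by \<open>\<Delta>(S\<^sup>-\<^sup>1(h\<^sub>3))\<close> on the left.\<close>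
lemma comult_antipode_inv:
  fixes T :: "'h \<Rightarrow> 'h \<Rightarrow> 'b::complex_vector"
  assumes "cbilinear T"
  shows "tsum (\<Delta> (S' h)) T = tsum (\<Delta> h) (\<lambda>a b. T (S' b) (S' a))"
proof -
  note T [clin] = cbilinear_left[OF assms] cbilinear_right[OF assms]
  have cancel: "tsum (\<Delta> h) (\<lambda>a c. tsum (\<Delta> a) (\<lambda>a1 a2. tsum (\<Delta> c) (\<lambda>c1 c2. U (c1 * S' a2) (c2 * S' a1)))) = \<epsilon> h *\<^sub>C U 1 1"
    if U: "cbilinear U" for U :: "'h \<Rightarrow> 'h \<Rightarrow> 'b::complex_vector" and h
  proof -
    note [clin] = cbilinear_left[OF U] cbilinear_right[OF U]
    have "tsum (\<Delta> h) (\<lambda>a c. tsum (\<Delta> a) (\<lambda>a1 a2. tsum (\<Delta> c) (\<lambda>c1 c2. U (c1 * S' a2) (c2 * S' a1))))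
       = tsum (\<Delta> h) (\<lambda>a b. tsum (\<Delta> b) (\<lambda>a2 c. tsum (\<Delta> c) (\<lambda>c1 c2. U (c1 * S' a2) (c2 * S' a))))"
      by (rule coassoc) (intro clin)+
    also have "\<dots> = tsum (\<Delta> h) (\<lambda>a b. tsum (\<Delta> b) (\<lambda>b1 c2. tsum (\<Delta> b1) (\<lambda>a2 c1. U (c1 * S' a2) (c2 * S' a))))"
      by (intro tsum_cong refl coassoc[symmetric] clin)
    also have "\<dots> = tsum (\<Delta> h) (\<lambda>a b. tsum (\<Delta> b) (\<lambda>b1 c2. \<epsilon> b1 *\<^sub>C U 1 (c2 * S' a)))"
      by (intro tsum_cong refl antipode_inv_right clin)
    also have "\<dots> = tsum (\<Delta> h) (\<lambda>a b. U 1 (b * S' a))"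
      by (intro tsum_cong refl counit_left clin)
    also have "\<dots> = \<epsilon> h *\<^sub>C U 1 1"
      by (intro antipode_inv_right clin)
    finally show ?thesis .
  qed
  have "tsum (\<Delta> h) (\<lambda>a b. T (S' b) (S' a)) = tsum (\<Delta> h) (\<lambda>x y. \<epsilon> y *\<^sub>C tsum (\<Delta> x) (\<lambda>a b. T (S' b) (S' a)))"
    by (rule counit_right[symmetric]) (intro clin)
  also have "\<dots> = tsum (\<Delta> h) (\<lambda>x y. \<epsilon> y *\<^sub>C tsum (\<Delta> 1) (\<lambda>p q. tsum (\<Delta> x) (\<lambda>a b. T (p * S' b) (q * S' a))))"
    by (simp add: comult_one tsum_pure clin)
  also have "\<dots> = tsum (\<Delta> h) (\<lambda>x y. tsum (\<Delta> y) (\<lambda>y1 y2. tsum (\<Delta> (S' y2 * y1)) (\<lambda>p q. tsum (\<Delta> x) (\<lambda>a b. T (p * S' b) (q * S' a)))))"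
    by (intro tsum_cong refl antipode_inv_left[symmetric] clin)
  also have "\<dots> = tsum (\<Delta> h) (\<lambda>x y. tsum (\<Delta> y) (\<lambda>y1 y2. tsum (\<Delta> (S' y2)) (\<lambda>s1 s2. tsum (\<Delta> y1) (\<lambda>p q.
      tsum (\<Delta> x) (\<lambda>a b. T (s1 * p * S' b) (s2 * q * S' a))))))"
    by (intro tsum_cong refl comult_mult clin)
  also have "\<dots> = tsum (\<Delta> h) (\<lambda>z y2. tsum (\<Delta> z) (\<lambda>x y1. tsum (\<Delta> (S' y2)) (\<lambda>s1 s2. tsum (\<Delta> y1) (\<lambda>p q.
      tsum (\<Delta> x) (\<lambda>a b. T (s1 * p * S' b) (s2 * q * S' a))))))"
    by (rule coassoc[symmetric]) (intro clin)+
  also have "\<dots> = tsum (\<Delta> h) (\<lambda>z y2. tsum (\<Delta> (S' y2)) (\<lambda>s1 s2. tsum (\<Delta> z) (\<lambda>x y1. tsum (\<Delta> x) (\<lambda>a b. tsum (\<Delta> y1) (\<lambda>p q.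
      T (s1 * (p * S' b)) (s2 * (q * S' a)))))))"
    by (subst tsum_swap, subst (4) tsum_swap) (simp add: mult.assoc)
  also have "\<dots> = tsum (\<Delta> h) (\<lambda>z y2. tsum (\<Delta> (S' y2)) (\<lambda>s1 s2. \<epsilon> z *\<^sub>C T (s1 * 1) (s2 * 1)))"
    by (intro tsum_cong refl cancel clin)
  also have "\<dots> = tsum (\<Delta> h) (\<lambda>z y2. \<epsilon> z *\<^sub>C tsum (\<Delta> (S' y2)) T)"
    by (simp add: tsum_scaleC)
  also have "\<dots> = tsum (\<Delta> (S' h)) T"
    by (intro counit_left clin assms)
  finally show ?thesis by simp
qed

end

section \<open>The diagonal action on words\<close>

definition is_arrow :: "('o, 'f, 'h) hcat \<Rightarrow> ('o, 'f) arrow \<Rightarrow> bool" where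
  "is_arrow D a \<longleftrightarrow> arr_src a \<in> Ob D \<and> arr_tgt a \<in> Ob D \<and> snd a \<in> Hom D (arr_src a) (arr_tgt a)"

text \<open>Linearity is demanded only on Hom spaces and only along arrow words with the label list
  \<open>L\<close>. Values of cochains are controlled nowhere else, and since \<open>H\<close> does
  not change labels, the condition is stable under the action.\<close>

definition multilinear_on :: "('o, 'f::complex_vector, 'h) hcat \<Rightarrow> ('o \<times> 'o) list
    \<Rightarrow> (('o, 'f) arrow list \<Rightarrow> 'c::complex_vector) \<Rightarrow> bool" where
  "multilinear_on D L F \<longleftrightarrow> (\<forall>us i vs. map fst us @ i # map fst vs = L \<and> fst i \<in> Ob D \<and> snd i \<in> Ob D \<and>
     (\<forall>a\<in>set us \<union> set vs. is_arrow D a) \<longrightarrow>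
     linear_on (Hom D (fst i) (snd i)) (\<lambda>f. F (us @ (i, f) # vs)))"

text \<open>\<open>hact H D w F h\<close> stands for \<open>F (h w)\<close>, where \<open>F\<close> is extended linearly to sums of words.\<close>
primrec hact :: "'h::complex_vector hopf_data \<Rightarrow> ('o, 'f, 'h) hcat \<Rightarrow> ('o, 'f) arrow list
    \<Rightarrow> (('o, 'f) arrow list \<Rightarrow> 'c::complex_vector) \<Rightarrow> 'h \<Rightarrow> 'c" where
  "hact H D [] = (\<lambda>F h. counit H h *\<^sub>C F [])"
| "hact H D (a # w) = (\<lambda>F h. tsum (comult H h) (\<lambda>x y. hact H D w (\<lambda>u. F (arr_act D x a # u)) y))"

lemma fst_arr_act [simp]: "fst (arr_act D h a) = fst a"
  by (simp add: arr_act_def)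

lemma fst_arr_comp [simp]: "fst (arr_comp D b a) = (arr_src a, arr_tgt b)"
  by (simp add: arr_comp_def)

lemma clinear_iff_linear_on: "clinear f \<longleftrightarrow> linear_on UNIV f"
  by (simp add: clinear_iff linear_on_def)

lemma linear_on_tsum_fun: "(\<And>a b. linear_on V (\<lambda>x. f x a b)) \<Longrightarrow> linear_on V (\<lambda>x. tsum t (f x))"
proof -
  have "linear_on V (\<lambda>x. \<Sum>p\<leftarrow>ps. f x (fst p) (snd p))" if "\<And>a b. linear_on V (\<lambda>x. f x a b)" for ps
    using that by (induction ps)
      (simp_all add: linear_on_def cvs.scale_zero_right scaleC_add_right add.assoc add.left_commute)
  then show "(\<And>a b. linear_on V (\<lambda>x. f x a b)) \<Longrightarrow> ?thesis" by (simp add: tsum_def)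
qed

lemma linear_on_scaleC_right: "linear_on V f \<Longrightarrow> linear_on V (\<lambda>x. c *\<^sub>C f x)"
  by (simp add: linear_on_def scaleC_add_right scaleC_scaleC mult.commute)

lemma multilinear_onD:
  assumes "multilinear_on D (map fst us @ i # map fst vs) F" "fst i \<in> Ob D" "snd i \<in> Ob D"
    "\<forall>a\<in>set us. is_arrow D a" "\<forall>a\<in>set vs. is_arrow D a"
  shows "linear_on (Hom D (fst i) (snd i)) (\<lambda>f. F (us @ (i, f) # vs))"
  using assms unfolding multilinear_on_def by blast

lemma multilinear_on_Cons:
  assumes "multilinear_on D (fst a # L) F" "is_arrow D a"
  shows "multilinear_on D L (\<lambda>w. F (a # w))"
  unfolding multilinear_on_def
proof (intro allI impI)
  fix us i vs
  assume "map fst us @ i # map fst vs = L \<and> fst i \<in> Ob D \<and> snd i \<in> Ob D \<and> (\<forall>a\<in>set us \<union> set vs. is_arrow D a)"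
  then show "linear_on (Hom D (fst i) (snd i)) (\<lambda>f. F (a # us @ (i, f) # vs))"
    using multilinear_onD[of D "a # us" i vs F] assms by auto
qed

lemma multilinear_on_append:
  assumes "multilinear_on D (map fst u @ L) F" "\<forall>a\<in>set u. is_arrow D a"
  shows "multilinear_on D L (\<lambda>w. F (u @ w))"
  using assms by (induction u arbitrary: F) (auto dest: multilinear_on_Cons)

lemma hact_map:
  assumes "\<And>h a. a \<in> set w \<Longrightarrow> g (arr_act D h a) = arr_act D' h (g a)"
  shows "hact H D' (map g w) F h = hact H D w (\<lambda>u. F (map g u)) h"
  using assms by (induction w arbitrary: F h) simp_all

lemma hact_tsum: "hact H D w (\<lambda>u. tsum t (\<lambda>a b. F a b u)) h = tsum t (\<lambda>a b. hact H D w (F a b) h)"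
proof (induction w arbitrary: F h)
  case (Cons a w)
  show ?case by (simp add: Cons.IH) (rule tsum_swap)
qed (simp add: tsum_scaleC)

lemma merge_Cons [simp]: "merge D (Suc i) (a # w) = a # merge D i w"
  by (simp add: merge_def)

lemma merge_append: "merge D (length u) (u @ b # a # v) = u @ arr_comp D b a # v"
  by (induction u) (simp_all add: merge_def)

section \<open>Properties of the diagonal action\<close>

locale hcategory = hopf H for H :: "('h::complex_algebra_1) hopf_data" +
  fixes D :: "('o, 'f::complex_vector, 'h) hcat"
  assumes hcat: "left_H_category H D"
begin

lemma klin: "k_linear_category D"
  using hcat by (simp add: left_H_category_def)

lemma subspace_Hom: "X \<in> Ob D \<Longrightarrow> Y \<in> Ob D \<Longrightarrow> cvs.subspace (Hom D X Y)"
  using klin by (simp add: k_linear_category_def)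

lemma Act_Hom: "X \<in> Ob D \<Longrightarrow> Y \<in> Ob D \<Longrightarrow> f \<in> Hom D X Y \<Longrightarrow> Act D X Y h f \<in> Hom D X Y"
  using hcat by (auto simp: left_H_category_def linear_map_def)

lemma linear_on_Act: "X \<in> Ob D \<Longrightarrow> Y \<in> Ob D \<Longrightarrow> linear_on (Hom D X Y) (Act D X Y h)"
  using hcat by (auto simp: left_H_category_def linear_map_def)

lemma clinear_Act: "X \<in> Ob D \<Longrightarrow> Y \<in> Ob D \<Longrightarrow> f \<in> Hom D X Y \<Longrightarrow> clinear (\<lambda>h. Act D X Y h f)"
  and Act_one: "X \<in> Ob D \<Longrightarrow> Y \<in> Ob D \<Longrightarrow> f \<in> Hom D X Y \<Longrightarrow> Act D X Y 1 f = f"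
  and Act_mult: "X \<in> Ob D \<Longrightarrow> Y \<in> Ob D \<Longrightarrow> f \<in> Hom D X Y \<Longrightarrow> Act D X Y (g * h) f = Act D X Y g (Act D X Y h f)"
  using hcat by (simp_all add: left_H_category_def)

lemma Comp_Hom:
  "X \<in> Ob D \<Longrightarrow> Y \<in> Ob D \<Longrightarrow> Z \<in> Ob D \<Longrightarrow> f \<in> Hom D X Y \<Longrightarrow> g \<in> Hom D Y Z \<Longrightarrow> Comp D X Y Z g f \<in> Hom D X Z"
  using klin unfolding k_linear_category_def linear_map_def Pi_iff by blast

lemma Comp_linear:
  assumes "X \<in> Ob D" "Y \<in> Ob D" "Z \<in> Ob D"
  shows "g \<in> Hom D Y Z \<Longrightarrow> linear_on (Hom D X Y) (Comp D X Y Z g)"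
    and "f \<in> Hom D X Y \<Longrightarrow> linear_on (Hom D Y Z) (\<lambda>g. Comp D X Y Z g f)"
  using klin assms by (auto simp: k_linear_category_def linear_map_def)

lemma Act_Comp:
  assumes "X \<in> Ob D" "Y \<in> Ob D" "Z \<in> Ob D" "f \<in> Hom D X Y" "g \<in> Hom D Y Z"
  shows "Act D X Z h (Comp D X Y Z g f) = tsum (\<Delta> h) (\<lambda>x y. Comp D X Y Z (Act D Y Z x g) (Act D X Y y f))"
proof -
  have "clinear (\<lambda>x. Comp D X Y Z (Act D Y Z x g) (Act D X Y y f))"
    "clinear (\<lambda>y. Comp D X Y Z (Act D Y Z x g) (Act D X Y y f))" for x y
    using Comp_linear(2)[OF assms(1-3) Act_Hom[OF assms(1,2,4)]] Comp_linear(1)[OF assms(1-3) Act_Hom[OF assms(2,3,5)]]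
      clinear_Act[OF assms(2,3,5)] clinear_Act[OF assms(1,2,4)] Act_Hom assms
    by (auto simp: clinear_iff linear_on_def)
  then have "cbilinear (\<lambda>x y. Comp D X Y Z (Act D Y Z x g) (Act D X Y y f))" by (rule cbilinearI)
  then show ?thesis using hcat assms by (simp add: left_H_category_def tensor_lift_eq_tsum)
qed

lemma is_arrow_act [simp]: "is_arrow D a \<Longrightarrow> is_arrow D (arr_act D h a)"
  by (simp add: is_arrow_def arr_act_def Act_Hom)

lemma is_arrow_comp: "is_arrow D a \<Longrightarrow> is_arrow D b \<Longrightarrow> arr_src b = arr_tgt a \<Longrightarrow> is_arrow D (arr_comp D b a)"
  by (simp add: is_arrow_def arr_comp_def Comp_Hom)

lemma arr_act_mult: "is_arrow D a \<Longrightarrow> arr_act D (g * h) a = arr_act D g (arr_act D h a)"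
  by (simp add: is_arrow_def arr_act_def Act_mult)

lemma arr_act_one: "is_arrow D a \<Longrightarrow> arr_act D 1 a = a"
  by (simp add: is_arrow_def arr_act_def Act_one)

lemma clinear_act_entry:
  assumes "multilinear_on D (map fst us @ fst a # map fst vs) F" "is_arrow D a"
    "\<forall>a\<in>set us. is_arrow D a" "\<forall>a\<in>set vs. is_arrow D a"
  shows "clinear (\<lambda>x. F (us @ arr_act D x a # vs))"
  using multilinear_onD[OF assms(1) _ _ assms(3,4)] clinear_Act[of "arr_src a" "arr_tgt a" "snd a"]
    assms(2) Act_Hom[of "arr_src a" "arr_tgt a" "snd a"]
  by (simp add: is_arrow_def arr_act_def linear_on_def clinear_iff)

lemma linear_on_hact_fun:
  assumes "\<forall>a\<in>set w. is_arrow D a"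
    and "\<And>u. map fst u = map fst w \<Longrightarrow> \<forall>a\<in>set u. is_arrow D a \<Longrightarrow> linear_on V (\<lambda>x. F x u)"
  shows "linear_on V (\<lambda>x. hact H D w (F x) y)"
  using assms
proof (induction w arbitrary: F y)
  case Nil
  then show ?case using linear_on_scaleC_right by fastforce
next
  case (Cons a w)
  show ?case
    unfolding hact.simps
  proof (rule linear_on_tsum_fun, rule Cons.IH)
    show "linear_on V (\<lambda>x. F x (arr_act D b a # u))"
      if "map fst u = map fst w" "\<forall>a\<in>set u. is_arrow D a" for b u
      using Cons.prems that by simp
  qed (use Cons.prems in simp)
qed

lemma clinear_hact_fun:
  assumes "\<forall>a\<in>set w. is_arrow D a"
    and "\<And>u. map fst u = map fst w \<Longrightarrow> \<forall>a\<in>set u. is_arrow D a \<Longrightarrow> clinear (\<lambda>x. F x u)"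
  shows "clinear (\<lambda>x. hact H D w (F x) y)"
  using linear_on_hact_fun[of w UNIV F] assms by (simp add: clinear_iff_linear_on)

lemma clinear_hact_entry:
  assumes "is_arrow D a" "\<forall>a\<in>set w. is_arrow D a" "multilinear_on D (fst a # map fst w) F"
  shows "clinear (\<lambda>x. hact H D w (\<lambda>u. F (arr_act D x a # u)) y)"
proof (rule clinear_hact_fun[OF assms(2)])
  fix u assume "map fst u = map fst w" "\<forall>a\<in>set u. is_arrow D a"
  then show "clinear (\<lambda>x. F (arr_act D x a # u))"
    using clinear_act_entry[of "[]" a u F] assms by simp
qed

text \<open>The action alters arrows but never labels, so it only sees the values of
  \<open>F\<close> on arrow words with the labels of \<open>w\<close>.\<close>

lemma hact_cong:
  assumes "\<forall>a\<in>set w. is_arrow D a"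
    and "\<And>u. map fst u = map fst w \<Longrightarrow> \<forall>a\<in>set u. is_arrow D a \<Longrightarrow> F u = G u"
  shows "hact H D w F y = hact H D w G y"
  using assms
proof (induction w arbitrary: F G y)
  case (Cons a w)
  show ?case unfolding hact.simps
    by (intro tsum_cong refl Cons.IH) (use Cons.prems in auto)
qed simp

lemma clinear_hact:
  assumes "\<forall>a\<in>set w. is_arrow D a" "multilinear_on D (map fst w) F"
  shows "clinear (hact H D w F)"
  using assms
proof (induction w arbitrary: F)
  case Nil
  show ?case by (simp add: clin)
next
  case (Cons a w)
  show ?case unfolding hact.simps
  proof (intro clin)
    fix x y
    show "clinear (\<lambda>x. hact H D w (\<lambda>u. F (arr_act D x a # u)) y)"
      using Cons.prems by (intro clinear_hact_entry) auto
    show "clinear (hact H D w (\<lambda>u. F (arr_act D x a # u)))"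
      using Cons.prems by (intro Cons.IH multilinear_on_Cons) auto
  qed
qed

lemma multilinear_on_hact:
  assumes "\<forall>a\<in>set v. is_arrow D a" "multilinear_on D (L @ map fst v) F"
  shows "multilinear_on D L (\<lambda>u. hact H D v (\<lambda>v'. F (u @ v')) y)"
  unfolding multilinear_on_def
proof (intro allI impI)
  fix us i vs
  assume *: "map fst us @ i # map fst vs = L \<and> fst i \<in> Ob D \<and> snd i \<in> Ob D \<and> (\<forall>a\<in>set us \<union> set vs. is_arrow D a)"
  show "linear_on (Hom D (fst i) (snd i)) (\<lambda>f. hact H D v (\<lambda>v'. F ((us @ (i, f) # vs) @ v')) y)"
  proof (rule linear_on_hact_fun[OF assms(1)])
    fix u assume u: "map fst u = map fst v" "\<forall>a\<in>set u. is_arrow D a"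
    have ml: "multilinear_on D (map fst us @ i # map fst (vs @ u)) F" using assms(2) * u by auto
    show "linear_on (Hom D (fst i) (snd i)) (\<lambda>f. F ((us @ (i, f) # vs) @ u))"
      using multilinear_onD[of D us i "vs @ u" F] ml * u unfolding set_append ball_Un by simp
  qed
qed

text \<open>Coassociativity: the iterated coproduct may first be split between the two blocks and
  then inside each of them.\<close>

lemma hact_append:
  assumes "\<forall>a\<in>set (u @ v). is_arrow D a" "multilinear_on D (map fst (u @ v)) F"
  shows "hact H D (u @ v) F h = tsum (\<Delta> h) (\<lambda>x y. hact H D u (\<lambda>u'. hact H D v (\<lambda>v'. F (u' @ v')) y) x)"
  using assms
proof (induction u arbitrary: F h)
  case Nil
  then show ?case using counit_left[OF clinear_hact[of v F]] by simp
next
  case (Cons a u)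
  have a: "is_arrow D a" and u: "\<forall>a\<in>set u. is_arrow D a" and v: "\<forall>a\<in>set v. is_arrow D a" using Cons.prems by auto
  have ml: "multilinear_on D (map fst u @ map fst v) (\<lambda>w. F (arr_act D x a # w))" for x
    using Cons.prems by (intro multilinear_on_Cons) auto
  let ?T = "\<lambda>x y1 y2. hact H D u (\<lambda>u'. hact H D v (\<lambda>v'. F (arr_act D x a # u' @ v')) y2) y1"
  have "hact H D ((a # u) @ v) F h = tsum (\<Delta> h) (\<lambda>x y. tsum (\<Delta> y) (?T x))"
    using Cons.prems ml by (simp add: Cons.IH)
  also have "\<dots> = tsum (\<Delta> h) (\<lambda>z y2. tsum (\<Delta> z) (\<lambda>x y1. ?T x y1 y2))"
  proof (rule coassoc[symmetric])
    show "clinear (\<lambda>x. ?T x y1 y2)" for y1 y2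
    proof (intro clinear_hact_fun u v)
      fix u' v' assume "map fst u' = map fst u" "\<forall>a\<in>set u'. is_arrow D a" "map fst v' = map fst v" "\<forall>a\<in>set v'. is_arrow D a"
      then show "clinear (\<lambda>x. F (arr_act D x a # u' @ v'))"
        using clinear_act_entry[of "[]" a "u' @ v'" F] Cons.prems by auto
    qed
    show "clinear (\<lambda>y1. ?T x y1 y2)" for x y2
      using multilinear_on_hact[OF v ml] by (intro clinear_hact u) simp
    show "clinear (?T x y1)" for x y1
    proof (intro clinear_hact_fun u clinear_hact v)
      fix u' assume u': "map fst u' = map fst u" "\<forall>a\<in>set u'. is_arrow D a"
      then show "multilinear_on D (map fst v) (\<lambda>v'. F (arr_act D x a # u' @ v'))"
        using multilinear_on_append[of D u' _ "\<lambda>w. F (arr_act D x a # w)"] ml[of x] by simp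
    qed
  qed
  finally show ?case by simp
qed

text \<open>The diagonal action is a module structure because comultiplication and counit are
  multiplicative. The inner element \<open>g\<close> acts after \<open>h\<close>.\<close>

lemma hact_mult:
  assumes "\<forall>a\<in>set w. is_arrow D a" "multilinear_on D (map fst w) F"
  shows "hact H D w (\<lambda>u. hact H D u F g) h = hact H D w F (g * h)"
  using assms
proof (induction w arbitrary: F g h)
  case Nil
  then show ?case by (simp add: counit_mult scaleC_scaleC mult.commute)
next
  case (Cons a w)
  have a: "is_arrow D a" and w: "\<forall>a\<in>set w. is_arrow D a" using Cons.prems by auto
  have ml: "multilinear_on D (map fst w) (\<lambda>w. F (arr_act D x a # w))" for x
    using Cons.prems by (intro multilinear_on_Cons) auto
  have "hact H D (a # w) (\<lambda>u. hact H D u F g) h = tsum (\<Delta> h) (\<lambda>x y. tsum (\<Delta> g) (\<lambda>p q.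
      hact H D w (\<lambda>u. hact H D u (\<lambda>u'. F (arr_act D (p * x) a # u')) q) y))"
    by (simp add: hact_tsum arr_act_mult a)
  also have "\<dots> = tsum (\<Delta> h) (\<lambda>x y. tsum (\<Delta> g) (\<lambda>p q. hact H D w (\<lambda>u. F (arr_act D (p * x) a # u)) (q * y)))"
    by (simp add: Cons.IH[OF w ml])
  also have "\<dots> = tsum (\<Delta> (g * h)) (\<lambda>p q. hact H D w (\<lambda>u. F (arr_act D p a # u)) q)"
  proof (subst comult_mult)
    show "cbilinear (\<lambda>p. hact H D w (\<lambda>u. F (arr_act D p a # u)))"
    proof (rule cbilinearI)
      show "clinear (\<lambda>x. hact H D w (\<lambda>u. F (arr_act D x a # u)) y)" for y
        using Cons.prems by (intro clinear_hact_entry) auto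
    qed (rule clinear_hact[OF w ml])
  qed (rule tsum_swap)
  finally show ?case by simp
qed

lemma hact_one:
  assumes "\<forall>a\<in>set w. is_arrow D a" "multilinear_on D (map fst w) F"
  shows "hact H D w F 1 = F w"
  using assms
proof (induction w arbitrary: F)
  case Nil
  show ?case by (simp add: counit_one scaleC_one)
next
  case (Cons a w)
  have "hact H D (a # w) F 1 = hact H D w (\<lambda>u. F (arr_act D 1 a # u)) 1"
    unfolding hact.simps comult_one
  proof (rule tsum_pure, rule cbilinearI)
    fix x y
    show "clinear (\<lambda>x. hact H D w (\<lambda>u. F (arr_act D x a # u)) y)"
      using Cons.prems by (intro clinear_hact_entry) auto
    show "clinear (hact H D w (\<lambda>u. F (arr_act D x a # u)))"
      using Cons.prems by (intro clinear_hact multilinear_on_Cons) auto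
  qed
  also have "\<dots> = F (a # w)"
    using Cons.prems by (subst Cons.IH) (auto simp: arr_act_one intro: multilinear_on_Cons)
  finally show ?case .
qed

lemma hact_single:
  assumes "is_arrow D a" "multilinear_on D [fst a] F"
  shows "hact H D [a] F h = F [arr_act D h a]"
  using counit_right[OF clinear_act_entry[of "[]" a "[]" F]] assms by simp

lemma hact_linear_out:
  assumes "\<forall>a\<in>set w. is_arrow D a" "linear_on V \<phi>" "cvs.subspace V"
    and "\<And>u. map fst u = map fst w \<Longrightarrow> \<forall>a\<in>set u. is_arrow D a \<Longrightarrow> F u \<in> V"
  shows "\<phi> (hact H D w F h) = hact H D w (\<lambda>u. \<phi> (F u)) h \<and> hact H D w F h \<in> V"
  using assms(1,4)
proof (induction w arbitrary: F h)
  case Nil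
  then show ?case using assms(2,3) by (simp add: linear_on_def cvs.subspace_scale)
next
  case (Cons a w)
  have IH: "\<phi> (hact H D w (\<lambda>u. F (arr_act D x a # u)) y) = hact H D w (\<lambda>u. \<phi> (F (arr_act D x a # u))) y \<and>
     hact H D w (\<lambda>u. F (arr_act D x a # u)) y \<in> V" for x y
    using Cons.prems by (intro Cons.IH) auto
  then show ?case
    using linear_on_tsum_out[OF assms(2,3), of "\<lambda>x y. hact H D w (\<lambda>u. F (arr_act D x a # u)) y"]
      subspace_tsum[OF assms(3), of "\<lambda>x y. hact H D w (\<lambda>u. F (arr_act D x a # u)) y"] by simp
qed

text \<open>The component of the coproduct that meets \<open>c\<close> contributes only its counit,
  which the counit axiom absorbs. This is applied to inserted identity arrows.\<close>

lemma hact_invariant: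
  assumes "is_arrow D c" "\<forall>a\<in>set w. is_arrow D a" "multilinear_on D (fst c # map fst w) F"
    and "\<And>h. arr_act D h c = (fst c, \<epsilon> h *\<^sub>C snd c)"
  shows "hact H D (c # w) F h = hact H D w (\<lambda>u. F (c # u)) h"
proof -
  have "hact H D w (\<lambda>u. F (arr_act D x c # u)) y = \<epsilon> x *\<^sub>C hact H D w (\<lambda>u. F (c # u)) y" for x y
  proof -
    have "hact H D w (\<lambda>u. F (arr_act D x c # u)) y = hact H D w (\<lambda>u. \<epsilon> x *\<^sub>C F (c # u)) y"
    proof (rule hact_cong[OF assms(2)])
      fix u assume "map fst u = map fst w" "\<forall>a\<in>set u. is_arrow D a"
      then show "F (arr_act D x c # u) = \<epsilon> x *\<^sub>C F (c # u)"
        using multilinear_onD[of D "[]" "fst c" u F] assms(1,3) by (simp add: assms(4) is_arrow_def linear_on_def)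
    qed
    also have "\<dots> = \<epsilon> x *\<^sub>C hact H D w (\<lambda>u. F (c # u)) y"
      using hact_linear_out[OF assms(2), of UNIV "\<lambda>z. \<epsilon> x *\<^sub>C z" "\<lambda>u. F (c # u)" y]
      by (simp add: linear_on_def scaleC_add_right scaleC_scaleC mult.commute cvs.subspace_UNIV)
    finally show ?thesis .
  qed
  then show ?thesis
    using counit_left[OF clinear_hact[OF assms(2) multilinear_on_Cons[OF assms(3,1)]]] by simp
qed

text \<open>Equivariance of composition splits the component acting on the composite into two; by
  coassociativity these are the consecutive components acting on its two factors.\<close>

lemma hact_merge:
  assumes "\<forall>x\<in>set (u @ b # a # v). is_arrow D x" "arr_src b = arr_tgt a"
    and "multilinear_on D (map fst (u @ arr_comp D b a # v)) F"
  shows "hact H D (u @ arr_comp D b a # v) F h = hact H D (u @ b # a # v) (\<lambda>w. F (merge D (length u) w)) h"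
  using assms
proof (induction u arbitrary: F h)
  case Nil
  have ab: "is_arrow D a" "is_arrow D b" and v: "\<forall>x\<in>set v. is_arrow D x" using Nil.prems by auto
  let ?i = "(arr_src a, arr_tgt b)"
  let ?T = "\<lambda>p q y. hact H D v (\<lambda>w. F (arr_comp D (arr_act D p b) (arr_act D q a) # w)) y"
  have act: "F (arr_act D x (arr_comp D b a) # w) = tsum (\<Delta> x) (\<lambda>p q. F (arr_comp D (arr_act D p b) (arr_act D q a) # w))"
    if w: "map fst w = map fst v" "\<forall>x\<in>set w. is_arrow D x" for x w
  proof -
    have "F (arr_act D x (arr_comp D b a) # w) = F ((?i, tsum (\<Delta> x) (\<lambda>p q. snd (arr_comp D (arr_act D p b) (arr_act D q a)))) # w)"
      using ab Nil.prems by (simp add: arr_act_def arr_comp_def Act_Comp is_arrow_def)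
    also have "\<dots> = tsum (\<Delta> x) (\<lambda>p q. F ((?i, snd (arr_comp D (arr_act D p b) (arr_act D q a))) # w))"
    proof (rule linear_on_tsum_out)
      show "linear_on (Hom D (arr_src a) (arr_tgt b)) (\<lambda>f. F ((?i, f) # w))"
        using multilinear_onD[of D "[]" ?i w F] Nil.prems w ab by (simp add: is_arrow_def)
      show "cvs.subspace (Hom D (arr_src a) (arr_tgt b))"
        using ab by (simp add: subspace_Hom is_arrow_def)
      show "snd (arr_comp D (arr_act D p b) (arr_act D q a)) \<in> Hom D (arr_src a) (arr_tgt b)" for p q
        using is_arrow_comp[of "arr_act D q a" "arr_act D p b"] ab Nil.prems
        by (simp add: is_arrow_def arr_comp_def arr_act_def Act_Hom)
    qed
    finally show ?thesis by (simp add: arr_comp_def)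
  qed
  have lin: "clinear (\<lambda>p. F (arr_comp D (arr_act D p b) (arr_act D q a) # w))"
    "clinear (\<lambda>q. F (arr_comp D (arr_act D p b) (arr_act D q a) # w))"
    if w: "map fst w = map fst v" "\<forall>x\<in>set w. is_arrow D x" for p q w
  proof -
    have l: "linear_on (Hom D (arr_src a) (arr_tgt b)) (\<lambda>f. F ((?i, f) # w))"
      using multilinear_onD[of D "[]" ?i w F] Nil.prems w ab by (simp add: is_arrow_def)
    let ?c = "\<lambda>p q. Comp D (arr_src a) (arr_tgt a) (arr_tgt b) (Act D (arr_tgt a) (arr_tgt b) p (snd b)) (Act D (arr_src a) (arr_tgt a) q (snd a))"
    have o: "arr_src a \<in> Ob D" "arr_tgt a \<in> Ob D" "arr_tgt b \<in> Ob D" "snd a \<in> Hom D (arr_src a) (arr_tgt a)"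
      "snd b \<in> Hom D (arr_tgt a) (arr_tgt b)"
      using ab Nil.prems by (auto simp: is_arrow_def)
    have c: "?c p q \<in> Hom D (arr_src a) (arr_tgt b)" for p q
      using o by (simp add: Comp_Hom Act_Hom)
    have "clinear (\<lambda>p. ?c p q)" "clinear (\<lambda>q. ?c p q)"
      using Comp_linear(2)[OF o(1-3), of "Act D (arr_src a) (arr_tgt a) q (snd a)"]
        Comp_linear(1)[OF o(1-3), of "Act D (arr_tgt a) (arr_tgt b) p (snd b)"]
        clinear_Act[OF o(1,2,4)] clinear_Act[OF o(2,3,5)] Act_Hom o
      by (auto simp: clinear_iff linear_on_def)
    then show "clinear (\<lambda>p. F (arr_comp D (arr_act D p b) (arr_act D q a) # w))"
        "clinear (\<lambda>q. F (arr_comp D (arr_act D p b) (arr_act D q a) # w))"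
      using l c Nil.prems(2) by (simp_all add: arr_comp_def arr_act_def linear_on_def clinear_iff)
  qed
  have "hact H D (arr_comp D b a # v) F h = tsum (\<Delta> h) (\<lambda>x y. tsum (\<Delta> x) (\<lambda>p q. ?T p q y))"
    by (simp add: hact_cong[OF v act] hact_tsum)
  also have "\<dots> = tsum (\<Delta> h) (\<lambda>p y. tsum (\<Delta> y) (\<lambda>q y. ?T p q y))"
  proof (rule coassoc)
    show "clinear (\<lambda>p. ?T p q y)" "clinear (\<lambda>q. ?T p q y)" for p q y
      using lin v by (auto intro!: clinear_hact_fun)
    have "is_arrow D (arr_comp D (arr_act D p b) (arr_act D q a))" for p q
      using ab Nil.prems by (intro is_arrow_comp) auto
    then show "clinear (\<lambda>y. ?T p q y)" for p q
      using v Nil.prems(3) multilinear_on_Cons[of D "arr_comp D (arr_act D p b) (arr_act D q a)"]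
      by (intro clinear_hact) auto
  qed
  also have "\<dots> = hact H D (b # a # v) (\<lambda>w. F (merge D (length []) w)) h"
    by (simp add: merge_def)
  finally show ?case by simp
next
  case (Cons c u)
  have "hact H D (u @ arr_comp D b a # v) (\<lambda>w. F (arr_act D x c # w)) y =
     hact H D (u @ b # a # v) (\<lambda>w. F (arr_act D x c # merge D (length u) w)) y" for x y
    using Cons.prems by (intro Cons.IH) (auto intro!: multilinear_on_Cons)
  then show ?case by simp
qed

lemma multilinear_on_word_pure: "multilinear_on D L word_pure"
  unfolding multilinear_on_def
proof (intro allI impI)
  fix us vs :: "('o, 'f) arrow list" and i
  have "clinear (\<lambda>x. word_pure (us @ (i, x) # vs))"
    by (rule multilinear_word_pure[unfolded multilinear_def, rule_format])
  then show "linear_on (Hom D (fst i) (snd i)) (\<lambda>f. word_pure (us @ (i, f) # vs))"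
    by (simp add: linear_on_def clinear_iff)
qed

lemma clinear_word_cons: "clinear (word_cons x)" and word_cons_pure: "word_cons x (word_pure w) = word_pure (x # w)"
proof -
  have "multilinear (\<lambda>w. word_pure (x # w))"
    unfolding multilinear_def
  proof (intro allI)
    fix us vs and i
    show "clinear (\<lambda>y. word_pure (x # us @ (i, y) # vs))"
      using multilinear_word_pure[unfolded multilinear_def, rule_format, of "x # us" i vs] by simp
  qed
  then show "clinear (word_cons x)" "word_cons x (word_pure w) = word_pure (x # w)"
    unfolding word_cons_def by (auto intro: clinear_word_lift simp: word_lift_pure)
qed

text \<open>Connects the action used in the definition of cochains with \<open>hact\<close>, by
  taking for \<open>F\<close> the passage to elementary tensors.\<close>

lemma diag_act_eq_hact:
  assumes "\<forall>a\<in>set w. is_arrow D a" shows "diag_act H D w h = hact H D w word_pure h"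
  using assms
proof (induction w arbitrary: h)
  case (Cons a w)
  have a: "is_arrow D a" and w: "\<forall>a\<in>set w. is_arrow D a" using Cons.prems by auto
  have "word_cons (arr_act D x a) (diag_act H D w y) = hact H D w (\<lambda>u. word_pure (arr_act D x a # u)) y" for x y
    using hact_linear_out[OF w, of UNIV "word_cons (arr_act D x a)" word_pure y] clinear_word_cons[of "arr_act D x a"]
    by (simp add: Cons.IH w word_cons_pure clinear_iff_linear_on cvs.subspace_UNIV)
  moreover have "cbilinear (\<lambda>x y. hact H D w (\<lambda>u. word_pure (arr_act D x a # u)) y)"
  proof (rule cbilinearI)
    fix x y
    show "clinear (\<lambda>x. hact H D w (\<lambda>u. word_pure (arr_act D x a # u)) y)"
      using w a by (intro clinear_hact_entry multilinear_on_word_pure)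
    show "clinear (hact H D w (\<lambda>u. word_pure (arr_act D x a # u)))"
      using w a by (intro clinear_hact multilinear_on_Cons) (auto intro: multilinear_on_word_pure)
  qed
  ultimately show ?case by (simp add: tensor_lift_eq_tsum)
qed simp

end

section \<open>Cochains as multilinear families\<close>

text \<open>Composability around the cycle is a condition on labels alone. Separated from the
  arrows, it survives the action of \<open>H\<close> and any change of the arrows within their Hom
  spaces.\<close>

definition linked :: "('o \<times> 'o) list \<Rightarrow> bool" where
  "linked L \<longleftrightarrow> successively (\<lambda>i j. fst i = snd j) L \<and> fst (last L) = snd (hd L)"

lemma cyclic_words_iff:
  "w \<in> cyclic_words D n \<longleftrightarrow> length w = Suc n \<and> (\<forall>a\<in>set w. is_arrow D a) \<and> linked (map fst w)"
proof (cases "length w = Suc n")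
  case True
  then have ne: "w \<noteq> []" by auto
  \<comment> \<open>The modulus matters only at \<open>i = n\<close>, where it closes the
    cycle.\<close>
  have "(\<forall>i\<le>n. arr_src (w ! i) = arr_tgt (w ! (Suc i mod Suc n))) \<longleftrightarrow>
      (\<forall>i<n. arr_src (w ! i) = arr_tgt (w ! Suc i)) \<and> arr_src (w ! n) = arr_tgt (w ! 0)"
    by (auto simp: le_less)
  also have "\<dots> \<longleftrightarrow> linked (map fst w)"
    using True ne by (auto simp: linked_def successively_conv_nth last_conv_nth hd_conv_nth)
  finally show ?thesis using True by (simp add: cyclic_words_def is_arrow_def)
qed (simp add: cyclic_words_def)

lemma cyclic_words_relabel:
  "w \<in> cyclic_words D n \<Longrightarrow> map fst u = map fst w \<Longrightarrow> \<forall>a\<in>set u. is_arrow D a \<Longrightarrow> u \<in> cyclic_words D n"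
  by (simp add: cyclic_words_iff) (metis length_map)

lemma cyclic_words_arrow: "w \<in> cyclic_words D n \<Longrightarrow> \<forall>a\<in>set w. is_arrow D a"
  by (simp add: cyclic_words_iff)

definition multilinear_values :: "('o, 'f::complex_vector, 'h) hcat \<Rightarrow> nat
    \<Rightarrow> ('m::complex_vector \<Rightarrow> ('o, 'f) arrow list \<Rightarrow> complex) \<Rightarrow> bool" where
  "multilinear_values D n F \<longleftrightarrow> (\<forall>w\<in>cyclic_words D n. clinear (\<lambda>m. F m w)) \<and>
     (\<forall>m. \<forall>w\<in>cyclic_words D n. multilinear_on D (map fst w) (F m))"

lemma pure_in_M_tensor_CN: "w \<in> cyclic_words D n \<Longrightarrow> m \<otimes>\<^sub>C word_pure w \<in> M_tensor_CN D n"
  unfolding M_tensor_CN_def CN_def by (auto intro!: cvs.span_base)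

lemma subspace_M_tensor_CN: "cvs.subspace (M_tensor_CN D n)"
  unfolding M_tensor_CN_def by (rule cvs.subspace_span)

lemma subspace_functionals: "cvs.subspace (functionals V)"
  by (rule cvs.subspaceI)
    (auto simp: functionals_def linear_on_def scaleC_fun_def scaleC_add_right scaleC_scaleC mult.commute
      cvs.scale_zero_right)

lemma subspace_vimage_eq:
  assumes "linear_on V \<phi>" "linear_on V \<psi>" "cvs.subspace V" "clinear f"
  shows "cvs.subspace {x. f x \<in> V \<and> \<phi> (f x) = \<psi> (f x)}"
proof (rule cvs.subspaceI)
  have "\<phi> (0 *\<^sub>C 0) = 0 *\<^sub>C \<phi> 0" "\<psi> (0 *\<^sub>C 0) = 0 *\<^sub>C \<psi> 0"
    using assms cvs.subspace_0 unfolding linear_on_def by blast+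
  then show "0 \<in> {x. f x \<in> V \<and> \<phi> (f x) = \<psi> (f x)}"
    using assms(3) by (simp add: clinear_zero[OF assms(4)] cvs.subspace_0)
qed (use assms in \<open>auto simp: linear_on_def clinear_iff cvs.subspace_add cvs.subspace_scale\<close>)

section \<open>Functionals and their values on elementary tensors\<close>

lemma functionals_eqI:
  fixes D :: "('o, 'f::complex_vector, 'h) hcat"
  assumes "\<phi> \<in> functionals (M_tensor_CN D n)" "\<psi> \<in> functionals (M_tensor_CN D n)"
    and "\<And>m w. w \<in> cyclic_words D n \<Longrightarrow> \<phi> (m \<otimes>\<^sub>C word_pure w) = \<psi> (m \<otimes>\<^sub>C word_pure w)"
  shows "\<phi> = \<psi>"
proof
  fix t
  let ?V = "M_tensor_CN D n"
  have lin: "linear_on ?V \<phi>" "linear_on ?V \<psi>" using assms(1,2) by (auto simp: functionals_def)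
  show "\<phi> t = \<psi> t"
  proof (cases "t \<in> ?V")
    case True
    have "m \<otimes>\<^sub>C x \<in> {x. x \<in> ?V \<and> \<phi> x = \<psi> x}" if "x \<in> CN D n" for m x
    proof -
      have "CN D n \<subseteq> {x. m \<otimes>\<^sub>C x \<in> ?V \<and> \<phi> (m \<otimes>\<^sub>C x) = \<psi> (m \<otimes>\<^sub>C x)}"
        unfolding CN_def
        by (intro cvs.span_minimal subspace_vimage_eq lin subspace_M_tensor_CN clin)
          (auto simp: assms(3) pure_in_M_tensor_CN)
      then show ?thesis using that by auto
    qed
    then have "{m \<otimes>\<^sub>C x |m x. x \<in> CN D n} \<subseteq> {x. x \<in> ?V \<and> \<phi> x = \<psi> x}" by blast
    from cvs.span_minimal[OF this subspace_vimage_eq[OF lin subspace_M_tensor_CN clinear_ident]] True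
    show ?thesis unfolding M_tensor_CN_def by auto
  next
    case False
    then show ?thesis using assms(1,2) by (simp add: functionals_def)
  qed
qed

lemma word_lift_eqI:
  assumes "multilinear g" "clinear L" "\<And>w. L (word_pure w) = g w"
  shows "word_lift g = L"
  using word_lift_unique_ex[OF assms(1)] assms(2,3) clinear_word_lift[OF assms(1)] word_lift_pure[OF assms(1)]
  by blast

text \<open>The tensor spaces are built from the ambient space of all arrows, while \<open>F\<close>
  is linear only on Hom spaces. Projecting every entry onto the Hom space of its label gives a
  family that is multilinear everywhere, to which the universal properties apply; restricting the
  result to the subspace recovers \<open>F\<close>.\<close>

lemma functional_exists:
  fixes F :: "'m::complex_vector \<Rightarrow> ('o, 'f::complex_vector) arrow list \<Rightarrow> complex"
  assumes sub: "\<And>X Y. X \<in> Ob D \<Longrightarrow> Y \<in> Ob D \<Longrightarrow> cvs.subspace (Hom D X Y)"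
    and F: "multilinear_values D n F"
  shows "\<exists>\<phi>\<in>functionals (M_tensor_CN D n). \<forall>m. \<forall>w\<in>cyclic_words D n. \<phi> (m \<otimes>\<^sub>C word_pure w) = F m w"
proof -
  have "\<exists>\<pi>. \<forall>i. fst i \<in> Ob D \<and> snd i \<in> Ob D \<longrightarrow> clinear (\<pi> i) \<and> range (\<pi> i) \<subseteq> Hom D (fst i) (snd i) \<and>
      (\<forall>x\<in>Hom D (fst i) (snd i). \<pi> i x = x)"
    by (rule choice) (use subspace_projection[OF sub] in blast)
  then obtain \<pi> where \<pi>: "\<And>i. fst i \<in> Ob D \<Longrightarrow> snd i \<in> Ob D \<Longrightarrow> clinear (\<pi> i)"
      "\<And>i x. fst i \<in> Ob D \<Longrightarrow> snd i \<in> Ob D \<Longrightarrow> \<pi> i x \<in> Hom D (fst i) (snd i)"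
      "\<And>i x. fst i \<in> Ob D \<Longrightarrow> snd i \<in> Ob D \<Longrightarrow> x \<in> Hom D (fst i) (snd i) \<Longrightarrow> \<pi> i x = x"
    by blast
  \<comment> \<open>Goodness depends on labels only. The case distinction in \<open>g\<close> is
    therefore constant along each entry and does not disturb multilinearity; label lists outside the
    cyclic words receive the value 0.\<close>
  define good where "good L \<longleftrightarrow> length L = Suc n \<and> linked L \<and> (\<forall>i\<in>set L. fst i \<in> Ob D \<and> snd i \<in> Ob D)" for L
  define p where "p a = (fst a, \<pi> (fst a) (snd a))" for a
  define g where "g m w = (if good (map fst w) then F m (map p w) else 0)" for m w
  have fp [simp]: "fst \<circ> p = fst" by (auto simp: p_def)
  have arr: "is_arrow D (p a)" if "fst (fst a) \<in> Ob D" "snd (fst a) \<in> Ob D" for a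
    using that \<pi>(2) by (simp add: p_def is_arrow_def)
  have cyc: "map p w \<in> cyclic_words D n" if "good (map fst w)" for w
    using that arr by (auto simp: good_def cyclic_words_iff)
  have g_cyc: "g m w = F m w" if w: "w \<in> cyclic_words D n" for m w
  proof -
    have "map p w = w" using w \<pi>(3) by (intro map_idI) (auto simp: cyclic_words_iff p_def is_arrow_def)
    moreover have "good (map fst w)" using w by (auto simp: good_def cyclic_words_iff is_arrow_def)
    ultimately show ?thesis by (simp add: g_def)
  qed
  have gm: "multilinear (g m)" for m
    unfolding multilinear_def
  proof (intro allI)
    fix us vs and i :: "'o \<times> 'o"
    show "clinear (\<lambda>x. g m (us @ (i, x) # vs))"
    proof (cases "good (map fst us @ i # map fst vs)")
      case True
      have i: "fst i \<in> Ob D" "snd i \<in> Ob D" using True by (auto simp: good_def)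
      have "map p (us @ (i, 0) # vs) \<in> cyclic_words D n" using True by (intro cyc) simp
      moreover have "map fst (map p (us @ (i, 0) # vs)) = map fst (map p us) @ i # map fst (map p vs)"
        by (simp add: p_def)
      ultimately have "multilinear_on D (map fst (map p us) @ i # map fst (map p vs)) (F m)"
        using F unfolding multilinear_values_def by metis
      then have "linear_on (Hom D (fst i) (snd i)) (\<lambda>f. F m (map p us @ (i, f) # map p vs))"
        by (rule multilinear_onD) (use i True arr in \<open>auto simp: good_def\<close>)
      then have "clinear (\<lambda>x. F m (map p us @ (i, \<pi> i x) # map p vs))"
        using \<pi>(1,2)[OF i] by (simp add: linear_on_def clinear_iff)
      then show ?thesis using True by (simp add: g_def p_def)
    next
      case False
      then show ?thesis by (simp add: g_def clin)
    qed
  qed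
  have gl: "clinear (\<lambda>m. g m w)" for w
    using F cyc[of w] by (cases "good (map fst w)") (auto simp: g_def multilinear_values_def clin)
  have bil: "cbilinear (\<lambda>m. word_lift (g m))"
  proof (rule cbilinearI)
    show "clinear (\<lambda>m. word_lift (g m) t)" for t
    proof (rule clinearI)
      have "word_lift (g (x + y)) = (\<lambda>t. word_lift (g x) t + word_lift (g y) t)" for x y
        using gm clinear_add[OF gl] by (intro word_lift_eqI clin) (auto simp: word_lift_pure intro: clinear_word_lift)
      then show "word_lift (g (x + y)) t = word_lift (g x) t + word_lift (g y) t" for x y by simp
      have "word_lift (g (c *\<^sub>C x)) = (\<lambda>t. c *\<^sub>C word_lift (g x) t)" for c x
        using gm clinear_scale[OF gl] by (intro word_lift_eqI clin) (auto simp: word_lift_pure intro: clinear_word_lift)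
      then show "word_lift (g (c *\<^sub>C x)) t = c *\<^sub>C word_lift (g x) t" for c x by simp
    qed
    show "clinear (word_lift (g m))" for m by (rule clinear_word_lift[OF gm])
  qed
  let ?\<psi> = "tensor_lift (\<lambda>m. word_lift (g m))"
  let ?V = "M_tensor_CN D n :: ('m \<otimes> ('o \<times> 'o, 'f) words) set"
  let ?\<phi> = "\<lambda>t. if t \<in> ?V then ?\<psi> t else 0"
  have "?\<phi> \<in> functionals ?V"
    using clinear_tensor_lift[OF bil]
    by (auto simp: functionals_def linear_on_def clinear_iff cvs.subspace_add[OF subspace_M_tensor_CN]
        cvs.subspace_scale[OF subspace_M_tensor_CN])
  moreover have "?\<phi> (m \<otimes>\<^sub>C word_pure w) = F m w" if "w \<in> cyclic_words D n" for m w
    using that by (simp add: pure_in_M_tensor_CN tensor_lift_pure[OF bil] word_lift_pure[OF gm] g_cyc)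
  ultimately show ?thesis by (intro bexI[of _ ?\<phi>]) auto
qed

lemma functional_of_cong:
  "(\<And>m w. w \<in> cyclic_words D n \<Longrightarrow> F m w = G m w) \<Longrightarrow> functional_of D n F = functional_of D n G"
  unfolding functional_of_def by simp

lemma multilinear_on_Cons_iff:
  "multilinear_on D (i # L) F \<longleftrightarrow> (fst i \<in> Ob D \<and> snd i \<in> Ob D \<longrightarrow>
     (\<forall>w. map fst w = L \<and> (\<forall>a\<in>set w. is_arrow D a) \<longrightarrow> linear_on (Hom D (fst i) (snd i)) (\<lambda>f. F ((i, f) # w))) \<and>
     (\<forall>f\<in>Hom D (fst i) (snd i). multilinear_on D L (\<lambda>w. F ((i, f) # w))))"
  (is "?l \<longleftrightarrow> ?r")
proof
  assume l: ?l
  show ?r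
  proof (intro impI conjI allI ballI)
    assume i: "fst i \<in> Ob D \<and> snd i \<in> Ob D"
    show "linear_on (Hom D (fst i) (snd i)) (\<lambda>f. F ((i, f) # w))"
      if "map fst w = L \<and> (\<forall>a\<in>set w. is_arrow D a)" for w
      using multilinear_onD[of D "[]" i w F] l i that by simp
    show "multilinear_on D L (\<lambda>w. F ((i, f) # w))" if "f \<in> Hom D (fst i) (snd i)" for f
      using multilinear_on_Cons[of D "(i, f)" L F] l i that by (simp add: is_arrow_def)
  qed
next
  assume r: ?r
  show ?l
    unfolding multilinear_on_def
  proof (intro allI impI)
    fix us j vs
    assume *: "map fst us @ j # map fst vs = i # L \<and> fst j \<in> Ob D \<and> snd j \<in> Ob D \<and> (\<forall>a\<in>set us \<union> set vs. is_arrow D a)"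
    show "linear_on (Hom D (fst j) (snd j)) (\<lambda>f. F (us @ (j, f) # vs))"
    proof (cases us)
      case Nil
      then show ?thesis using r * by auto
    next
      case (Cons a us')
      then have a: "fst a = i" "is_arrow D a" "map fst us' @ j # map fst vs = L" using * by auto
      then have i: "fst i \<in> Ob D" "snd i \<in> Ob D" "snd a \<in> Hom D (fst i) (snd i)" by (auto simp: is_arrow_def)
      then have "multilinear_on D L (\<lambda>w. F ((i, snd a) # w))" using r by blast
      then have "multilinear_on D (map fst us' @ j # map fst vs) (\<lambda>w. F (a # w))"
        using a by (metis prod.collapse)
      then show ?thesis
        using multilinear_onD[of D us' j vs "\<lambda>w. F (a # w)"] * Cons by simp
    qed
  qed
qed

lemma functional_tsum_out:
  assumes "\<phi> \<in> functionals (M_tensor_CN D n)" "\<And>a b. w a b \<in> cyclic_words D n"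
  shows "\<phi> (tsum t (\<lambda>a x. g a x \<otimes>\<^sub>C word_pure (w a x))) = tsum t (\<lambda>a x. \<phi> (g a x \<otimes>\<^sub>C word_pure (w a x)))"
  using assms by (intro linear_on_tsum_out[OF _ subspace_M_tensor_CN] pure_in_M_tensor_CN) (auto simp: functionals_def)

lemma functional_multilinear:
  assumes "\<phi> \<in> functionals (M_tensor_CN D n)"
    and sub: "\<And>X Y. X \<in> Ob D \<Longrightarrow> Y \<in> Ob D \<Longrightarrow> cvs.subspace (Hom D X Y)"
  shows "multilinear_values D n (\<lambda>m w. \<phi> (m \<otimes>\<^sub>C word_pure w))"
  unfolding multilinear_values_def
proof (intro conjI ballI allI)
  have lin: "linear_on (M_tensor_CN D n) \<phi>" using assms(1) by (simp add: functionals_def)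
  fix w assume w: "w \<in> cyclic_words D n"
  show "clinear (\<lambda>m. \<phi> (m \<otimes>\<^sub>C word_pure w))"
    using lin
    by (simp add: clinear_iff linear_on_def tensor_pure_add_left tensor_pure_scaleC pure_in_M_tensor_CN[OF w])
  fix m
  show "multilinear_on D (map fst w) (\<lambda>w. \<phi> (m \<otimes>\<^sub>C word_pure w))"
    unfolding multilinear_on_def
  proof (intro allI impI)
    fix us vs i
    assume *: "map fst us @ i # map fst vs = map fst w \<and> fst i \<in> Ob D \<and> snd i \<in> Ob D \<and> (\<forall>a\<in>set us \<union> set vs. is_arrow D a)"
    have V: "m \<otimes>\<^sub>C word_pure (us @ (i, f) # vs) \<in> M_tensor_CN D n" if "f \<in> Hom D (fst i) (snd i)" for f
      using * that by (intro pure_in_M_tensor_CN cyclic_words_relabel[OF w]) (auto simp: is_arrow_def)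
    have "clinear (\<lambda>f. word_pure (us @ (i, f) # vs))"
      by (rule multilinear_word_pure[unfolded multilinear_def, rule_format])
    then have "clinear (\<lambda>f. m \<otimes>\<^sub>C word_pure (us @ (i, f) # vs))" by (intro clin)
    then show "linear_on (Hom D (fst i) (snd i)) (\<lambda>f. \<phi> (m \<otimes>\<^sub>C word_pure (us @ (i, f) # vs)))"
      using lin V sub * by (simp add: clinear_iff linear_on_def)
  qed
qed

context
  fixes D :: "('o, 'f::complex_vector, 'h) hcat" and n
    and F :: "'m::complex_vector \<Rightarrow> ('o, 'f) arrow list \<Rightarrow> complex"
  assumes sub: "\<And>X Y. X \<in> Ob D \<Longrightarrow> Y \<in> Ob D \<Longrightarrow> cvs.subspace (Hom D X Y)"
    and F: "multilinear_values D n F"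
begin

lemma functional_of: "functional_of D n F \<in> functionals (M_tensor_CN D n) \<and>
    (\<forall>m. \<forall>w\<in>cyclic_words D n. functional_of D n F (m \<otimes>\<^sub>C word_pure w) = F m w)"
proof -
  have "\<exists>!\<phi>. \<phi> \<in> functionals (M_tensor_CN D n) \<and> (\<forall>m. \<forall>w\<in>cyclic_words D n. \<phi> (m \<otimes>\<^sub>C word_pure w) = F m w)"
  proof (rule ex_ex1I)
    fix \<phi> \<psi>
    assume "\<phi> \<in> functionals (M_tensor_CN D n) \<and> (\<forall>m. \<forall>w\<in>cyclic_words D n. \<phi> (m \<otimes>\<^sub>C word_pure w) = F m w)"
      "\<psi> \<in> functionals (M_tensor_CN D n) \<and> (\<forall>m. \<forall>w\<in>cyclic_words D n. \<psi> (m \<otimes>\<^sub>C word_pure w) = F m w)"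
    then show "\<phi> = \<psi>" by (intro functionals_eqI[of \<phi> D n \<psi>]) auto
  qed (use functional_exists[OF sub F] in blast)
  from theI'[OF this] show ?thesis unfolding functional_of_def .
qed

lemma functional_of_functional: "functional_of D n F \<in> functionals (M_tensor_CN D n)"
  using functional_of by blast

lemma functional_of_pure: "w \<in> cyclic_words D n \<Longrightarrow> functional_of D n F (m \<otimes>\<^sub>C word_pure w) = F m w"
  using functional_of by blast

end

section \<open>The cocyclic module of cochains\<close>

locale sayd = hopf H for H :: "('h::complex_algebra_1) hopf_data" +
  fixes M :: "('h, 'm::complex_vector) mod_comod"
  assumes sayd: "sayd_module H M"
begin

lemma cbilinear_ract: "cbilinear (ract M)" and ract_one: "ract M m 1 = m"
  and ract_mult: "ract M m (g * h) = ract M (ract M m g) h" and clinear_coact: "clinear (coact M)"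
  using sayd by (simp_all add: sayd_module_def right_module_def left_comodule_def)

lemmas clinear_sayd [clin] = cbilinear_left[OF cbilinear_ract] cbilinear_right[OF cbilinear_ract]
  clinear_comp[OF clinear_coact]

lemma coact_coassoc:
  assumes "\<And>b c. clinear (\<lambda>a. T a b c)" "\<And>a c. clinear (\<lambda>b. T a b c)" "\<And>a b. clinear (\<lambda>c. T a b c)"
  shows "tsum (coact M m) (\<lambda>a n. tsum (\<Delta> a) (\<lambda>a1 a2. T a1 a2 n)) = tsum (coact M m) (\<lambda>a n. tsum (coact M n) (\<lambda>b n. T a b n))"
proof -
  have bT: "cbilinear (\<lambda>a u. tsum u (T a))" "cbilinear (T a)" for a
    by (intro clin assms)+
  have "tensor_lift (\<lambda>a n. tensor_lift (\<lambda>a\<^sub>1 a\<^sub>2. a\<^sub>1 \<otimes>\<^sub>C (a\<^sub>2 \<otimes>\<^sub>C n)) (\<Delta> a)) (coact M m)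
      = tensor_lift (\<lambda>a n. a \<otimes>\<^sub>C coact M n) (coact M m)"
    using sayd by (simp add: sayd_module_def left_comodule_def)
  then have "tsum (coact M m) (\<lambda>a n. tsum (\<Delta> a) (\<lambda>a1 a2. a1 \<otimes>\<^sub>C (a2 \<otimes>\<^sub>C n))) = tsum (coact M m) (\<lambda>a n. a \<otimes>\<^sub>C coact M n)"
    by (simp add: tensor_lift_eq_tsum clin)
  then have "tsum (tsum (coact M m) (\<lambda>a n. tsum (\<Delta> a) (\<lambda>a1 a2. a1 \<otimes>\<^sub>C (a2 \<otimes>\<^sub>C n)))) (\<lambda>a u. tsum u (T a))
     = tsum (tsum (coact M m) (\<lambda>a n. a \<otimes>\<^sub>C coact M n)) (\<lambda>a u. tsum u (T a))"
    by simp
  then show ?thesis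
    by (simp add: clinear_tsum_out[OF clinear_tsum[OF bT(1)]] tsum_pure[OF bT(1)] tsum_pure[OF bT(2)])
qed

lemma coact_counit:
  assumes "clinear f" shows "tsum (coact M m) (\<lambda>a n. \<epsilon> a *\<^sub>C f n) = f m"
proof -
  have "tensor_lift (\<lambda>a n. \<epsilon> a *\<^sub>C n) (coact M m) = m"
    using sayd by (simp add: sayd_module_def left_comodule_def)
  then have "f (tsum (coact M m) (\<lambda>a n. \<epsilon> a *\<^sub>C n)) = f m" by (simp add: tensor_lift_eq_tsum clin)
  then show ?thesis by (simp add: clinear_tsum_out[OF assms] clinear_scale[OF assms])
qed

lemma coact_stable:
  assumes "clinear f" shows "tsum (coact M m) (\<lambda>a n. f (ract M n a)) = f m"
proof -
  have "tensor_lift (\<lambda>a n. ract M n a) (coact M m) = m"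
    using sayd by (simp add: sayd_module_def)
  then have "f (tsum (coact M m) (\<lambda>a n. ract M n a)) = f m" by (simp add: tensor_lift_eq_tsum clin)
  then show ?thesis by (simp add: clinear_tsum_out[OF assms])
qed

lemma coact_ract:
  assumes "cbilinear \<beta>"
  shows "tsum (coact M (ract M m h)) \<beta> = tsum (\<Delta> h) (\<lambda>h1 h'. tsum (\<Delta> h') (\<lambda>h2 h3.
     tsum (coact M m) (\<lambda>a n. \<beta> (S h3 * a * h1) (ract M n h2))))"
proof -
  have "coact M (ract M m h) = tensor_lift (\<lambda>h\<^sub>1 h'. tensor_lift (\<lambda>h\<^sub>2 h\<^sub>3. tensor_lift (\<lambda>a n.
            (S h\<^sub>3 * a * h\<^sub>1) \<otimes>\<^sub>C ract M n h\<^sub>2) (coact M m)) (\<Delta> h')) (\<Delta> h)"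
    using sayd by (simp add: sayd_module_def)
  also have "\<dots> = tsum (\<Delta> h) (\<lambda>h1 h'. tsum (\<Delta> h') (\<lambda>h2 h3. tsum (coact M m) (\<lambda>a n. (S h3 * a * h1) \<otimes>\<^sub>C ract M n h2)))"
    by (simp add: tensor_lift_eq_tsum clin)
  finally show ?thesis
    by (simp add: clinear_tsum_out[OF clinear_tsum[OF assms]] tsum_pure[OF assms])
qed

text \<open>Stability rewrites m_(0) as m_(0)(0) m_(0)(-1). After coassociativity of the coaction
  the second coproduct component of m_(-1) meets \<open>S'\<close> of the first, and the two cancel.
  This is what gives \<open>tau\<close> finite order.\<close>

lemma coact_antipode_inv_stable:
  assumes "clinear f" shows "tsum (coact M m) (\<lambda>a n. f (ract M n (S' a))) = f m"
proof -
  note [clin] = clinear_comp[OF assms]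
  have "tsum (coact M m) (\<lambda>a n. f (ract M n (S' a)))
      = tsum (coact M m) (\<lambda>a n. tsum (coact M n) (\<lambda>b n'. f (ract M (ract M n' b) (S' a))))"
    by (intro tsum_cong refl coact_stable[symmetric] clin)
  also have "\<dots> = tsum (coact M m) (\<lambda>a n. tsum (\<Delta> a) (\<lambda>a1 a2. f (ract M (ract M n a2) (S' a1))))"
    by (rule coact_coassoc[symmetric]) (intro clin)+
  also have "\<dots> = tsum (coact M m) (\<lambda>a n. tsum (\<Delta> a) (\<lambda>a1 a2. f (ract M n (a2 * S' a1))))"
    by (simp add: ract_mult)
  also have "\<dots> = tsum (coact M m) (\<lambda>a n. \<epsilon> a *\<^sub>C f (ract M n 1))"
    by (intro tsum_cong refl antipode_inv_right clin)
  also have "\<dots> = f m"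
    by (simp add: ract_one coact_counit[OF assms])
  finally show ?thesis .
qed

end

section \<open>Cochains as invariant families of values\<close>

locale hopf_cyclic = sayd H M + hcategory H D
  for H :: "('h::complex_algebra_1) hopf_data" and M :: "('h, 'm::complex_vector) mod_comod"
    and D :: "('o, 'f::complex_vector, 'h) hcat"
begin

definition invariant_values :: "nat \<Rightarrow> ('m \<Rightarrow> ('o, 'f) arrow list \<Rightarrow> complex) \<Rightarrow> bool" where
  "invariant_values n F \<longleftrightarrow> (\<forall>m h. \<forall>w\<in>cyclic_words D n. F (ract M m h) w = hact H D w (F m) h)"

lemma values_multilinear_on: "multilinear_values D n F \<Longrightarrow> w \<in> cyclic_words D n \<Longrightarrow> multilinear_on D (map fst w) (F m)"
  and values_clinear: "multilinear_values D n F \<Longrightarrow> w \<in> cyclic_words D n \<Longrightarrow> clinear (\<lambda>m. F m w)"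
  by (auto simp: multilinear_values_def)

lemma clinear_values_hact:
  assumes "multilinear_values D n F" "w \<in> cyclic_words D n"
  shows "clinear (hact H D w (F m))" "clinear (\<lambda>m. hact H D w (F m) h)"
proof -
  note arr = cyclic_words_arrow[OF assms(2)]
  show "clinear (hact H D w (F m))"
    by (rule clinear_hact[OF arr values_multilinear_on[OF assms]])
  show "clinear (\<lambda>m. hact H D w (F m) h)"
    by (rule clinear_hact_fun[OF arr values_clinear[OF assms(1) cyclic_words_relabel[OF assms(2)]]])
qed

text \<open>The functional is moved inside both the coproduct sum and the diagonal action, so that
  the defining condition speaks of values on elementary tensors only.\<close>

lemma cochain_condition:
  assumes \<phi>: "\<phi> \<in> functionals (M_tensor_CN D n)" and w: "w \<in> cyclic_words D n"
  shows "\<phi> (tensor_lift (\<lambda>h\<^sub>1 h\<^sub>2. ract M m h\<^sub>1 \<otimes>\<^sub>C diag_act H D w (S h\<^sub>2)) (\<Delta> h))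
     = tsum (\<Delta> h) (\<lambda>h1 h2. hact H D w (\<lambda>u. \<phi> (ract M m h1 \<otimes>\<^sub>C word_pure u)) (S h2))"
proof -
  have lin: "linear_on (M_tensor_CN D n) \<phi>" using \<phi> by (simp add: functionals_def)
  note arr = cyclic_words_arrow[OF w]
  note [clin] = clinear_comp[OF clinear_hact[OF arr multilinear_on_word_pure]]
  have out: "x \<otimes>\<^sub>C hact H D w word_pure y = hact H D w (\<lambda>u. x \<otimes>\<^sub>C word_pure u) y" for x :: 'm and y
    using hact_linear_out[OF arr, of UNIV "\<lambda>t. x \<otimes>\<^sub>C t" word_pure y] clinear_tensor_pure(2)[OF clinear_ident, of x]
    by (simp add: clinear_iff_linear_on cvs.subspace_UNIV)
  have V: "\<phi> (hact H D w (\<lambda>u. x \<otimes>\<^sub>C word_pure u) y) = hact H D w (\<lambda>u. \<phi> (x \<otimes>\<^sub>C word_pure u)) y \<and>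
     hact H D w (\<lambda>u. x \<otimes>\<^sub>C word_pure u) y \<in> M_tensor_CN D n" for x :: 'm and y
    using cyclic_words_relabel[OF w]
    by (intro hact_linear_out[OF arr lin subspace_M_tensor_CN]) (auto intro: pure_in_M_tensor_CN)
  have "tensor_lift (\<lambda>h\<^sub>1 h\<^sub>2. ract M m h\<^sub>1 \<otimes>\<^sub>C diag_act H D w (S h\<^sub>2)) (\<Delta> h)
      = tsum (\<Delta> h) (\<lambda>h1 h2. ract M m h1 \<otimes>\<^sub>C hact H D w word_pure (S h2))"
    by (simp add: diag_act_eq_hact[OF arr]) (intro tensor_lift_eq_tsum clin)
  then show ?thesis
    using linear_on_tsum_out[OF lin subspace_M_tensor_CN, of "\<lambda>h1 h2. ract M m h1 \<otimes>\<^sub>C hact H D w word_pure (S h2)"] V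
    by (simp add: out)
qed

text \<open>Since the antipode is convolution inverse to the identity, the defining condition of a
  cochain says that \<open>\<phi>(mh \<otimes> x) = \<phi>(m \<otimes> hx)\<close>, which no longer involves the antipode.\<close>
lemma cochains_iff:
  "\<phi> \<in> cochains H M D n \<longleftrightarrow> \<phi> \<in> functionals (M_tensor_CN D n) \<and> invariant_values n (\<lambda>m w. \<phi> (m \<otimes>\<^sub>C word_pure w))"
proof (cases "\<phi> \<in> functionals (M_tensor_CN D n)")
  case True
  let ?F = "\<lambda>m w. \<phi> (m \<otimes>\<^sub>C word_pure w)"
  have F: "multilinear_values D n ?F" by (rule functional_multilinear[OF True subspace_Hom])
  have eq: "\<phi> \<in> cochains H M D n \<longleftrightarrow> (\<forall>m h. \<forall>w\<in>cyclic_words D n.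
      tsum (\<Delta> h) (\<lambda>h1 h2. hact H D w (?F (ract M m h1)) (S h2)) = \<epsilon> h * ?F m w)"
    using True by (simp add: cochains_def cochain_condition cong: tsum_cong)
  have "\<phi> \<in> cochains H M D n \<longleftrightarrow> invariant_values n ?F"
  proof
    assume inv: "invariant_values n ?F"
    show "\<phi> \<in> cochains H M D n"
      unfolding eq
    proof (intro allI ballI)
      fix m h w assume w: "w \<in> cyclic_words D n"
      note [clin] = clinear_values_hact[OF F w]
      have "hact H D w (?F (ract M m g)) z = hact H D w (?F m) (g * z)" for g z
        using hact_cong[OF cyclic_words_arrow[OF w], of "?F (ract M m g)" "\<lambda>u. hact H D u (?F m) g"]
          hact_mult[OF cyclic_words_arrow[OF w] values_multilinear_on[OF F w]] inv cyclic_words_relabel[OF w]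
        by (simp add: invariant_values_def)
      then have "tsum (\<Delta> h) (\<lambda>h1 h2. hact H D w (?F (ract M m h1)) (S h2)) = tsum (\<Delta> h) (\<lambda>h1 h2. hact H D w (?F m) (h1 * S h2))"
        by simp
      also have "\<dots> = \<epsilon> h *\<^sub>C hact H D w (?F m) 1"
        by (intro antipode_right clin)
      finally show "tsum (\<Delta> h) (\<lambda>h1 h2. hact H D w (?F (ract M m h1)) (S h2)) = \<epsilon> h * ?F m w"
        using hact_one[OF cyclic_words_arrow[OF w] values_multilinear_on[OF F w]]
        by (simp add: scaleC_complex_def)
    qed
  next
    assume "\<phi> \<in> cochains H M D n"
    then have c: "tsum (\<Delta> h) (\<lambda>h1 h2. hact H D w (?F (ract M m h1)) (S h2)) = \<epsilon> h *\<^sub>C ?F m w"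
      if "w \<in> cyclic_words D n" for m h w
      using eq that by (simp add: scaleC_complex_def)
    show "invariant_values n ?F"
      unfolding invariant_values_def
    proof (intro allI ballI)
      fix m h w assume w: "w \<in> cyclic_words D n"
      note arr = cyclic_words_arrow[OF w]
      note [clin] = clinear_comp[OF clinear_values_hact(1)[OF F w]] clinear_comp[OF clinear_values_hact(2)[OF F w]]
      \<comment> \<open>Letting \<open>g\<close> act on the word before the cochain condition is
        applied yields its version with \<open>S h2 * g\<close> as second component. The
        coassociativity step below produces this form.\<close>
      have c': "tsum (\<Delta> h) (\<lambda>h1 h2. hact H D w (?F (ract M m h1)) (S h2 * g)) = \<epsilon> h *\<^sub>C hact H D w (?F m) g" for g h
      proof -
        have "tsum (\<Delta> h) (\<lambda>h1 h2. hact H D w (?F (ract M m h1)) (S h2 * g))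
            = hact H D w (\<lambda>u. tsum (\<Delta> h) (\<lambda>h1 h2. hact H D u (?F (ract M m h1)) (S h2))) g"
          by (simp add: hact_mult[OF arr values_multilinear_on[OF F w]] hact_tsum)
        also have "\<dots> = hact H D w (\<lambda>u. \<epsilon> h *\<^sub>C ?F m u) g"
          by (intro hact_cong arr c cyclic_words_relabel[OF w])
        also have "\<dots> = \<epsilon> h *\<^sub>C hact H D w (?F m) g"
          using hact_linear_out[OF arr, of UNIV "\<lambda>z. \<epsilon> h *\<^sub>C z" "?F m" g]
          by (simp add: linear_on_def scaleC_add_right scaleC_scaleC mult.commute cvs.subspace_UNIV)
        finally show ?thesis .
      qed
      have "?F (ract M m h) w = hact H D w (?F (ract M m h)) 1"
        by (simp add: hact_one[OF arr values_multilinear_on[OF F w]])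
      also have "\<dots> = tsum (\<Delta> h) (\<lambda>a b. \<epsilon> b *\<^sub>C hact H D w (?F (ract M m a)) 1)"
        by (intro counit_right[symmetric] clin)
      also have "\<dots> = tsum (\<Delta> h) (\<lambda>a b. tsum (\<Delta> b) (\<lambda>b1 b2. hact H D w (?F (ract M m a)) (S b1 * b2)))"
        by (intro tsum_cong refl antipode_left[symmetric] clin)
      also have "\<dots> = tsum (\<Delta> h) (\<lambda>a b. tsum (\<Delta> a) (\<lambda>a1 a2. hact H D w (?F (ract M m a1)) (S a2 * b)))"
        by (rule coassoc[symmetric]) (intro clin)+
      also have "\<dots> = tsum (\<Delta> h) (\<lambda>a b. \<epsilon> a *\<^sub>C hact H D w (?F m) b)"
        by (simp add: c')
      also have "\<dots> = hact H D w (?F m) h"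
        by (intro counit_left clin)
      finally show "?F (ract M m h) w = hact H D w (?F m) h" .
    qed
  qed
  then show ?thesis using True by simp
qed (simp add: cochains_def)

lemma subspace_cochains: "cvs.subspace (cochains H M D n)"
proof -
  have "hact H D w (\<lambda>u. F u + G u) h = hact H D w F h + hact H D w G h" for F G :: "_ \<Rightarrow> complex" and w h
  proof (induction w arbitrary: F G h)
    case (Cons a w)
    then show ?case by (simp add: tsum_def sum_list_addf)
  qed (simp add: scaleC_add_right)
  moreover have "hact H D w (\<lambda>u. c *\<^sub>C F u) h = c *\<^sub>C hact H D w F h" for c and F :: "_ \<Rightarrow> complex" and w h
  proof (induction w arbitrary: F h)
    case (Cons a w)
    then show ?case by (simp add: tsum_def scaleC_sum_list)
  qed (simp add: scaleC_scaleC mult.commute)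
  moreover from this[of _ 0] have "hact H D w (\<lambda>u. 0) h = (0::complex)" for w h
    by (simp add: cvs.scale_zero_left)
  ultimately show ?thesis
    using subspace_functionals[of "M_tensor_CN D n"]
    by (intro cvs.subspaceI) (auto simp: cochains_iff invariant_values_def scaleC_fun_def
        cvs.subspace_0 cvs.subspace_add cvs.subspace_scale dest: cvs.subspace_scale)
qed

lemma cochain_functional: "\<phi> \<in> cochains H M D n \<Longrightarrow> \<phi> \<in> functionals (M_tensor_CN D n)"
  by (simp add: cochains_def)

lemma cochain_multilinear: "\<phi> \<in> cochains H M D n \<Longrightarrow> multilinear_values D n (\<lambda>m w. \<phi> (m \<otimes>\<^sub>C word_pure w))"
  by (intro functional_multilinear subspace_Hom) (simp_all add: cochain_functional)

lemma cochain_invariant: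
  "\<phi> \<in> cochains H M D n \<Longrightarrow> w \<in> cyclic_words D n \<Longrightarrow>
    \<phi> (ract M m h \<otimes>\<^sub>C word_pure w) = hact H D w (\<lambda>u. \<phi> (m \<otimes>\<^sub>C word_pure u)) h"
  by (simp add: cochains_iff invariant_values_def)

lemma functional_of_cochain:
  assumes "multilinear_values D n F" "invariant_values n F"
  shows "functional_of D n F \<in> cochains H M D n"
  unfolding cochains_iff
proof
  show "functional_of D n F \<in> functionals (M_tensor_CN D n)"
    by (rule functional_of_functional[OF subspace_Hom assms(1)])
  have pure: "functional_of D n F (m \<otimes>\<^sub>C word_pure w) = F m w" if "w \<in> cyclic_words D n" for m w
    by (rule functional_of_pure[OF subspace_Hom assms(1) that])
  show "invariant_values n (\<lambda>m w. functional_of D n F (m \<otimes>\<^sub>C word_pure w))"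
    unfolding invariant_values_def
  proof (intro allI ballI)
    fix m h w assume w: "w \<in> cyclic_words D n"
    have "hact H D w (\<lambda>u. functional_of D n F (m \<otimes>\<^sub>C word_pure u)) h = hact H D w (F m) h"
      by (intro hact_cong cyclic_words_arrow[OF w] pure cyclic_words_relabel[OF w])
    then show "functional_of D n F (ract M m h \<otimes>\<^sub>C word_pure w) =
        hact H D w (\<lambda>u. functional_of D n F (m \<otimes>\<^sub>C word_pure u)) h"
      using assms(2) w by (simp add: pure invariant_values_def)
  qed
qed

lemma cochain_eqI:
  assumes "\<phi> \<in> cochains H M D n" "\<psi> \<in> cochains H M D n"
    and "\<And>m w. w \<in> cyclic_words D n \<Longrightarrow> \<phi> (m \<otimes>\<^sub>C word_pure w) = \<psi> (m \<otimes>\<^sub>C word_pure w)"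
  shows "\<phi> = \<psi>"
  using assms by (intro functionals_eqI) (auto simp: cochain_functional)

end

section \<open>Cofaces that compose two neighbours\<close>

lemma linked_merge:
  assumes "linked (L1 @ i # j # L2)"
  shows "fst i = snd j" "linked (L1 @ (fst j, snd i) # L2)"
proof -
  show "fst i = snd j" using assms by (simp add: linked_def successively_append_iff)
  show "linked (L1 @ (fst j, snd i) # L2)"
    using assms by (cases L1 rule: rev_cases; cases L2)
      (auto simp: linked_def successively_append_iff successively_Cons hd_append)
qed

lemma linked_rotate: "linked (L @ [i]) \<Longrightarrow> linked (i # L)"
  by (cases L rule: rev_cases) (auto simp: linked_def successively_append_iff successively_Cons hd_append)

lemma split_at_pair:
  assumes "length w = Suc (Suc n)" "i \<le> n"
  obtains u b a v where "w = u @ b # a # v" "length u = i"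
proof -
  have "w = take i w @ w ! i # w ! Suc i # drop (Suc (Suc i)) w"
    using assms by (metis Cons_nth_drop_Suc Suc_le_lessD Suc_le_mono append_take_drop_id le_imp_less_Suc le_SucI)
  then show thesis using that[of "take i w"] assms by simp
qed

context hopf_cyclic
begin

lemma cyclic_merge:
  assumes "u @ b # a # v \<in> cyclic_words D (Suc n)"
  shows "arr_src b = arr_tgt a" "u @ arr_comp D b a # v \<in> cyclic_words D n"
proof -
  have l: "linked (map fst u @ fst b # fst a # map fst v)" using assms by (simp add: cyclic_words_iff)
  show s: "arr_src b = arr_tgt a" using linked_merge(1)[OF l] .
  show "u @ arr_comp D b a # v \<in> cyclic_words D n"
    using linked_merge(2)[OF l] assms is_arrow_comp[OF _ _ s] by (auto simp: cyclic_words_iff)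
qed

lemma cyclic_words_split:
  assumes "w \<in> cyclic_words D (Suc n)" "i \<le> n"
  obtains u b a v where "w = u @ b # a # v" "length u = i" "arr_src b = arr_tgt a" "u @ arr_comp D b a # v \<in> cyclic_words D n"
proof -
  have "length w = Suc (Suc n)" using assms(1) by (simp add: cyclic_words_iff)
  from split_at_pair[OF this assms(2)] obtain u b a v where "w = u @ b # a # v" "length u = i" .
  then show thesis using that cyclic_merge[of u b a v n] assms(1) by simp
qed

lemma merge_cyclic_words: "w \<in> cyclic_words D (Suc n) \<Longrightarrow> i \<le> n \<Longrightarrow> merge D i w \<in> cyclic_words D n"
  by (erule (1) cyclic_words_split) (auto simp: merge_append)

lemma rotate_cyclic_words: "u @ [c] \<in> cyclic_words D n \<Longrightarrow> arr_act D y c # u \<in> cyclic_words D n"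
  using linked_rotate[of "map fst u" "fst c"] by (auto simp: cyclic_words_iff)

text \<open>Bilinearity of composition lets the two merged letters vary separately; every other
  letter passes through unchanged. The induction on \<open>L1\<close> reduces the position of the
  merge to 0.\<close>

lemma multilinear_on_merge:
  assumes "multilinear_on D (L1 @ (p, r) # L2) F" "p \<in> Ob D" "q \<in> Ob D" "r \<in> Ob D"
  shows "multilinear_on D (L1 @ (q, r) # (p, q) # L2) (\<lambda>w. F (merge D (length L1) w))"
  using assms(1)
proof (induction L1 arbitrary: F)
  case Nil
  then have lin: "linear_on (Hom D p r) (\<lambda>f. F (((p, r), f) # w))" if "map fst w = L2" "\<forall>a\<in>set w. is_arrow D a" for w
    using that assms by (simp add: multilinear_on_Cons_iff)
  have ml: "multilinear_on D L2 (\<lambda>w. F (((p, r), f) # w))" if "f \<in> Hom D p r" for f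
    using Nil that assms by (simp add: multilinear_on_Cons_iff)
  have m: "merge D 0 (((q, r), g) # ((p, q), f) # w) = ((p, r), Comp D p q r g f) # w" for g f w
    by (simp add: merge_def arr_comp_def)
  have lin1: "linear_on (Hom D q r) (\<lambda>g. F (((p, r), Comp D p q r g f) # w))"
    if "map fst w = L2" "\<forall>a\<in>set w. is_arrow D a" "f \<in> Hom D p q" for w f
    using lin[OF that(1,2)] Comp_linear(2)[OF assms(2-4) that(3)] Comp_Hom[OF assms(2-4) that(3)]
    by (simp add: linear_on_def)
  have lin2: "linear_on (Hom D p q) (\<lambda>f. F (((p, r), Comp D p q r g f) # w))"
    if "map fst w = L2" "\<forall>a\<in>set w. is_arrow D a" "g \<in> Hom D q r" for w g
    using lin[OF that(1,2)] Comp_linear(1)[OF assms(2-4) that(3)] Comp_Hom[OF assms(2-4) _ that(3)]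
    by (simp add: linear_on_def)
  show ?case
    unfolding append_Nil list.size multilinear_on_Cons_iff
  proof (intro conjI impI allI ballI)
    fix w assume w: "map fst w = (p, q) # L2 \<and> (\<forall>a\<in>set w. is_arrow D a)"
    then obtain a v where "w = a # v" by (cases w) auto
    with w obtain f v where wv: "w = ((p, q), f) # v" "map fst v = L2" "\<forall>a\<in>set v. is_arrow D a" "f \<in> Hom D p q"
      by (cases a) (auto simp: is_arrow_def)
    then show "linear_on (Hom D (fst (q, r)) (snd (q, r))) (\<lambda>f. F (merge D 0 (((q, r), f) # w)))"
      using lin1 by (simp add: m)
  qed (use lin2 ml Comp_Hom[OF assms(2-4)] in \<open>simp_all add: m\<close>)
next
  case (Cons i L1)
  have mono: "merge D (length L1) w \<in> {v. map fst v = L1 @ (p, r) # L2 \<and> (\<forall>a\<in>set v. is_arrow D a)}"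
    if "map fst w = L1 @ (q, r) # (p, q) # L2" "\<forall>a\<in>set w. is_arrow D a" for w
  proof -
    from that(1) obtain u b a v where w: "w = u @ b # a # v" "map fst u = L1" "fst b = (q, r)" "fst a = (p, q)" "map fst v = L2"
      by (auto simp: map_eq_append_conv map_eq_Cons_conv)
    then show ?thesis
      using that(2) is_arrow_comp[of a b] by (auto simp: merge_append[of D u b a v] simp flip: w(2))
  qed
  show ?case
    unfolding append_Cons multilinear_on_Cons_iff
  proof (intro conjI impI allI ballI)
    assume i: "fst i \<in> Ob D \<and> snd i \<in> Ob D"
    have *: "(\<forall>w. map fst w = L1 @ (p, r) # L2 \<and> (\<forall>a\<in>set w. is_arrow D a) \<longrightarrow>
        linear_on (Hom D (fst i) (snd i)) (\<lambda>f. F ((i, f) # w))) \<and>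
       (\<forall>f\<in>Hom D (fst i) (snd i). multilinear_on D (L1 @ (p, r) # L2) (\<lambda>w. F ((i, f) # w)))"
      using Cons.prems i unfolding append_Cons multilinear_on_Cons_iff by blast
    show "linear_on (Hom D (fst i) (snd i)) (\<lambda>f. F (merge D (length (i # L1)) ((i, f) # w)))"
      if "map fst w = L1 @ (q, r) # (p, q) # L2 \<and> (\<forall>a\<in>set w. is_arrow D a)" for w
      using mono[of w] that * by simp
    show "multilinear_on D (L1 @ (q, r) # (p, q) # L2) (\<lambda>w. F (merge D (length (i # L1)) ((i, f) # w)))"
      if "f \<in> Hom D (fst i) (snd i)" for f
      using Cons.IH[of "\<lambda>w. F ((i, f) # w)"] * that by simp
  qed
qed

lemma multilinear_values_merge:
  assumes "multilinear_values D n F" "i \<le> n"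
  shows "multilinear_values D (Suc n) (\<lambda>m w. F m (merge D i w))"
  unfolding multilinear_values_def
proof (intro conjI allI ballI)
  fix m w assume w: "w \<in> cyclic_words D (Suc n)"
  show "clinear (\<lambda>m. F m (merge D i w))"
    using assms merge_cyclic_words[OF w] by (intro values_clinear) auto
  from cyclic_words_split[OF w \<open>i \<le> n\<close>] obtain u b a v where wu: "w = u @ b # a # v" "length u = i"
    and cyc: "arr_src b = arr_tgt a" "u @ arr_comp D b a # v \<in> cyclic_words D n" .
  have ob: "arr_src a \<in> Ob D" "arr_tgt a \<in> Ob D" "arr_tgt b \<in> Ob D"
    using w wu by (auto simp: cyclic_words_iff is_arrow_def)
  have "fst b = (arr_tgt a, arr_tgt b)" "fst a = (arr_src a, arr_tgt a)" using cyc(1) by (auto simp: prod_eq_iff)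
  then show "multilinear_on D (map fst w) (\<lambda>w. F m (merge D i w))"
    using multilinear_on_merge[of "map fst u" "arr_src a" "arr_tgt b" "map fst v" "F m" "arr_tgt a"]
      values_multilinear_on[OF assms(1) cyc(2)] ob wu by simp
qed

lemma invariant_values_merge:
  assumes "multilinear_values D n F" "invariant_values n F" "i \<le> n"
  shows "invariant_values (Suc n) (\<lambda>m w. F m (merge D i w))"
  unfolding invariant_values_def
proof (intro allI ballI)
  fix m h w assume w: "w \<in> cyclic_words D (Suc n)"
  from cyclic_words_split[OF w \<open>i \<le> n\<close>] obtain u b a v where wu: "w = u @ b # a # v" "length u = i"
    and cyc: "arr_src b = arr_tgt a" "u @ arr_comp D b a # v \<in> cyclic_words D n" .
  have "F (ract M m h) (merge D i w) = hact H D (u @ arr_comp D b a # v) (F m) h"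
    using assms(2) cyc(2) wu by (auto simp: invariant_values_def merge_append)
  also have "\<dots> = hact H D w (\<lambda>w. F m (merge D i w)) h"
    using hact_merge[OF _ cyc(1), of u v "F m" h] cyclic_words_arrow[OF w]
      values_multilinear_on[OF assms(1) cyc(2)] wu by simp
  finally show "F (ract M m h) (merge D i w) = hact H D w (\<lambda>w. F m (merge D i w)) h" .
qed

lemma
  assumes \<phi>: "\<phi> \<in> cochains H M D n" and i: "i \<le> n"
  shows delta_cochain_less_last: "delta H M D n i \<phi> \<in> cochains H M D (Suc n)"
    and delta_pure: "w \<in> cyclic_words D (Suc n) \<Longrightarrow> delta H M D n i \<phi> (m \<otimes>\<^sub>C word_pure w) = \<phi> (m \<otimes>\<^sub>C word_pure (merge D i w))"
proof -
  have ml: "multilinear_values D (Suc n) (\<lambda>m w. \<phi> (m \<otimes>\<^sub>C word_pure (merge D i w)))"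
    using multilinear_values_merge[OF cochain_multilinear[OF \<phi>] i] .
  have eq: "delta H M D n i \<phi> = functional_of D (Suc n) (\<lambda>m w. \<phi> (m \<otimes>\<^sub>C word_pure (merge D i w)))"
    using i by (simp add: delta_def)
  show "delta H M D n i \<phi> \<in> cochains H M D (Suc n)"
    unfolding eq using \<phi>
    by (intro functional_of_cochain ml invariant_values_merge[OF cochain_multilinear[OF \<phi>] _ i]) (simp add: cochains_iff)
  show "w \<in> cyclic_words D (Suc n) \<Longrightarrow> delta H M D n i \<phi> (m \<otimes>\<^sub>C word_pure w) = \<phi> (m \<otimes>\<^sub>C word_pure (merge D i w))"
    unfolding eq by (rule functional_of_pure[OF subspace_Hom ml])
qed

text \<open>\<open>twist\<close> is \<open>\<tau>\<close> on multilinear families.\<close>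

definition twist :: "('m \<Rightarrow> ('o, 'f) arrow list \<Rightarrow> complex) \<Rightarrow> 'm \<Rightarrow> ('o, 'f) arrow list \<Rightarrow> complex" where
  "twist F m w = tsum (coact M m) (\<lambda>a x. F x (arr_act D (S' a) (last w) # butlast w))"

section \<open>The cyclic operator and the anti-Yetter-Drinfeld condition\<close>

lemma cbilinear_twist:
  assumes "multilinear_values D n F" "u @ [c] \<in> cyclic_words D n"
  shows "cbilinear (\<lambda>a x. F x (arr_act D (S' a) c # u))"
proof -
  have r: "arr_act D y c # u \<in> cyclic_words D n" for y by (rule rotate_cyclic_words[OF assms(2)])
  have c: "is_arrow D c" "\<forall>a\<in>set u. is_arrow D a" using assms(2) by (auto simp: cyclic_words_iff)
  have "clinear (\<lambda>y. F x (arr_act D y c # u))" for x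
    using clinear_act_entry[of "[]" c u "F x"] values_multilinear_on[OF assms(1) r, where m = x] c by simp
  from clinear_comp[OF this clinear_antipode_inv] values_clinear[OF assms(1) r]
  show ?thesis by (intro cbilinearI)
qed

lemma twist_snoc: "twist F m (u @ [c]) = tsum (coact M m) (\<lambda>a x. F x (arr_act D (S' a) c # u))"
  by (simp add: twist_def)

lemma multilinear_values_twist:
  assumes "multilinear_values D n F"
  shows "multilinear_values D n (twist F)"
  unfolding multilinear_values_def
proof (intro conjI allI ballI)
  fix m w assume w: "w \<in> cyclic_words D n"
  then obtain u c where uc: "w = u @ [c]" by (cases w rule: rev_cases) (auto simp: cyclic_words_iff)
  note uc_cyc = w[unfolded uc]
  show "clinear (\<lambda>m. twist F m w)"
    unfolding uc twist_snoc by (intro clin cbilinear_twist[OF assms uc_cyc])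
  have c: "is_arrow D c" "\<forall>a\<in>set u. is_arrow D a" using uc_cyc by (auto simp: cyclic_words_iff)
  \<comment> \<open>Acting by 1 is an arbitrary choice: only the labels of the rotated word matter
    here.\<close>
  have ml: "multilinear_on D (fst c # map fst u) (F x)" for x
    using values_multilinear_on[OF assms rotate_cyclic_words[OF uc_cyc, of 1]] by simp
  show "multilinear_on D (map fst w) (twist F m)"
    unfolding multilinear_on_def twist_def
  proof (intro allI impI linear_on_tsum_fun)
    fix us i vs a x
    assume *: "map fst us @ i # map fst vs = map fst w \<and> fst i \<in> Ob D \<and> snd i \<in> Ob D \<and> (\<forall>a\<in>set us \<union> set vs. is_arrow D a)"
    show "linear_on (Hom D (fst i) (snd i)) (\<lambda>f. F x (arr_act D (S' a) (last (us @ (i, f) # vs)) # butlast (us @ (i, f) # vs)))"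
    \<comment> \<open>The varying letter is either the last one, which is acted on and moved to the
      front, or one that merely shifts.\<close>
    proof (cases vs rule: rev_cases)
      case Nil
      then have i: "i = fst c" "map fst us = map fst u" using * uc by auto
      have "linear_on (Hom D (fst i) (snd i)) (\<lambda>f. F x ((i, f) # us))"
        using multilinear_onD[of D "[]" i us "F x"] ml[of x] * i by simp
      then show ?thesis
        using * linear_on_Act[of "fst i" "snd i" "S' a"] Act_Hom[of "fst i" "snd i"] Nil
        by (simp add: arr_act_def linear_on_def butlast_append)
    next
      case (snoc vs' d)
      then have d: "fst d = fst c" "map fst us @ i # map fst vs' = map fst u" "is_arrow D d" using * uc by auto
      then show ?thesis
        using multilinear_onD[of D "arr_act D (S' a) d # us" i vs' "F x"] ml[of x] * snoc
        by (simp add: butlast_append)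
    qed
  qed
qed

text \<open>The coaction of mh has the legs S(h_3) m_(-1) h_1 and m_(0) h_2. Under \<open>S'\<close>
  the first becomes S'(h_1) S'(m_(-1)) h_3, and invariance of \<open>F\<close> transfers h_2 to the
  rotated word. There its first component cancels S'(h_1). What remains of h acts on
  \<open>u\<close> and then on \<open>c\<close>, in the order of the original word.\<close>

lemma invariant_values_twist:
  assumes F: "multilinear_values D n F" and inv: "invariant_values n F"
  shows "invariant_values n (twist F)"
  unfolding invariant_values_def
proof (intro allI ballI)
  fix m h w assume w: "w \<in> cyclic_words D n"
  then obtain u c where uc: "w = u @ [c]" by (cases w rule: rev_cases) (auto simp: cyclic_words_iff)
  note cyc = w[unfolded uc]
  have c: "is_arrow D c" and u: "\<forall>a\<in>set u. is_arrow D a" using cyc by (auto simp: cyclic_words_iff)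
  have rot: "arr_act D y c # u \<in> cyclic_words D n" for y by (rule rotate_cyclic_words[OF cyc])
  have rot': "arr_act D y c # u' \<in> cyclic_words D n" if "map fst u' = map fst u" "\<forall>a\<in>set u'. is_arrow D a" for y u'
    using cyclic_words_relabel[OF rot[of y], of "arr_act D y c # u'"] that c by simp
  have ml: "multilinear_on D (fst c # map fst u) (F x)" for x
    using values_multilinear_on[OF F rot[of 1]] by simp
  have mlu: "multilinear_on D (map fst u) (\<lambda>u'. F x (arr_act D y c # u'))" for x y
    using ml c by (intro multilinear_on_Cons) auto
  \<comment> \<open>The value at \<open>x\<close> and the rotated word, with \<open>y\<close> acting
    on the front letter and \<open>z\<close> on the rest. Keeping three independent linear arguments
    makes the Sweedler identities applicable.\<close>
  define K where "K x y z = hact H D u (\<lambda>u'. F x (arr_act D y c # u')) z" for x y z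
  have K1: "clinear (\<lambda>x. K x y z)" for y z
    unfolding K_def by (intro clinear_hact_fun u values_clinear[OF F] rot')
  have K2: "clinear (\<lambda>y. K x y z)" for x z
    unfolding K_def by (intro clinear_hact_entry c u ml)
  have K3: "clinear (\<lambda>z. K x y z)" for x y
    unfolding K_def by (intro clinear_hact u mlu)
  note [clin] = clinear_comp[OF K1] clinear_comp[OF K2] clinear_comp[OF K3]
  have Kone: "K x y 1 = F x (arr_act D y c # u)" for x y
    unfolding K_def by (intro hact_one u mlu)
  have Kinv: "K (ract M x g) y z = tsum (\<Delta> g) (\<lambda>p q. K x (p * y) (q * z))" for x g y z
  proof -
    have "K (ract M x g) y z = hact H D u (\<lambda>u'. hact H D (arr_act D y c # u') (F x) g) z"
      unfolding K_def using inv rot' by (intro hact_cong u) (simp add: invariant_values_def)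
    also have "\<dots> = tsum (\<Delta> g) (\<lambda>p q. hact H D u (\<lambda>u'. hact H D u' (\<lambda>v. F x (arr_act D (p * y) c # v)) q) z)"
      by (simp add: hact_tsum arr_act_mult c)
    also have "\<dots> = tsum (\<Delta> g) (\<lambda>p q. K x (p * y) (q * z))"
      by (simp add: hact_mult[OF u mlu] K_def)
    finally show ?thesis .
  qed
  have "twist F (ract M m h) w = tsum (coact M (ract M m h)) (\<lambda>a x. K x (S' a) 1)"
    by (simp add: uc twist_snoc Kone)
  also have "\<dots> = tsum (\<Delta> h) (\<lambda>h1 h'. tsum (\<Delta> h') (\<lambda>h2 h3. tsum (coact M m) (\<lambda>a n. K (ract M n h2) (S' (S h3 * a * h1)) 1)))"
    by (intro coact_ract clin)
  also have "\<dots> = tsum (\<Delta> h) (\<lambda>h1 h'. tsum (\<Delta> h') (\<lambda>h2 h3. tsum (coact M m) (\<lambda>a n.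
      tsum (\<Delta> h2) (\<lambda>p q. K n (p * S' h1 * (S' a * h3)) q))))"
    by (simp add: Kinv antipode_inv_mult mult.assoc)
  also have "\<dots> = tsum (coact M m) (\<lambda>a n. tsum (\<Delta> h) (\<lambda>h1 h'. tsum (\<Delta> h') (\<lambda>h2 h3.
      tsum (\<Delta> h2) (\<lambda>p q. K n (p * S' h1 * (S' a * h3)) q))))"
    by (simp add: tsum_swap[of _ "coact M m"])
  also have "\<dots> = tsum (coact M m) (\<lambda>a n. tsum (\<Delta> h) (\<lambda>h1 h'. tsum (\<Delta> h') (\<lambda>p h''.
      tsum (\<Delta> h'') (\<lambda>q h3. K n (p * S' h1 * (S' a * h3)) q))))"
    by (intro tsum_cong refl coassoc clin)
  also have "\<dots> = tsum (coact M m) (\<lambda>a n. tsum (\<Delta> h) (\<lambda>z h''. tsum (\<Delta> z) (\<lambda>h1 p.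
      tsum (\<Delta> h'') (\<lambda>q h3. K n (p * S' h1 * (S' a * h3)) q))))"
    by (intro tsum_cong refl coassoc[symmetric] clin)
  \<comment> \<open>Now \<open>h1\<close> and \<open>p\<close> are the two components of
    \<open>z\<close>, so \<open>p * S' h1\<close> reduces to the counit.\<close>
  also have "\<dots> = tsum (coact M m) (\<lambda>a n. tsum (\<Delta> h) (\<lambda>z h''. \<epsilon> z *\<^sub>C
      tsum (\<Delta> h'') (\<lambda>q h3. K n (1 * (S' a * h3)) q)))"
    by (intro tsum_cong refl antipode_inv_right clin)
  also have "\<dots> = tsum (coact M m) (\<lambda>a n. tsum (\<Delta> h) (\<lambda>q h3. K n (1 * (S' a * h3)) q))"
    by (intro tsum_cong refl counit_left clin)
  also have "\<dots> = tsum (\<Delta> h) (\<lambda>q h3. tsum (coact M m) (\<lambda>a n. K n (S' a * h3) q))"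
    by (simp add: tsum_swap[of "coact M m"])
  also have "\<dots> = tsum (\<Delta> h) (\<lambda>x y. hact H D u (\<lambda>u'. twist F m (u' @ [arr_act D y c])) x)"
    by (simp add: twist_snoc hact_tsum K_def arr_act_mult c)
  also have "\<dots> = hact H D w (twist F m) h"
  proof -
    have mlt: "multilinear_on D (map fst (u @ [c])) (twist F m)"
      using values_multilinear_on[OF multilinear_values_twist[OF F] cyc] .
    have "hact H D [c] (\<lambda>v'. twist F m (u' @ v')) y = twist F m (u' @ [arr_act D y c])"
      if "map fst u' = map fst u" "\<forall>a\<in>set u'. is_arrow D a" for u' y
      using hact_single[OF c, of "\<lambda>v'. twist F m (u' @ v')" y] multilinear_on_append[of D u' "[fst c]" "twist F m"] mlt that
      by simp
    then have "hact H D u (\<lambda>u'. hact H D [c] (\<lambda>v'. twist F m (u' @ v')) y) x = hact H D u (\<lambda>u'. twist F m (u' @ [arr_act D y c])) x" for x y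
      by (intro hact_cong u)
    then show ?thesis
      using hact_append[OF _ mlt] u c by (simp add: uc)
  qed
  finally show "twist F (ract M m h) w = hact H D w (twist F m) h" .
qed

lemma
  assumes \<phi>: "\<phi> \<in> cochains H M D n"
  shows tau_cochain: "tau H M D n \<phi> \<in> cochains H M D n"
    and tau_pure: "w \<in> cyclic_words D n \<Longrightarrow> tau H M D n \<phi> (m \<otimes>\<^sub>C word_pure w) = twist (\<lambda>m w. \<phi> (m \<otimes>\<^sub>C word_pure w)) m w"
proof -
  let ?F = "\<lambda>m w. \<phi> (m \<otimes>\<^sub>C word_pure w)"
  note F = cochain_multilinear[OF \<phi>]
  have eq: "tau H M D n \<phi> = functional_of D n (twist ?F)"
    unfolding tau_def
  proof (rule functional_of_cong)
    fix m w assume w: "w \<in> cyclic_words D n"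
    then obtain u c where uc: "w = u @ [c]" by (cases w rule: rev_cases) (auto simp: cyclic_words_iff)
    note cyc = w[unfolded uc]
    have c: "is_arrow D c" using cyc by (auto simp: cyclic_words_iff)
    have "clinear (\<lambda>y. word_pure (arr_act D y c # u))"
      using clinear_act_entry[of "[]" c u word_pure] c cyc
      by (auto simp: multilinear_on_word_pure cyclic_words_iff)
    note [clin] = clinear_comp[OF this]
    have "\<phi> (tensor_lift (\<lambda>a m\<^sub>0. m\<^sub>0 \<otimes>\<^sub>C word_pure (arr_act D (S' a) c # u)) (coact M m))
        = \<phi> (tsum (coact M m) (\<lambda>a m\<^sub>0. m\<^sub>0 \<otimes>\<^sub>C word_pure (arr_act D (S' a) c # u)))"
      by (intro arg_cong[where f = \<phi>] tensor_lift_eq_tsum clin)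
    also have "\<dots> = tsum (coact M m) (\<lambda>a m\<^sub>0. \<phi> (m\<^sub>0 \<otimes>\<^sub>C word_pure (arr_act D (S' a) c # u)))"
      by (intro functional_tsum_out[OF cochain_functional[OF \<phi>]] rotate_cyclic_words[OF cyc])
    finally show "\<phi> (tensor_lift (\<lambda>a m\<^sub>0. m\<^sub>0 \<otimes>\<^sub>C word_pure (arr_act D (S' a) (last w) # butlast w)) (coact M m))
       = twist ?F m w"
      by (simp add: uc twist_snoc)
  qed
  show "tau H M D n \<phi> \<in> cochains H M D n"
    unfolding eq using \<phi>
    by (intro functional_of_cochain multilinear_values_twist invariant_values_twist F) (simp add: cochains_iff)
  show "w \<in> cyclic_words D n \<Longrightarrow> tau H M D n \<phi> (m \<otimes>\<^sub>C word_pure w) = twist ?F m w"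
    unfolding eq by (rule functional_of_pure[OF subspace_Hom multilinear_values_twist[OF F]])
qed

end

section \<open>Powers of the cyclic operator and the cocyclic identities\<close>

lemma linked_swap: "linked (L1 @ L2) \<Longrightarrow> linked (L2 @ L1)"
proof (induction L2 arbitrary: L1 rule: rev_induct)
  case (snoc i L2)
  then show ?case using linked_rotate[of "L1 @ L2" i] snoc.IH[of "i # L1"] by simp
qed simp

lemma cyclic_words_swap: "u @ v \<in> cyclic_words D n \<Longrightarrow> v @ u \<in> cyclic_words D n"
  using linked_swap[of "map fst u" "map fst v"] by (auto simp: cyclic_words_iff)

lemma multilinear_on_append_right:
  assumes "multilinear_on D (L @ map fst u) F" "\<forall>a\<in>set u. is_arrow D a"
  shows "multilinear_on D L (\<lambda>w. F (w @ u))"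
  unfolding multilinear_on_def
proof (intro allI impI)
  fix us i vs
  assume *: "map fst us @ i # map fst vs = L \<and> fst i \<in> Ob D \<and> snd i \<in> Ob D \<and> (\<forall>a\<in>set us \<union> set vs. is_arrow D a)"
  then have "multilinear_on D (map fst us @ i # map fst (vs @ u)) F" using assms(1) by auto
  from multilinear_onD[OF this] show "linear_on (Hom D (fst i) (snd i)) (\<lambda>f. F ((us @ (i, f) # vs) @ u))"
    using * assms(2) by auto
qed

text \<open>For \<open>j = i + 1\<close> the two merges share a letter and this is associativity.
  Otherwise they take place at disjoint positions and only the index shifts.\<close>

lemma (in hcategory) merge_merge:
  assumes "\<forall>a\<in>set w. is_arrow D a" "linked (map fst w)" "i < j" "Suc j < length w"
  shows "merge D i (merge D j w) = merge D (j - 1) (merge D i w)"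
proof -
  have "merge D i (merge D j w) = merge D (j - 1) (merge D i w)"
    if "successively (\<lambda>a b. arr_src a = arr_tgt b) w" using that assms(1,3,4)
  proof (induction i arbitrary: j w)
    case 0
    then obtain a b v where w: "w = a # b # v" by (cases w; cases "tl w") auto
    show ?case
    proof (cases "j = 1")
      case True
      then obtain c v' where v: "v = c # v'" using 0 w by (cases v) auto
      have s: "arr_src a = arr_tgt b" "arr_src b = arr_tgt c" using 0 w v by auto
      have "\<forall>f\<in>Hom D (arr_src c) (arr_tgt c). \<forall>g\<in>Hom D (arr_tgt c) (arr_tgt b). \<forall>h\<in>Hom D (arr_tgt b) (arr_tgt a).
        Comp D (arr_src c) (arr_tgt b) (arr_tgt a) h (Comp D (arr_src c) (arr_tgt c) (arr_tgt b) g f)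
         = Comp D (arr_src c) (arr_tgt c) (arr_tgt a) (Comp D (arr_tgt c) (arr_tgt b) (arr_tgt a) h g) f"
        using klin 0 w v unfolding k_linear_category_def by (simp add: is_arrow_def)
      then have "arr_comp D a (arr_comp D b c) = arr_comp D (arr_comp D a b) c"
        using 0 w v s by (simp add: arr_comp_def is_arrow_def)
      then show ?thesis using True w v by (simp add: merge_def)
    next
      case False
      then obtain j' where j: "j = Suc (Suc j')" using 0 by (cases j; cases "j - 1") auto
      then show ?thesis using w by (simp add: merge_def)
    qed
  next
    case (Suc i)
    then obtain a v j' where w: "w = a # v" "j = Suc j'" by (cases w; cases j) auto
    then have "merge D i (merge D j' v) = merge D (j' - 1) (merge D i v)"
      using Suc by (intro Suc.IH) (auto simp: successively_Cons)
    moreover obtain j'' where "j' = Suc j''" using Suc.prems w by (cases j') auto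
    ultimately show ?case using w by simp
  qed
  then show ?thesis using assms(2) by (simp add: linked_def successively_map)
qed

lemma merge_snoc: "Suc i < length w \<Longrightarrow> merge D i (w @ [c]) = merge D i w @ [c]"
  by (simp add: merge_def nth_append)

context hopf_cyclic
begin

lemma cyclic_words_snoc:
  assumes "w \<in> cyclic_words D n" obtains u c where "w = u @ [c]" "length u = n"
  using assms by (cases w rule: rev_cases) (auto simp: cyclic_words_iff)

lemma twist_cong:
  assumes "w \<in> cyclic_words D n" "\<And>m u. u \<in> cyclic_words D n \<Longrightarrow> F m u = G m u"
  shows "twist F m w = twist G m w"
proof -
  obtain u c where "w = u @ [c]" "length u = n" using cyclic_words_snoc[OF assms(1)] .
  then show ?thesis using rotate_cyclic_words[of u c n] assms by (simp add: twist_snoc)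
qed

text \<open>Composing the acted-on last letter with the first one is a rotation followed by the
  merge at 0. Everything about the last coface is deduced from \<open>tau\<close> and the zeroth
  coface by this identity.\<close>

lemma delta_last:
  assumes \<phi>: "\<phi> \<in> cochains H M D n"
  shows "delta H M D n (Suc n) \<phi> = tau H M D (Suc n) (delta H M D n 0 \<phi>)"
proof -
  let ?G = "\<lambda>m w. \<phi> (m \<otimes>\<^sub>C word_pure (merge D 0 w))"
  have G: "multilinear_values D (Suc n) ?G"
    by (rule multilinear_values_merge[OF cochain_multilinear[OF \<phi>]]) simp
  have eq: "delta H M D n (Suc n) \<phi> = functional_of D (Suc n) (twist ?G)"
    unfolding delta_def
  proof (rule functional_of_cong)
    fix m w assume w: "w \<in> cyclic_words D (Suc n)"
    then obtain u c where u: "w = u @ [c]" "length u = Suc n" using cyclic_words_snoc by blast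
    then obtain b v where uc: "w = b # v @ [c]" by (cases u) auto
    have cyc: "(b # v) @ [c] \<in> cyclic_words D (Suc n)" using w uc by simp
    have arr: "is_arrow D c" "is_arrow D b" "\<forall>a\<in>set v. is_arrow D a" using w uc by (auto simp: cyclic_words_iff)
    note rot = rotate_cyclic_words[OF cyc]
    have src: "arr_src c = arr_tgt b" using cyclic_merge(1)[of "[]" "arr_act D 1 c" b v n] rot[of 1] by simp
    have m0: "merge D 0 (x # b # v) = arr_comp D x b # v" for x by (simp add: merge_def)
    have "multilinear_on D ([] @ (arr_tgt b, arr_tgt c) # (arr_src b, arr_tgt b) # map fst v) (\<lambda>w. word_pure (merge D (length ([]::('o \<times> 'o) list)) w))"
      using arr by (intro multilinear_on_merge multilinear_on_word_pure) (auto simp: is_arrow_def)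
    moreover have "fst c = (arr_tgt b, arr_tgt c)" using src by (simp add: prod_eq_iff)
    ultimately have "clinear (\<lambda>y. word_pure (arr_comp D (arr_act D y c) b # v))"
      using clinear_act_entry[of "[]" c "b # v" "\<lambda>w. word_pure (merge D 0 w)"] arr by (simp add: m0)
    note [clin] = clinear_comp[OF this]
    have "\<phi> (tensor_lift (\<lambda>a m\<^sub>0. m\<^sub>0 \<otimes>\<^sub>C word_pure (arr_comp D (arr_act D (S' a) c) b # v)) (coact M m))
        = \<phi> (tsum (coact M m) (\<lambda>a m\<^sub>0. m\<^sub>0 \<otimes>\<^sub>C word_pure (arr_comp D (arr_act D (S' a) c) b # v)))"
      by (intro arg_cong[where f = \<phi>] tensor_lift_eq_tsum clin)
    also have "\<dots> = tsum (coact M m) (\<lambda>a m\<^sub>0. \<phi> (m\<^sub>0 \<otimes>\<^sub>C word_pure (arr_comp D (arr_act D (S' a) c) b # v)))"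
      using merge_cyclic_words[OF rot, of 0] by (intro functional_tsum_out[OF cochain_functional[OF \<phi>]]) (simp add: m0)
    also have "\<dots> = twist ?G m w"
      using twist_snoc[of ?G m "b # v" c] by (simp add: uc m0)
    finally show "(if Suc n \<le> n then \<phi> (m \<otimes>\<^sub>C word_pure (merge D (Suc n) w))
           else \<phi> (tensor_lift (\<lambda>a m\<^sub>0. m\<^sub>0 \<otimes>\<^sub>C word_pure (arr_comp D (arr_act D (S' a) (last w)) (hd w) # butlast (tl w)))
                  (coact M m))) = twist ?G m w"
      by (simp add: uc butlast_append)
  qed
  show ?thesis
  proof (rule functionals_eqI)
    have \<delta>: "delta H M D n 0 \<phi> \<in> cochains H M D (Suc n)" by (rule delta_cochain_less_last[OF \<phi>]) simp
    show "tau H M D (Suc n) (delta H M D n 0 \<phi>) \<in> functionals (M_tensor_CN D (Suc n))"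
      by (rule cochain_functional[OF tau_cochain[OF \<delta>]])
    show "delta H M D n (Suc n) \<phi> \<in> functionals (M_tensor_CN D (Suc n))"
      unfolding eq by (rule functional_of_functional[OF subspace_Hom multilinear_values_twist[OF G]])
    fix m w assume w: "w \<in> cyclic_words D (Suc n)"
    show "delta H M D n (Suc n) \<phi> (m \<otimes>\<^sub>C word_pure w) = tau H M D (Suc n) (delta H M D n 0 \<phi>) (m \<otimes>\<^sub>C word_pure w)"
    proof -
      have "delta H M D n (Suc n) \<phi> (m \<otimes>\<^sub>C word_pure w) = twist ?G m w"
        unfolding eq by (rule functional_of_pure[OF subspace_Hom multilinear_values_twist[OF G] w])
      also have "\<dots> = twist (\<lambda>m w. delta H M D n 0 \<phi> (m \<otimes>\<^sub>C word_pure w)) m w"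
        by (rule twist_cong[OF w]) (simp add: delta_pure[OF \<phi>])
      also have "\<dots> = tau H M D (Suc n) (delta H M D n 0 \<phi>) (m \<otimes>\<^sub>C word_pure w)"
        by (rule tau_pure[OF \<delta> w, symmetric])
      finally show ?thesis .
    qed
  qed
qed

lemma delta_cochain: "\<phi> \<in> cochains H M D n \<Longrightarrow> i \<le> Suc n \<Longrightarrow> delta H M D n i \<phi> \<in> cochains H M D (Suc n)"
  by (cases "i = Suc n") (auto simp: delta_last intro: delta_cochain_less_last tau_cochain)

lemma tau_funpow_cochain: "\<phi> \<in> cochains H M D n \<Longrightarrow> (tau H M D n ^^ k) \<phi> \<in> cochains H M D n"
  by (induction k) (auto intro: tau_cochain)

text \<open>Successive rotations take one leg of the iterated coaction each, and coassociativity
  makes these the coproduct components of a single leg. The letters leave from right to left; this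
  reversal is undone by \<open>S'\<close>, which also reverses the coproduct, so the block as a
  whole carries the diagonal action of \<open>S'\<close> of that leg.\<close>

lemma tau_funpow_pure:
  assumes "\<phi> \<in> cochains H M D n" "u @ v \<in> cyclic_words D n"
  shows "(tau H M D n ^^ length v) \<phi> (m \<otimes>\<^sub>C word_pure (u @ v))
    = tsum (coact M m) (\<lambda>a x. hact H D v (\<lambda>v'. \<phi> (x \<otimes>\<^sub>C word_pure (v' @ u))) (S' a))"
  using assms
proof (induction v arbitrary: u \<phi>)
  case Nil
  have "clinear (\<lambda>m. \<phi> (m \<otimes>\<^sub>C word_pure u))"
    using values_clinear[OF cochain_multilinear] Nil by simp
  then show ?case by (simp add: counit_antipode_inv coact_counit)
next
  case (Cons c v)
  let ?F = "\<lambda>m w. \<phi> (m \<otimes>\<^sub>C word_pure w)"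
  note F = cochain_multilinear[OF Cons.prems(1)]
  have cyc: "(u @ [c]) @ v \<in> cyclic_words D n" using Cons.prems(2) by simp
  have c: "is_arrow D c" and u: "\<forall>a\<in>set u. is_arrow D a" and v: "\<forall>a\<in>set v. is_arrow D a"
    using Cons.prems(2) by (auto simp: cyclic_words_iff)
  have cyc': "(v' @ u) @ [c] \<in> cyclic_words D n" if "map fst v' = map fst v" "\<forall>a\<in>set v'. is_arrow D a" for v'
    using cyclic_words_relabel[OF cyclic_words_swap[OF cyc], of "(v' @ u) @ [c]"] that u c by auto
  have ml: "multilinear_on D (fst c # map fst v @ map fst u) (?F y)" for y
    using values_multilinear_on[OF F rotate_cyclic_words[OF cyc'[OF refl v], of 1], of y] by simp
  define T where "T y q p = hact H D v (\<lambda>v'. ?F y (arr_act D q c # v' @ u)) p" for y q p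
  have T1: "clinear (\<lambda>y. T y q p)" for q p
    unfolding T_def by (intro clinear_hact_fun v values_clinear[OF F] rotate_cyclic_words cyc')
  have T2: "clinear (\<lambda>q. T y q p)" for y p
    unfolding T_def
  proof (rule clinear_hact_fun[OF v])
    fix v' assume v': "map fst v' = map fst v" "\<forall>a\<in>set v'. is_arrow D a"
    show "clinear (\<lambda>q. ?F y (arr_act D q c # v' @ u))"
      using clinear_act_entry[of "[]" c "v' @ u" "?F y"] ml[of y] v' u c by auto
  qed
  have T3: "clinear (\<lambda>p. T y q p)" for y q
    unfolding T_def
  proof (intro clinear_hact v)
    have "multilinear_on D (map fst v @ map fst u) (\<lambda>w. ?F y (arr_act D q c # w))"
      using ml[of y] c by (intro multilinear_on_Cons) auto
    from multilinear_on_append_right[OF this u] show "multilinear_on D (map fst v) (\<lambda>v'. ?F y (arr_act D q c # v' @ u))"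
      by simp
  qed
  note [clin] = clinear_comp[OF T1] clinear_comp[OF T2] clinear_comp[OF T3]
  have "(tau H M D n ^^ length (c # v)) \<phi> (m \<otimes>\<^sub>C word_pure (u @ c # v))
      = (tau H M D n ^^ length v) (tau H M D n \<phi>) (m \<otimes>\<^sub>C word_pure ((u @ [c]) @ v))"
    by (simp add: funpow_swap1)
  also have "\<dots> = tsum (coact M m) (\<lambda>a x. hact H D v (\<lambda>v'. tau H M D n \<phi> (x \<otimes>\<^sub>C word_pure (v' @ u @ [c]))) (S' a))"
    by (subst Cons.IH[OF tau_cochain[OF Cons.prems(1)] cyc]) simp
  also have "\<dots> = tsum (coact M m) (\<lambda>a x. hact H D v (\<lambda>v'. tsum (coact M x) (\<lambda>b y. ?F y (arr_act D (S' b) c # v' @ u))) (S' a))"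
  proof (intro tsum_cong refl hact_cong v)
    fix x v' assume v': "map fst v' = map fst v" "\<forall>a\<in>set v'. is_arrow D a"
    show "tau H M D n \<phi> (x \<otimes>\<^sub>C word_pure (v' @ u @ [c])) = tsum (coact M x) (\<lambda>b y. ?F y (arr_act D (S' b) c # v' @ u))"
      using tau_pure[OF Cons.prems(1) cyc'[OF v'], of x] twist_snoc[of ?F x "v' @ u" c] by simp
  qed
  also have "\<dots> = tsum (coact M m) (\<lambda>a x. tsum (coact M x) (\<lambda>b y. T y (S' b) (S' a)))"
    by (simp add: hact_tsum T_def)
  also have "\<dots> = tsum (coact M m) (\<lambda>a y. tsum (\<Delta> a) (\<lambda>a1 a2. T y (S' a2) (S' a1)))"
    by (rule coact_coassoc[symmetric]) (intro clin)+
  also have "\<dots> = tsum (coact M m) (\<lambda>a y. tsum (\<Delta> (S' a)) (\<lambda>q p. T y q p))"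
    by (intro tsum_cong refl comult_antipode_inv[symmetric] clin)
  finally show ?case by (simp add: T_def)
qed

lemma tau_order:
  assumes \<phi>: "\<phi> \<in> cochains H M D n"
  shows "(tau H M D n ^^ Suc n) \<phi> = \<phi>"
proof (rule cochain_eqI[OF tau_funpow_cochain[OF \<phi>] \<phi>])
  fix m w assume w: "w \<in> cyclic_words D n"
  have "clinear (\<lambda>m. \<phi> (m \<otimes>\<^sub>C word_pure w))" using values_clinear[OF cochain_multilinear[OF \<phi>] w] .
  then have "tsum (coact M m) (\<lambda>a x. \<phi> (ract M x (S' a) \<otimes>\<^sub>C word_pure w)) = \<phi> (m \<otimes>\<^sub>C word_pure w)"
    by (rule coact_antipode_inv_stable)
  then show "(tau H M D n ^^ Suc n) \<phi> (m \<otimes>\<^sub>C word_pure w) = \<phi> (m \<otimes>\<^sub>C word_pure w)"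
    using tau_funpow_pure[OF \<phi>, of "[]" w m] w by (simp add: cochain_invariant[OF \<phi> w] cyclic_words_iff)
qed

lemma delta_delta:
  assumes \<phi>: "\<phi> \<in> cochains H M D n" and "i < j" "j \<le> Suc n"
  shows "delta H M D (Suc n) j (delta H M D n i \<phi>) = delta H M D (Suc n) i (delta H M D n (j - 1) \<phi>)"
proof (rule cochain_eqI)
  show "delta H M D (Suc n) j (delta H M D n i \<phi>) \<in> cochains H M D (Suc (Suc n))"
    "delta H M D (Suc n) i (delta H M D n (j - 1) \<phi>) \<in> cochains H M D (Suc (Suc n))"
    using assms by (auto intro!: delta_cochain)
  fix m w assume w: "w \<in> cyclic_words D (Suc (Suc n))"
  have "merge D j w \<in> cyclic_words D (Suc n)" "merge D i w \<in> cyclic_words D (Suc n)"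
    using w assms by (auto intro: merge_cyclic_words)
  moreover have "merge D i (merge D j w) = merge D (j - 1) (merge D i w)"
    using w assms by (intro merge_merge) (auto simp: cyclic_words_iff)
  ultimately show "delta H M D (Suc n) j (delta H M D n i \<phi>) (m \<otimes>\<^sub>C word_pure w)
      = delta H M D (Suc n) i (delta H M D n (j - 1) \<phi>) (m \<otimes>\<^sub>C word_pure w)"
    using assms w by (simp add: delta_pure delta_cochain)
qed

text \<open>For \<open>i <= n\<close> the merge avoids the rotated letter or stays clear of the end,
  and only its position shifts. For the last coface the left side is the square of
  \<open>tau\<close> on the zeroth coface: it moves a block of two letters and then composes them,
  which agrees with moving the composite because composition is equivariant.\<close>

lemma tau_delta:
  assumes \<phi>: "\<phi> \<in> cochains H M D n" and "1 \<le> i" "i \<le> Suc n"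
  shows "tau H M D (Suc n) (delta H M D n i \<phi>) = delta H M D n (i - 1) (tau H M D n \<phi>)"
proof (rule cochain_eqI)
  show "tau H M D (Suc n) (delta H M D n i \<phi>) \<in> cochains H M D (Suc n)"
    "delta H M D n (i - 1) (tau H M D n \<phi>) \<in> cochains H M D (Suc n)"
    using assms by (auto intro!: delta_cochain tau_cochain)
  fix m w assume w: "w \<in> cyclic_words D (Suc n)"
  let ?F = "\<lambda>m w. \<phi> (m \<otimes>\<^sub>C word_pure w)"
  have R: "delta H M D n (i - 1) (tau H M D n \<phi>) (m \<otimes>\<^sub>C word_pure w) = twist ?F m (merge D (i - 1) w)"
    using assms w by (simp add: delta_pure tau_pure tau_cochain merge_cyclic_words)
  show "tau H M D (Suc n) (delta H M D n i \<phi>) (m \<otimes>\<^sub>C word_pure w) = delta H M D n (i - 1) (tau H M D n \<phi>) (m \<otimes>\<^sub>C word_pure w)"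
  proof (cases "i \<le> n")
    case True
    obtain u c where uc: "w = u @ [c]" "length u = Suc n" using cyclic_words_snoc[OF w] .
    obtain k where k: "i = Suc k" using assms by (cases i) auto
    have "tau H M D (Suc n) (delta H M D n i \<phi>) (m \<otimes>\<^sub>C word_pure w) = twist (\<lambda>m w. delta H M D n i \<phi> (m \<otimes>\<^sub>C word_pure w)) m w"
      by (rule tau_pure[OF delta_cochain[OF \<phi> assms(3)] w])
    also have "\<dots> = twist (\<lambda>m w. ?F m (merge D i w)) m w"
      by (rule twist_cong[OF w delta_pure[OF \<phi> True]])
    also have "\<dots> = twist ?F m (merge D k w)"
      using uc True k by (simp add: twist_snoc merge_snoc)
    finally show ?thesis using R k by simp
  next
    case False
    then have i: "i = Suc n" using assms by simp
    have len: "length w = Suc (Suc n)" using w by (simp add: cyclic_words_iff)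
    from cyclic_words_split[OF w le_refl] obtain u b a v where uv: "w = u @ b # a # v" "length u = n"
      and cyc: "arr_src b = arr_tgt a" "u @ arr_comp D b a # v \<in> cyclic_words D n" .
    then have v: "v = []" using len by simp
    have w2: "u @ [b, a] \<in> cyclic_words D (Suc n)" using w uv v by simp
    have arr: "is_arrow D a" "is_arrow D b" "\<forall>a\<in>set u. is_arrow D a"
      using w2 by (auto simp: cyclic_words_iff)
    have c2: "u @ [arr_comp D b a] \<in> cyclic_words D n" using cyc v by simp
    have \<delta>: "delta H M D n 0 \<phi> \<in> cochains H M D (Suc n)" by (rule delta_cochain[OF \<phi>]) simp
    have "tau H M D (Suc n) (delta H M D n i \<phi>) (m \<otimes>\<^sub>C word_pure w)
        = (tau H M D (Suc n) ^^ length [b, a]) (delta H M D n 0 \<phi>) (m \<otimes>\<^sub>C word_pure (u @ [b, a]))"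
      using uv v i by (simp add: delta_last[OF \<phi>])
    also have "\<dots> = tsum (coact M m) (\<lambda>h x. hact H D [b, a] (\<lambda>v'. delta H M D n 0 \<phi> (x \<otimes>\<^sub>C word_pure (v' @ u))) (S' h))"
      by (rule tau_funpow_pure[OF \<delta> w2])
    also have "\<dots> = tsum (coact M m) (\<lambda>h x. hact H D [b, a] (\<lambda>v'. ?F x (merge D 0 v' @ u)) (S' h))"
    proof (intro tsum_cong refl hact_cong)
      fix x v' assume v': "map fst v' = map fst [b, a]" "\<forall>a\<in>set v'. is_arrow D a"
      then have "v' @ u \<in> cyclic_words D (Suc n)"
        using cyclic_words_relabel[OF cyclic_words_swap[OF w2], of "v' @ u"] arr by auto
      moreover obtain b' a' where "v' = [b', a']" using v'(1) by auto
      ultimately show "delta H M D n 0 \<phi> (x \<otimes>\<^sub>C word_pure (v' @ u)) = ?F x (merge D 0 v' @ u)"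
        by (simp add: delta_pure[OF \<phi>] merge_def)
    qed (use arr in auto)
    also have "\<dots> = tsum (coact M m) (\<lambda>h x. hact H D [arr_comp D b a] (\<lambda>v'. ?F x (v' @ u)) (S' h))"
    proof (intro tsum_cong refl)
      fix h x
      have "multilinear_on D [fst (arr_comp D b a)] (\<lambda>v'. ?F x (v' @ u))"
        using values_multilinear_on[OF cochain_multilinear[OF \<phi>] cyclic_words_swap[OF c2], of x] arr
        by (intro multilinear_on_append_right) auto
      then show "hact H D [b, a] (\<lambda>v'. ?F x (merge D 0 v' @ u)) (S' h) = hact H D [arr_comp D b a] (\<lambda>v'. ?F x (v' @ u)) (S' h)"
        using hact_merge[of "[]" b a "[]" "\<lambda>v'. ?F x (v' @ u)"] arr cyc by simp
    qed
    also have "\<dots> = (tau H M D n ^^ length [arr_comp D b a]) \<phi> (m \<otimes>\<^sub>C word_pure (u @ [arr_comp D b a]))"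
      by (rule tau_funpow_pure[OF \<phi> c2, symmetric])
    also have "\<dots> = twist ?F m (u @ [arr_comp D b a])"
      by (simp add: tau_pure[OF \<phi> c2])
    finally show ?thesis using R i uv(1) v merge_append[of D u b a "[]"] unfolding uv(2) by simp
  qed
qed

lemma linear_delta: "i \<le> Suc n \<Longrightarrow> linear_map (cochains H M D n) (cochains H M D (Suc n)) (delta H M D n i)"
  and linear_tau: "linear_map (cochains H M D n) (cochains H M D n) (tau H M D n)"
proof -
  note add = cvs.subspace_add[OF subspace_cochains] and scale = cvs.subspace_scale[OF subspace_cochains]
  have tau: "linear_map (cochains H M D n) (cochains H M D n) (tau H M D n)" for n
    unfolding linear_map_def linear_on_def
  proof (intro conjI ballI allI funcsetI tau_cochain)
    fix \<phi> \<psi> :: "('m, 'o, 'f) cochain" and c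
    assume \<phi>: "\<phi> \<in> cochains H M D n"
    show "tau H M D n (c *\<^sub>C \<phi>) = c *\<^sub>C tau H M D n \<phi>"
    proof (rule cochain_eqI[of _ n])
      show "tau H M D n (c *\<^sub>C \<phi>) (m \<otimes>\<^sub>C word_pure w) = (c *\<^sub>C tau H M D n \<phi>) (m \<otimes>\<^sub>C word_pure w)"
        if "w \<in> cyclic_words D n" for m w
        unfolding scaleC_fun_def[of c "tau H M D n \<phi>"] tau_pure[OF scale[OF \<phi>] that] tau_pure[OF \<phi> that]
        by (simp add: twist_def scaleC_fun_def tsum_scaleC)
    qed (intro scale tau_cochain \<phi>)+
    assume \<psi>: "\<psi> \<in> cochains H M D n"
    show "tau H M D n (\<phi> + \<psi>) = tau H M D n \<phi> + tau H M D n \<psi>"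
      by (rule cochain_eqI[of _ n])
        (simp_all add: \<phi> \<psi> tau_cochain add tau_pure twist_def tsum_def sum_list_addf)
  qed
  then show "linear_map (cochains H M D n) (cochains H M D n) (tau H M D n)" .
  have d: "linear_map (cochains H M D n) (cochains H M D (Suc n)) (delta H M D n i)" if i: "i \<le> n" for i
    unfolding linear_map_def linear_on_def
  proof (intro conjI ballI allI funcsetI delta_cochain)
    fix \<phi> \<psi> :: "('m, 'o, 'f) cochain" and c
    assume \<phi>: "\<phi> \<in> cochains H M D n"
    show "delta H M D n i (c *\<^sub>C \<phi>) = c *\<^sub>C delta H M D n i \<phi>"
    proof (rule cochain_eqI[of _ "Suc n"])
      show "delta H M D n i (c *\<^sub>C \<phi>) (m \<otimes>\<^sub>C word_pure w) = (c *\<^sub>C delta H M D n i \<phi>) (m \<otimes>\<^sub>C word_pure w)"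
        if "w \<in> cyclic_words D (Suc n)" for m w
        unfolding scaleC_fun_def[of c "delta H M D n i \<phi>"] delta_pure[OF scale[OF \<phi>] i that] delta_pure[OF \<phi> i that]
        by (simp add: scaleC_fun_def)
    qed (use i in \<open>auto intro!: scale delta_cochain \<phi>\<close>)
    assume \<psi>: "\<psi> \<in> cochains H M D n"
    show "delta H M D n i (\<phi> + \<psi>) = delta H M D n i \<phi> + delta H M D n i \<psi>"
      by (rule cochain_eqI[of _ "Suc n"])
        (simp_all add: \<phi> \<psi> delta_cochain add delta_pure i le_SucI)
  qed (use i in simp_all)
  show "i \<le> Suc n \<Longrightarrow> linear_map (cochains H M D n) (cochains H M D (Suc n)) (delta H M D n i)"
  proof (cases "i \<le> n")
    case False
    assume "i \<le> Suc n"
    then have i: "i = Suc n" using False by simp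
    show ?thesis
      using d[of 0] tau[of "Suc n"] unfolding i linear_map_def linear_on_def Pi_iff
      by (simp add: delta_last add scale)
  qed (rule d)
qed

end

section \<open>Cocyclic modules\<close>

lemma linear_map_mem: "linear_map V W f \<Longrightarrow> x \<in> V \<Longrightarrow> f x \<in> W"
  and linear_map_add: "linear_map V W f \<Longrightarrow> x \<in> V \<Longrightarrow> y \<in> V \<Longrightarrow> f (x + y) = f x + f y"
  and linear_map_scale: "linear_map V W f \<Longrightarrow> x \<in> V \<Longrightarrow> f (c *\<^sub>C x) = c *\<^sub>C f x"
  by (auto simp: linear_map_def linear_on_def)

lemma linear_map_zero: "linear_map V W f \<Longrightarrow> cvs.subspace V \<Longrightarrow> f 0 = 0"
  using linear_map_scale[of V W f 0 0] by (simp add: cvs.subspace_0 cvs.scale_zero_left)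

lemma linear_map_diff:
  assumes "linear_map V W f" "cvs.subspace V" "x \<in> V" "y \<in> V"
  shows "f (x - y) = f x - f y"
  using linear_map_add[OF assms(1), of "x - y" y] assms by (simp add: cvs.subspace_diff)

lemma linear_map_sum:
  assumes "linear_map V W f" "cvs.subspace V" "\<And>i. i \<in> A \<Longrightarrow> g i \<in> V"
  shows "f (sum g A) = (\<Sum>i\<in>A. f (g i))"
  using assms(3)
proof (induction A rule: infinite_finite_induct)
  case (insert i A)
  then show ?case
    using linear_map_add[OF assms(1), of "g i" "sum g A"] cvs.subspace_sum[OF assms(2), of A g] by simp
qed (simp_all add: linear_map_zero[OF assms(1,2)])

lemma linear_map_compose: "linear_map V W f \<Longrightarrow> linear_map U V g \<Longrightarrow> linear_map U W (\<lambda>x. f (g x))"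
  by (auto simp: linear_map_def linear_on_def Pi_iff)

lemma linear_map_sum_fun:
  assumes "cvs.subspace W" "\<And>i. i \<in> A \<Longrightarrow> linear_map V W (f i)"
  shows "linear_map V W (\<lambda>x. \<Sum>i\<in>A. f i x)"
  unfolding linear_map_def linear_on_def
proof (intro conjI funcsetI ballI allI)
  fix x assume x: "x \<in> V"
  show "(\<Sum>i\<in>A. f i x) \<in> W" using assms x by (intro cvs.subspace_sum) (auto intro: linear_map_mem)
  show "(\<Sum>i\<in>A. f i (c *\<^sub>C x)) = c *\<^sub>C (\<Sum>i\<in>A. f i x)" for c
    unfolding cvs.scale_sum_right using assms(2) x by (intro sum.cong refl linear_map_scale)
  show "(\<Sum>i\<in>A. f i (x + y)) = (\<Sum>i\<in>A. f i x) + (\<Sum>i\<in>A. f i y)" if "y \<in> V" for y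
    unfolding sum.distrib[symmetric] using assms(2) x that by (intro sum.cong refl linear_map_add)
qed

lemma linear_map_scale_fun: "cvs.subspace W \<Longrightarrow> linear_map V W f \<Longrightarrow> linear_map V W (\<lambda>x. c *\<^sub>C f x)"
  by (auto simp: linear_map_def linear_on_def Pi_iff cvs.subspace_scale scaleC_add_right scaleC_scaleC mult.commute)

lemma linear_map_diff_fun: "cvs.subspace W \<Longrightarrow> linear_map V W f \<Longrightarrow> linear_map V W g \<Longrightarrow> linear_map V W (\<lambda>x. f x - g x)"
  by (auto simp: linear_map_def linear_on_def Pi_iff cvs.subspace_diff cvs.scale_right_diff_distrib)

lemma linear_map_ident: "linear_map V V (\<lambda>x. x)"
  by (simp add: linear_map_def linear_on_def)

lemma linear_map_funpow: "linear_map V V f \<Longrightarrow> linear_map V V (f ^^ k)"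
  by (induction k) (auto simp: linear_map_def linear_on_def Pi_iff)

lemma minus_one_power_scale: "(-1) ^ (i + Suc j) *\<^sub>C x = - ((-1) ^ (i + j) *\<^sub>C (x :: 'a::complex_vector))"
  by (simp add: cvs.scale_minus_left)

text \<open>The bijection from \<open>(j, i)\<close> with \<open>i < j\<close> to
  \<open>(i, j - 1)\<close> matches the two halves of the index rectangle and reverses the
  sign.\<close>

lemma alternating_double_sum:
  fixes f :: "nat \<Rightarrow> nat \<Rightarrow> 'a::complex_vector"
  assumes "\<And>i j. i < j \<Longrightarrow> j \<le> Suc K \<Longrightarrow> f i j = f (j - 1) i"
  shows "(\<Sum>j\<le>Suc K. \<Sum>i\<le>K. (-1) ^ (i + j) *\<^sub>C f i j) = 0"
proof -
  let ?g = "\<lambda>(j, i). (-1) ^ (i + j) *\<^sub>C f i j"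
  let ?A = "{..Suc K} \<times> {..K}"
  have "(\<Sum>p\<in>{p\<in>?A. snd p < fst p}. ?g p) = (\<Sum>p\<in>{p\<in>?A. \<not> snd p < fst p}. - ?g p)"
  proof (rule sum.reindex_bij_witness[of _ "\<lambda>(j, i). (Suc i, j)" "\<lambda>(j, i). (i, j - 1)"])
    fix p assume "p \<in> {p\<in>?A. snd p < fst p}"
    then obtain i j where p: "p = (j, i)" "i < j" "j \<le> Suc K" "i \<le> K" by auto
    then obtain j' where j: "j = Suc j'" by (cases j) auto
    show "- ?g (case p of (j, i) \<Rightarrow> (i, j - 1)) = ?g p"
      using assms[of i j] p minus_one_power_scale[of i j'] by (simp add: j add.commute)
  qed auto
  moreover have "(\<Sum>j\<le>Suc K. \<Sum>i\<le>K. (-1) ^ (i + j) *\<^sub>C f i j) = sum ?g ?A"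
    by (rule sum.cartesian_product)
  moreover have "sum ?g ?A = sum ?g {p\<in>?A. snd p < fst p} + sum ?g {p\<in>?A. \<not> snd p < fst p}"
    by (subst sum.union_disjoint[symmetric]) (auto intro: sum.cong)
  ultimately show ?thesis by (simp add: sum_negf)
qed

text \<open>Only the cofaces and the cyclic operator are axiomatised. What codegeneracies would
  supply, namely exactness for \<open>b'\<close>, is the hypothesis \<open>bar\<close> of the
  periodicity argument below.\<close>

locale cocyclic_module =
  fixes C :: "nat \<Rightarrow> 'v::complex_vector set" and d :: "nat \<Rightarrow> nat \<Rightarrow> 'v \<Rightarrow> 'v" and t :: "nat \<Rightarrow> 'v \<Rightarrow> 'v"
  assumes sub: "cvs.subspace (C n)"
    and d: "i \<le> Suc n \<Longrightarrow> linear_map (C n) (C (Suc n)) (d n i)"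
    and t: "linear_map (C n) (C n) (t n)"
    and t_order: "x \<in> C n \<Longrightarrow> (t n ^^ Suc n) x = x"
    and dd: "x \<in> C n \<Longrightarrow> i < j \<Longrightarrow> j \<le> Suc n \<Longrightarrow> d (Suc n) j (d n i x) = d (Suc n) i (d n (j - 1) x)"
    and td: "x \<in> C n \<Longrightarrow> 1 \<le> i \<Longrightarrow> i \<le> Suc n \<Longrightarrow> t (Suc n) (d n i x) = d n (i - 1) (t n x)"
    and td0: "x \<in> C n \<Longrightarrow> t (Suc n) (d n 0 x) = d n (Suc n) x"
begin

definition b where "b n x = (\<Sum>i\<le>Suc n. (-1) ^ i *\<^sub>C d n i x)"
definition b' where "b' n x = (\<Sum>i\<le>n. (-1) ^ i *\<^sub>C d n i x)"
definition l where "l n x = (-1) ^ n *\<^sub>C t n x"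
definition N where "N n x = (\<Sum>i\<le>n. (l n ^^ i) x)"

lemma lin: "linear_map (C n) (C (Suc n)) (b n)" "linear_map (C n) (C (Suc n)) (b' n)"
    "linear_map (C n) (C n) (l n)"
  unfolding b_def b'_def l_def
  by (intro linear_map_sum_fun linear_map_scale_fun sub d t; simp)+

lemma lin_N: "linear_map (C n) (C n) (N n)"
  unfolding N_def by (intro linear_map_sum_fun linear_map_funpow lin sub)

lemmas mem = linear_map_mem[OF lin(1)] linear_map_mem[OF lin(2)] linear_map_mem[OF lin(3)]
  linear_map_mem[OF lin_N] cvs.subspace_add[OF sub] cvs.subspace_diff[OF sub] cvs.subspace_scale[OF sub]

lemmas lin_diff = linear_map_diff[OF lin(1) sub] linear_map_diff[OF lin(2) sub] linear_map_diff[OF lin(3) sub]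
  linear_map_diff[OF lin_N sub]

lemmas lin_scale = linear_map_scale[OF lin(1)] linear_map_scale[OF lin(2)] linear_map_scale[OF lin(3)]
  linear_map_scale[OF lin_N]

lemma d_mem: "x \<in> C n \<Longrightarrow> i \<le> Suc n \<Longrightarrow> d n i x \<in> C (Suc n)"
  using linear_map_mem[OF d] .

lemma t_mem: "x \<in> C n \<Longrightarrow> t n x \<in> C n"
  using linear_map_mem[OF t] .

text \<open>The last coface is \<open>t\<close> composed with the first one, so the cosimplicial identities that
  involve it follow from the others.\<close>
lemma dd_last:
  assumes x: "x \<in> C n" and "i < j" "j \<le> Suc (Suc n)"
  shows "d (Suc n) j (d n i x) = d (Suc n) i (d n (j - 1) x)"
proof (cases "j \<le> Suc n")
  case True
  then show ?thesis using dd assms by simp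
next
  case False
  then have j: "j = Suc (Suc n)" using assms by simp
  have d0: "d n 0 x \<in> C (Suc n)" using d_mem[OF x] by simp
  have di: "d n i x \<in> C (Suc n)" using d_mem[OF x] assms j by simp
  have R: "d (Suc n) i (d n (Suc n) x) = t (Suc (Suc n)) (d (Suc n) (Suc i) (d n 0 x))"
    using td[OF d0, of "Suc i"] assms j by (simp add: td0[OF x])
  have L: "d (Suc n) j (d n i x) = t (Suc (Suc n)) (d (Suc n) 0 (d n i x))"
    using td0[OF di] j by simp
  have "d (Suc n) 0 (d n i x) = d (Suc n) (Suc i) (d n 0 x)"
  proof (cases "i = Suc n")
    case False
    then show ?thesis using dd[OF x, of 0 "Suc i"] assms j by simp
  next
    case True
    have "d (Suc n) (Suc i) (d n 0 x) = t (Suc (Suc n)) (d (Suc n) 0 (d n 0 x))"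
      using td0[OF d0] True by simp
    also have "\<dots> = t (Suc (Suc n)) (d (Suc n) (Suc 0) (d n 0 x))"
      using dd[OF x, of 0 1] by simp
    also have "\<dots> = d (Suc n) 0 (t (Suc n) (d n 0 x))"
      using td[OF d0, of 1] by simp
    also have "\<dots> = d (Suc n) 0 (d n i x)"
      using td0[OF x] True by simp
    finally show ?thesis by simp
  qed
  then show ?thesis using L R j by simp
qed

lemma sum_d_sum:
  assumes x: "x \<in> C n" and "J \<le> Suc (Suc n)" "I \<le> Suc n"
  shows "(\<Sum>j\<le>J. (-1) ^ j *\<^sub>C d (Suc n) j (\<Sum>i\<le>I. (-1) ^ i *\<^sub>C d n i x))
    = (\<Sum>j\<le>J. \<Sum>i\<le>I. (-1) ^ (i + j) *\<^sub>C d (Suc n) j (d n i x))"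
proof (intro sum.cong refl)
  fix j assume "j \<in> {..J}"
  then have D: "linear_map (C (Suc n)) (C (Suc (Suc n))) (d (Suc n) j)" using assms by (intro d) simp
  show "(-1) ^ j *\<^sub>C d (Suc n) j (\<Sum>i\<le>I. (-1) ^ i *\<^sub>C d n i x) = (\<Sum>i\<le>I. (-1) ^ (i + j) *\<^sub>C d (Suc n) j (d n i x))"
    using assms by (subst linear_map_sum[OF D sub])
      (auto simp: d_mem mem linear_map_scale[OF D] cvs.scale_sum_right scaleC_scaleC power_add mult.commute intro!: sum.cong)
qed

lemma b_b: "x \<in> C n \<Longrightarrow> b (Suc n) (b n x) = 0"
  unfolding b_def sum_d_sum[OF _ le_refl le_refl] by (rule alternating_double_sum) (rule dd_last)

lemma b'_b': "x \<in> C n \<Longrightarrow> b' (Suc n) (b' n x) = 0"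
  unfolding b'_def sum_d_sum[OF _ le_SucI[OF le_refl] le_SucI[OF le_refl]]
  by (rule alternating_double_sum) (rule dd)

text \<open>Signed cofaces: with the sign absorbed on both sides, the relations between
  \<open>D\<close> and \<open>l\<close> carry no signs.\<close>

definition D where "D n i x = (-1) ^ i *\<^sub>C d n i x"

lemma D_mem: "x \<in> C n \<Longrightarrow> i \<le> Suc n \<Longrightarrow> D n i x \<in> C (Suc n)"
  by (simp add: D_def d_mem mem)

lemma l_D:
  assumes x: "x \<in> C n" and i: "Suc i \<le> Suc n"
  shows "l (Suc n) (D n (Suc i) x) = D n i (l n x)"
proof -
  have "l (Suc n) (D n (Suc i) x) = (-1) ^ Suc n *\<^sub>C (-1) ^ Suc i *\<^sub>C t (Suc n) (d n (Suc i) x)"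
    by (simp only: l_def D_def linear_map_scale[OF t d_mem[OF x i]])
  also have "\<dots> = (-1) ^ i *\<^sub>C (-1) ^ n *\<^sub>C d n i (t n x)"
    using td[OF x _ i] by (simp add: scaleC_scaleC mult.commute)
  also have "\<dots> = D n i (l n x)"
    using i linear_map_scale[OF d t_mem[OF x]] by (simp add: D_def l_def)
  finally show ?thesis .
qed

lemma l_D0: "x \<in> C n \<Longrightarrow> l (Suc n) (D n 0 x) = D n (Suc n) x"
  by (simp add: l_def D_def td0 scaleC_one)

lemma b_D: "b n x = (\<Sum>i\<le>Suc n. D n i x)" and b'_D: "b' n x = (\<Sum>i\<le>n. D n i x)"
  by (simp_all add: b_def b'_def D_def)

text \<open>Applying \<open>l\<close> to the sum of the signed cofaces sends the zeroth term to the
  last one and term i + 1 to term i after \<open>l\<close>. The last terms cancel, and the rest is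
  the truncated sum on 1 - \<open>l\<close>.\<close>

lemma l_b: 
  assumes x: "x \<in> C n"
  shows "b n x - l (Suc n) (b n x) = b' n (x - l n x)"
proof -
  have "l (Suc n) (b n x) = (\<Sum>i\<le>Suc n. l (Suc n) (D n i x))"
    unfolding b_D using D_mem[OF x] by (intro linear_map_sum[OF lin(3) sub]) simp
  also have "\<dots> = D n (Suc n) x + (\<Sum>i\<le>n. D n i (l n x))"
    unfolding sum.atMost_Suc_shift using x by (simp add: l_D0 l_D)
  finally show ?thesis
    using x by (simp add: lin_diff mem b'_D[symmetric]) (simp add: b_D b'_D)
qed

lemma l_funpow: "x \<in> C n \<Longrightarrow> (l n ^^ k) x = (-1) ^ (n * k) *\<^sub>C (t n ^^ k) x"
proof (induction k)
  case (Suc k)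
  have "(t n ^^ k) x \<in> C n" using linear_map_mem[OF linear_map_funpow[OF t]] Suc.prems .
  then show ?case using Suc by (simp add: l_def linear_map_scale[OF t] scaleC_scaleC power_add)
qed (simp add: scaleC_one)

lemma l_order: "x \<in> C n \<Longrightarrow> (l n ^^ Suc n) x = x"
proof -
  assume x: "x \<in> C n"
  \<comment> \<open>The sign of the power n + 1 of \<open>l\<close> is (-1)^(n(n+1)).\<close>
  have "even (n * Suc n)" by simp
  then have "(-1::complex) ^ (n * Suc n) = 1" by (rule neg_one_even_power)
  then show ?thesis using l_funpow[OF x, of "Suc n"] t_order[OF x] by (simp only: scaleC_one)
qed

lemma funpow_mem: "x \<in> C n \<Longrightarrow> (l n ^^ k) x \<in> C n"
  using linear_map_mem[OF linear_map_funpow[OF lin(3)]] .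

lemma l_N: "x \<in> C n \<Longrightarrow> l n (N n x) = N n x"
  and N_l: "x \<in> C n \<Longrightarrow> N n (l n x) = N n x"
proof -
  assume x: "x \<in> C n"
  have "(\<Sum>i\<le>n. (l n ^^ Suc i) x) = (\<Sum>i\<le>n. (l n ^^ i) x)"
  proof -
    have "(\<Sum>i\<le>n. (l n ^^ Suc i) x) + x = (\<Sum>i\<le>Suc n. (l n ^^ i) x)"
      by (subst sum.atMost_Suc_shift) simp
    also have "\<dots> = (\<Sum>i\<le>n. (l n ^^ i) x) + x" using l_order[OF x] by simp
    finally show ?thesis by simp
  qed
  moreover have "l n (N n x) = (\<Sum>i\<le>n. (l n ^^ Suc i) x)"
    unfolding N_def by (subst linear_map_sum[OF lin(3) sub]) (simp_all add: funpow_mem x)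
  moreover have "N n (l n x) = (\<Sum>i\<le>n. (l n ^^ Suc i) x)"
    unfolding N_def by (simp add: funpow_swap1)
  ultimately show "l n (N n x) = N n x" "N n (l n x) = N n x" by (simp_all add: N_def)
qed

text \<open>Abel summation gives (1 - l)(sum of i l^i x) = N x - (n + 1) x, because l^(n+1) x = x.
  If N x = 0, dividing by -(n + 1) solves the equation; this is where characteristic zero is
  used.\<close>

lemma N_kernel:
  assumes x: "x \<in> C n" and "N n x = 0"
  shows "\<exists>y\<in>C n. x = y - l n y"
proof -
  let ?y = "\<Sum>i\<le>n. of_nat i *\<^sub>C (l n ^^ i) x"
  have "(\<Sum>i\<le>m. of_nat i *\<^sub>C (l n ^^ i) x) - (\<Sum>i\<le>m. of_nat i *\<^sub>C (l n ^^ Suc i) x)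
      = (\<Sum>i\<le>m. (l n ^^ i) x) - x - of_nat m *\<^sub>C (l n ^^ Suc m) x" for m
    by (induction m) (simp_all add: cvs.scale_zero_left scaleC_add_left scaleC_one algebra_simps)
  from this[of n] have "?y - (\<Sum>i\<le>n. of_nat i *\<^sub>C (l n ^^ Suc i) x) = - (of_nat (Suc n) *\<^sub>C x)"
    using assms l_order[OF x] by (simp add: N_def scaleC_add_left scaleC_one)
  moreover have "l n ?y = (\<Sum>i\<le>n. of_nat i *\<^sub>C (l n ^^ Suc i) x)"
    by (subst linear_map_sum[OF lin(3) sub]) (simp_all add: funpow_mem x mem lin_scale)
  ultimately have y: "?y - l n ?y = - (of_nat (Suc n) *\<^sub>C x)" by simp
  have yC: "?y \<in> C n" by (intro cvs.subspace_sum[OF sub] mem funpow_mem x)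
  let ?c = "- inverse (of_nat (Suc n)) :: complex"
  have "c *\<^sub>C ?y - l n (c *\<^sub>C ?y) = c *\<^sub>C (?y - l n ?y)" for c
    using lin_scale(3)[OF yC] by (simp only: cvs.scale_right_diff_distrib)
  then have "?c *\<^sub>C ?y - l n (?c *\<^sub>C ?y) = ?c *\<^sub>C (?y - l n ?y)" .
  also have "\<dots> = x"
    unfolding y by (simp add: cvs.scale_minus_left cvs.scale_minus_right scaleC_scaleC scaleC_one del: of_nat_Suc)
  finally have "x = ?c *\<^sub>C ?y - l n (?c *\<^sub>C ?y)" by (rule sym)
  then show ?thesis using mem(7)[OF yC] by (rule bexI)
qed

lemma l_funpow_D: "x \<in> C n \<Longrightarrow> i \<le> Suc n \<Longrightarrow> (l (Suc n) ^^ i) (D n i x) = D n 0 ((l n ^^ i) x)"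
proof (induction i arbitrary: x)
  case (Suc i)
  have "(l (Suc n) ^^ Suc i) (D n (Suc i) x) = (l (Suc n) ^^ i) (l (Suc n) (D n (Suc i) x))"
    by (simp add: funpow_swap1)
  also have "\<dots> = (l (Suc n) ^^ i) (D n i (l n x))"
    by (simp only: l_D[OF Suc.prems])
  also have "\<dots> = D n 0 ((l n ^^ i) (l n x))"
    using Suc by (intro Suc.IH mem) auto
  finally show ?case by (simp add: funpow_swap1)
qed simp

lemma N_l_funpow: "x \<in> C n \<Longrightarrow> N n ((l n ^^ k) x) = N n x"
  by (induction k) (simp_all add: N_l funpow_mem)

text \<open>Both sides equal N D_0 N x. On the right, the i-th coface becomes the zeroth under l^i,
  a power that \<open>N\<close> does not see. On the left, N x is fixed by \<open>l\<close>, so its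
  cofaces are the translates of the zeroth one by all powers of \<open>l\<close>, and their sum is
  again \<open>N\<close>.\<close>

lemma b_N:
  assumes x: "x \<in> C n"
  shows "b n (N n x) = N (Suc n) (b' n x)"
proof -
  have Nx: "N n x \<in> C n" by (rule mem(4)[OF x])
  have D0: "linear_map (C n) (C (Suc n)) (D n 0)"
    unfolding D_def by (intro linear_map_scale_fun sub d) simp
  have "N (Suc n) (b' n x) = (\<Sum>i\<le>n. N (Suc n) (D n i x))"
    unfolding b'_D using D_mem[OF x] by (intro linear_map_sum[OF lin_N sub]) simp
  also have "\<dots> = (\<Sum>i\<le>n. N (Suc n) (D n 0 ((l n ^^ i) x)))"
  proof (intro sum.cong refl)
    fix i assume "i \<in> {..n}"
    then show "N (Suc n) (D n i x) = N (Suc n) (D n 0 ((l n ^^ i) x))"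
      using l_funpow_D[OF x, of i] N_l_funpow[OF D_mem[OF x, of i], of i] by simp
  qed
  also have "\<dots> = N (Suc n) (D n 0 (N n x))"
    unfolding N_def[of n] using funpow_mem[OF x] linear_map_mem[OF D0]
    by (simp add: linear_map_sum[OF D0 sub] linear_map_sum[OF lin_N sub])
  finally have R: "N (Suc n) (b' n x) = N (Suc n) (D n 0 (N n x))" .
  have inv: "(l n ^^ i) (N n x) = N n x" for i by (induction i) (simp_all add: l_N[OF x])
  \<comment> \<open>In degree n + 1 the operator \<open>l\<close> has order dividing n + 2, so the
    power n + 2 - i inverts l^i.\<close>
  have flip: "D n i (N n x) = (l (Suc n) ^^ Suc (Suc n - i)) (D n 0 (N n x))" if "i \<le> Suc n" for i
  proof -
    have "D n i (N n x) = (l (Suc n) ^^ (Suc (Suc n - i) + i)) (D n i (N n x))"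
      using l_order[OF D_mem[OF Nx that]] that by (simp del: funpow.simps)
    also have "\<dots> = (l (Suc n) ^^ Suc (Suc n - i)) ((l (Suc n) ^^ i) (D n i (N n x)))"
      by (simp only: funpow_add comp_apply)
    finally show ?thesis using l_funpow_D[OF Nx that] inv by simp
  qed
  have "b n (N n x) = (\<Sum>i\<le>Suc n. (l (Suc n) ^^ Suc (Suc n - i)) (D n 0 (N n x)))"
    unfolding b_D by (intro sum.cong refl flip) simp
  also have "\<dots> = (\<Sum>i\<le>Suc n. (l (Suc n) ^^ Suc i) (D n 0 (N n x)))"
    by (rule sum.reindex_bij_witness[of _ "\<lambda>i. Suc n - i" "\<lambda>i. Suc n - i"]) auto
  also have "\<dots> = N (Suc n) (l (Suc n) (D n 0 (N n x)))"
    by (simp only: N_def funpow_Suc_right comp_apply)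
  also have "\<dots> = N (Suc n) (D n 0 (N n x))"
    using N_l[OF D_mem[OF Nx, of 0]] by simp
  finally show ?thesis using R by simp
qed

text \<open>Connes' periodicity argument: a direct summand of a cocyclic module with vanishing
  Hochschild cohomology has vanishing cyclic cohomology.\<close>

context
  fixes P :: "nat \<Rightarrow> 'v \<Rightarrow> 'v"
  assumes P: "linear_map (C n) (C n) (P n)"
    and PP: "x \<in> C n \<Longrightarrow> P n (P n x) = P n x"
    and Pd: "x \<in> C n \<Longrightarrow> i \<le> Suc n \<Longrightarrow> P (Suc n) (d n i x) = d n i (P n x)"
    and Pt: "x \<in> C n \<Longrightarrow> P n (t n x) = t n (P n x)"
    and hochschild: "x \<in> C (Suc n) \<Longrightarrow> b (Suc n) x = 0 \<Longrightarrow> \<exists>y\<in>C n. b n y = x - P (Suc n) x"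
    and hochschild_0: "x \<in> C 0 \<Longrightarrow> b 0 x = 0 \<Longrightarrow> P 0 x = x"
    and bar: "x \<in> C (Suc n) \<Longrightarrow> b' (Suc n) x = 0 \<Longrightarrow> \<exists>y\<in>C n. b' n y = x"
begin

lemma P_mem: "x \<in> C n \<Longrightarrow> P n x \<in> C n" using linear_map_mem[OF P] .
lemma P_diff: "x \<in> C n \<Longrightarrow> y \<in> C n \<Longrightarrow> P n (x - y) = P n x - P n y" using linear_map_diff[OF P sub] .

lemma P_b: "x \<in> C n \<Longrightarrow> P (Suc n) (b n x) = b n (P n x)"
  and P_b': "x \<in> C n \<Longrightarrow> P (Suc n) (b' n x) = b' n (P n x)"
  unfolding b_def b'_def
  by (subst linear_map_sum[OF P sub]; simp add: mem d_mem linear_map_scale[OF P] Pd)+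

lemma P_l: "x \<in> C n \<Longrightarrow> P n (l n x) = l n (P n x)"
  by (simp add: l_def linear_map_scale[OF P] t_mem Pt)

lemma P_N: "x \<in> C n \<Longrightarrow> P n (N n x) = N n (P n x)"
proof -
  assume x: "x \<in> C n"
  have "P n ((l n ^^ k) x) = (l n ^^ k) (P n x)" for k
    by (induction k) (simp_all add: P_l funpow_mem x)
  then show ?thesis
    unfolding N_def by (subst linear_map_sum[OF P sub]) (simp_all add: funpow_mem x)
qed

text \<open>Write x = b \<psi> by Hochschild vanishing. Then (1 - l) \<psi> is
  \<open>b'\<close>-closed, hence equals b' \<chi>, and N \<chi> is a cyclic cocycle two degrees
  lower. By induction it bounds, so \<chi> can be corrected to satisfy N \<chi> = 0, that is, \<chi>
  = (1 - l) \<zeta>. Now (1 - l) \<psi> = (1 - l) b \<zeta>, and \<psi> - b \<zeta> is a cyclic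
  cochain with coboundary x. All choices are kept in the kernel of \<open>P\<close>, which the
  induction hypothesis requires.\<close>

lemma kernel_vanishing:
  assumes "x \<in> C n" "P n x = 0" "l n x = x" "b n x = 0"
  shows "(n = 0 \<longrightarrow> x = 0) \<and> (\<forall>k. n = Suc k \<longrightarrow> (\<exists>y\<in>C k. P k y = 0 \<and> l k y = y \<and> b k y = x))"
  using assms
proof (induction n arbitrary: x rule: less_induct)
  case (less n)
  show ?case
  proof (intro conjI impI allI)
    assume "n = 0"
    then show "x = 0" using hochschild_0[of x] less.prems by simp
  next
    fix k assume n: "n = Suc k"
    obtain \<psi>0 where \<psi>0: "\<psi>0 \<in> C k" "b k \<psi>0 = x" using hochschild[of x k] less.prems n by auto
    \<comment> \<open>1 - \<open>P\<close> projects onto the kernel of \<open>P\<close>; since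
      \<open>P\<close> commutes with \<open>b\<close> and kills x, the equation b \<psi> = x
      persists.\<close>
    define \<psi> where "\<psi> = \<psi>0 - P k \<psi>0"
    have \<psi>: "\<psi> \<in> C k" "P k \<psi> = 0" "b k \<psi> = x"
      using \<psi>0 less.prems n by (simp_all add: \<psi>_def P_mem mem P_diff PP lin_diff P_b[symmetric])
    define z where "z = \<psi> - l k \<psi>"
    have z: "z \<in> C k" "P k z = 0" "b' k z = 0"
      using \<psi> l_b[OF \<psi>(1)] less.prems n lin_scale(3)[OF \<psi>(1), of 0]
      by (simp_all add: z_def mem P_diff P_l cvs.scale_zero_left)
    show "\<exists>y\<in>C k. P k y = 0 \<and> l k y = y \<and> b k y = x"
    proof (cases k)
      case 0
      \<comment> \<open>In degree 0 the operator \<open>l\<close> has order 1, so every cochain is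
        cyclic.\<close>
      then have "l k \<psi> = \<psi>" using l_order[OF \<psi>(1)] by simp
      then show ?thesis using \<psi> by blast
    next
      case (Suc m)
      obtain \<chi>0 where \<chi>0: "\<chi>0 \<in> C m" "b' m \<chi>0 = z" using bar[of z m] z Suc by auto
      define \<chi> where "\<chi> = \<chi>0 - P m \<chi>0"
      have \<chi>: "\<chi> \<in> C m" "P m \<chi> = 0" "b' m \<chi> = z"
        using \<chi>0 z Suc by (simp_all add: \<chi>_def P_mem mem P_diff PP lin_diff P_b'[symmetric])
      have "b m (N m \<chi>) = N k z" using b_N[OF \<chi>(1)] \<chi> Suc by simp
      also have "\<dots> = 0" using \<psi> by (simp add: z_def lin_diff mem N_l)
      finally have bN: "b m (N m \<chi>) = 0" .
      have N0: "N m 0 = 0" by (rule linear_map_zero[OF lin_N sub])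
      have IH: "(m = 0 \<longrightarrow> N m \<chi> = 0) \<and> (\<forall>k. m = Suc k \<longrightarrow> (\<exists>y\<in>C k. P k y = 0 \<and> l k y = y \<and> b k y = N m \<chi>))"
        using \<chi> n Suc bN N0 by (intro less.IH) (simp_all add: mem P_N l_N)
      have "\<exists>\<chi>'\<in>C m. N m \<chi>' = 0 \<and> b' m \<chi>' = z"
      proof (cases m)
        case 0
        \<comment> \<open>In degree 0 a cyclic cocycle in the kernel is zero, and \<chi> needs no
          correction.\<close>
        then show ?thesis using IH \<chi> by blast
      next
        case (Suc p)
        then obtain \<xi> where \<xi>: "\<xi> \<in> C p" "l p \<xi> = \<xi>" "b p \<xi> = N m \<chi>" using IH by blast
        have "(l p ^^ i) \<xi> = \<xi>" for i by (induction i) (simp_all add: \<xi>)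
        then have N\<xi>: "N p \<xi> = of_nat (Suc p) *\<^sub>C \<xi>"
          by (simp add: N_def cvs.sum_constant_scale)
        \<comment> \<open>The cochain \<xi> is cyclic, so N multiplies it by p + 1 and N b' \<xi> =
          b N \<xi> = (p + 1) N \<chi>. The inverse of p + 1 is the coefficient that cancels N
          \<chi>, and subtracting a multiple of b' \<xi> leaves b' \<chi> unchanged.\<close>
        let ?c = "inverse (of_nat (Suc p)) :: complex"
        have "N m (\<chi> - ?c *\<^sub>C b' p \<xi>) = N m \<chi> - ?c *\<^sub>C b p (N p \<xi>)"
          using \<chi> \<xi> Suc by (simp add: lin_diff mem lin_scale b_N)
        also have "\<dots> = 0"
          unfolding N\<xi> using \<xi> by (simp add: lin_scale scaleC_scaleC scaleC_one del: of_nat_Suc)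
        finally have "N m (\<chi> - ?c *\<^sub>C b' p \<xi>) = 0" .
        moreover have "b' m (\<chi> - ?c *\<^sub>C b' p \<xi>) = z"
          using \<chi> \<xi> Suc b'_b'[OF \<xi>(1)] by (simp add: lin_diff mem lin_scale cvs.scale_zero_right)
        moreover have "\<chi> - ?c *\<^sub>C b' p \<xi> \<in> C m" using \<chi> \<xi> Suc by (simp add: mem)
        ultimately show ?thesis by blast
      qed
      then obtain \<chi>' where \<chi>': "\<chi>' \<in> C m" "N m \<chi>' = 0" "b' m \<chi>' = z" by blast
      then obtain \<zeta>0 where \<zeta>0: "\<zeta>0 \<in> C m" "\<chi>' = \<zeta>0 - l m \<zeta>0" using N_kernel by blast
      have b\<zeta>0: "z = b m \<zeta>0 - l k (b m \<zeta>0)" using l_b[OF \<zeta>0(1)] \<chi>' \<zeta>0 Suc by simp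
      define \<zeta> where "\<zeta> = \<zeta>0 - P m \<zeta>0"
      have \<zeta>: "\<zeta> \<in> C m" "P m \<zeta> = 0" using \<zeta>0 by (simp_all add: \<zeta>_def P_mem mem P_diff PP)
      have "z = z - P k z" using z by simp
      also have "\<dots> = b m \<zeta> - l k (b m \<zeta>)"
        using \<zeta>0 Suc unfolding b\<zeta>0 \<zeta>_def
        by (simp add: P_diff mem P_b P_l lin_diff P_mem algebra_simps)
      finally have "\<psi> - l k \<psi> = b m \<zeta> - l k (b m \<zeta>)" by (simp add: z_def)
      then have "l k (\<psi> - b m \<zeta>) = \<psi> - b m \<zeta>"
        using \<psi> \<zeta> Suc by (simp add: lin_diff mem algebra_simps)
      moreover have "P k (\<psi> - b m \<zeta>) = 0"
        using \<psi> \<zeta> Suc linear_map_zero[OF lin(1)[of m] sub] by (simp add: P_diff mem P_b)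
      moreover have "b k (\<psi> - b m \<zeta>) = x"
        using \<psi> \<zeta> Suc b_b[OF \<zeta>(1)] by (simp add: lin_diff mem)
      moreover have "\<psi> - b m \<zeta> \<in> C k" using \<psi> \<zeta> Suc by (simp add: mem)
      ultimately show ?thesis by blast
    qed
  qed
qed

text \<open>The component x - P x is a cyclic cocycle in the kernel of \<open>P\<close>, because
  \<open>P\<close> is idempotent and commutes with \<open>b\<close> and \<open>l\<close>.\<close>

lemma cyclic_vanishing:
  assumes "x \<in> C n" "l n x = x" "b n x = 0"
  shows "n = 0 \<Longrightarrow> P n x = x" "n = Suc k \<Longrightarrow> \<exists>y\<in>C k. l k y = y \<and> b k y = x - P n x"
proof -
  let ?y = "x - P n x"
  have "b n (P n x) = 0" using P_b[OF assms(1)] assms linear_map_zero[OF P sub, of "Suc n"] by simp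
  then have "?y \<in> C n" "P n ?y = 0" "l n ?y = ?y" "b n ?y = 0"
    using assms by (simp_all add: mem P_mem P_diff PP lin_diff P_l[symmetric])
  from kernel_vanishing[OF this]
  show "n = 0 \<Longrightarrow> P n x = x" "n = Suc k \<Longrightarrow> \<exists>y\<in>C k. l k y = y \<and> b k y = x - P n x"
    by auto
qed

end

end

section \<open>Quotient spaces\<close>

context
  fixes B :: "'v::complex_vector set"
  assumes B: "cvs.subspace B"
begin

lemma coset_eq_iff: "x +o B = y +o B \<longleftrightarrow> x - y \<in> B"
proof
  assume "x +o B = y +o B"
  then have "x + 0 \<in> y +o B" using cvs.subspace_0[OF B] by (metis set_plus_intro2)
  then show "x - y \<in> B" by (auto simp: elt_set_plus_def)
next
  assume xy: "x - y \<in> B"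
  have sub: "u +o B \<subseteq> v +o B" if "u - v \<in> B" for u v
  proof
    fix c assume "c \<in> u +o B"
    then obtain b where b: "b \<in> B" "c = u + b" by (auto simp: elt_set_plus_def)
    then have "c = v + ((u - v) + b)" "(u - v) + b \<in> B" using that by (simp_all add: cvs.subspace_add[OF B])
    then show "c \<in> v +o B" unfolding elt_set_plus_def by blast
  qed
  have "y - x \<in> B" using cvs.subspace_neg[OF B xy] by simp
  then show "x +o B = y +o B" using sub[OF xy] sub[of y x] by blast
qed

lemma subspace_plus_self: "B + B = B"
  using cvs.subspace_0[OF B] by (auto simp: set_plus_def cvs.subspace_add[OF B]) (metis add_0)

lemma coset_add: "(x +o B) + (y +o B) = (x + y) +o B"
  by (simp add: set_plus_rearrange subspace_plus_self)

text \<open>The image of a coset may be only part of a coset of \<open>B'\<close>, for instance a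
  single point for the zero map. Adding \<open>B'\<close> completes it, which explains the form of
  \<open>HC_map\<close> and of scalar multiplication on the quotient.\<close>

lemma image_coset:
  assumes "\<And>b. b \<in> B \<Longrightarrow> f (x + b) = f x + f b" "cvs.subspace B'" "f ` B \<subseteq> B'"
  shows "f ` (x +o B) + B' = f x +o B'"
proof
  show "f ` (x +o B) + B' \<subseteq> f x +o B'"
  proof
    fix c assume "c \<in> f ` (x +o B) + B'"
    then obtain b b' where b: "b \<in> B" "b' \<in> B'" "c = f (x + b) + b'"
      by (auto simp: set_plus_def elt_set_plus_def)
    then have "c = f x + (f b + b')" "f b + b' \<in> B'"
      using assms by (auto simp: add.assoc intro!: cvs.subspace_add[OF assms(2)])
    then show "c \<in> f x +o B'" unfolding elt_set_plus_def by blast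
  qed
  show "f x +o B' \<subseteq> f ` (x +o B) + B'"
  proof
    fix c assume "c \<in> f x +o B'"
    then obtain b' where b': "b' \<in> B'" "c = f x + b'" by (auto simp: elt_set_plus_def)
    have "x + 0 \<in> x +o B" using cvs.subspace_0[OF B] by (rule set_plus_intro2)
    then have "f x \<in> f ` (x +o B)" by simp
    then show "c \<in> f ` (x +o B) + B'" using b' by (auto intro: set_plus_intro)
  qed
qed

lemma coset_scale: "(\<lambda>z. c *\<^sub>C z) ` (x +o B) + B = (c *\<^sub>C x) +o B"
  by (rule image_coset[OF _ B]) (auto simp: scaleC_add_right cvs.subspace_scale[OF B])

lemma module_quotient_space:
  assumes Z: "cvs.subspace Z"
  shows "Module.module complex_ring (quotient_space Z B)"
proof (rule moduleI)
  show "cring complex_ring"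
    by (intro cringI abelian_groupI comm_monoidI)
      (auto simp: complex_ring_def algebra_simps intro: exI[of _ "- x" for x])
  note [simp] = coset_add coset_scale
  have z: "zero (quotient_space Z B) = 0 +o B" by (simp add: quotient_space_def)
  show "abelian_group (quotient_space Z B)"
  proof (rule abelian_groupI)
    fix x assume "x \<in> carrier (quotient_space Z B)"
    then obtain a where a: "a \<in> Z" "x = a +o B" by (auto simp: quotient_space_def)
    have "(- a) +o B \<in> carrier (quotient_space Z B)"
      using a cvs.subspace_neg[OF Z] by (auto simp: quotient_space_def)
    moreover have "(- a) +o B \<oplus>\<^bsub>quotient_space Z B\<^esub> x = \<zero>\<^bsub>quotient_space Z B\<^esub>"
      unfolding z using a by (simp add: quotient_space_def)
    ultimately show "\<exists>y\<in>carrier (quotient_space Z B). y \<oplus>\<^bsub>quotient_space Z B\<^esub> x = \<zero>\<^bsub>quotient_space Z B\<^esub>" by blast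
    show "\<zero>\<^bsub>quotient_space Z B\<^esub> \<oplus>\<^bsub>quotient_space Z B\<^esub> x = x"
      using a coset_add[of 0 a] by (simp add: quotient_space_def)
  next
    show "\<zero>\<^bsub>quotient_space Z B\<^esub> \<in> carrier (quotient_space Z B)"
      unfolding z using imageI[OF cvs.subspace_0[OF Z], of "\<lambda>z. z +o B"] by (simp add: quotient_space_def)
  qed (auto simp: quotient_space_def ac_simps cvs.subspace_add[OF Z])
  have carrier: "carrier (quotient_space Z B) = (\<lambda>z. z +o B) ` Z" by (simp add: quotient_space_def)
  have smult: "smult (quotient_space Z B) c (x +o B) = (c *\<^sub>C x) +o B" for c x
    by (simp add: quotient_space_def)
  have add: "add (quotient_space Z B) (x +o B) (y +o B) = (x + y) +o B" for x y
    by (simp add: quotient_space_def)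
  fix x assume x: "x \<in> carrier (quotient_space Z B)"
  then obtain z where z: "z \<in> Z" "x = z +o B" by (auto simp: carrier)
  show "\<one>\<^bsub>complex_ring\<^esub> \<odot>\<^bsub>quotient_space Z B\<^esub> x = x"
    by (simp only: z smult) (simp add: complex_ring_def scaleC_one)
  fix a
  show "a \<odot>\<^bsub>quotient_space Z B\<^esub> x \<in> carrier (quotient_space Z B)"
    using z cvs.subspace_scale[OF Z] by (auto simp: smult carrier)
  show "a \<odot>\<^bsub>quotient_space Z B\<^esub> (x \<oplus>\<^bsub>quotient_space Z B\<^esub> y)
      = a \<odot>\<^bsub>quotient_space Z B\<^esub> x \<oplus>\<^bsub>quotient_space Z B\<^esub> a \<odot>\<^bsub>quotient_space Z B\<^esub> y"
    if "y \<in> carrier (quotient_space Z B)" for y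
    using z that by (auto simp only: smult add carrier scaleC_add_right)
  fix b
  show "(a \<oplus>\<^bsub>complex_ring\<^esub> b) \<odot>\<^bsub>quotient_space Z B\<^esub> x
      = a \<odot>\<^bsub>quotient_space Z B\<^esub> x \<oplus>\<^bsub>quotient_space Z B\<^esub> b \<odot>\<^bsub>quotient_space Z B\<^esub> x"
    by (simp only: z smult add) (simp add: complex_ring_def scaleC_add_left)
  show "(a \<otimes>\<^bsub>complex_ring\<^esub> b) \<odot>\<^bsub>quotient_space Z B\<^esub> x
      = a \<odot>\<^bsub>quotient_space Z B\<^esub> (b \<odot>\<^bsub>quotient_space Z B\<^esub> x)"
    by (simp only: z smult) (simp add: complex_ring_def scaleC_scaleC)
qed

end

section \<open>Functoriality\<close>

context hopf_cyclic
begin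

sublocale cocyc: cocyclic_module "cochains H M D" "delta H M D" "tau H M D"
  by (unfold_locales)
    (use tau_order in \<open>simp_all add: subspace_cochains linear_delta linear_tau delta_delta tau_delta delta_last del: funpow.simps\<close>)

lemma hoch_b_eq: "hoch_b H M D n = cocyc.b n"
  by (rule ext) (simp add: hoch_b_def cocyc.b_def)

lemma hoch_b'_eq: "hoch_b' H M D n = cocyc.b' n"
  by (rule ext) (simp add: hoch_b'_def cocyc.b'_def)

lemma lambda_eq: "lambda H M D n = cocyc.l n"
  by (rule ext) (simp add: lambda_def cocyc.l_def)

lemma norm_op_eq: "norm_op H M D n = cocyc.N n"
  by (rule ext) (simp add: norm_op_def cocyc.N_def lambda_eq)

lemma one_minus_lambda_eq: "one_minus_lambda H M D n \<phi> = \<phi> - cocyc.l n \<phi>"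
  by (simp add: one_minus_lambda_def lambda_eq)

text \<open>The relations (1 - l) b = b' (1 - l) and b N = N b' are commutations; the sign in -b' on
  the odd columns turns them into anticommutations.\<close>

lemma double_complex_cyclic: "double_complex (cyclic_double_complex H M D)"
proof -
  note L = cocyc.lin cocyc.lin_N subspace_cochains
  have l1: "linear_map (cochains H M D n) (cochains H M D n) (one_minus_lambda H M D n)" for n
    using linear_map_diff_fun[OF L(5) linear_map_ident L(3)] by (simp add: one_minus_lambda_eq[abs_def])
  have b': "linear_map (cochains H M D n) (cochains H M D (Suc n)) (\<lambda>\<phi>. - hoch_b' H M D n \<phi>)" for n
    using linear_map_scale_fun[OF L(5) L(2), of n "-1"]
    by (simp add: hoch_b'_eq cvs.scale_minus_left scaleC_one)
  have mem: "x \<in> cochains H M D n \<Longrightarrow> cocyc.b n x \<in> cochains H M D (Suc n)"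
    "x \<in> cochains H M D n \<Longrightarrow> cocyc.b' n x \<in> cochains H M D (Suc n)"
    "x \<in> cochains H M D n \<Longrightarrow> cocyc.l n x \<in> cochains H M D n"
    "x \<in> cochains H M D n \<Longrightarrow> cocyc.N n x \<in> cochains H M D n" for n x
    by (rule cocyc.mem; assumption)+
  have neg: "cocyc.b' n (- x) = - cocyc.b' n x" "cocyc.N n (- x) = - cocyc.N n x" if "x \<in> cochains H M D n" for n x
    using linear_map_scale[OF L(2) that, of "-1"] linear_map_scale[OF L(4) that, of "-1"]
    by (simp_all add: cvs.scale_minus_left scaleC_one)
  show ?thesis
    unfolding double_complex_def
  proof (intro allI conjI ballI)
    fix p q x
    show "cvs.subspace (dc_space (cyclic_double_complex H M D) p q)"
      by (simp add: cyclic_double_complex_def subspace_cochains)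
    show "linear_map (dc_space (cyclic_double_complex H M D) p q) (dc_space (cyclic_double_complex H M D) p (Suc q))
        (dc_vert (cyclic_double_complex H M D) p q)"
      using L b' by (cases "even p") (simp_all add: cyclic_double_complex_def hoch_b_eq)
    show "linear_map (dc_space (cyclic_double_complex H M D) p q) (dc_space (cyclic_double_complex H M D) (Suc p) q)
        (dc_horiz (cyclic_double_complex H M D) p q)"
      using L l1 by (cases "even p") (simp_all add: cyclic_double_complex_def norm_op_eq)
    assume "x \<in> dc_space (cyclic_double_complex H M D) p q"
    then have x: "x \<in> cochains H M D q" by (simp add: cyclic_double_complex_def)
    show "dc_vert (cyclic_double_complex H M D) p (Suc q) (dc_vert (cyclic_double_complex H M D) p q x) = 0"
      using cocyc.b_b[OF x] cocyc.b'_b'[OF x] neg mem x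
      by (cases "even p") (simp_all add: cyclic_double_complex_def hoch_b_eq hoch_b'_eq)
    show "dc_horiz (cyclic_double_complex H M D) (Suc p) q (dc_horiz (cyclic_double_complex H M D) p q x) = 0"
      using cocyc.l_N[OF x] cocyc.N_l[OF x] x mem
      by (cases "even p") (simp_all add: cyclic_double_complex_def one_minus_lambda_eq norm_op_eq cocyc.lin_diff)
    show "dc_horiz (cyclic_double_complex H M D) p (Suc q) (dc_vert (cyclic_double_complex H M D) p q x) +
        dc_vert (cyclic_double_complex H M D) (Suc p) q (dc_horiz (cyclic_double_complex H M D) p q x) = 0"
      using cocyc.l_b[OF x] cocyc.b_N[OF x] x mem neg
      by (cases "even p") (simp_all add: cyclic_double_complex_def one_minus_lambda_eq norm_op_eq hoch_b_eq hoch_b'_eq)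
  qed
qed

lemma cyclic_cochains_iff: "\<phi> \<in> cyclic_cochains H M D n \<longleftrightarrow> \<phi> \<in> cochains H M D n \<and> cocyc.l n \<phi> = \<phi>"
  by (auto simp: cyclic_cochains_def one_minus_lambda_eq)

lemma cyclic_cocycles_iff:
  "\<phi> \<in> cyclic_cocycles H M D n \<longleftrightarrow> \<phi> \<in> cochains H M D n \<and> cocyc.l n \<phi> = \<phi> \<and> cocyc.b n \<phi> = 0"
  by (auto simp: cyclic_cocycles_def cyclic_cochains_iff hoch_b_eq)

lemma subspace_cyclic_cochains: "cvs.subspace (cyclic_cochains H M D n)"
  using linear_map_zero[OF cocyc.lin(3) subspace_cochains, of n]
  by (intro cvs.subspaceI) (simp_all add: cyclic_cochains_iff cocyc.mem cvs.subspace_0[OF subspace_cochains]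
      linear_map_add[OF cocyc.lin(3)] cocyc.lin_scale)

lemma subspace_cyclic_cocycles: "cvs.subspace (cyclic_cocycles H M D n)"
  using linear_map_zero[OF cocyc.lin(3) subspace_cochains, of n] linear_map_zero[OF cocyc.lin(1) subspace_cochains, of n]
  by (intro cvs.subspaceI) (simp_all add: cyclic_cocycles_iff cocyc.mem cvs.subspace_0[OF subspace_cochains]
      linear_map_add[OF cocyc.lin(3)] linear_map_add[OF cocyc.lin(1)] cocyc.lin_scale cvs.scale_zero_right)

lemma subspace_cyclic_coboundaries: "cvs.subspace (cyclic_coboundaries H M D n)"
proof (cases n)
  case (Suc k)
  have "cvs.subspace (cocyc.b k ` cyclic_cochains H M D k)"
  proof (rule cvs.subspaceI)
    note S = subspace_cyclic_cochains[of k]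
    show "0 \<in> cocyc.b k ` cyclic_cochains H M D k"
      using cvs.subspace_0[OF S] linear_map_zero[OF cocyc.lin(1) subspace_cochains, of k] by (metis imageI)
    have C: "x \<in> cyclic_cochains H M D k \<Longrightarrow> x \<in> cochains H M D k" for x by (simp add: cyclic_cochains_iff)
    show "x + y \<in> cocyc.b k ` cyclic_cochains H M D k"
      if xy: "x \<in> cocyc.b k ` cyclic_cochains H M D k" "y \<in> cocyc.b k ` cyclic_cochains H M D k" for x y
    proof -
      obtain u v where "u \<in> cyclic_cochains H M D k" "v \<in> cyclic_cochains H M D k" "x = cocyc.b k u" "y = cocyc.b k v"
        using xy by auto
      then show ?thesis
        using cvs.subspace_add[OF S] C by (intro image_eqI[of _ _ "u + v"]) (auto simp: linear_map_add[OF cocyc.lin(1)])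
    qed
    show "c *\<^sub>C x \<in> cocyc.b k ` cyclic_cochains H M D k" if x: "x \<in> cocyc.b k ` cyclic_cochains H M D k" for c x
    proof -
      obtain u where "u \<in> cyclic_cochains H M D k" "x = cocyc.b k u" using x by auto
      then show ?thesis
        using cvs.subspace_scale[OF S] C by (intro image_eqI[of _ _ "c *\<^sub>C u"]) (auto simp: cocyc.lin_scale)
    qed
  qed
  then show ?thesis using Suc by (simp add: cyclic_coboundaries_def hoch_b_eq)
qed (simp add: cyclic_coboundaries_def)

lemma cyclic_coboundaries_cocycles: "cyclic_coboundaries H M D n \<subseteq> cyclic_cocycles H M D n"
proof (cases n)
  case 0
  then show ?thesis using cvs.subspace_0[OF subspace_cyclic_cocycles] by (simp add: cyclic_coboundaries_def)
next
  case (Suc k)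
  have "cocyc.b k \<psi> \<in> cyclic_cocycles H M D (Suc k)" if "\<psi> \<in> cyclic_cochains H M D k" for \<psi>
  proof -
    have \<psi>: "\<psi> \<in> cochains H M D k" "cocyc.l k \<psi> = \<psi>" using that by (simp_all add: cyclic_cochains_iff)
    have "cocyc.b k \<psi> - cocyc.l (Suc k) (cocyc.b k \<psi>) = 0"
      using cocyc.l_b[OF \<psi>(1)] \<psi>(2) linear_map_zero[OF cocyc.lin(2) subspace_cochains, of k] by simp
    then show ?thesis using \<psi> cocyc.b_b[OF \<psi>(1)] cocyc.mem(1) by (simp add: cyclic_cocycles_iff)
  qed
  then show ?thesis using Suc by (auto simp: cyclic_coboundaries_def hoch_b_eq)
qed

lemma module_HC: "Module.module complex_ring (HC H M D n)"
  unfolding HC_def by (rule module_quotient_space[OF subspace_cyclic_coboundaries subspace_cyclic_cocycles])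

end

section \<open>Maps induced by a semifunctor\<close>

locale hopf_semifunctor = S: hopf_cyclic H M D + T: hopf_cyclic H M D'
  for H :: "('h::complex_algebra_1) hopf_data" and M :: "('h, 'm::complex_vector) mod_comod"
    and D :: "('o1, 'f1::complex_vector, 'h) hcat" and D' :: "('o2, 'f2::complex_vector, 'h) hcat" +
  fixes \<alpha>
  assumes semifunctor: "H_semifunctor D D' \<alpha>"
begin

lemma arr_map_arrow: "is_arrow D a \<Longrightarrow> is_arrow D' (arr_map \<alpha> a)"
  using semifunctor by (auto simp: H_semifunctor_def is_arrow_def arr_map_def linear_map_def)

lemma arr_map_act: "is_arrow D a \<Longrightarrow> arr_map \<alpha> (arr_act D h a) = arr_act D' h (arr_map \<alpha> a)"
  using semifunctor by (simp add: H_semifunctor_def is_arrow_def arr_map_def arr_act_def)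

lemma arr_map_comp:
  "is_arrow D a \<Longrightarrow> is_arrow D b \<Longrightarrow> arr_src b = arr_tgt a \<Longrightarrow>
    arr_map \<alpha> (arr_comp D b a) = arr_comp D' (arr_map \<alpha> b) (arr_map \<alpha> a)"
  using semifunctor by (simp add: H_semifunctor_def is_arrow_def arr_map_def arr_comp_def)

lemma linked_map: "linked L \<Longrightarrow> L \<noteq> [] \<Longrightarrow> linked (map (\<lambda>i. (on_ob \<alpha> (fst i), on_ob \<alpha> (snd i))) L)"
  by (auto simp: linked_def successively_map hd_map last_map elim!: successively_mono)

lemma map_cyclic_words:
  assumes w: "w \<in> cyclic_words D n" shows "map (arr_map \<alpha>) w \<in> cyclic_words D' n"
proof -
  have "map fst (map (arr_map \<alpha>) w) = map (\<lambda>i. (on_ob \<alpha> (fst i), on_ob \<alpha> (snd i))) (map fst w)"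
    by (simp add: arr_map_def)
  then show ?thesis
    using w linked_map[of "map fst w"] arr_map_arrow unfolding cyclic_words_iff
    by (metis (no_types, lifting) imageE length_map list.set_map list.size(3) nat.distinct(1))
qed

lemma multilinear_values_map:
  assumes F: "multilinear_values D' n F"
  shows "multilinear_values D n (\<lambda>m w. F m (map (arr_map \<alpha>) w))"
  unfolding multilinear_values_def
proof (intro conjI allI ballI)
  fix m w assume w: "w \<in> cyclic_words D n"
  show "clinear (\<lambda>m. F m (map (arr_map \<alpha>) w))"
    by (rule T.values_clinear[OF F map_cyclic_words[OF w]])
  show "multilinear_on D (map fst w) (\<lambda>w. F m (map (arr_map \<alpha>) w))"
    unfolding multilinear_on_def
  proof (intro allI impI)
    fix us i vs
    let ?i = "(on_ob \<alpha> (fst i), on_ob \<alpha> (snd i))"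
    assume *: "map fst us @ i # map fst vs = map fst w \<and> fst i \<in> Ob D \<and> snd i \<in> Ob D \<and> (\<forall>a\<in>set us \<union> set vs. is_arrow D a)"
    have ob: "on_ob \<alpha> (fst i) \<in> Ob D'" "on_ob \<alpha> (snd i) \<in> Ob D'"
      and hom: "linear_map (Hom D (fst i) (snd i)) (Hom D' (on_ob \<alpha> (fst i)) (on_ob \<alpha> (snd i))) (on_hom \<alpha> (fst i) (snd i))"
      using * semifunctor by (auto simp: H_semifunctor_def)
    have lab: "map fst (map (arr_map \<alpha>) w) = map (\<lambda>i. (on_ob \<alpha> (fst i), on_ob \<alpha> (snd i))) (map fst w)" for w
      by (simp add: arr_map_def)
    have "map fst (map (arr_map \<alpha>) w) = map fst (map (arr_map \<alpha>) us) @ ?i # map fst (map (arr_map \<alpha>) vs)"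
      using arg_cong[OF conjunct1[OF *], of "map (\<lambda>i. (on_ob \<alpha> (fst i), on_ob \<alpha> (snd i)))"]
      unfolding lab by simp
    then have "multilinear_on D' (map fst (map (arr_map \<alpha>) us) @ ?i # map fst (map (arr_map \<alpha>) vs)) (F m)"
      using T.values_multilinear_on[OF F map_cyclic_words[OF w]] by simp
    from multilinear_onD[OF this]
    have "linear_on (Hom D' (fst ?i) (snd ?i)) (\<lambda>f. F m (map (arr_map \<alpha>) us @ (?i, f) # map (arr_map \<alpha>) vs))"
      using ob * arr_map_arrow by auto
    then show "linear_on (Hom D (fst i) (snd i)) (\<lambda>f. F m (map (arr_map \<alpha>) (us @ (i, f) # vs)))"
      using hom by (auto simp: linear_on_def linear_map_def arr_map_def Pi_iff)
  qed
qed

lemma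
  assumes \<phi>: "\<phi> \<in> cochains H M D' n"
  shows cochain_map_cochain: "cochain_map D \<alpha> n \<phi> \<in> cochains H M D n"
    and cochain_map_pure: "w \<in> cyclic_words D n \<Longrightarrow>
      cochain_map D \<alpha> n \<phi> (m \<otimes>\<^sub>C word_pure w) = \<phi> (m \<otimes>\<^sub>C word_pure (map (arr_map \<alpha>) w))"
proof -
  let ?F = "\<lambda>m w. \<phi> (m \<otimes>\<^sub>C word_pure (map (arr_map \<alpha>) w))"
  have ml: "multilinear_values D n ?F"
    by (rule multilinear_values_map[OF T.cochain_multilinear[OF \<phi>]])
  have "S.invariant_values n ?F"
    unfolding S.invariant_values_def
  proof (intro allI ballI)
    fix m h w assume w: "w \<in> cyclic_words D n"
    have "hact H D' (map (arr_map \<alpha>) w) (\<lambda>u. \<phi> (m \<otimes>\<^sub>C word_pure u)) h = hact H D w (?F m) h"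
      using cyclic_words_arrow[OF w] by (intro hact_map arr_map_act) auto
    then show "?F (ract M m h) w = hact H D w (?F m) h"
      by (simp add: T.cochain_invariant[OF \<phi> map_cyclic_words[OF w]])
  qed
  then show "cochain_map D \<alpha> n \<phi> \<in> cochains H M D n"
    unfolding cochain_map_def by (intro S.functional_of_cochain ml)
  show "w \<in> cyclic_words D n \<Longrightarrow> cochain_map D \<alpha> n \<phi> (m \<otimes>\<^sub>C word_pure w) = ?F m w"
    unfolding cochain_map_def by (rule functional_of_pure[OF S.subspace_Hom ml])
qed

lemma cochain_map_tau:
  assumes \<phi>: "\<phi> \<in> cochains H M D' n"
  shows "cochain_map D \<alpha> n (tau H M D' n \<phi>) = tau H M D n (cochain_map D \<alpha> n \<phi>)"
proof (rule S.cochain_eqI)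
  show "cochain_map D \<alpha> n (tau H M D' n \<phi>) \<in> cochains H M D n" "tau H M D n (cochain_map D \<alpha> n \<phi>) \<in> cochains H M D n"
    by (intro cochain_map_cochain S.tau_cochain T.tau_cochain \<phi>)+
  fix m w assume w: "w \<in> cyclic_words D n"
  obtain u c where uc: "w = u @ [c]" "length u = n" using S.cyclic_words_snoc[OF w] .
  have c: "is_arrow D c" using w uc by (simp add: cyclic_words_iff)
  have "cochain_map D \<alpha> n (tau H M D' n \<phi>) (m \<otimes>\<^sub>C word_pure w)
      = T.twist (\<lambda>m w. \<phi> (m \<otimes>\<^sub>C word_pure w)) m (map (arr_map \<alpha>) u @ [arr_map \<alpha> c])"
    unfolding cochain_map_pure[OF T.tau_cochain[OF \<phi>] w] T.tau_pure[OF \<phi> map_cyclic_words[OF w]] by (simp add: uc)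
  also have "\<dots> = S.twist (\<lambda>m w. \<phi> (m \<otimes>\<^sub>C word_pure (map (arr_map \<alpha>) w))) m w"
    by (simp add: T.twist_snoc S.twist_snoc uc arr_map_act c)
  also have "\<dots> = S.twist (\<lambda>m w. cochain_map D \<alpha> n \<phi> (m \<otimes>\<^sub>C word_pure w)) m w"
    by (rule S.twist_cong[OF w]) (simp add: cochain_map_pure[OF \<phi>])
  finally show "cochain_map D \<alpha> n (tau H M D' n \<phi>) (m \<otimes>\<^sub>C word_pure w) = tau H M D n (cochain_map D \<alpha> n \<phi>) (m \<otimes>\<^sub>C word_pure w)"
    by (simp add: S.tau_pure[OF cochain_map_cochain[OF \<phi>] w])
qed

text \<open>Cofaces compose and act but insert no identities, so a semifunctor is enough. The last
  coface is reduced to \<open>tau\<close> and the zeroth coface.\<close>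

lemma cochain_map_delta:
  assumes \<phi>: "\<phi> \<in> cochains H M D' n" and "i \<le> Suc n"
  shows "cochain_map D \<alpha> (Suc n) (delta H M D' n i \<phi>) = delta H M D n i (cochain_map D \<alpha> n \<phi>)"
proof -
  have *: "cochain_map D \<alpha> (Suc n) (delta H M D' n i \<phi>) = delta H M D n i (cochain_map D \<alpha> n \<phi>)" if i: "i \<le> n" for i
  proof (rule S.cochain_eqI)
    show "cochain_map D \<alpha> (Suc n) (delta H M D' n i \<phi>) \<in> cochains H M D (Suc n)"
        "delta H M D n i (cochain_map D \<alpha> n \<phi>) \<in> cochains H M D (Suc n)"
      using i by (auto intro!: cochain_map_cochain S.delta_cochain T.delta_cochain \<phi>)
    fix m w assume w: "w \<in> cyclic_words D (Suc n)"
    from S.cyclic_words_split[OF w i] obtain u b a v where uv: "w = u @ b # a # v" "length u = i"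
      and cyc: "arr_src b = arr_tgt a" "u @ arr_comp D b a # v \<in> cyclic_words D n" .
    have "merge D' i (map (arr_map \<alpha>) w) = map (arr_map \<alpha>) (merge D i w)"
      using cyclic_words_arrow[OF w] cyc(1) uv merge_append[of D' "map (arr_map \<alpha>) u"] merge_append[of D u]
      by (auto simp: arr_map_comp)
    then show "cochain_map D \<alpha> (Suc n) (delta H M D' n i \<phi>) (m \<otimes>\<^sub>C word_pure w) =
        delta H M D n i (cochain_map D \<alpha> n \<phi>) (m \<otimes>\<^sub>C word_pure w)"
      using w i \<phi> map_cyclic_words[OF w] S.merge_cyclic_words[OF w i]
      by (simp add: cochain_map_pure T.delta_cochain T.delta_pure S.delta_pure cochain_map_cochain)
  qed
  show ?thesis
  proof (cases "i \<le> n")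
    case False
    then have i: "i = Suc n" using assms by simp
    show ?thesis
      using *[of 0] cochain_map_tau[OF T.delta_cochain[OF \<phi>, of 0]]
      by (simp add: i T.delta_last[OF \<phi>] S.delta_last[OF cochain_map_cochain[OF \<phi>]])
  qed (rule *)
qed

lemma linear_cochain_map: "linear_map (cochains H M D' n) (cochains H M D n) (cochain_map D \<alpha> n)"
  unfolding linear_map_def linear_on_def
proof (intro conjI ballI allI funcsetI cochain_map_cochain)
  note scale = cvs.subspace_scale[OF T.subspace_cochains] cvs.subspace_scale[OF S.subspace_cochains]
  note add = cvs.subspace_add[OF T.subspace_cochains] cvs.subspace_add[OF S.subspace_cochains]
  fix \<phi> c
  assume \<phi>: "\<phi> \<in> cochains H M D' n"
  show "cochain_map D \<alpha> n (c *\<^sub>C \<phi>) = c *\<^sub>C cochain_map D \<alpha> n \<phi>"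
  proof (rule S.cochain_eqI)
    show "cochain_map D \<alpha> n (c *\<^sub>C \<phi>) (m \<otimes>\<^sub>C word_pure w) = (c *\<^sub>C cochain_map D \<alpha> n \<phi>) (m \<otimes>\<^sub>C word_pure w)"
      if "w \<in> cyclic_words D n" for m w
      unfolding scaleC_fun_def[of c "cochain_map D \<alpha> n \<phi>"] cochain_map_pure[OF scale(1)[OF \<phi>] that] cochain_map_pure[OF \<phi> that]
      by (simp add: scaleC_fun_def)
  qed (intro scale cochain_map_cochain \<phi>)+
  fix \<psi> assume \<psi>: "\<psi> \<in> cochains H M D' n"
  show "cochain_map D \<alpha> n (\<phi> + \<psi>) = cochain_map D \<alpha> n \<phi> + cochain_map D \<alpha> n \<psi>"
    by (rule S.cochain_eqI[of _ n]) (simp_all add: \<phi> \<psi> cochain_map_cochain add cochain_map_pure)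
qed

lemma cochain_map_b:
  assumes \<phi>: "\<phi> \<in> cochains H M D' n"
  shows "cochain_map D \<alpha> (Suc n) (T.cocyc.b n \<phi>) = S.cocyc.b n (cochain_map D \<alpha> n \<phi>)"
    and "cochain_map D \<alpha> (Suc n) (T.cocyc.b' n \<phi>) = S.cocyc.b' n (cochain_map D \<alpha> n \<phi>)"
proof -
  note D = T.delta_cochain[OF \<phi>] and mem = cvs.subspace_scale[OF T.subspace_cochains]
  note L = linear_cochain_map
  show "cochain_map D \<alpha> (Suc n) (T.cocyc.b n \<phi>) = S.cocyc.b n (cochain_map D \<alpha> n \<phi>)"
      "cochain_map D \<alpha> (Suc n) (T.cocyc.b' n \<phi>) = S.cocyc.b' n (cochain_map D \<alpha> n \<phi>)"
    unfolding T.cocyc.b_def S.cocyc.b_def T.cocyc.b'_def S.cocyc.b'_def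
    by (subst linear_map_sum[OF L T.subspace_cochains];
        auto simp: linear_map_scale[OF L] D mem cochain_map_delta[OF \<phi>] intro!: sum.cong simp del: sum.atMost_Suc)+
qed

lemma cochain_map_l:
  "\<phi> \<in> cochains H M D' n \<Longrightarrow> cochain_map D \<alpha> n (T.cocyc.l n \<phi>) = S.cocyc.l n (cochain_map D \<alpha> n \<phi>)"
  by (simp add: T.cocyc.l_def S.cocyc.l_def linear_map_scale[OF linear_cochain_map] T.tau_cochain cochain_map_tau)

lemma cochain_map_N:
  assumes \<phi>: "\<phi> \<in> cochains H M D' n"
  shows "cochain_map D \<alpha> n (T.cocyc.N n \<phi>) = S.cocyc.N n (cochain_map D \<alpha> n \<phi>)"
proof -
  have "cochain_map D \<alpha> n ((T.cocyc.l n ^^ k) \<phi>) = (S.cocyc.l n ^^ k) (cochain_map D \<alpha> n \<phi>)" for k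
    by (induction k) (simp_all add: cochain_map_l T.cocyc.funpow_mem[OF \<phi>])
  then show ?thesis
    unfolding T.cocyc.N_def S.cocyc.N_def
    by (subst linear_map_sum[OF linear_cochain_map T.subspace_cochains]) (simp_all add: T.cocyc.funpow_mem[OF \<phi>])
qed

lemma double_complex_morphism_cochain_map:
  "double_complex_morphism (cyclic_double_complex H M D') (cyclic_double_complex H M D) (\<lambda>p q. cochain_map D \<alpha> q)"
proof -
  have neg: "cochain_map D \<alpha> n (- \<phi>) = - cochain_map D \<alpha> n \<phi>" if "\<phi> \<in> cochains H M D' n" for n \<phi>
    using linear_map_scale[OF linear_cochain_map that, of "-1"] by (simp add: cvs.scale_minus_left scaleC_one)
  have diff: "cochain_map D \<alpha> n (\<phi> - \<psi>) = cochain_map D \<alpha> n \<phi> - cochain_map D \<alpha> n \<psi>"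
    if "\<phi> \<in> cochains H M D' n" "\<psi> \<in> cochains H M D' n" for n \<phi> \<psi>
    by (rule linear_map_diff[OF linear_cochain_map T.subspace_cochains that])
  show ?thesis
    unfolding double_complex_morphism_def
    using T.double_complex_cyclic S.double_complex_cyclic linear_cochain_map T.cocyc.mem
    by (auto simp: cyclic_double_complex_def T.hoch_b_eq S.hoch_b_eq T.hoch_b'_eq S.hoch_b'_eq
        T.one_minus_lambda_eq S.one_minus_lambda_eq T.norm_op_eq S.norm_op_eq cochain_map_b cochain_map_l
        cochain_map_N neg diff)
qed

lemma cochain_map_cocycle:
  assumes "\<phi> \<in> cyclic_cocycles H M D' n"
  shows "cochain_map D \<alpha> n \<phi> \<in> cyclic_cocycles H M D n"
  using assms linear_map_zero[OF linear_cochain_map T.subspace_cochains, of "Suc n"]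
  by (auto simp: T.cyclic_cocycles_iff S.cyclic_cocycles_iff cochain_map_cochain
      simp flip: cochain_map_l cochain_map_b)

lemma cochain_map_coboundary:
  assumes "\<phi> \<in> cyclic_coboundaries H M D' n"
  shows "cochain_map D \<alpha> n \<phi> \<in> cyclic_coboundaries H M D n"
proof (cases n)
  case 0
  then show ?thesis
    using assms linear_map_zero[OF linear_cochain_map T.subspace_cochains] by (auto simp: cyclic_coboundaries_def)
next
  case (Suc k)
  then obtain \<psi> where \<psi>: "\<psi> \<in> cyclic_cochains H M D' k" "\<phi> = hoch_b H M D' k \<psi>"
    using assms by (auto simp: cyclic_coboundaries_def)
  then have "cochain_map D \<alpha> k \<psi> \<in> cyclic_cochains H M D k" "cochain_map D \<alpha> n \<phi> = hoch_b H M D k (cochain_map D \<alpha> k \<psi>)"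
    using Suc by (auto simp: T.cyclic_cochains_iff S.cyclic_cochains_iff cochain_map_cochain T.hoch_b_eq S.hoch_b_eq
        cochain_map_b simp flip: cochain_map_l)
  then show ?thesis using Suc by (auto simp: cyclic_coboundaries_def)
qed

lemma cocycle_cochain: "\<phi> \<in> cyclic_cocycles H M D' n \<Longrightarrow> \<phi> \<in> cochains H M D' n"
  by (simp add: T.cyclic_cocycles_iff)

lemma HC_map_class:
  assumes \<phi>: "\<phi> \<in> cyclic_cocycles H M D' n"
  shows "HC_map H M D \<alpha> n (\<phi> +o cyclic_coboundaries H M D' n) = cochain_map D \<alpha> n \<phi> +o cyclic_coboundaries H M D n"
  unfolding HC_map_def
proof (rule image_coset[OF T.subspace_cyclic_coboundaries _ S.subspace_cyclic_coboundaries])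
  show "cochain_map D \<alpha> n (\<phi> + \<psi>) = cochain_map D \<alpha> n \<phi> + cochain_map D \<alpha> n \<psi>" if "\<psi> \<in> cyclic_coboundaries H M D' n" for \<psi>
    using that T.cyclic_coboundaries_cocycles \<phi> by (intro linear_map_add[OF linear_cochain_map] cocycle_cochain) auto
qed (use cochain_map_coboundary in auto)

lemma module_linear_HC_map: "module_linear (HC H M D' n) (HC H M D n) (HC_map H M D \<alpha> n)"
proof -
  note Z = T.subspace_cyclic_cocycles[of n] and add = coset_add[OF T.subspace_cyclic_coboundaries] coset_add[OF S.subspace_cyclic_coboundaries]
    and scale = coset_scale[OF T.subspace_cyclic_coboundaries] coset_scale[OF S.subspace_cyclic_coboundaries]
  note L = linear_map_add[OF linear_cochain_map] linear_map_scale[OF linear_cochain_map]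
  show ?thesis
    unfolding module_linear_def
  proof (intro conjI ballI allI funcsetI)
    fix K c assume "K \<in> carrier (HC H M D' n)"
    then obtain \<phi> where \<phi>: "\<phi> \<in> cyclic_cocycles H M D' n" "K = \<phi> +o cyclic_coboundaries H M D' n"
      by (auto simp: HC_def quotient_space_def)
    show "HC_map H M D \<alpha> n K \<in> carrier (HC H M D n)"
      using \<phi> cochain_map_cocycle by (auto simp: HC_map_class HC_def quotient_space_def)
    show "HC_map H M D \<alpha> n (c \<odot>\<^bsub>HC H M D' n\<^esub> K) = c \<odot>\<^bsub>HC H M D n\<^esub> HC_map H M D \<alpha> n K"
      using HC_map_class[OF cvs.subspace_scale[OF Z \<phi>(1), of c]] \<phi> L(2)[OF cocycle_cochain[OF \<phi>(1)]]
      by (simp add: HC_map_class HC_def quotient_space_def scale)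
    fix K' assume "K' \<in> carrier (HC H M D' n)"
    then obtain \<psi> where \<psi>: "\<psi> \<in> cyclic_cocycles H M D' n" "K' = \<psi> +o cyclic_coboundaries H M D' n"
      by (auto simp: HC_def quotient_space_def)
    show "HC_map H M D \<alpha> n (K \<oplus>\<^bsub>HC H M D' n\<^esub> K') = HC_map H M D \<alpha> n K \<oplus>\<^bsub>HC H M D n\<^esub> HC_map H M D \<alpha> n K'"
      using HC_map_class[OF cvs.subspace_add[OF Z \<phi>(1) \<psi>(1)]] \<phi> \<psi> L(1)[OF cocycle_cochain[OF \<phi>(1)] cocycle_cochain[OF \<psi>(1)]]
      by (simp add: HC_map_class HC_def quotient_space_def add)
  qed
qed

end

section \<open>Compatibility with identities and composition\<close>

lemma H_semifunctor_comp:
  "H_semifunctor D D' \<alpha> \<Longrightarrow> H_semifunctor D' D'' \<beta> \<Longrightarrow> H_semifunctor D D'' (comp_semifun \<beta> \<alpha>)"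
  unfolding H_semifunctor_def comp_semifun_def
  by (auto simp: Pi_iff linear_map_def linear_on_def)

lemma arr_map_comp_semifun: "arr_map (comp_semifun \<beta> \<alpha>) = arr_map \<beta> \<circ> arr_map \<alpha>"
  by (rule ext) (simp add: arr_map_def comp_semifun_def)

lemma cochain_map_comp_semifun:
  assumes "hopf_semifunctor H M D D' \<alpha>" "hopf_semifunctor H M D' D'' \<beta>" "\<phi> \<in> cochains H M D'' n"
  shows "cochain_map D (comp_semifun \<beta> \<alpha>) n \<phi> = cochain_map D \<alpha> n (cochain_map D' \<beta> n \<phi>)"
proof -
  interpret A: hopf_semifunctor H M D D' \<alpha> by fact
  interpret B: hopf_semifunctor H M D' D'' \<beta> by fact
  interpret C: hopf_semifunctor H M D D'' "comp_semifun \<beta> \<alpha>"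
    by (intro hopf_semifunctor.intro hopf_semifunctor_axioms.intro H_semifunctor_comp[OF A.semifunctor B.semifunctor]
        A.S.hopf_cyclic_axioms B.T.hopf_cyclic_axioms)
  show ?thesis
    by (rule A.S.cochain_eqI[of _ n])
      (simp_all add: assms C.cochain_map_cochain A.cochain_map_cochain B.cochain_map_cochain
        C.cochain_map_pure A.cochain_map_pure B.cochain_map_pure A.map_cyclic_words arr_map_comp_semifun)
qed

lemma HC_map_comp_semifun:
  assumes "hopf_semifunctor H M D D' \<alpha>" "hopf_semifunctor H M D' D'' \<beta>" "K \<in> carrier (HC H M D'' n)"
  shows "HC_map H M D (comp_semifun \<beta> \<alpha>) n K = HC_map H M D \<alpha> n (HC_map H M D' \<beta> n K)"
proof -
  interpret A: hopf_semifunctor H M D D' \<alpha> by fact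
  interpret B: hopf_semifunctor H M D' D'' \<beta> by fact
  interpret C: hopf_semifunctor H M D D'' "comp_semifun \<beta> \<alpha>"
    by (intro hopf_semifunctor.intro hopf_semifunctor_axioms.intro H_semifunctor_comp[OF A.semifunctor B.semifunctor]
        A.S.hopf_cyclic_axioms B.T.hopf_cyclic_axioms)
  obtain \<phi> where \<phi>: "\<phi> \<in> cyclic_cocycles H M D'' n" "K = \<phi> +o cyclic_coboundaries H M D'' n"
    using assms(3) by (auto simp: HC_def quotient_space_def)
  show ?thesis
    using \<phi> cochain_map_comp_semifun[OF assms(1,2) B.cocycle_cochain[OF \<phi>(1)]]
    by (simp add: C.HC_map_class B.HC_map_class A.HC_map_class B.cochain_map_cocycle)
qed

lemma sum_apply: "(\<Sum>i\<in>A. f i) x = (\<Sum>i\<in>A. f i x :: 'a::comm_monoid_add)"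
  by (induction A rule: infinite_finite_induct) auto

lemma (in hcategory) multilinear_on_cong:
  assumes "multilinear_on D L G" "\<And>w. map fst w = L \<Longrightarrow> \<forall>a\<in>set w. is_arrow D a \<Longrightarrow> F w = G w"
  shows "multilinear_on D L F"
  unfolding multilinear_on_def
proof (intro allI impI)
  fix us i vs
  assume *: "map fst us @ i # map fst vs = L \<and> fst i \<in> Ob D \<and> snd i \<in> Ob D \<and> (\<forall>a\<in>set us \<union> set vs. is_arrow D a)"
  then have G: "linear_on (Hom D (fst i) (snd i)) (\<lambda>f. G (us @ (i, f) # vs))"
    using assms(1) unfolding multilinear_on_def by blast
  have FG: "f \<in> Hom D (fst i) (snd i) \<Longrightarrow> F (us @ (i, f) # vs) = G (us @ (i, f) # vs)" for f
    using * by (intro assms(2)) (auto simp: is_arrow_def)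
  have "cvs.subspace (Hom D (fst i) (snd i))" using * subspace_Hom by blast
  then show "linear_on (Hom D (fst i) (snd i)) (\<lambda>f. F (us @ (i, f) # vs))"
    using G by (simp add: linear_on_def FG cvs.subspace_add cvs.subspace_scale)
qed

context hopf_cyclic
begin

lemma id_semifunctor: "H_semifunctor D D id_semifun"
  by (auto simp: H_semifunctor_def id_semifun_def linear_map_def linear_on_def)

lemma HC_map_id:
  assumes "K \<in> carrier (HC H M D n)" shows "HC_map H M D id_semifun n K = K"
proof -
  interpret I: hopf_semifunctor H M D D id_semifun
    by unfold_locales (rule id_semifunctor)
  obtain \<phi> where \<phi>: "\<phi> \<in> cyclic_cocycles H M D n" "K = \<phi> +o cyclic_coboundaries H M D n"
    using assms by (auto simp: HC_def quotient_space_def)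
  have am: "arr_map id_semifun = (\<lambda>a. a)" by (auto simp: arr_map_def id_semifun_def)
  have "cochain_map D id_semifun n \<phi> = \<phi>"
    using I.cocycle_cochain[OF \<phi>(1)]
    by (intro cochain_eqI[of _ n]) (simp_all add: I.cochain_map_cochain I.cochain_map_pure am)
  then show ?thesis using \<phi> by (simp add: I.HC_map_class)
qed

section \<open>Identities, invariant isomorphisms and exactness for the truncated coboundary\<close>

lemma Id_Hom: "X \<in> Ob D \<Longrightarrow> hcat.Id D X \<in> Hom D X X"
  and Comp_Id: "X \<in> Ob D \<Longrightarrow> Y \<in> Ob D \<Longrightarrow> f \<in> Hom D X Y \<Longrightarrow> Comp D X Y Y (hcat.Id D Y) f = f"
    "X \<in> Ob D \<Longrightarrow> Y \<in> Ob D \<Longrightarrow> f \<in> Hom D X Y \<Longrightarrow> Comp D X X Y f (hcat.Id D X) = f"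
  using klin by (simp_all add: k_linear_category_def)

lemma Act_Id: "X \<in> Ob D \<Longrightarrow> Act D X X h (hcat.Id D X) = \<epsilon> h *\<^sub>C hcat.Id D X"
  using hcat by (simp add: left_H_category_def)

lemma Comp_assoc:
  "W \<in> Ob D \<Longrightarrow> X \<in> Ob D \<Longrightarrow> Y \<in> Ob D \<Longrightarrow> Z \<in> Ob D \<Longrightarrow> f \<in> Hom D W X \<Longrightarrow> g \<in> Hom D X Y \<Longrightarrow> h \<in> Hom D Y Z \<Longrightarrow>
    Comp D W Y Z h (Comp D W X Y g f) = Comp D W X Z (Comp D X Y Z h g) f"
  using klin by (simp add: k_linear_category_def)

definition id_arrow :: "'o \<Rightarrow> ('o, 'f) arrow" where
  "id_arrow X = ((X, X), hcat.Id D X)"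

definition cons_id :: "('o, 'f) arrow list \<Rightarrow> ('o, 'f) arrow list" where
  "cons_id w = id_arrow (arr_tgt (hd w)) # w"

lemma is_arrow_id: "X \<in> Ob D \<Longrightarrow> is_arrow D (id_arrow X)"
  by (simp add: id_arrow_def is_arrow_def Id_Hom)

lemma cons_id_cyclic_words:
  assumes w: "w \<in> cyclic_words D n" shows "cons_id w \<in> cyclic_words D (Suc n)"
proof -
  obtain a v where av: "w = a # v" using w by (cases w) (auto simp: cyclic_words_iff)
  have "arr_tgt a \<in> Ob D" using w av by (auto simp: cyclic_words_iff is_arrow_def)
  then show ?thesis
    using w is_arrow_id[of "arr_tgt a"]
    by (auto simp: av cons_id_def cyclic_words_iff linked_def id_arrow_def)
qed

text \<open>Inserting an identity in front contracts the complex with differential \<open>b'\<close>.\<close>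
lemma bar_exact:
  assumes \<phi>: "\<phi> \<in> cochains H M D (Suc n)" and bar: "cocyc.b' (Suc n) \<phi> = 0"
  shows "\<exists>\<psi>\<in>cochains H M D n. cocyc.b' n \<psi> = \<phi>"
proof -
  let ?F = "\<lambda>m w. \<phi> (m \<otimes>\<^sub>C word_pure w)"
  let ?G = "\<lambda>m w. ?F m (cons_id w)"
  note F = cochain_multilinear[OF \<phi>]
  have ml: "multilinear_values D n ?G"
    unfolding multilinear_values_def
  proof (intro conjI allI ballI)
    fix m w assume w: "w \<in> cyclic_words D n"
    show "clinear (\<lambda>m. ?G m w)"
      by (rule values_clinear[OF F cons_id_cyclic_words[OF w]])
    obtain a v where av: "w = a # v" using w by (cases w) (auto simp: cyclic_words_iff)
    have a: "arr_tgt a \<in> Ob D" using w av by (auto simp: cyclic_words_iff is_arrow_def)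
    have "multilinear_on D (map fst w) (\<lambda>u. ?F m (id_arrow (arr_tgt a) # u))"
      using values_multilinear_on[OF F cons_id_cyclic_words[OF w], of m] is_arrow_id[OF a]
      by (intro multilinear_on_Cons) (simp_all add: cons_id_def av)
    then show "multilinear_on D (map fst w) (?G m)"
      by (rule multilinear_on_cong) (auto simp: cons_id_def av)
  qed
  have "invariant_values n ?G"
    unfolding invariant_values_def
  proof (intro allI ballI)
    fix m h w assume w: "w \<in> cyclic_words D n"
    obtain a v where av: "w = a # v" using w by (cases w) (auto simp: cyclic_words_iff)
    have a: "arr_tgt a \<in> Ob D" using w av by (auto simp: cyclic_words_iff is_arrow_def)
    have "?G (ract M m h) w = hact H D (id_arrow (arr_tgt a) # w) (?F m) h"
      using cochain_invariant[OF \<phi> cons_id_cyclic_words[OF w]] by (simp add: cons_id_def av)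
    also have "\<dots> = hact H D w (\<lambda>u. ?F m (id_arrow (arr_tgt a) # u)) h"
      using values_multilinear_on[OF F cons_id_cyclic_words[OF w], of m]
      by (intro hact_invariant is_arrow_id a cyclic_words_arrow[OF w])
        (auto simp: cons_id_def av arr_act_def id_arrow_def Act_Id a)
    also have "\<dots> = hact H D w (?G m) h"
      by (intro hact_cong cyclic_words_arrow[OF w]) (auto simp: cons_id_def av)
    finally show "?G (ract M m h) w = hact H D w (?G m) h" .
  qed
  then have \<psi>: "functional_of D n ?G \<in> cochains H M D n" by (rule functional_of_cochain[OF ml])
  have pure: "functional_of D n ?G (m \<otimes>\<^sub>C word_pure w) = ?G m w" if "w \<in> cyclic_words D n" for m w
    by (rule functional_of_pure[OF subspace_Hom ml that])
  have "cocyc.b' n (functional_of D n ?G) = \<phi>"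
  proof (rule cochain_eqI[OF cocyc.mem(2)[OF \<psi>] \<phi>])
    fix m w assume w: "w \<in> cyclic_words D (Suc n)"
    obtain a v where av: "w = a # v" using w by (cases w) (auto simp: cyclic_words_iff)
    have a: "is_arrow D a" using w av by (auto simp: cyclic_words_iff)
    have first: "merge D 0 (cons_id w) = w"
      using a by (cases a) (auto simp: av cons_id_def id_arrow_def merge_def arr_comp_def is_arrow_def Comp_Id)
    have later: "merge D (Suc j) (cons_id w) = cons_id (merge D j w)" if "j \<le> n" for j
    proof (cases j)
      case 0
      then obtain c v' where "v = c # v'" using w av by (cases v) (auto simp: cyclic_words_iff)
      then show ?thesis using 0 by (simp add: av cons_id_def merge_def arr_comp_def)
    next
      case (Suc k)
      then show ?thesis by (simp add: av cons_id_def)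
    qed
    \<comment> \<open>Evaluate b' \<phi> = 0 on the word with an identity in front. The zeroth
      coface composes the identity away and returns \<phi>; the others sit one place further right,
      which gives -b' of the new cochain.\<close>
    have "0 = (\<Sum>j\<le>Suc n. (-1) ^ j * delta H M D (Suc n) j \<phi> (m \<otimes>\<^sub>C word_pure (cons_id w)))"
      using fun_cong[OF bar, of "m \<otimes>\<^sub>C word_pure (cons_id w)"]
      by (simp add: cocyc.b'_def scaleC_fun_def scaleC_complex_def sum_apply)
    also have "\<dots> = (\<Sum>j\<le>Suc n. (-1) ^ j * ?F m (merge D j (cons_id w)))"
      by (intro sum.cong refl) (simp add: delta_pure[OF \<phi> _ cons_id_cyclic_words[OF w]])
    also have "\<dots> = ?F m w - (\<Sum>j\<le>n. (-1) ^ j * ?G m (merge D j w))"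
      unfolding sum.atMost_Suc_shift by (simp add: first later sum_negf)
    also have "(\<Sum>j\<le>n. (-1) ^ j * ?G m (merge D j w)) = cocyc.b' n (functional_of D n ?G) (m \<otimes>\<^sub>C word_pure w)"
      using w by (simp add: cocyc.b'_def scaleC_fun_def scaleC_complex_def delta_pure[OF \<psi>] pure merge_cyclic_words sum_apply)
    finally show "cocyc.b' n (functional_of D n ?G) (m \<otimes>\<^sub>C word_pure w) = \<phi> (m \<otimes>\<^sub>C word_pure w)" by simp
  qed
  then show ?thesis using \<psi> by blast
qed

text \<open>In the equivariance formula the invariant factor turns its component of the coproduct
  into a counit, and the counit axiom leaves h on the other factor.\<close>

lemma Act_Comp_invariant:
  assumes o: "X \<in> Ob D" "Y \<in> Ob D" "Z \<in> Ob D" and f: "f \<in> Hom D X Y" and g: "g \<in> Hom D Y Z"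
  shows "(\<And>h. Act D Y Z h g = \<epsilon> h *\<^sub>C g) \<Longrightarrow> Act D X Z h (Comp D X Y Z g f) = Comp D X Y Z g (Act D X Y h f)"
    and "(\<And>h. Act D X Y h f = \<epsilon> h *\<^sub>C f) \<Longrightarrow> Act D X Z h (Comp D X Y Z g f) = Comp D X Y Z (Act D Y Z h g) f"
proof -
  have 1: "clinear (\<lambda>h. Comp D X Y Z g (Act D X Y h f))"
    using clinear_Act[OF o(1,2) f] Comp_linear(1)[OF o g] Act_Hom[OF o(1,2) f]
    by (simp add: clinear_iff linear_on_def)
  have 2: "clinear (\<lambda>h. Comp D X Y Z (Act D Y Z h g) f)"
    using clinear_Act[OF o(2,3) g] Comp_linear(2)[OF o f] Act_Hom[OF o(2,3) g]
    by (simp add: clinear_iff linear_on_def)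
  have s1: "Comp D X Y Z (c *\<^sub>C g) f' = c *\<^sub>C Comp D X Y Z g f'" if "f' \<in> Hom D X Y" for c f'
    using Comp_linear(2)[OF o that] g by (simp add: linear_on_def)
  have s2: "Comp D X Y Z g' (c *\<^sub>C f) = c *\<^sub>C Comp D X Y Z g' f" if "g' \<in> Hom D Y Z" for c g'
    using Comp_linear(1)[OF o that] f by (simp add: linear_on_def)
  show "Act D X Z h (Comp D X Y Z g f) = Comp D X Y Z g (Act D X Y h f)" if "\<And>h. Act D Y Z h g = \<epsilon> h *\<^sub>C g"
    using counit_left[OF 1, of h] by (simp add: Act_Comp[OF o f g] that s1 Act_Hom[OF o(1,2) f])
  show "Act D X Z h (Comp D X Y Z g f) = Comp D X Y Z (Act D Y Z h g) f" if "\<And>h. Act D X Y h f = \<epsilon> h *\<^sub>C f"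
    using counit_right[OF 2, of h] by (simp add: Act_Comp[OF o f g] that s2 Act_Hom[OF o(2,3) g])
qed

definition is_unit :: "'o \<Rightarrow> 'f \<Rightarrow> bool" where
  "is_unit X u \<longleftrightarrow> u \<in> Aut D X \<and> (\<forall>h. Act D X X h u = \<epsilon> h *\<^sub>C u)"

lemma inverse_arrows_inv_arrow:
  assumes X: "X \<in> Ob D" and u: "u \<in> Aut D X"
  shows "inverse_arrows D X u (inv_arrow D X u)"
proof -
  obtain v where v: "inverse_arrows D X u v" using u by (auto simp: Aut_def)
  have "v' = v" if v': "inverse_arrows D X u v'" for v'
  proof -
    have "v' = Comp D X X X v' (Comp D X X X u v)"
      using v v' Comp_Id X by (simp add: inverse_arrows_def)
    also have "\<dots> = Comp D X X X (Comp D X X X v' u) v"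
      using v v' X by (intro Comp_assoc) (auto simp: inverse_arrows_def)
    also have "\<dots> = v" using v v' Comp_Id X by (simp add: inverse_arrows_def)
    finally show ?thesis .
  qed
  then show ?thesis unfolding inv_arrow_def by (rule theI[of "inverse_arrows D X u", OF v])
qed

text \<open>Invariance of u gives u (h u^{-1}) = h (u u^{-1}) = \<epsilon>(h) 1; composing with
  u^{-1} on the left isolates h u^{-1}.\<close>

lemma is_unit_inv:
  assumes X: "X \<in> Ob D" and u: "is_unit X u"
  shows "Act D X X h (inv_arrow D X u) = \<epsilon> h *\<^sub>C inv_arrow D X u"
proof -
  let ?v = "inv_arrow D X u"
  have v: "u \<in> Hom D X X" "?v \<in> Hom D X X" "Comp D X X X u ?v = hcat.Id D X" "Comp D X X X ?v u = hcat.Id D X"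
    using inverse_arrows_inv_arrow[OF X] u by (auto simp: is_unit_def inverse_arrows_def)
  note Av = Act_Hom[OF X X v(2), of h]
  have "Act D X X h ?v = Comp D X X X (Comp D X X X ?v u) (Act D X X h ?v)"
    using v Comp_Id[OF X X Av] by simp
  also have "\<dots> = Comp D X X X ?v (Comp D X X X u (Act D X X h ?v))"
    by (rule Comp_assoc[OF X X X X Av v(1,2), symmetric])
  also have "Comp D X X X u (Act D X X h ?v) = Act D X X h (Comp D X X X u ?v)"
    using u by (intro Act_Comp_invariant(1)[symmetric] X v) (auto simp: is_unit_def)
  also have "\<dots> = \<epsilon> h *\<^sub>C hcat.Id D X" by (simp add: v Act_Id X)
  also have "Comp D X X X ?v \<dots> = \<epsilon> h *\<^sub>C ?v"
    using Comp_linear(1)[OF X X X v(2)] Comp_Id(2)[OF X X v(2)] Id_Hom[OF X] by (simp add: linear_on_def)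
  finally show ?thesis .
qed

lemma is_unit_Id: "X \<in> Ob D \<Longrightarrow> is_unit X (hcat.Id D X)"
  using Id_Hom Comp_Id by (auto simp: is_unit_def Aut_def inverse_arrows_def Act_Id intro!: exI[of _ "hcat.Id D X"])

lemma inv_arrow_Id: "X \<in> Ob D \<Longrightarrow> inv_arrow D X (hcat.Id D X) = hcat.Id D X"
  using inverse_arrows_inv_arrow[of X "hcat.Id D X"] is_unit_Id[of X] Comp_Id[of X X]
  by (auto simp: is_unit_def inverse_arrows_def)

end

section \<open>Two copies of every object\<close>

text \<open>The flag does not enter the Hom spaces. The doubled category is therefore equivalent to
  \<open>D\<close>, and the identity of an object also serves as an isomorphism between its two
  copies.\<close>

definition double_hcat :: "('o, 'f, 'h) hcat \<Rightarrow> ('o \<times> bool, 'f, 'h) hcat" where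
  "double_hcat D = \<lparr>Ob = Ob D \<times> UNIV, Hom = (\<lambda>X Y. Hom D (fst X) (fst Y)),
     Comp = (\<lambda>X Y Z. Comp D (fst X) (fst Y) (fst Z)), Id = (\<lambda>X. hcat.Id D (fst X)),
     Act = (\<lambda>X Y. Act D (fst X) (fst Y))\<rparr>"

lemma double_hcat_simps [simp]:
  "Ob (double_hcat D) = Ob D \<times> UNIV" "Hom (double_hcat D) X Y = Hom D (fst X) (fst Y)"
  "Comp (double_hcat D) X Y Z = Comp D (fst X) (fst Y) (fst Z)" "hcat.Id (double_hcat D) X = hcat.Id D (fst X)"
  "Act (double_hcat D) X Y = Act D (fst X) (fst Y)"
  by (simp_all add: double_hcat_def)

text \<open>The idempotent p of the overview.\<close>

definition collapse :: "('o \<times> bool, 'f, 'o \<times> bool, 'f) semifun" where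
  "collapse = \<lparr>on_ob = (\<lambda>X. (fst X, False)), on_hom = (\<lambda>X Y f. f)\<rparr>"

text \<open>The embeddings i_0 and i_1 of the overview, for \<open>False\<close> and
  \<open>True\<close>.\<close>

definition inclusion :: "bool \<Rightarrow> ('o, 'f, 'o \<times> bool, 'f) semifun" where
  "inclusion e = \<lparr>on_ob = (\<lambda>X. (X, e)), on_hom = (\<lambda>X Y f. f)\<rparr>"

definition low_head :: "('o \<times> bool, 'f) arrow list \<Rightarrow> ('o \<times> bool, 'f) arrow list" where
  "low_head w = ((arr_src (hd w), (fst (arr_tgt (hd w)), False)), snd (hd w)) # tl w"

text \<open>The component, at the source of \<open>a\<close>, of the natural isomorphism from
  \<open>collapse\<close> to the identity functor.\<close>

definition link :: "('o, 'f, 'h) hcat \<Rightarrow> ('o \<times> bool, 'f) arrow \<Rightarrow> ('o \<times> bool, 'f) arrow" where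
  "link D a = (((fst (arr_src a), False), arr_src a), hcat.Id D (fst (arr_src a)))"

text \<open>The homotopy inserts the isomorphism between the two copies of the source of the \<open>i\<close>-th factor and
  moves all later factors to the copy \<open>False\<close>; \<open>low_head\<close> closes the resulting cyclic word.\<close>
primrec insert_link :: "('o, 'f, 'h) hcat \<Rightarrow> nat \<Rightarrow> ('o \<times> bool, 'f) arrow list \<Rightarrow> ('o \<times> bool, 'f) arrow list" where
  "insert_link D 0 w = hd w # link D (hd w) # map (arr_map collapse) (tl w)"
| "insert_link D (Suc i) w = hd w # insert_link D i (tl w)"

lemma low_head_Cons [simp]: "low_head (a # v) = ((arr_src a, (fst (arr_tgt a), False)), snd a) # v"
  by (simp add: low_head_def)

lemma link_simps [simp]: "arr_src (link D a) = (fst (arr_src a), False)" "arr_tgt (link D a) = arr_src a"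
  "snd (link D a) = hcat.Id D (fst (arr_src a))"
  by (simp_all add: link_def)

lemma link_cong: "arr_src a = arr_src b \<Longrightarrow> link D a = link D b"
  by (simp add: link_def)

lemma collapse_simps [simp]: "fst (arr_map collapse a) = ((fst (arr_src a), False), (fst (arr_tgt a), False))"
  "snd (arr_map collapse a) = snd a"
  by (simp_all add: arr_map_def collapse_def)

lemma linked_map_fst:
  "w \<noteq> [] \<Longrightarrow> linked (map fst w) \<longleftrightarrow> successively (\<lambda>a b. arr_src a = arr_tgt b) w \<and> arr_src (last w) = arr_tgt (hd w)"
  by (simp add: linked_def successively_map last_map hd_map)

lemma insert_link_Nil [simp]: "insert_link D i w \<noteq> []"
  by (cases i) auto

lemma hd_insert_link [simp]: "hd (insert_link D i w) = hd w"
  by (cases i) auto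

lemma length_insert_link: "i < length w \<Longrightarrow> length (insert_link D i w) = Suc (length w)"
  by (induction i arbitrary: w) auto

text \<open>The link depends on a letter only through its source, so changing the target or the
  arrow of the first letter leaves the tail alone. This lets the head be lowered or composed
  freely.\<close>

lemma tl_insert_link_cong: "arr_src a = arr_src b \<Longrightarrow> tl (insert_link D i (a # v)) = tl (insert_link D i (b # v))"
  by (cases i) (auto intro: link_cong)

lemma labels_insert_link:
  "map fst w = map fst v \<Longrightarrow> i < length w \<Longrightarrow> map fst (insert_link D i w) = map fst (insert_link D i v)"
proof (induction i arbitrary: w v)
  case 0
  then obtain a w' b v' where w: "w = a # w'" "v = b # v'" "fst a = fst b" "map fst w' = map fst v'"
    by (cases w; cases v) auto
  have lab: "map fst (map (arr_map collapse) u) = map (\<lambda>i. ((fst (fst i), False), (fst (snd i), False))) (map fst u)"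
    for u :: "('a \<times> bool, 'b) arrow list" by simp
  then have "map fst (map (arr_map collapse) w') = map fst (map (arr_map collapse) v')" unfolding lab w(4) ..
  moreover have "link D a = link D b" using w by (intro link_cong) simp
  ultimately show ?case using w by simp
next
  case (Suc i)
  then obtain a w' b v' where w: "w = a # w'" "v = b # v'" "fst a = fst b" "map fst w' = map fst v'"
    by (cases w; cases v) auto
  then show ?case using Suc.IH[OF w(4)] Suc.prems by simp
qed

lemma arr_src_last_insert_link:
  "i < length w \<Longrightarrow> arr_src (last (insert_link D i w)) = (fst (arr_src (last w)), False)"
proof (induction i arbitrary: w)
  case 0
  then show ?case by (cases w rule: rev_cases; cases "butlast w") (auto simp: last_map)
next
  case (Suc i)
  then show ?case by (cases w) auto
qed

lemma successively_insert_link: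
  "i < length w \<Longrightarrow> successively (\<lambda>a b. arr_src a = arr_tgt b) w \<Longrightarrow> successively (\<lambda>a b. arr_src a = arr_tgt b) (insert_link D i w)"
proof (induction i arbitrary: w)
  case 0
  then obtain a v where w: "w = a # v" by (cases w) auto
  then have "successively (\<lambda>a b. arr_src a = arr_tgt b) (map (arr_map collapse) v)"
    using 0 unfolding successively_map by (auto simp: successively_Cons elim!: successively_mono)
  then show ?case using 0 w by (cases v) auto
next
  case (Suc i)
  then obtain a v where "w = a # v" by (cases w) auto
  then show ?case using Suc by (cases v) (auto simp: successively_Cons)
qed

lemma insert_link_snoc: "i < length w \<Longrightarrow> insert_link D i (w @ [c]) = insert_link D i w @ [arr_map collapse c]"
proof (induction i arbitrary: w)
  case 0
  then show ?case by (cases w) auto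
next
  case (Suc i)
  then show ?case by (cases w) auto
qed

lemma arr_map_collapse_comp:
  "arr_map collapse (arr_comp (double_hcat D) b a) = arr_comp (double_hcat D) (arr_map collapse b) (arr_map collapse a)"
  by (simp add: arr_map_def collapse_def arr_comp_def)

lemma merge_map_collapse:
  "Suc j < length w \<Longrightarrow> merge (double_hcat D) j (map (arr_map collapse) w) = map (arr_map collapse) (merge (double_hcat D) j w)"
  by (simp add: merge_def arr_map_collapse_comp take_map drop_map)

text \<open>A merge to the left of the link shortens the part before it, so the link moves down by
  one place.\<close>

lemma merge_insert_link_less:
  assumes "j < i" "i < length w"
  shows "merge (double_hcat D) j (insert_link D i w) = insert_link D (i - 1) (merge (double_hcat D) j w)"
  using assms
proof (induction j arbitrary: i w)
  case 0
  then obtain i' a b v where i: "i = Suc i'" "w = a # b # v" by (cases i; cases w; cases "tl w") auto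
  have "merge (double_hcat D) 0 (insert_link D i w) = arr_comp (double_hcat D) a b # tl (insert_link D i' (b # v))"
    using hd_insert_link[of D i' "b # v"] by (cases "insert_link D i' (b # v)") (auto simp: i merge_def)
  also have "\<dots> = insert_link D i' (arr_comp (double_hcat D) a b # v)"
    using tl_insert_link_cong[of b "arr_comp (double_hcat D) a b" D i' v] hd_insert_link[of D i' "arr_comp (double_hcat D) a b # v"]
    by (cases "insert_link D i' (arr_comp (double_hcat D) a b # v)") auto
  finally show ?case using i by (simp add: merge_def)
next
  case (Suc j)
  then obtain i' a v where i: "i = Suc i'" "w = a # v" by (cases i; cases w) auto
  obtain i'' where i'': "i' = Suc i''" using Suc i by (cases i') auto
  have IH: "merge (double_hcat D) j (insert_link D i' v) = insert_link D (i' - 1) (merge (double_hcat D) j v)"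
    using Suc.prems i by (intro Suc.IH) auto
  have "merge (double_hcat D) (Suc j) (insert_link D i w) = a # merge (double_hcat D) j (insert_link D i' v)"
    by (simp add: i)
  also have "\<dots> = insert_link D (i - 1) (merge (double_hcat D) (Suc j) w)"
    unfolding IH by (simp add: i i'')
  finally show ?case .
qed

text \<open>A merge beyond the link takes place inside the collapsed part, where it commutes with
  \<open>collapse\<close>.\<close>

lemma merge_insert_link_greater:
  assumes "Suc (Suc i) \<le> j" "j < length w"
  shows "merge (double_hcat D) j (insert_link D i w) = insert_link D i (merge (double_hcat D) (j - 1) w)"
  using assms
proof (induction i arbitrary: j w)
  case 0
  then obtain j' a v where j: "j = Suc (Suc j')" "w = a # v" by (cases j; cases "j - 1"; cases w) auto
  then show ?case using 0 by (simp add: merge_map_collapse)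
next
  case (Suc i)
  then obtain j' a v where j: "j = Suc (Suc j')" "w = a # v" by (cases j; cases "j - 1"; cases w) auto
  then show ?case using Suc.IH[of "Suc j'" v] Suc.prems by simp
qed

lemma low_head_merge:
  "Suc j < length w \<Longrightarrow> merge (double_hcat D) j (low_head w) = low_head (merge (double_hcat D) j w)"
proof (cases j)
  case 0
  assume "Suc j < length w"
  then obtain a b v where "w = a # b # v" using 0 by (cases w; cases "tl w") auto
  then show ?thesis using 0 by (simp add: merge_def arr_comp_def)
next
  case (Suc k)
  assume "Suc j < length w"
  then obtain a v where "w = a # v" by (cases w) auto
  then show ?thesis using Suc by simp
qed

text \<open>A separate locale for the same data: making the doubled category an instance of
  \<open>hopf_cyclic\<close> inside \<open>hopf_cyclic\<close> itself would force endless
  doubling.\<close>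

locale hopf_double = hopf_cyclic H M D
  for H :: "('h::complex_algebra_1) hopf_data" and M :: "('h, 'm::complex_vector) mod_comod"
    and D :: "('o, 'f::complex_vector, 'h) hcat"
begin

abbreviation "DD \<equiv> double_hcat D"

lemma left_H_category_double: "left_H_category H DD"
  using hcat unfolding left_H_category_def k_linear_category_def by (simp add: split_paired_Ball_Sigma)

sublocale E: hopf_cyclic H M DD
  by unfold_locales (rule left_H_category_double)

lemma is_arrow_double: "is_arrow DD a \<longleftrightarrow> fst (arr_src a) \<in> Ob D \<and> fst (arr_tgt a) \<in> Ob D \<and>
    snd a \<in> Hom D (fst (arr_src a)) (fst (arr_tgt a))"
  by (simp add: is_arrow_def mem_Times_iff)

lemma arr_act_collapse: "arr_act DD h (arr_map collapse a) = arr_map collapse (arr_act DD h a)"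
  by (simp add: arr_act_def arr_map_def collapse_def)

lemma is_arrow_collapse: "is_arrow DD a \<Longrightarrow> is_arrow DD (arr_map collapse a)"
  by (simp add: is_arrow_double)

lemma is_arrow_link: "is_arrow DD a \<Longrightarrow> is_arrow DD (link D a)"
  by (simp add: is_arrow_double Id_Hom)

lemma arrows_insert_link: "i < length w \<Longrightarrow> \<forall>a\<in>set w. is_arrow DD a \<Longrightarrow> \<forall>a\<in>set (insert_link D i w). is_arrow DD a"
proof (induction i arbitrary: w)
  case 0
  then show ?case by (cases w) (auto simp: is_arrow_collapse is_arrow_link)
next
  case (Suc i)
  then show ?case by (cases w) auto
qed

lemma arrows_low_head: "w \<noteq> [] \<Longrightarrow> \<forall>a\<in>set w. is_arrow DD a \<Longrightarrow> \<forall>a\<in>set (low_head w). is_arrow DD a"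
  by (cases w) (auto simp: is_arrow_double)

section \<open>The homotopy between collapsing and the identity\<close>

lemma insert_cyclic_words:
  assumes w: "w \<in> cyclic_words DD n" and i: "i \<le> n"
  shows "insert_link D i (low_head w) \<in> cyclic_words DD (Suc n)"
proof -
  obtain a v where av: "w = a # v" using w by (cases w) (auto simp: cyclic_words_iff)
  have s: "successively (\<lambda>a b. arr_src a = arr_tgt b) w" "arr_src (last w) = arr_tgt (hd w)"
    using w linked_map_fst[of w] av unfolding cyclic_words_iff by blast+
  have s': "successively (\<lambda>a b. arr_src a = arr_tgt b) (low_head w)"
    using s(1) by (cases v) (auto simp: av)
  have len: "i < length (low_head w)" using w i av by (simp add: cyclic_words_iff)
  have l: "arr_src (last (low_head w)) = arr_tgt (hd w)" using s(2) by (simp add: av split: if_splits)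
  show ?thesis
    unfolding cyclic_words_iff linked_map_fst[OF insert_link_Nil]
  proof (intro conjI)
    show "length (insert_link D i (low_head w)) = Suc (Suc n)"
      using length_insert_link[OF len] w by (simp add: av cyclic_words_iff)
    show "\<forall>a\<in>set (insert_link D i (low_head w)). is_arrow DD a"
      by (rule arrows_insert_link[OF len arrows_low_head[OF _ cyclic_words_arrow[OF w]]]) (simp add: av)
    show "successively (\<lambda>a b. arr_src a = arr_tgt b) (insert_link D i (low_head w))"
      by (rule successively_insert_link[OF len s'])
    show "arr_src (last (insert_link D i (low_head w))) = arr_tgt (hd (insert_link D i (low_head w)))"
      unfolding arr_src_last_insert_link[OF len] l hd_insert_link by (simp add: av)
  qed
qed

lemma multilinear_on_map_collapse:
  assumes "multilinear_on DD (map fst (map (arr_map collapse) w0)) F"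
  shows "multilinear_on DD (map fst w0) (\<lambda>w. F (map (arr_map collapse) w))"
  unfolding multilinear_on_def
proof (intro allI impI)
  fix us i vs
  let ?c = "\<lambda>i :: ('o \<times> bool) \<times> ('o \<times> bool). ((fst (fst i), False), (fst (snd i), False))"
  assume *: "map fst us @ i # map fst vs = map fst w0 \<and> fst i \<in> Ob DD \<and> snd i \<in> Ob DD \<and> (\<forall>a\<in>set us \<union> set vs. is_arrow DD a)"
  have lab: "map fst (map (arr_map collapse) w) = map ?c (map fst w)" for w :: "('o \<times> bool, 'f) arrow list" by simp
  have "map fst (map (arr_map collapse) us) @ ?c i # map fst (map (arr_map collapse) vs) = map fst (map (arr_map collapse) w0)"
    using arg_cong[OF conjunct1[OF *], of "map ?c"] unfolding lab by simp
  then have "multilinear_on DD (map fst (map (arr_map collapse) us) @ ?c i # map fst (map (arr_map collapse) vs)) F"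
    using assms by simp
  from multilinear_onD[OF this] * is_arrow_collapse
  have "linear_on (Hom DD (fst (?c i)) (snd (?c i))) (\<lambda>f. F (map (arr_map collapse) us @ (?c i, f) # map (arr_map collapse) vs))"
    by (auto simp: mem_Times_iff)
  moreover have "arr_map collapse (i, f) = (?c i, f)" for f :: 'f by (simp add: arr_map_def collapse_def)
  ultimately show "linear_on (Hom DD (fst i) (snd i)) (\<lambda>f. F (map (arr_map collapse) (us @ (i, f) # vs)))"
    by simp
qed

lemma multilinear_on_insert_link:
  assumes "\<forall>a\<in>set w. is_arrow DD a" "i < length w" "multilinear_on DD (map fst (insert_link D i w)) F"
  shows "multilinear_on DD (map fst w) (\<lambda>u. F (insert_link D i u))"
  using assms
proof (induction i arbitrary: w F)
  case 0
  then obtain a v where w: "w = a # v" by (cases w) auto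
  have a: "is_arrow DD a" and v: "\<forall>a\<in>set v. is_arrow DD a" using 0 w by auto
  have F: "multilinear_on DD (fst a # fst (link D a) # map fst (map (arr_map collapse) v)) F" using 0 w by simp
  have lk: "link D (fst a, f) = link D a" for f by (rule link_cong) simp
  show ?case
    unfolding w list.map multilinear_on_Cons_iff
  proof (intro impI conjI allI ballI)
    assume ob: "fst (fst a) \<in> Ob DD \<and> snd (fst a) \<in> Ob DD"
    show "linear_on (Hom DD (fst (fst a)) (snd (fst a))) (\<lambda>f. F (insert_link D 0 ((fst a, f) # u)))"
      if u: "map fst u = map fst v \<and> (\<forall>a\<in>set u. is_arrow DD a)" for u
    proof -
      have "map fst (insert_link D 0 (a # u)) = map fst (insert_link D 0 (a # v))"
        using u by (intro labels_insert_link) auto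
      then have "multilinear_on DD (map fst [] @ fst a # map fst (link D a # map (arr_map collapse) u)) F"
        using F by simp
      from multilinear_onD[OF this] show ?thesis
        using ob u is_arrow_link[OF a] is_arrow_collapse by (auto simp: lk)
    qed
    show "multilinear_on DD (map fst v) (\<lambda>w. F (insert_link D 0 ((fst a, f) # w)))"
      if f: "f \<in> Hom DD (fst (fst a)) (snd (fst a))" for f
    proof -
      have "is_arrow DD (fst a, f)" using f ob by (simp add: is_arrow_def)
      then have "multilinear_on DD (map fst (map (arr_map collapse) v)) (\<lambda>w. F ((fst a, f) # link D a # w))"
        using F by (intro multilinear_on_Cons[OF multilinear_on_Cons] is_arrow_link[OF a]) auto
      from multilinear_on_map_collapse[OF this] show ?thesis by (simp add: lk)
    qed
  qed
next
  case (Suc i)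
  then obtain a v where w: "w = a # v" by (cases w) auto
  have a: "is_arrow DD a" and v: "\<forall>a\<in>set v. is_arrow DD a" "i < length v" using Suc w by auto
  have F: "multilinear_on DD (fst a # map fst (insert_link D i v)) F" using Suc w by simp
  show ?case
    unfolding w list.map multilinear_on_Cons_iff
  proof (intro impI conjI allI ballI)
    assume ob: "fst (fst a) \<in> Ob DD \<and> snd (fst a) \<in> Ob DD"
    show "linear_on (Hom DD (fst (fst a)) (snd (fst a))) (\<lambda>f. F (insert_link D (Suc i) ((fst a, f) # u)))"
      if u: "map fst u = map fst v \<and> (\<forall>a\<in>set u. is_arrow DD a)" for u
    proof -
      have i: "i < length u" using u v by (metis length_map)
      have "multilinear_on DD (map fst [] @ fst a # map fst (insert_link D i u)) F"
        using F labels_insert_link[of u v i D] u i by simp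
      from multilinear_onD[OF this] show ?thesis
        using ob arrows_insert_link[OF i] u by simp
    qed
    show "multilinear_on DD (map fst v) (\<lambda>w. F (insert_link D (Suc i) ((fst a, f) # w)))"
      if f: "f \<in> Hom DD (fst (fst a)) (snd (fst a))" for f
    proof -
      have "is_arrow DD (fst a, f)" using f ob by (simp add: is_arrow_def)
      then have "multilinear_on DD (map fst (insert_link D i v)) (\<lambda>w. F ((fst a, f) # w))"
        using F by (intro multilinear_on_Cons) auto
      from Suc.IH[OF v this] show ?thesis by simp
    qed
  qed
qed

text \<open>The link is an identity of \<open>D\<close>, on which \<open>H\<close> acts through the
  counit, and \<open>collapse\<close> is \<open>H\<close>-linear. Inserting the link is therefore
  compatible with the diagonal action, so the homotopy preserves invariance.\<close>

lemma hact_insert_link: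
  assumes "\<forall>a\<in>set w. is_arrow DD a" "i < length w" "multilinear_on DD (map fst (insert_link D i w)) F"
  shows "hact H DD (insert_link D i w) F h = hact H DD w (\<lambda>u. F (insert_link D i u)) h"
  using assms
proof (induction i arbitrary: w F h)
  case 0
  then obtain a v where w: "w = a # v" by (cases w) auto
  have a: "is_arrow DD a" and v: "\<forall>a\<in>set v. is_arrow DD a" using 0 w by auto
  have F: "multilinear_on DD (fst a # fst (link D a) # map fst (map (arr_map collapse) v)) F" using 0 w by simp
  have lk: "link D (arr_act DD x a) = link D a" for x by (rule link_cong) simp
  have "hact H DD (link D a # map (arr_map collapse) v) (\<lambda>u. F (arr_act DD x a # u)) y
      = hact H DD v (\<lambda>u. F (arr_act DD x a # link D a # map (arr_map collapse) u)) y" for x y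
  proof -
    have "hact H DD (link D a # map (arr_map collapse) v) (\<lambda>u. F (arr_act DD x a # u)) y
      = hact H DD (map (arr_map collapse) v) (\<lambda>u. F (arr_act DD x a # link D a # u)) y"
    proof (rule E.hact_invariant[OF is_arrow_link[OF a]])
      show "multilinear_on DD (fst (link D a) # map fst (map (arr_map collapse) v)) (\<lambda>u. F (arr_act DD x a # u))"
        using F a by (intro multilinear_on_Cons) auto
      show "arr_act DD h (link D a) = (fst (link D a), \<epsilon> h *\<^sub>C snd (link D a))" for h
        using a by (simp add: arr_act_def Act_Id is_arrow_double)
    qed (use v is_arrow_collapse in auto)
    also have "\<dots> = hact H DD v (\<lambda>u. F (arr_act DD x a # link D a # map (arr_map collapse) u)) y"
      by (rule hact_map) (simp add: arr_act_collapse)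
    finally show ?thesis .
  qed
  then show ?case by (simp add: w lk)
next
  case (Suc i)
  then obtain a v where w: "w = a # v" by (cases w) auto
  have a: "is_arrow DD a" and v: "\<forall>a\<in>set v. is_arrow DD a" "i < length v" using Suc w by auto
  have "multilinear_on DD (map fst (insert_link D i v)) (\<lambda>u. F (arr_act DD x a # u))" for x
    using Suc.prems w a by (intro multilinear_on_Cons) auto
  then show ?case using Suc.IH[OF v] by (simp add: w)
qed

lemma multilinear_on_low_head:
  assumes "w \<noteq> []" "multilinear_on DD (map fst (low_head w)) F"
  shows "multilinear_on DD (map fst w) (\<lambda>u. F (low_head u))"
proof -
  obtain a v where w: "w = a # v" using assms(1) by (cases w) auto
  show ?thesis
    using assms(2) unfolding w low_head_Cons list.map fst_conv multilinear_on_Cons_iff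
    by (simp add: mem_Times_iff)
qed

lemma hact_low_head: "w \<noteq> [] \<Longrightarrow> hact H DD (low_head w) F h = hact H DD w (\<lambda>u. F (low_head u)) h"
  by (cases w) (simp_all add: arr_act_def)

text \<open>One component of a homotopy between \<open>collapse\<close> and the identity on the
  level of cofaces; the alternating sum over \<open>i\<close> is the homotopy for
  \<open>b\<close>.\<close>

definition homotopy :: "nat \<Rightarrow> nat \<Rightarrow> ('m, 'o \<times> bool, 'f) cochain \<Rightarrow> ('m, 'o \<times> bool, 'f) cochain" where
  "homotopy n i \<phi> = functional_of DD n (\<lambda>m w. \<phi> (m \<otimes>\<^sub>C word_pure (insert_link D i (low_head w))))"

lemma
  assumes \<phi>: "\<phi> \<in> cochains H M DD (Suc n)" and i: "i \<le> n"
  shows homotopy_cochain: "homotopy n i \<phi> \<in> cochains H M DD n"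
    and homotopy_pure: "w \<in> cyclic_words DD n \<Longrightarrow>
      homotopy n i \<phi> (m \<otimes>\<^sub>C word_pure w) = \<phi> (m \<otimes>\<^sub>C word_pure (insert_link D i (low_head w)))"
proof -
  let ?F = "\<lambda>m w. \<phi> (m \<otimes>\<^sub>C word_pure w)"
  let ?G = "\<lambda>m w. ?F m (insert_link D i (low_head w))"
  note F = E.cochain_multilinear[OF \<phi>]
  have facts: "w \<noteq> []" "\<forall>a\<in>set (low_head w). is_arrow DD a" "i < length (low_head w)"
    "multilinear_on DD (map fst (insert_link D i (low_head w))) (?F m)" if w: "w \<in> cyclic_words DD n" for w m
  proof -
    show ne: "w \<noteq> []" using w by (auto simp: cyclic_words_iff)
    show "\<forall>a\<in>set (low_head w). is_arrow DD a" using arrows_low_head[OF ne] cyclic_words_arrow[OF w] .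
    show "i < length (low_head w)" using w i by (cases w) (auto simp: cyclic_words_iff)
    show "multilinear_on DD (map fst (insert_link D i (low_head w))) (?F m)"
      by (rule E.values_multilinear_on[OF F insert_cyclic_words[OF w i]])
  qed
  have ml: "multilinear_values DD n ?G"
    unfolding multilinear_values_def
  proof (intro conjI allI ballI)
    fix m w assume w: "w \<in> cyclic_words DD n"
    show "clinear (\<lambda>m. ?G m w)" by (rule E.values_clinear[OF F insert_cyclic_words[OF w i]])
    show "multilinear_on DD (map fst w) (?G m)"
      by (rule multilinear_on_low_head[OF facts(1)[OF w] multilinear_on_insert_link[OF facts(2-4)[OF w]]])
  qed
  have "E.invariant_values n ?G"
    unfolding E.invariant_values_def
  proof (intro allI ballI)
    fix m h w assume w: "w \<in> cyclic_words DD n"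
    show "?G (ract M m h) w = hact H DD w (?G m) h"
      unfolding E.cochain_invariant[OF \<phi> insert_cyclic_words[OF w i]] hact_insert_link[OF facts(2-4)[OF w]]
      by (rule hact_low_head[OF facts(1)[OF w]])
  qed
  then show "homotopy n i \<phi> \<in> cochains H M DD n"
    unfolding homotopy_def by (rule E.functional_of_cochain[OF ml])
  show "w \<in> cyclic_words DD n \<Longrightarrow> homotopy n i \<phi> (m \<otimes>\<^sub>C word_pure w) = ?G m w"
    unfolding homotopy_def by (rule functional_of_pure[OF E.subspace_Hom ml])
qed

end

lemma insert_link_last: "length w = Suc n \<Longrightarrow> insert_link D n w = w @ [link D (last w)]"
proof (induction n arbitrary: w)
  case 0
  then show ?case by (cases w) auto
next
  case (Suc n)
  then show ?case by (cases w) auto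
qed

text \<open>The usual cancellation for a homotopy between families of cofaces. \<open>A i j\<close>
  stands for the j-th coface evaluated after the i-th insertion, \<open>B i j\<close> for the j-th
  coface of the i-th homotopy component. Away from j = i and j = i + 1 an index shift turns
  \<open>A\<close> into -\<open>B\<close>; the two remaining diagonals telescope to the end
  terms.\<close>

lemma homotopy_sum:
  fixes A B :: "nat \<Rightarrow> nat \<Rightarrow> complex"
  assumes L: "\<And>i j. j < i \<Longrightarrow> i \<le> Suc k \<Longrightarrow> A i j = B (i - 1) j"
    and M: "\<And>i. 1 \<le> i \<Longrightarrow> i \<le> Suc k \<Longrightarrow> A i i = A (i - 1) i"
    and U: "\<And>i j. Suc (Suc i) \<le> j \<Longrightarrow> j \<le> Suc (Suc k) \<Longrightarrow> A i j = B i (j - 1)"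
  shows "(\<Sum>i\<le>Suc k. \<Sum>j\<le>Suc (Suc k). (-1) ^ (i + j) * A i j)
    = A 0 0 - A (Suc k) (Suc (Suc k)) - (\<Sum>i\<le>k. \<Sum>j\<le>Suc k. (-1) ^ (i + j) * B i j)"
proof -
  let ?S = "{..Suc k} \<times> {..Suc (Suc k)}" and ?T = "{..k} \<times> {..Suc k}"
  let ?a = "\<lambda>(i, j). (-1) ^ (i + j) * A i j" and ?b = "\<lambda>(i, j). (-1) ^ (i + j) * B i j"
  have l: "sum ?a {p\<in>?S. snd p < fst p} = (\<Sum>p\<in>{p\<in>?T. snd p \<le> fst p}. - ?b p)"
  proof (rule sum.reindex_bij_witness[of _ "\<lambda>(i, j). (Suc i, j)" "\<lambda>(i, j). (i - 1, j)"])
    fix p assume "p \<in> {p\<in>?S. snd p < fst p}"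
    then obtain i j where p: "p = (Suc i, j)" "j < Suc i" "i \<le> k" by (cases p; cases "fst p") auto
    then show "- ?b (case p of (i, j) \<Rightarrow> (i - 1, j)) = ?a p" using L[of j "Suc i"] by simp
  qed auto
  have u: "sum ?a {p\<in>?S. Suc (fst p) < snd p} = (\<Sum>p\<in>{p\<in>?T. fst p < snd p}. - ?b p)"
  proof (rule sum.reindex_bij_witness[of _ "\<lambda>(i, j). (i, Suc j)" "\<lambda>(i, j). (i, j - 1)"])
    fix p assume "p \<in> {p\<in>?S. Suc (fst p) < snd p}"
    then obtain i j where p: "p = (i, Suc j)" "i < j" "j \<le> Suc k" by (cases p; cases "snd p") auto
    then show "- ?b (case p of (i, j) \<Rightarrow> (i, j - 1)) = ?a p" using U[of i "Suc j"] by simp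
  qed auto
  have d1: "sum ?a {p\<in>?S. snd p = fst p} = (\<Sum>i\<le>Suc k. A i i)"
    by (rule sum.reindex_bij_witness[of _ "\<lambda>i. (i, i)" fst]) auto
  have d2: "sum ?a {p\<in>?S. snd p = Suc (fst p)} = (\<Sum>i\<le>Suc k. - A i (Suc i))"
    by (rule sum.reindex_bij_witness[of _ "\<lambda>i. (i, Suc i)" fst]) auto
  have S: "sum ?a ?S = sum ?a {p\<in>?S. snd p < fst p} + sum ?a {p\<in>?S. Suc (fst p) < snd p}
      + sum ?a {p\<in>?S. snd p = fst p} + sum ?a {p\<in>?S. snd p = Suc (fst p)}"
  proof -
    have "?S = (({p\<in>?S. snd p < fst p} \<union> {p\<in>?S. Suc (fst p) < snd p}) \<union> {p\<in>?S. snd p = fst p}) \<union> {p\<in>?S. snd p = Suc (fst p)}"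
      by auto
    then have "sum ?a ?S = sum ?a ((({p\<in>?S. snd p < fst p} \<union> {p\<in>?S. Suc (fst p) < snd p}) \<union> {p\<in>?S. snd p = fst p}) \<union> {p\<in>?S. snd p = Suc (fst p)})"
      by (rule arg_cong)
    then show ?thesis
      by (simp only:) (subst sum.union_disjoint, auto)+
  qed
  have T: "sum ?b ?T = sum ?b {p\<in>?T. snd p \<le> fst p} + sum ?b {p\<in>?T. fst p < snd p}"
    by (subst sum.union_disjoint[symmetric]) (auto intro: sum.cong)
  have "(\<Sum>i\<le>Suc k. A i i) + (\<Sum>i\<le>Suc k. - A i (Suc i)) = A 0 0 - A (Suc k) (Suc (Suc k))"
  proof -
    have "(\<Sum>i\<le>k. A i (Suc i)) = (\<Sum>i\<le>k. A (Suc i) (Suc i))" using M[of "Suc i" for i] by (intro sum.cong) auto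
    moreover have "(\<Sum>i\<le>Suc k. A i i) = A 0 0 + (\<Sum>i\<le>k. A (Suc i) (Suc i))" by (rule sum.atMost_Suc_shift)
    ultimately show ?thesis by (simp add: sum_negf)
  qed
  moreover have "(\<Sum>i\<le>Suc k. \<Sum>j\<le>Suc (Suc k). (-1) ^ (i + j) * A i j) = sum ?a ?S"
    "(\<Sum>i\<le>k. \<Sum>j\<le>Suc k. (-1) ^ (i + j) * B i j) = sum ?b ?T"
    by (rule sum.cartesian_product)+
  ultimately show ?thesis using l u d1 d2 S T by (simp add: sum_negf del: sum.atMost_Suc)
qed

context hopf_double
begin

lemma collapse_semifunctor: "H_semifunctor DD DD collapse"
  by (auto simp: H_semifunctor_def collapse_def linear_map_def linear_on_def)

lemma inclusion_semifunctor: "H_semifunctor D DD (inclusion e)"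
  by (auto simp: H_semifunctor_def inclusion_def linear_map_def linear_on_def)

sublocale P: hopf_semifunctor H M DD DD collapse
  by unfold_locales (rule collapse_semifunctor)

text \<open>Naturality of the link: a letter after the link at its source equals the link at its
  target after the collapsed letter.\<close>

lemma merge_insert_link_same:
  assumes "\<forall>a\<in>set w. is_arrow DD a" "successively (\<lambda>a b. arr_src a = arr_tgt b) w" "1 \<le> i" "i < length w"
  shows "merge DD i (insert_link D i w) = merge DD i (insert_link D (i - 1) w)"
  using assms
proof (induction i arbitrary: w)
  case (Suc i)
  then obtain a v where w: "w = a # v" by (cases w) auto
  show ?case
  proof (cases i)
    case 0
    then obtain b v' where v: "v = b # v'" using Suc.prems w by (cases v) auto
    have "is_arrow DD b" "arr_src a = arr_tgt b" using Suc.prems w v by auto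
    then have "arr_comp DD b (link D b) = arr_comp DD (link D a) (arr_map collapse b)"
      by (auto simp: arr_comp_def link_def arr_map_def collapse_def is_arrow_double Comp_Id)
    then show ?thesis by (simp add: 0 w v merge_def)
  next
    case (Suc i')
    have "merge DD i (insert_link D i v) = merge DD i (insert_link D (i - 1) v)"
      using Suc.prems w Suc by (intro Suc.IH) (auto simp: successively_Cons)
    then show ?thesis by (simp add: w Suc del: insert_link.simps(2)) (simp add: Suc)
  qed
qed simp

context
  fixes \<phi> n
  assumes \<phi>: "\<phi> \<in> cochains H M DD n"
begin

lemma low_head_facts:
  assumes w: "w \<in> cyclic_words DD n"
  shows "\<forall>a\<in>set (low_head w). is_arrow DD a" "successively (\<lambda>a b. arr_src a = arr_tgt b) (low_head w)"
    "length (low_head w) = Suc n" "arr_src (last (low_head w)) = arr_tgt (hd w)" "w \<noteq> []"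
proof -
  obtain a v where av: "w = a # v" using w by (cases w) (auto simp: cyclic_words_iff)
  have s: "successively (\<lambda>a b. arr_src a = arr_tgt b) w" "arr_src (last w) = arr_tgt (hd w)"
    using w linked_map_fst[of w] av unfolding cyclic_words_iff by blast+
  show "successively (\<lambda>a b. arr_src a = arr_tgt b) (low_head w)"
    using s(1) by (cases v) (auto simp: av)
  show "arr_src (last (low_head w)) = arr_tgt (hd w)" using s(2) by (simp add: av split: if_splits)
  show "length (low_head w) = Suc n" using w by (simp add: av cyclic_words_iff)
  show "w \<noteq> []" by (simp add: av)
  then show "\<forall>a\<in>set (low_head w). is_arrow DD a" using arrows_low_head cyclic_words_arrow[OF w] by blast
qed

text \<open>Composing the lowered first letter with the link at its source collapses that letter;
  all later ones are already collapsed.\<close>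

lemma homotopy_first:
  assumes w: "w \<in> cyclic_words DD n"
  shows "delta H M DD n 0 \<phi> (m \<otimes>\<^sub>C word_pure (insert_link D 0 (low_head w))) = \<phi> (m \<otimes>\<^sub>C word_pure (map (arr_map collapse) w))"
proof -
  obtain a v where av: "w = a # v" using w by (cases w) (auto simp: cyclic_words_iff)
  have "is_arrow DD a" using w by (simp add: av cyclic_words_iff)
  then have "merge DD 0 (insert_link D 0 (low_head w)) = map (arr_map collapse) w"
    by (simp add: av merge_def arr_comp_def link_def arr_map_def collapse_def is_arrow_double Comp_Id)
  then show ?thesis
    using insert_cyclic_words[OF w, of 0] by (simp add: E.delta_pure[OF \<phi>] del: insert_link.simps)
qed

text \<open>Here the link stands at the end. The last coface carries it around and composes it with
  the lowered head, which restores the original target. The leg of the coaction acts on the link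
  through the counit and disappears.\<close>

lemma homotopy_last:
  assumes w: "w \<in> cyclic_words DD n"
  shows "delta H M DD n (Suc n) \<phi> (m \<otimes>\<^sub>C word_pure (insert_link D n (low_head w))) = \<phi> (m \<otimes>\<^sub>C word_pure w)"
proof -
  note lf = low_head_facts[OF w]
  obtain a v where av: "w = a # v" using lf(5) by (cases w) auto
  have a: "is_arrow DD a" using w by (simp add: av cyclic_words_iff)
  define l where "l = link D (last (low_head w))"
  have W: "insert_link D n (low_head w) = low_head w @ [l]" unfolding l_def by (rule insert_link_last[OF lf(3)])
  note cyc = insert_cyclic_words[OF w le_refl, unfolded W]
  have l: "l = (((fst (arr_tgt a), False), arr_tgt a), hcat.Id D (fst (arr_tgt a)))"
    unfolding l_def link_def lf(4) by (simp add: av)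
  have "merge DD 0 (arr_act DD y l # low_head w) = (fst a, \<epsilon> y *\<^sub>C snd a) # v" for y
    using a Comp_linear(2)[of "fst (arr_src a)" "fst (arr_tgt a)" "fst (arr_tgt a)" "snd a"] Id_Hom[of "fst (arr_tgt a)"]
    by (simp add: l av merge_def arr_comp_def arr_act_def is_arrow_double Act_Id Comp_Id linear_on_def)
  moreover have "\<phi> (x \<otimes>\<^sub>C word_pure ((fst a, c *\<^sub>C snd a) # v)) = c *\<^sub>C \<phi> (x \<otimes>\<^sub>C word_pure w)" for x c
    using multilinear_onD[of DD "[]" "fst a" v "\<lambda>w. \<phi> (x \<otimes>\<^sub>C word_pure w)"]
      E.values_multilinear_on[OF E.cochain_multilinear[OF \<phi>] w, of x] a cyclic_words_arrow[OF w]
    by (simp add: av is_arrow_def linear_on_def)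
  moreover have \<delta>: "delta H M DD n 0 \<phi> \<in> cochains H M DD (Suc n)" by (rule E.delta_cochain[OF \<phi>]) simp
  ultimately have "delta H M DD n (Suc n) \<phi> (m \<otimes>\<^sub>C word_pure (low_head w @ [l]))
      = tsum (coact M m) (\<lambda>h x. \<epsilon> h *\<^sub>C \<phi> (x \<otimes>\<^sub>C word_pure w))"
    using E.rotate_cyclic_words[OF cyc]
    by (simp add: E.delta_last[OF \<phi>] E.tau_pure[OF \<delta> cyc] E.twist_snoc E.delta_pure[OF \<phi>] counit_antipode_inv)
  also have "\<dots> = \<phi> (m \<otimes>\<^sub>C word_pure w)"
    by (rule coact_counit[OF E.values_clinear[OF E.cochain_multilinear[OF \<phi>] w]])
  finally show ?thesis by (simp only: W)
qed

lemma homotopy_middle: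
  assumes w: "w \<in> cyclic_words DD n" and i: "1 \<le> i" "i \<le> n"
  shows "delta H M DD n i \<phi> (m \<otimes>\<^sub>C word_pure (insert_link D i (low_head w)))
    = delta H M DD n i \<phi> (m \<otimes>\<^sub>C word_pure (insert_link D (i - 1) (low_head w)))"
  using merge_insert_link_same[OF low_head_facts(1,2)[OF w] i(1)] i low_head_facts(3)[OF w]
    insert_cyclic_words[OF w, of i] insert_cyclic_words[OF w, of "i - 1"]
  by (simp add: E.delta_pure[OF \<phi>])

lemma homotopy_lower:
  assumes w: "w \<in> cyclic_words DD n" and n: "n = Suc k" and i: "j < i" "i \<le> n"
  shows "delta H M DD n j \<phi> (m \<otimes>\<^sub>C word_pure (insert_link D i (low_head w)))
    = delta H M DD k j (homotopy k (i - 1) \<phi>) (m \<otimes>\<^sub>C word_pure w)"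
proof -
  have \<phi>': "\<phi> \<in> cochains H M DD (Suc k)" and w': "w \<in> cyclic_words DD (Suc k)" using \<phi> w n by simp_all
  have len: "length w = Suc n" using w by (simp add: cyclic_words_iff)
  have "merge DD j (insert_link D i (low_head w)) = insert_link D (i - 1) (low_head (merge DD j w))"
    using merge_insert_link_less[of j i "low_head w" D] low_head_merge[of j w D] low_head_facts(3)[OF w] i len by simp
  then show ?thesis
    using i n E.merge_cyclic_words[OF w', of j] homotopy_cochain[OF \<phi>', of "i - 1"] insert_cyclic_words[OF w, of i]
    by (simp add: E.delta_pure[OF \<phi>'] E.delta_pure[OF _ _ w'] homotopy_pure[OF \<phi>'])
qed

lemma homotopy_upper:
  assumes w: "w \<in> cyclic_words DD n" and n: "n = Suc k" and j: "Suc (Suc i) \<le> j" "j \<le> Suc n"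
  shows "delta H M DD n j \<phi> (m \<otimes>\<^sub>C word_pure (insert_link D i (low_head w)))
    = delta H M DD k (j - 1) (homotopy k i \<phi>) (m \<otimes>\<^sub>C word_pure w)"
proof -
  have \<phi>': "\<phi> \<in> cochains H M DD (Suc k)" and w': "w \<in> cyclic_words DD (Suc k)" using \<phi> w n by simp_all
  have i: "i \<le> k" "i \<le> n" using j n by simp_all
  have len: "length w = Suc n" using w by (simp add: cyclic_words_iff)
  note h = homotopy_cochain[OF \<phi>' i(1)]
  show ?thesis
  proof (cases "j \<le> n")
    case True
    have "merge DD j (insert_link D i (low_head w)) = insert_link D i (low_head (merge DD (j - 1) w))"
      using merge_insert_link_greater[OF j(1), of "low_head w" D] low_head_merge[of "j - 1" w D] low_head_facts(3)[OF w] j True len by simp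
    then show ?thesis
      using True i n E.merge_cyclic_words[OF w', of "j - 1"] insert_cyclic_words[OF w, of i]
      by (simp add: E.delta_pure[OF \<phi>'] E.delta_pure[OF h _ w'] homotopy_pure[OF \<phi>'])
  next
    case False
    then have j: "j = Suc (Suc k)" using j n by simp
    then have jn: "j = Suc n" using n by simp
    obtain u c where u: "w = u @ [c]" "length u = Suc k" using E.cyclic_words_snoc[OF w'] .
    then obtain a v where av: "w = a # v @ [c]" "length v = k" by (cases u) auto
    let ?a = "((arr_src a, (fst (arr_tgt a), False)), snd a)"
    let ?e = "\<lambda>y. arr_comp DD (arr_act DD y c) a"
    have W: "insert_link D i (low_head w) = insert_link D i (?a # v) @ [arr_map collapse c]"
      using insert_link_snoc[of i "?a # v" D c] i av by simp
    have V: "insert_link D i (b # v) = b # tl (insert_link D i (b # v))" for b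
      using hd_insert_link[of D i "b # v"] insert_link_Nil[of D i "b # v"] by (metis list.collapse list.sel(1))
    \<comment> \<open>Composing the rotated, collapsed last letter with the lowered head gives the
      lowered composite of the original letters, and the tail sees only the unchanged
      source.\<close>
    have e: "arr_comp DD (arr_act DD y (arr_map collapse c)) ?a # tl (insert_link D i (?a # v))
        = insert_link D i (low_head (?e y # v))" for y
    proof -
      let ?b = "((arr_src (?e y), (fst (arr_tgt (?e y)), False)), snd (?e y))"
      have "arr_comp DD (arr_act DD y (arr_map collapse c)) ?a = ?b"
        by (simp add: arr_comp_def arr_act_def arr_map_def collapse_def)
      moreover have "tl (insert_link D i (?a # v)) = tl (insert_link D i (?b # v))"
        by (rule tl_insert_link_cong) simp
      ultimately show ?thesis using V[of ?b] by simp
    qed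
    have \<delta>: "delta H M DD n 0 \<phi> \<in> cochains H M DD (Suc n)" by (rule E.delta_cochain[OF \<phi>]) simp
    have \<delta>h: "delta H M DD k 0 (homotopy k i \<phi>) \<in> cochains H M DD n" unfolding n by (rule E.delta_cochain[OF h]) simp
    note cW = insert_cyclic_words[OF w i(2), unfolded W]
    have cw: "(a # v) @ [c] \<in> cyclic_words DD n" using w av by simp
    note rw = E.rotate_cyclic_words[OF cw]
    have ce: "?e y # v \<in> cyclic_words DD k" for y
      using E.merge_cyclic_words[of "arr_act DD y c # a # v" k 0] rw[of y] n by (simp add: merge_def)
    have "delta H M DD n j \<phi> (m \<otimes>\<^sub>C word_pure (insert_link D i (low_head w)))
      = tsum (coact M m) (\<lambda>y x. \<phi> (x \<otimes>\<^sub>C word_pure (merge DD 0 (arr_act DD (S' y) (arr_map collapse c) # insert_link D i (?a # v)))))"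
      using E.rotate_cyclic_words[OF cW] unfolding W jn
      by (simp add: E.delta_last[OF \<phi>] E.tau_pure[OF \<delta> cW] E.twist_snoc E.delta_pure[OF \<phi>])
    also have "\<dots> = tsum (coact M m) (\<lambda>y x. \<phi> (x \<otimes>\<^sub>C word_pure (insert_link D i (low_head (?e (S' y) # v)))))"
    proof -
      have "merge DD 0 (arr_act DD y (arr_map collapse c) # insert_link D i (?a # v)) = insert_link D i (low_head (?e y # v))" for y
        unfolding e[symmetric] by (subst V) (simp add: merge_def)
      then show ?thesis by (simp only:)
    qed
    also have "\<dots> = tsum (coact M m) (\<lambda>y x. homotopy k i \<phi> (x \<otimes>\<^sub>C word_pure (?e (S' y) # v)))"
      by (simp only: homotopy_pure[OF \<phi>' i(1) ce])
    also have "\<dots> = tsum (coact M m) (\<lambda>y x. delta H M DD k 0 (homotopy k i \<phi>) (x \<otimes>\<^sub>C word_pure (arr_act DD (S' y) c # a # v)))"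
      using rw n by (simp add: E.delta_pure[OF h] merge_def)
    also have "\<dots> = delta H M DD k (j - 1) (homotopy k i \<phi>) (m \<otimes>\<^sub>C word_pure w)"
      using E.tau_pure[OF \<delta>h cw] E.twist_snoc[of _ m "a # v" c] j n av
      by (simp add: E.delta_last[OF h])
    finally show ?thesis .
  qed
qed

end

text \<open>Summing b \<phi> = 0 over all words with an inserted link gives, by
  \<open>homotopy_sum\<close>, the relation b h = p^* \<phi> - \<phi> for the alternating sum h of
  the homotopy components.\<close>

lemma hochschild_collapse:
  assumes \<phi>: "\<phi> \<in> cochains H M DD (Suc k)" and b: "E.cocyc.b (Suc k) \<phi> = 0"
  shows "\<exists>\<psi>\<in>cochains H M DD k. E.cocyc.b k \<psi> = \<phi> - cochain_map DD collapse (Suc k) \<phi>"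
proof -
  let ?h = "\<Sum>i\<le>k. (-1) ^ i *\<^sub>C homotopy k i \<phi>"
  have hi: "homotopy k i \<phi> \<in> cochains H M DD k" if "i \<le> k" for i
    by (rule homotopy_cochain[OF \<phi> that])
  have h: "?h \<in> cochains H M DD k"
    by (intro cvs.subspace_sum[OF E.subspace_cochains] cvs.subspace_scale[OF E.subspace_cochains] hi) simp
  have P\<phi>: "cochain_map DD collapse (Suc k) \<phi> \<in> cochains H M DD (Suc k)" by (rule P.cochain_map_cochain[OF \<phi>])
  have "E.cocyc.b k ?h = cochain_map DD collapse (Suc k) \<phi> - \<phi>"
  proof (rule E.cochain_eqI[OF E.cocyc.mem(1)[OF h] cvs.subspace_diff[OF E.subspace_cochains P\<phi> \<phi>]])
    fix m :: 'm and w assume w: "w \<in> cyclic_words DD (Suc k)"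
    let ?W = "\<lambda>i. m \<otimes>\<^sub>C word_pure (insert_link D i (low_head w))"
    let ?A = "\<lambda>i j. delta H M DD (Suc k) j \<phi> (?W i)"
    let ?B = "\<lambda>i j. delta H M DD k j (homotopy k i \<phi>) (m \<otimes>\<^sub>C word_pure w)"
    have "(\<Sum>i\<le>Suc k. \<Sum>j\<le>Suc (Suc k). (-1) ^ (i + j) * ?A i j) = (\<Sum>i\<le>Suc k. (-1) ^ i * E.cocyc.b (Suc k) \<phi> (?W i))"
      by (simp add: E.cocyc.b_def sum_apply scaleC_fun_def scaleC_complex_def power_add sum_distrib_left mult.assoc
          del: sum.atMost_Suc)
    also have "\<dots> = 0" by (simp add: b)
    finally have "0 = ?A 0 0 - ?A (Suc k) (Suc (Suc k)) - (\<Sum>i\<le>k. \<Sum>j\<le>Suc k. (-1) ^ (i + j) * ?B i j)"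
      using homotopy_sum[of k ?A ?B, OF homotopy_lower[OF \<phi> w refl] homotopy_middle[OF \<phi> w] homotopy_upper[OF \<phi> w refl]]
      by simp
    moreover have "E.cocyc.b k ?h (m \<otimes>\<^sub>C word_pure w) = (\<Sum>i\<le>k. \<Sum>j\<le>Suc k. (-1) ^ (i + j) * ?B i j)"
    proof -
      have "E.cocyc.b k ?h = (\<Sum>i\<le>k. (-1) ^ i *\<^sub>C E.cocyc.b k (homotopy k i \<phi>))"
      proof -
        have "E.cocyc.b k ?h = (\<Sum>i\<le>k. E.cocyc.b k ((-1) ^ i *\<^sub>C homotopy k i \<phi>))"
          by (rule linear_map_sum[OF E.cocyc.lin(1) E.subspace_cochains])
            (simp add: cvs.subspace_scale[OF E.subspace_cochains] hi)
        also have "\<dots> = (\<Sum>i\<le>k. (-1) ^ i *\<^sub>C E.cocyc.b k (homotopy k i \<phi>))"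
          by (intro sum.cong refl E.cocyc.lin_scale(1)[OF hi]) simp
        finally show ?thesis .
      qed
      then show ?thesis
        by (simp add: E.cocyc.b_def sum_apply scaleC_fun_def scaleC_complex_def power_add sum_distrib_left mult.assoc
            del: sum.atMost_Suc)
    qed
    ultimately show "E.cocyc.b k ?h (m \<otimes>\<^sub>C word_pure w) = (cochain_map DD collapse (Suc k) \<phi> - \<phi>) (m \<otimes>\<^sub>C word_pure w)"
      using homotopy_first[OF \<phi> w] homotopy_last[OF \<phi> w] by (simp add: P.cochain_map_pure[OF \<phi> w])
  qed
  \<comment> \<open>The homotopy produces the difference with the opposite sign, so the witness is
    -h.\<close>
  then have "E.cocyc.b k (- ?h) = \<phi> - cochain_map DD collapse (Suc k) \<phi>"
    using E.cocyc.lin_scale(1)[OF h, of "-1"] by (simp add: cvs.scale_minus_left scaleC_one)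
  moreover have "- ?h \<in> cochains H M DD k" by (rule cvs.subspace_neg[OF E.subspace_cochains h])
  ultimately show ?thesis by blast
qed

text \<open>There is a single insertion in degree 0, and the vanishing of b \<phi> on it equates the
  two ends of the homotopy directly.\<close>

lemma hochschild_collapse_0:
  assumes \<phi>: "\<phi> \<in> cochains H M DD 0" and b: "E.cocyc.b 0 \<phi> = 0"
  shows "cochain_map DD collapse 0 \<phi> = \<phi>"
proof (rule E.cochain_eqI[OF P.cochain_map_cochain[OF \<phi>] \<phi>])
  fix m w assume w: "w \<in> cyclic_words DD 0"
  have "E.cocyc.b 0 \<phi> (m \<otimes>\<^sub>C word_pure (insert_link D 0 (low_head w))) = 0" by (simp add: b)
  then have "delta H M DD 0 0 \<phi> (m \<otimes>\<^sub>C word_pure (insert_link D 0 (low_head w)))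
      = delta H M DD 0 (Suc 0) \<phi> (m \<otimes>\<^sub>C word_pure (insert_link D 0 (low_head w)))"
    by (simp add: E.cocyc.b_def scaleC_fun_def scaleC_complex_def del: insert_link.simps)
  then show "cochain_map DD collapse 0 \<phi> (m \<otimes>\<^sub>C word_pure w) = \<phi> (m \<otimes>\<^sub>C word_pure w)"
    using homotopy_first[OF \<phi> w] homotopy_last[OF \<phi> w] by (simp add: P.cochain_map_pure[OF \<phi> w])
qed

lemma cyclic_collapse:
  assumes "\<phi> \<in> cochains H M DD n" "E.cocyc.l n \<phi> = \<phi>" "E.cocyc.b n \<phi> = 0"
  shows "n = 0 \<Longrightarrow> cochain_map DD collapse n \<phi> = \<phi>"
    and "n = Suc k \<Longrightarrow> \<exists>\<psi>\<in>cochains H M DD k. E.cocyc.l k \<psi> = \<psi> \<and> E.cocyc.b k \<psi> = \<phi> - cochain_map DD collapse n \<phi>"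
proof -
  have "arr_map collapse \<circ> arr_map collapse = (arr_map collapse :: ('o \<times> bool, 'f) arrow \<Rightarrow> _)"
    by (rule ext) (simp add: arr_map_def collapse_def)
  then have idem: "cochain_map DD collapse n (cochain_map DD collapse n \<phi>) = cochain_map DD collapse n \<phi>"
    if "\<phi> \<in> cochains H M DD n" for n \<phi>
    using that
    by (intro E.cochain_eqI[of _ n]) (simp_all add: P.cochain_map_cochain P.cochain_map_pure P.map_cyclic_words)
  note vanish = E.cocyc.cyclic_vanishing[of "cochain_map DD collapse", OF P.linear_cochain_map idem P.cochain_map_delta
      P.cochain_map_tau hochschild_collapse hochschild_collapse_0 E.bar_exact assms]
  show "n = 0 \<Longrightarrow> cochain_map DD collapse n \<phi> = \<phi>" by (rule vanish(1))
  show "n = Suc k \<Longrightarrow> \<exists>\<psi>\<in>cochains H M DD k. E.cocyc.l k \<psi> = \<psi> \<and> E.cocyc.b k \<psi> = \<phi> - cochain_map DD collapse n \<phi>"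
    by (rule vanish(2))
qed

end

section \<open>Inner automorphisms\<close>

context hopf_double
begin

context
  fixes \<eta>
  assumes \<eta>: "\<eta> \<in> unit_families H D"
begin

definition unit_at :: "'o \<times> bool \<Rightarrow> 'f" where
  "unit_at X = (if snd X then \<eta> (fst X) else hcat.Id D (fst X))"

text \<open>The semifunctor q of the overview: conjugation by the chosen isomorphisms, which does
  nothing on the first copy and is \<Phi>_\<eta> on the second.\<close>

definition transport :: "('o \<times> bool, 'f, 'o, 'f) semifun" where
  "transport = \<lparr>on_ob = fst, on_hom = (\<lambda>X Y f. Comp D (fst X) (fst Y) (fst Y) (unit_at Y)
     (Comp D (fst X) (fst X) (fst Y) f (inv_arrow D (fst X) (unit_at X))))\<rparr>"

lemma unit_at:
  assumes "fst X \<in> Ob D"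
  shows "unit_at X \<in> Hom D (fst X) (fst X)" "inv_arrow D (fst X) (unit_at X) \<in> Hom D (fst X) (fst X)"
    "Comp D (fst X) (fst X) (fst X) (unit_at X) (inv_arrow D (fst X) (unit_at X)) = hcat.Id D (fst X)"
    "Comp D (fst X) (fst X) (fst X) (inv_arrow D (fst X) (unit_at X)) (unit_at X) = hcat.Id D (fst X)"
    "Act D (fst X) (fst X) h (unit_at X) = \<epsilon> h *\<^sub>C unit_at X"
    "Act D (fst X) (fst X) h (inv_arrow D (fst X) (unit_at X)) = \<epsilon> h *\<^sub>C inv_arrow D (fst X) (unit_at X)"
proof -
  have u: "is_unit (fst X) (unit_at X)"
    using assms \<eta> is_unit_Id[OF assms] by (auto simp: unit_at_def is_unit_def unit_families_def)
  have "inverse_arrows D (fst X) (unit_at X) (inv_arrow D (fst X) (unit_at X))"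
    using u by (intro inverse_arrows_inv_arrow assms) (simp add: is_unit_def)
  then show "unit_at X \<in> Hom D (fst X) (fst X)" "inv_arrow D (fst X) (unit_at X) \<in> Hom D (fst X) (fst X)"
    "Comp D (fst X) (fst X) (fst X) (unit_at X) (inv_arrow D (fst X) (unit_at X)) = hcat.Id D (fst X)"
    "Comp D (fst X) (fst X) (fst X) (inv_arrow D (fst X) (unit_at X)) (unit_at X) = hcat.Id D (fst X)"
    by (simp_all add: inverse_arrows_def)
  show "Act D (fst X) (fst X) h (unit_at X) = \<epsilon> h *\<^sub>C unit_at X"
    using u by (simp add: is_unit_def)
  show "Act D (fst X) (fst X) h (inv_arrow D (fst X) (unit_at X)) = \<epsilon> h *\<^sub>C inv_arrow D (fst X) (unit_at X)"
    by (rule is_unit_inv[OF assms u])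
qed

lemma transport_semifunctor: "H_semifunctor DD D transport"
  unfolding H_semifunctor_def
proof (intro conjI ballI allI)
  let ?i = "\<lambda>X. inv_arrow D (fst X) (unit_at X)"
  show "on_ob transport \<in> Ob DD \<rightarrow> Ob D" by (auto simp: transport_def)
  fix X Y assume "X \<in> Ob DD" "Y \<in> Ob DD"
  then have X: "fst X \<in> Ob D" and Y: "fst Y \<in> Ob D" by auto
  note uX = unit_at[OF X] and uY = unit_at[OF Y]
  have right: "linear_map (Hom D (fst X) (fst Y)) (Hom D (fst X) (fst Y)) (\<lambda>f. Comp D (fst X) (fst X) (fst Y) f (?i X))"
    using klin X Y uX(2) by (simp add: k_linear_category_def)
  have left: "linear_map (Hom D (fst X) (fst Y)) (Hom D (fst X) (fst Y)) (Comp D (fst X) (fst Y) (fst Y) (unit_at Y))"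
    using klin X Y uY(1) by (simp add: k_linear_category_def)
  show "linear_map (Hom DD X Y) (Hom D (on_ob transport X) (on_ob transport Y)) (on_hom transport X Y)"
    using linear_map_compose[OF left right] by (simp add: transport_def)
  fix f assume "f \<in> Hom DD X Y"
  then have f: "f \<in> Hom D (fst X) (fst Y)" by simp
  note fi = Comp_Hom[OF X X Y uX(2) f]
  show "on_hom transport X Y (Act DD X Y h f) = Act D (on_ob transport X) (on_ob transport Y) h (on_hom transport X Y f)" for h
    using Act_Comp_invariant(1)[OF X Y Y fi uY(1) uY(5), of h] Act_Comp_invariant(2)[OF X X Y uX(2) f uX(6), of h]
    by (simp add: transport_def)
  fix Z g assume "Z \<in> Ob DD" "g \<in> Hom DD Y Z"
  then have Z: "fst Z \<in> Ob D" and g: "g \<in> Hom D (fst Y) (fst Z)" by auto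
  note uZ = unit_at[OF Z]
  note gi = Comp_Hom[OF Y Y Z uY(2) g]
  let ?f = "Comp D (fst X) (fst X) (fst Y) f (?i X)"
  have "Comp D (fst X) (fst Y) (fst Z) (Comp D (fst Y) (fst Y) (fst Z) g (?i Y)) (Comp D (fst X) (fst Y) (fst Y) (unit_at Y) ?f)
      = Comp D (fst X) (fst Y) (fst Z) g (Comp D (fst X) (fst Y) (fst Y) (?i Y) (Comp D (fst X) (fst Y) (fst Y) (unit_at Y) ?f))"
    by (rule Comp_assoc[OF X Y Y Z Comp_Hom[OF X Y Y fi uY(1)] uY(2) g, symmetric])
  \<comment> \<open>The isomorphism at the middle object meets its inverse and cancels.\<close>
  also have "Comp D (fst X) (fst Y) (fst Y) (?i Y) (Comp D (fst X) (fst Y) (fst Y) (unit_at Y) ?f) = ?f"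
    using Comp_assoc[OF X Y Y Y fi uY(1,2)] uY(4) Comp_Id(1)[OF X Y fi] by simp
  also have "Comp D (fst X) (fst Y) (fst Z) g ?f = Comp D (fst X) (fst X) (fst Z) (Comp D (fst X) (fst Y) (fst Z) g f) (?i X)"
    by (rule Comp_assoc[OF X X Y Z uX(2) f g])
  finally have "Comp D (fst X) (fst Y) (fst Z) (Comp D (fst Y) (fst Z) (fst Z) (unit_at Z) (Comp D (fst Y) (fst Y) (fst Z) g (?i Y)))
        (Comp D (fst X) (fst Y) (fst Y) (unit_at Y) ?f)
      = Comp D (fst X) (fst Z) (fst Z) (unit_at Z) (Comp D (fst X) (fst X) (fst Z) (Comp D (fst X) (fst Y) (fst Z) g f) (?i X))"
    using Comp_assoc[OF X Y Z Z Comp_Hom[OF X Y Y fi uY(1)] gi uZ(1)] by simp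
  then show "on_hom transport X Z (Comp DD X Y Z g f) = Comp D (on_ob transport X) (on_ob transport Y) (on_ob transport Z)
      (on_hom transport Y Z g) (on_hom transport X Y f)"
    by (simp add: transport_def)
qed

lemma transport_inclusion_True: "comp_semifun transport (inclusion True) = inner_automorphism D \<eta>"
  by (simp add: comp_semifun_def transport_def inclusion_def inner_automorphism_def unit_at_def)

lemma transport_inclusion_False:
  "is_arrow D a \<Longrightarrow> arr_map (comp_semifun transport (inclusion False)) a = a"
  by (cases a) (auto simp: arr_map_def comp_semifun_def transport_def inclusion_def unit_at_def inv_arrow_Id
      is_arrow_def Comp_Id)

lemma inner_semifunctor: "H_semifunctor D D (inner_automorphism D \<eta>)"
  unfolding transport_inclusion_True[symmetric]
  by (rule H_semifunctor_comp[OF inclusion_semifunctor transport_semifunctor])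

lemma H_automorphism_inner: "H_automorphism D (inner_automorphism D \<eta>)"
  unfolding H_automorphism_def
proof (intro conjI ballI)
  show "H_semifunctor D D (inner_automorphism D \<eta>)" by (rule inner_semifunctor)
  show "bij_betw (on_ob (inner_automorphism D \<eta>)) (Ob D) (Ob D)"
    by (simp add: inner_automorphism_def bij_betw_def)
  fix X assume X: "X \<in> Ob D"
  let ?i = "\<lambda>X. inv_arrow D X (\<eta> X)"
  have u: "\<eta> Z \<in> Hom D Z Z" "?i Z \<in> Hom D Z Z" "Comp D Z Z Z (\<eta> Z) (?i Z) = hcat.Id D Z"
    "Comp D Z Z Z (?i Z) (\<eta> Z) = hcat.Id D Z" if "Z \<in> Ob D" for Z
    using unit_at[of "(Z, True)"] that by (simp_all add: unit_at_def)
  show "on_hom (inner_automorphism D \<eta>) X X (hcat.Id D X) = hcat.Id D (on_ob (inner_automorphism D \<eta>) X)"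
    using u[OF X] X by (simp add: inner_automorphism_def Comp_Id)
  fix Y assume Y: "Y \<in> Ob D"
  \<comment> \<open>Stated for arbitrary pairs, so that it covers both orders of conjugating by
    \<eta> and by its inverse.\<close>
  have cancel: "Comp D X Y Y (v Y) (Comp D X X Y (Comp D X Y Y (w Y) (Comp D X X Y f (w' X))) (v' X)) = f"
    if f: "f \<in> Hom D X Y" and v: "v Y \<in> Hom D Y Y" "v' X \<in> Hom D X X" "w Y \<in> Hom D Y Y" "w' X \<in> Hom D X X"
      "Comp D Y Y Y (v Y) (w Y) = hcat.Id D Y" "Comp D X X X (w' X) (v' X) = hcat.Id D X" for f v v' w w'
  proof -
    note fw = Comp_Hom[OF X X Y v(4) f]
    have "Comp D X X Y (Comp D X Y Y (w Y) (Comp D X X Y f (w' X))) (v' X)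
        = Comp D X Y Y (w Y) (Comp D X X Y (Comp D X X Y f (w' X)) (v' X))"
      by (rule Comp_assoc[OF X X Y Y v(2) fw v(3), symmetric])
    also have "Comp D X X Y (Comp D X X Y f (w' X)) (v' X) = f"
      using Comp_assoc[OF X X X Y v(2,4) f] v(6) Comp_Id(2)[OF X Y f] by simp
    finally show ?thesis
      using Comp_assoc[OF X Y Y Y f v(3,1)] v(5) Comp_Id(1)[OF X Y f] by simp
  qed
  show "bij_betw (on_hom (inner_automorphism D \<eta>) X Y) (Hom D X Y)
      (Hom D (on_ob (inner_automorphism D \<eta>) X) (on_ob (inner_automorphism D \<eta>) Y))"
  proof (rule bij_betw_byWitness[where f' = "\<lambda>g. Comp D X Y Y (?i Y) (Comp D X X Y g (\<eta> X))"])
    show "\<forall>f\<in>Hom D X Y. Comp D X Y Y (?i Y) (Comp D X X Y (on_hom (inner_automorphism D \<eta>) X Y f) (\<eta> X)) = f"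
      using cancel[of _ ?i \<eta> \<eta> ?i] u[OF X] u[OF Y] by (simp add: inner_automorphism_def)
    show "\<forall>g\<in>Hom D (on_ob (inner_automorphism D \<eta>) X) (on_ob (inner_automorphism D \<eta>) Y).
        on_hom (inner_automorphism D \<eta>) X Y (Comp D X Y Y (?i Y) (Comp D X X Y g (\<eta> X))) = g"
      using cancel[of _ \<eta> ?i ?i \<eta>] u[OF X] u[OF Y] by (simp add: inner_automorphism_def)
    show "on_hom (inner_automorphism D \<eta>) X Y ` Hom D X Y \<subseteq> Hom D (on_ob (inner_automorphism D \<eta>) X) (on_ob (inner_automorphism D \<eta>) Y)"
      using X Y u by (auto simp: inner_automorphism_def intro!: Comp_Hom)
    show "(\<lambda>g. Comp D X Y Y (?i Y) (Comp D X X Y g (\<eta> X))) ` Hom D (on_ob (inner_automorphism D \<eta>) X) (on_ob (inner_automorphism D \<eta>) Y) \<subseteq> Hom D X Y"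
      using X Y u by (auto simp: inner_automorphism_def intro!: Comp_Hom)
  qed
qed

lemma inner_automorphism_cohomologous:
  assumes \<phi>: "\<phi> \<in> cyclic_cocycles H M D n"
  shows "cochain_map D (inner_automorphism D \<eta>) n \<phi> - \<phi> \<in> cyclic_coboundaries H M D n"
proof -
  interpret Q: hopf_semifunctor H M DD D transport
    by unfold_locales (rule transport_semifunctor)
  interpret T: hopf_semifunctor H M D DD "inclusion True"
    by unfold_locales (rule inclusion_semifunctor)
  interpret F: hopf_semifunctor H M D DD "inclusion False"
    by unfold_locales (rule inclusion_semifunctor)
  have \<phi>C: "\<phi> \<in> cochains H M D n" using \<phi> by (simp add: cyclic_cocycles_iff)
  let ?x = "cochain_map DD transport n \<phi>"
  have x: "?x \<in> cochains H M DD n" "E.cocyc.l n ?x = ?x" "E.cocyc.b n ?x = 0"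
    using Q.cochain_map_cocycle[OF \<phi>] by (simp_all add: E.cyclic_cocycles_iff)
  have Tx: "cochain_map D (inclusion True) n ?x = cochain_map D (inner_automorphism D \<eta>) n \<phi>"
    using cochain_map_comp_semifun[OF T.hopf_semifunctor_axioms Q.hopf_semifunctor_axioms \<phi>C]
    by (simp add: transport_inclusion_True)
  have Fx: "cochain_map D (inclusion False) n ?x = \<phi>"
  proof -
    interpret QF: hopf_semifunctor H M D D "comp_semifun transport (inclusion False)"
      by unfold_locales (rule H_semifunctor_comp[OF inclusion_semifunctor transport_semifunctor])
    have "cochain_map D (comp_semifun transport (inclusion False)) n \<phi> = \<phi>"
    proof (rule cochain_eqI[OF QF.cochain_map_cochain[OF \<phi>C] \<phi>C])
      fix m w assume w: "w \<in> cyclic_words D n"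
      have "map (arr_map (comp_semifun transport (inclusion False))) w = w"
        using cyclic_words_arrow[OF w] by (intro map_idI) (simp add: transport_inclusion_False)
      then show "cochain_map D (comp_semifun transport (inclusion False)) n \<phi> (m \<otimes>\<^sub>C word_pure w) = \<phi> (m \<otimes>\<^sub>C word_pure w)"
        by (simp add: QF.cochain_map_pure[OF \<phi>C w])
    qed
    then show ?thesis
      using cochain_map_comp_semifun[OF F.hopf_semifunctor_axioms Q.hopf_semifunctor_axioms \<phi>C] by simp
  qed
  have "comp_semifun collapse (inclusion True) = (inclusion False :: ('o, 'f, 'o \<times> bool, 'f) semifun)"
    by (simp add: comp_semifun_def collapse_def inclusion_def)
  then have TP: "cochain_map D (inclusion True) n (cochain_map DD collapse n ?x) = \<phi>"
    using cochain_map_comp_semifun[OF T.hopf_semifunctor_axioms P.hopf_semifunctor_axioms x(1)] Fx by simp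
  show ?thesis
  proof (cases n)
    case 0
    \<comment> \<open>In degree 0 only zero is a coboundary, and the two cochains are in fact
      equal.\<close>
    then have "cochain_map D (inner_automorphism D \<eta>) n \<phi> = \<phi>"
      using cyclic_collapse(1)[OF x] Tx TP by simp
    then show ?thesis using cvs.subspace_0[OF subspace_cyclic_coboundaries] by simp
  next
    case (Suc k)
    then obtain \<psi> where \<psi>: "\<psi> \<in> cochains H M DD k" "E.cocyc.l k \<psi> = \<psi>" "E.cocyc.b k \<psi> = ?x - cochain_map DD collapse n ?x"
      using cyclic_collapse(2)[OF x] by blast
    have "cochain_map D (inner_automorphism D \<eta>) n \<phi> - \<phi> = cochain_map D (inclusion True) n (E.cocyc.b k \<psi>)"
      using linear_map_diff[OF T.linear_cochain_map E.subspace_cochains x(1) P.cochain_map_cochain[OF x(1)]]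
      by (simp add: \<psi>(3) Tx TP)
    also have "\<dots> = hoch_b H M D k (cochain_map D (inclusion True) k \<psi>)"
      by (simp add: Suc hoch_b_eq T.cochain_map_b(1)[OF \<psi>(1)])
    also have "cochain_map D (inclusion True) k \<psi> \<in> cyclic_cochains H M D k"
      using T.cochain_map_l[OF \<psi>(1)] \<psi>(2) by (simp add: cyclic_cochains_iff T.cochain_map_cochain[OF \<psi>(1)])
    ultimately show ?thesis by (simp add: Suc cyclic_coboundaries_def)
  qed
qed

lemma HC_map_inner:
  assumes "K \<in> carrier (HC H M D n)"
  shows "HC_map H M D (inner_automorphism D \<eta>) n K = K"
proof -
  interpret I: hopf_semifunctor H M D D "inner_automorphism D \<eta>"
    by unfold_locales (rule inner_semifunctor)
  obtain \<phi> where \<phi>: "\<phi> \<in> cyclic_cocycles H M D n" "K = \<phi> +o cyclic_coboundaries H M D n"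
    using assms by (auto simp: HC_def quotient_space_def)
  then show ?thesis
    using inner_automorphism_cohomologous[OF \<phi>(1)]
    by (simp add: I.HC_map_class coset_eq_iff[OF subspace_cyclic_coboundaries])
qed

end

end

lemma hopf_cyclicI: "hopf_algebra H \<Longrightarrow> sayd_module H M \<Longrightarrow> left_H_category H D \<Longrightarrow> hopf_cyclic H M D"
  by unfold_locales

theorem lemma5p4:
  fixes H :: "('h::complex_algebra_1) hopf_data"
    and M :: "('h, 'm::complex_vector) mod_comod"
  assumes "hopf_algebra H"
    and "sayd_module H M"
  shows
    \<comment> \<open>(1) maps on cochains, on double complexes and on cohomology induced by a semifunctor\<close>
    "(\<forall>(D :: ('o1, 'f1::complex_vector, 'h) hcat) (D' :: ('o2, 'f2::complex_vector, 'h) hcat) \<alpha>.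
        left_H_category H D \<and> left_H_category H D' \<and> H_semifunctor D D' \<alpha> \<longrightarrow>
          (\<forall>n. linear_map (cochains H M D' n) (cochains H M D n) (cochain_map D \<alpha> n) \<and>
             (\<forall>\<phi>\<in>cochains H M D' n. \<forall>m. \<forall>w\<in>cyclic_words D n.
                cochain_map D \<alpha> n \<phi> (m \<otimes>\<^sub>C word_pure w)
                  = \<phi> (m \<otimes>\<^sub>C word_pure (map (arr_map \<alpha>) w)))) \<and>
          double_complex_morphism (cyclic_double_complex H M D') (cyclic_double_complex H M D)
            (\<lambda>p q. cochain_map D \<alpha> q) \<and>
          (\<forall>n. module_linear (HC H M D' n) (HC H M D n) (HC_map H M D \<alpha> n) \<and>
             (\<forall>\<phi>\<in>cyclic_cocycles H M D' n.
                cochain_map D \<alpha> n \<phi> \<in> cyclic_cocycles H M D n \<and>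
                HC_map H M D \<alpha> n (HC_class H M D' n \<phi>) = HC_class H M D n (cochain_map D \<alpha> n \<phi>)))) \<and>
     \<comment> \<open>(1) functoriality: objects, identities, composition\<close>
     (\<forall>(D :: ('o1, 'f1, 'h) hcat) n. left_H_category H D \<longrightarrow>
        Module.module complex_ring (HC H M D n) \<and>
        H_semifunctor D D id_semifun \<and>
        (\<forall>K\<in>carrier (HC H M D n). HC_map H M D id_semifun n K = K)) \<and>
     (\<forall>(D :: ('o1, 'f1, 'h) hcat) (D' :: ('o2, 'f2, 'h) hcat)
        (D'' :: ('o3, 'f3::complex_vector, 'h) hcat) \<alpha> \<beta> n.
        left_H_category H D \<and> left_H_category H D' \<and> left_H_category H D'' \<and>
        H_semifunctor D D' \<alpha> \<and> H_semifunctor D' D'' \<beta> \<longrightarrow>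
          H_semifunctor D D'' (comp_semifun \<beta> \<alpha>) \<and>
          (\<forall>K\<in>carrier (HC H M D'' n).
             HC_map H M D (comp_semifun \<beta> \<alpha>) n K = HC_map H M D \<alpha> n (HC_map H M D' \<beta> n K))) \<and>
     \<comment> \<open>(2)\<close>
     (\<forall>(D :: ('o1, 'f1, 'h) hcat) \<eta>. left_H_category H D \<and> \<eta> \<in> unit_families H D \<longrightarrow>
        H_automorphism D (inner_automorphism D \<eta>) \<and>
        (\<forall>n. \<forall>K\<in>carrier (HC H M D n). HC_map H M D (inner_automorphism D \<eta>) n K = K))"

proof -
  note cyc = hopf_cyclicI[OF assms]
  show ?thesis
  proof (intro conjI allI impI; (elim conjE)?)
    fix D :: "('o1, 'f1, 'h) hcat" and D' :: "('o2, 'f2, 'h) hcat" and \<alpha>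
    assume *: "left_H_category H D" "left_H_category H D'" "H_semifunctor D D' \<alpha>"
    then interpret A: hopf_semifunctor H M D D' \<alpha>
      by (intro hopf_semifunctor.intro hopf_semifunctor_axioms.intro cyc)
    show "linear_map (cochains H M D' n) (cochains H M D n) (cochain_map D \<alpha> n)" for n
      by (rule A.linear_cochain_map)
    show "\<forall>\<phi>\<in>cochains H M D' n. \<forall>m. \<forall>w\<in>cyclic_words D n. cochain_map D \<alpha> n \<phi> (m \<otimes>\<^sub>C word_pure w)
        = \<phi> (m \<otimes>\<^sub>C word_pure (map (arr_map \<alpha>) w))" for n
      by (simp add: A.cochain_map_pure)
    show "double_complex_morphism (cyclic_double_complex H M D') (cyclic_double_complex H M D) (\<lambda>p. cochain_map D \<alpha>)"
      by (rule A.double_complex_morphism_cochain_map)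
    show "module_linear (HC H M D' n) (HC H M D n) (HC_map H M D \<alpha> n)" for n
      by (rule A.module_linear_HC_map)
    show "\<forall>\<phi>\<in>cyclic_cocycles H M D' n. cochain_map D \<alpha> n \<phi> \<in> cyclic_cocycles H M D n \<and>
        HC_map H M D \<alpha> n (HC_class H M D' n \<phi>) = HC_class H M D n (cochain_map D \<alpha> n \<phi>)" for n
      by (simp add: A.cochain_map_cocycle A.HC_map_class HC_class_def)
  next
    fix D :: "('o1, 'f1, 'h) hcat" and n
    assume "left_H_category H D"
    then interpret A: hopf_cyclic H M D by (rule cyc)
    show "Module.module complex_ring (HC H M D n)" by (rule A.module_HC)
    show "H_semifunctor D D id_semifun" by (rule A.id_semifunctor)
    show "\<forall>K\<in>carrier (HC H M D n). HC_map H M D id_semifun n K = K" by (simp add: A.HC_map_id)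
  next
    fix D :: "('o1, 'f1, 'h) hcat" and D' :: "('o2, 'f2, 'h) hcat" and D'' :: "('o3, 'f3, 'h) hcat" and \<alpha> \<beta> n
    assume *: "left_H_category H D" "left_H_category H D'" "left_H_category H D''"
      "H_semifunctor D D' \<alpha>" "H_semifunctor D' D'' \<beta>"
    show "H_semifunctor D D'' (comp_semifun \<beta> \<alpha>)" by (rule H_semifunctor_comp[OF *(4,5)])
    have "hopf_semifunctor H M D D' \<alpha>" "hopf_semifunctor H M D' D'' \<beta>"
      using * by (auto intro!: hopf_semifunctor.intro hopf_semifunctor_axioms.intro cyc)
    from HC_map_comp_semifun[OF this]
    show "\<forall>K\<in>carrier (HC H M D'' n). HC_map H M D (comp_semifun \<beta> \<alpha>) n K = HC_map H M D \<alpha> n (HC_map H M D' \<beta> n K)"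
      by blast
  next
    fix D :: "('o1, 'f1, 'h) hcat" and \<eta>
    assume *: "left_H_category H D" "\<eta> \<in> unit_families H D"
    from *(1) interpret A: hopf_double H M D by (intro hopf_double.intro cyc)
    show "H_automorphism D (inner_automorphism D \<eta>)" by (rule A.H_automorphism_inner[OF *(2)])
    show "\<forall>K\<in>carrier (HC H M D n). HC_map H M D (inner_automorphism D \<eta>) n K = K" for n
      using A.HC_map_inner[OF *(2)] by blast
  qed
qed

end
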